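(* Let $R$ be the ring of integers in a nonarchimedean local field $K$, with residue field $\mathbb{F}_q$. Let $\Lambda$ be an $R$-order in a finite-dimensional semisimple $K$-algebra $A$. Let $L$ and $M$ be full left $\Lambda$-lattices in a finitely generated left $A$-module $V$. Choose a maximal $R$-order $\Lambda'$ in $A$ containing $\Lambda$, and let $\iota:\Lambda\hookrightarrow\Lambda'$ be the inclusion. Write $L'=\Lambda'L$ and $I=\{a\in A: \Lambda'a\Lambda'\subseteq \Lambda\}$. Let $\mu$ be the Möbius function of the partially ordered set (under inclusion) of left $\Lambda'/I$-submodules of $L'/IL'$. Then $\iota^*Z_{\Lambda'}(L')$ is a unit in $\mathrm{Dir}(\Lambda)$ that is independent of the choice of $\Lambda'$. Moreover, $$\frac{Z_\Lambda(L,M)}{\iota^* Z_{\Lambda'}(L')}=\sum_{\substack{X\leq_{\Lambda} L\\ X\simeq M\\ IL'\subseteq\Lambda'X}}[L/X]\,\iota^*Q_{\Lambda'}(\Lambda'X/IL'),$$ where, with $W=\Lambda'X/IL'$, $$Q_{\Lambda'}(W):=\sum_{U\leq_{\Lambda'} W}\mu(U,W)[{}_{\Lambda'}W/U]\in\mathbb{Z}[\mathcal{M}(\Lambda')].$$ The sum over $X$ is finite and $\iota^*Q_{\Lambda'}(W)\in\mathbb{Z}[\mathcal{M}(\Lambda)]$; hence the quotient series $Z_\Lambda(L,M)/\iota^* Z_{\Lambda'}(L')$ lies in $\mathbb{Z}[\mathcal{M}(\Lambda)]$.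
   Context: An $R$-order in $A$ is an $R$-subalgebra of $A$ that is finitely generated as an $R$-module and spans $A$ over $K$. A full left $\Lambda$-lattice in $V$ is a finitely generated left $\Lambda$-submodule $L$ of $V$ with $KL=V$. $X\le_\Lambda L$ means $X$ is a left $\Lambda$-submodule of $L$; $X\simeq M$ means isomorphic as left $\Lambda$-modules. For a module-finite $R$-algebra $\Gamma$: $\mathcal{S}(\Gamma)$ is the finite set of isomorphism classes of simple left $\Gamma$-modules; $\mathcal{G}(\Gamma)$ is the Grothendieck group of finite-length left $\Gamma$-modules, written multiplicatively (so $[N]=[N'][N'']$ for a short exact sequence $0\to N'\to N\to N''\to 0$), which is free abelian on $\mathcal{S}(\Gamma)$; $\mathcal{M}(\Gamma)$ is the submonoid generated by $\mathcal{S}(\Gamma)$, so $\mathbb{Z}[\mathcal{M}(\Gamma)]$ is the polynomial ring over $\mathbb{Z}$ in variables indexed by $\mathcal{S}(\Gamma)$; and $\mathrm{Dir}(\Gamma)$, the Dirichlet ring, is the completion of $\mathbb{Z}[\mathcal{M}(\Gamma)]$ at the ideal generated by $\mathcal{S}(\Gamma)$, i.e. the corresponding formal power series ring. The inclusion $\iota:\Lambda\hookrightarrow\Lambda'$ induces by restriction of scalars a monoid homomorphism $\iota^*:\mathcal{M}(\Lambda')\to\mathcal{M}(\Lambda)$, $[{}_{\Lambda'}S]\mapsto[{}_\Lambda S]$, and a continuous ring homomorphism $\iota^*:\mathrm{Dir}(\Lambda')\to\mathrm{Dir}(\Lambda)$. For finitely generated left $\Gamma$-modules $N,N_0$, the Bushnell–Reiner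 zeta functions are the elements of $\mathrm{Dir}(\Gamma)$ $$Z_\Gamma(N)=\sum_{X\leq_\Gamma N} [N/X], \qquad Z_\Gamma(N,N_0)=\sum_{\substack{X\leq_\Gamma N\\ X\simeq N_0}}[N/X],$$ the first sum over all finite-index $\Gamma$-submodules $X$ of $N$, the second only over those isomorphic to $N_0$. *)

theory Defs
  imports "HOL-Algebra.Generated_Groups" "HOL-Algebra.Subrings" "HOL-Algebra.QuotRing"
    "HOL-Algebra.Module" "HOL-Library.Multiset"
begin

section \<open>Local fields\<close>

text \<open>A nonarchimedean local field is a field that is complete with respect to a normalised
  discrete valuation with finite residue field. The value of \<open>v\<close> at zero (mathematically
  infinity) is irrelevant and never used.\<close>

definition val_ring :: "('k, 'c) ring_scheme \<Rightarrow> ('k \<Rightarrow> int) \<Rightarrow> ('k, 'c) ring_scheme" where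
  "val_ring K v = K\<lparr>carrier := {x \<in> carrier K. x = \<zero>\<^bsub>K\<^esub> \<or> 0 \<le> v x}\<rparr>"

definition val_max_ideal :: "('k, 'c) ring_scheme \<Rightarrow> ('k \<Rightarrow> int) \<Rightarrow> 'k set" where
  "val_max_ideal K v = {x \<in> carrier K. x = \<zero>\<^bsub>K\<^esub> \<or> 0 < v x}"

definition residue_field :: "('k, 'c) ring_scheme \<Rightarrow> ('k \<Rightarrow> int) \<Rightarrow> 'k set ring" where
  "residue_field K v = val_ring K v Quot val_max_ideal K v"

text \<open>\<open>val_close K v n x y\<close> says that \<open>x - y\<close> has valuation at least \<open>n\<close>.\<close>

definition val_close :: "('k, 'c) ring_scheme \<Rightarrow> ('k \<Rightarrow> int) \<Rightarrow> int \<Rightarrow> 'k \<Rightarrow> 'k \<Rightarrow> bool" where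
  "val_close K v n x y \<longleftrightarrow> x = y \<or> n \<le> v (x \<ominus>\<^bsub>K\<^esub> y)"

locale local_field = field K for K (structure) +
  fixes v :: "'a \<Rightarrow> int"
  assumes val_mult: "\<lbrakk>x \<in> carrier K - {\<zero>}; y \<in> carrier K - {\<zero>}\<rbrakk> \<Longrightarrow> v (x \<otimes> y) = v x + v y"
    and val_add: "\<lbrakk>x \<in> carrier K - {\<zero>}; y \<in> carrier K - {\<zero>}; x \<oplus> y \<noteq> \<zero>\<rbrakk>
      \<Longrightarrow> min (v x) (v y) \<le> v (x \<oplus> y)"
    and val_surj: "v ` (carrier K - {\<zero>}) = UNIV"
    and val_complete: "\<And>s :: nat \<Rightarrow> 'a. \<lbrakk>range s \<subseteq> carrier K; \<And>n. \<exists>N. \<forall>i\<ge>N. \<forall>j\<ge>N. val_close K v n (s i) (s j)\<rbrakk>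
      \<Longrightarrow> \<exists>l\<in>carrier K. \<forall>n. \<exists>N. \<forall>i\<ge>N. val_close K v n (s i) l"
    and residue_finite: "finite (carrier (residue_field K v))"


section \<open>Left modules\<close>

text \<open>The library's locale \<open>module\<close> requires a commutative ring of scalars. Left modules over
  arbitrary rings reuse its record type; as there, the fields \<open>mult\<close> and \<open>one\<close> of the module
  record carry no meaning. The library's predicate \<open>submodule\<close> makes sense over any ring. A
  submodule \<open>X\<close> of \<open>M\<close>, regarded as a module itself, is \<open>M\<lparr>carrier := X\<rparr>\<close>; a subring \<open>S\<close> of \<open>A\<close>,
  regarded as a ring, is \<open>A\<lparr>carrier := S\<rparr>\<close>; and a module over a ring is, as the same record, a
  module over each subring (restriction of scalars).\<close>

locale left_module = R?: ring R + M?: abelian_group M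
    for R :: "('r, 'c) ring_scheme" (structure) and M :: "('r, 'm, 'd) module_scheme" (structure) +
  assumes smult_closed: "\<lbrakk>a \<in> carrier R; x \<in> carrier M\<rbrakk> \<Longrightarrow> a \<odot>\<^bsub>M\<^esub> x \<in> carrier M"
    and smult_l_distr: "\<lbrakk>a \<in> carrier R; b \<in> carrier R; x \<in> carrier M\<rbrakk>
      \<Longrightarrow> (a \<oplus> b) \<odot>\<^bsub>M\<^esub> x = a \<odot>\<^bsub>M\<^esub> x \<oplus>\<^bsub>M\<^esub> b \<odot>\<^bsub>M\<^esub> x"
    and smult_r_distr: "\<lbrakk>a \<in> carrier R; x \<in> carrier M; y \<in> carrier M\<rbrakk>
      \<Longrightarrow> a \<odot>\<^bsub>M\<^esub> (x \<oplus>\<^bsub>M\<^esub> y) = a \<odot>\<^bsub>M\<^esub> x \<oplus>\<^bsub>M\<^esub> a \<odot>\<^bsub>M\<^esub> y"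
    and smult_assoc: "\<lbrakk>a \<in> carrier R; b \<in> carrier R; x \<in> carrier M\<rbrakk>
      \<Longrightarrow> (a \<otimes> b) \<odot>\<^bsub>M\<^esub> x = a \<odot>\<^bsub>M\<^esub> (b \<odot>\<^bsub>M\<^esub> x)"
    and smult_one: "x \<in> carrier M \<Longrightarrow> \<one> \<odot>\<^bsub>M\<^esub> x = x"

definition regular_module :: "('a, 'c) ring_scheme \<Rightarrow> ('a, 'a) module" where
  "regular_module R = \<lparr>carrier = carrier R, monoid.mult = monoid.mult R, one = one R,
     zero = zero R, add = add R, smult = monoid.mult R\<rparr>"

definition module_isomorphic ::
    "('r, 'c) ring_scheme \<Rightarrow> ('r, 'm, 'd) module_scheme \<Rightarrow> ('r, 'n, 'e) module_scheme \<Rightarrow> bool" where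
  "module_isomorphic R M N \<longleftrightarrow> (\<exists>h \<in> iso (add_monoid M) (add_monoid N).
     \<forall>a \<in> carrier R. \<forall>x \<in> carrier M. h (a \<odot>\<^bsub>M\<^esub> x) = a \<odot>\<^bsub>N\<^esub> h x)"

text \<open>The quotient of \<open>M\<close> by a submodule \<open>X\<close>: if \<open>C\<close> is the coset of \<open>c\<close>, then
  \<open>X <+> a C\<close> is the coset of \<open>a c\<close>.\<close>

definition quot_module ::
    "('r, 'm, 'd) module_scheme \<Rightarrow> 'm set \<Rightarrow> ('r, 'm set) module" where
  "quot_module M X = \<lparr>carrier = a_rcosets\<^bsub>M\<^esub> X, monoid.mult = (\<lambda>_ _. X), one = X,
     zero = X, add = set_add M,
     smult = (\<lambda>a C. X <+>\<^bsub>M\<^esub> ((\<lambda>c. a \<odot>\<^bsub>M\<^esub> c) ` C))\<rparr>"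

text \<open>The same quotient as a module over the factor ring by a two-sided ideal that maps \<open>M\<close>
  into \<open>X\<close>: scalars are cosets, too.\<close>

definition quot_module_factor ::
    "('r, 'm, 'd) module_scheme \<Rightarrow> 'm set \<Rightarrow> ('r set, 'm set) module" where
  "quot_module_factor M X = \<lparr>carrier = a_rcosets\<^bsub>M\<^esub> X, monoid.mult = (\<lambda>_ _. X), one = X,
     zero = X, add = set_add M,
     smult = (\<lambda>B C. X <+>\<^bsub>M\<^esub> {b \<odot>\<^bsub>M\<^esub> c | b c. b \<in> B \<and> c \<in> C})\<rparr>"

text \<open>The additive subgroup \<open>S X\<close> of \<open>M\<close> consisting of the finite sums of products \<open>s x\<close>.\<close>

definition set_smult :: "('r, 'm, 'd) module_scheme \<Rightarrow> 'r set \<Rightarrow> 'm set \<Rightarrow> 'm set" where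
  "set_smult M S X = generate (add_monoid M) {s \<odot>\<^bsub>M\<^esub> x | s x. s \<in> S \<and> x \<in> X}"

definition fin_gen :: "('r, 'c) ring_scheme \<Rightarrow> ('r, 'm, 'd) module_scheme \<Rightarrow> bool" where
  "fin_gen R M \<longleftrightarrow> (\<exists>S. finite S \<and> S \<subseteq> carrier M \<and> set_smult M (carrier R) S = carrier M)"

definition simple_module :: "('r, 'c) ring_scheme \<Rightarrow> ('r, 'm, 'd) module_scheme \<Rightarrow> bool" where
  "simple_module R M \<longleftrightarrow> left_module R M \<and> carrier M \<noteq> {\<zero>\<^bsub>M\<^esub>} \<and>
     (\<forall>X. submodule X R M \<longrightarrow> X = {\<zero>\<^bsub>M\<^esub>} \<or> X = carrier M)"

text \<open>A module is semisimple if it is the sum of its simple submodules.\<close>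

definition semisimple_module :: "('r, 'c) ring_scheme \<Rightarrow> ('r, 'm, 'd) module_scheme \<Rightarrow> bool" where
  "semisimple_module R M \<longleftrightarrow> left_module R M \<and>
     generate (add_monoid M) (\<Union>{X. submodule X R M \<and> simple_module R (M\<lparr>carrier := X\<rparr>)})
       = carrier M"

definition semisimple_ring :: "('a, 'c) ring_scheme \<Rightarrow> bool" where
  "semisimple_ring R \<longleftrightarrow> ring R \<and> semisimple_module R (regular_module R)"


section \<open>Orders and lattices\<close>

text \<open>The library's locale \<open>algebra\<close> is about commutative algebras.\<close>

locale fin_dim_algebra = module K A + A?: ring A
    for K :: "('k, 'c) ring_scheme" (structure) and A :: "('k, 'a, 'd) module_scheme" (structure) +
  assumes smult_mult_left: "\<lbrakk>c \<in> carrier K; x \<in> carrier A; y \<in> carrier A\<rbrakk>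
      \<Longrightarrow> (c \<odot>\<^bsub>A\<^esub> x) \<otimes>\<^bsub>A\<^esub> y = c \<odot>\<^bsub>A\<^esub> (x \<otimes>\<^bsub>A\<^esub> y)"
    and smult_mult_right: "\<lbrakk>c \<in> carrier K; x \<in> carrier A; y \<in> carrier A\<rbrakk>
      \<Longrightarrow> x \<otimes>\<^bsub>A\<^esub> (c \<odot>\<^bsub>A\<^esub> y) = c \<odot>\<^bsub>A\<^esub> (x \<otimes>\<^bsub>A\<^esub> y)"
    and fin_dim: "fin_gen K A"

definition is_order ::
    "('k, 'c) ring_scheme \<Rightarrow> ('k, 'd) ring_scheme \<Rightarrow> ('k, 'a, 'e) module_scheme \<Rightarrow> 'a set \<Rightarrow> bool" where
  "is_order R K A \<Lambda> \<longleftrightarrow> subring \<Lambda> A \<and> submodule \<Lambda> R A \<and> fin_gen R (A\<lparr>carrier := \<Lambda>\<rparr>) \<and>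
     set_smult A (carrier K) \<Lambda> = carrier A"

definition is_maximal_order ::
    "('k, 'c) ring_scheme \<Rightarrow> ('k, 'd) ring_scheme \<Rightarrow> ('k, 'a, 'e) module_scheme \<Rightarrow> 'a set \<Rightarrow> bool" where
  "is_maximal_order R K A \<Lambda> \<longleftrightarrow> is_order R K A \<Lambda> \<and>
     (\<forall>\<Gamma>. is_order R K A \<Gamma> \<longrightarrow> \<Lambda> \<subseteq> \<Gamma> \<longrightarrow> \<Gamma> = \<Lambda>)"

text \<open>\<open>K\<close> acts on the \<open>A\<close>-module \<open>V\<close> through the structure map \<open>c \<mapsto> c 1\<close> of the algebra \<open>A\<close>.\<close>

definition is_full_lattice ::
    "('k, 'd) ring_scheme \<Rightarrow> ('k, 'a, 'e) module_scheme \<Rightarrow> 'a set \<Rightarrow> ('a, 'v, 'f) module_scheme \<Rightarrow>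
      'v set \<Rightarrow> bool" where
  "is_full_lattice K A \<Lambda> V L \<longleftrightarrow> submodule L (A\<lparr>carrier := \<Lambda>\<rparr>) V \<and>
     fin_gen (A\<lparr>carrier := \<Lambda>\<rparr>) (V\<lparr>carrier := L\<rparr>) \<and>
     set_smult V ((\<lambda>c. c \<odot>\<^bsub>A\<^esub> \<one>\<^bsub>A\<^esub>) ` carrier K) L = carrier V"

definition two_sided_conductor :: "('a, 'c) ring_scheme \<Rightarrow> 'a set \<Rightarrow> 'a set \<Rightarrow> 'a set" where
  "two_sided_conductor A \<Lambda>' \<Lambda> =
     {a \<in> carrier A. \<forall>x \<in> \<Lambda>'. \<forall>y \<in> \<Lambda>'. x \<otimes>\<^bsub>A\<^esub> a \<otimes>\<^bsub>A\<^esub> y \<in> \<Lambda>}"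


section \<open>Classes of modules of finite length\<close>

text \<open>Every simple module over a ring with elements of type \<open>'a\<close> is isomorphic to the quotient of
  the ring by a maximal left ideal, hence to a module with elements of type \<open>'a set\<close>.
  The isomorphism class of a simple module on an arbitrary type is therefore represented by the
  set of all modules on \<open>'a set\<close> that are isomorphic to it.\<close>

type_synonym 'a simple_class = "('a, 'a set) module set"

definition iso_class ::
    "('a, 'c) ring_scheme \<Rightarrow> ('a, 'm, 'd) module_scheme \<Rightarrow> 'a simple_class" where
  "iso_class \<Gamma> N = {T. left_module \<Gamma> T \<and> module_isomorphic \<Gamma> N T}"

definition simple_classes :: "('a, 'c) ring_scheme \<Rightarrow> 'a simple_class set" where
  "simple_classes \<Gamma> = iso_class \<Gamma> ` {T :: ('a, 'a set) module. simple_module \<Gamma> T}"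

text \<open>The Grothendieck group of modules of finite length is free abelian on the classes of simple
  modules. The submonoid generated by these is thus the free commutative monoid on them, whose
  elements are multisets (with multiset union as the operation).\<close>

definition class_monoid :: "('a, 'c) ring_scheme \<Rightarrow> 'a simple_class multiset set" where
  "class_monoid \<Gamma> = {m. set_mset m \<subseteq> simple_classes \<Gamma>}"

definition composition_series ::
    "('a, 'c) ring_scheme \<Rightarrow> ('a, 'm, 'd) module_scheme \<Rightarrow> 'm set list \<Rightarrow> bool" where
  "composition_series \<Gamma> N Xs \<longleftrightarrow> Xs \<noteq> [] \<and> hd Xs = {\<zero>\<^bsub>N\<^esub>} \<and> last Xs = carrier N \<and>
     (\<forall>X \<in> set Xs. submodule X \<Gamma> N) \<and>
     (\<forall>i. Suc i < length Xs \<longrightarrow> Xs ! i \<subseteq> Xs ! Suc i \<and>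
        simple_module \<Gamma> (quot_module (N\<lparr>carrier := Xs ! Suc i\<rparr>) (Xs ! i)))"

definition composition_factors ::
    "('a, 'c) ring_scheme \<Rightarrow> ('a, 'm, 'd) module_scheme \<Rightarrow> 'm set list \<Rightarrow> 'a simple_class multiset" where
  "composition_factors \<Gamma> N Xs =
     mset (map (\<lambda>i. iso_class \<Gamma> (quot_module (N\<lparr>carrier := Xs ! Suc i\<rparr>) (Xs ! i)))
       [0..<length Xs - 1])"

text \<open>The class \<open>[N]\<close> of a module of finite length in the Grothendieck group, written in the basis
  of simple classes: by the relations for short exact sequences it is the product of the classes
  of the factors of any composition series; by the Jordan-Hoelder theorem this is well defined.\<close>

definition mod_class ::
    "('a, 'c) ring_scheme \<Rightarrow> ('a, 'm, 'd) module_scheme \<Rightarrow> 'a simple_class multiset" where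
  "mod_class \<Gamma> N =
     (THE m. \<exists>Xs. composition_series \<Gamma> N Xs \<and> composition_factors \<Gamma> N Xs = m)"


section \<open>The Dirichlet ring\<close>

text \<open>Formal power series over the integers in the variables \<open>simple_classes \<Gamma>\<close>. Monomials are
  multisets of variables, and a series is its function of coefficients.\<close>

type_synonym 'a dir = "'a simple_class multiset \<Rightarrow> int"

definition Dir :: "('a, 'c) ring_scheme \<Rightarrow> 'a dir ring" where
  "Dir \<Gamma> = \<lparr>carrier = {f. \<forall>m. f m \<noteq> 0 \<longrightarrow> m \<in> class_monoid \<Gamma>},
     monoid.mult = (\<lambda>f g m. \<Sum>k \<in> {k. k \<subseteq># m}. f k * g (m - k)),
     one = (\<lambda>m. if m = {#} then 1 else 0),
     zero = (\<lambda>_. 0),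
     add = (\<lambda>f g m. f m + g m)\<rparr>"

definition Dir_poly :: "('a, 'c) ring_scheme \<Rightarrow> 'a dir set" where
  "Dir_poly \<Gamma> = {f \<in> carrier (Dir \<Gamma>). finite {m. f m \<noteq> 0}}"

definition dir_monom :: "'a simple_class multiset \<Rightarrow> 'a dir" where
  "dir_monom m = (\<lambda>k. if k = m then 1 else 0)"

text \<open>The sum of a family of series of which every coefficient vanishes for all but finitely many
  members; this is its sum in the topology of the completion. (A coefficient that is nonzero
  for infinitely many members gets the value 0.)\<close>

definition dir_sum :: "'i set \<Rightarrow> ('i \<Rightarrow> 'a dir) \<Rightarrow> 'a dir" where
  "dir_sum J f = (\<lambda>m. \<Sum>j \<in> {j \<in> J. f j m \<noteq> 0}. f j m)"

text \<open>Restriction of scalars from \<open>\<Gamma>'\<close> to a subring \<open>\<Gamma>\<close>, on monomials and on series. All members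
  of a class of simple \<open>\<Gamma>'\<close>-modules have the same class over \<open>\<Gamma>\<close>, which \<open>the_elem\<close> selects.\<close>

definition res_class ::
    "('a, 'c) ring_scheme \<Rightarrow> 'a simple_class multiset \<Rightarrow> 'a simple_class multiset" where
  "res_class \<Gamma> m = \<Sum>\<^sub># (image_mset (\<lambda>s. the_elem (mod_class \<Gamma> ` s)) m)"

definition dir_res :: "('a, 'c) ring_scheme \<Rightarrow> ('a, 'd) ring_scheme \<Rightarrow> 'a dir \<Rightarrow> 'a dir" where
  "dir_res \<Gamma>' \<Gamma> f = dir_sum (class_monoid \<Gamma>') (\<lambda>m k. f m * dir_monom (res_class \<Gamma> m) k)"


section \<open>Zeta functions\<close>

definition zeta :: "('a, 'c) ring_scheme \<Rightarrow> ('a, 'm, 'd) module_scheme \<Rightarrow> 'a dir" where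
  "zeta \<Gamma> N = dir_sum {X. submodule X \<Gamma> N \<and> finite (carrier (quot_module N X))}
     (\<lambda>X. dir_monom (mod_class \<Gamma> (quot_module N X)))"

definition partial_zeta ::
    "('a, 'c) ring_scheme \<Rightarrow> ('a, 'm, 'd) module_scheme \<Rightarrow> ('a, 'n, 'e) module_scheme \<Rightarrow> 'a dir" where
  "partial_zeta \<Gamma> N N\<^sub>0 = dir_sum {X. submodule X \<Gamma> N \<and> finite (carrier (quot_module N X)) \<and>
       module_isomorphic \<Gamma> (N\<lparr>carrier := X\<rparr>) N\<^sub>0}
     (\<lambda>X. dir_monom (mod_class \<Gamma> (quot_module N X)))"


section \<open>Moebius functions\<close>

text \<open>The Moebius function of a poset \<open>P\<close> with the order of its type (for a set of sets: inclusion).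
  It is set to 0 outside of \<open>x \<le> y\<close>, and also for infinite intervals.\<close>

function moebius :: "'p::order set \<Rightarrow> 'p \<Rightarrow> 'p \<Rightarrow> int" where
  "moebius P x y =
     (if x \<in> P \<and> y \<in> P \<and> x \<le> y \<and> finite {z \<in> P. x \<le> z \<and> z \<le> y}
      then if x = y then 1 else - (\<Sum>z \<in> {z \<in> P. x \<le> z \<and> z < y}. moebius P x z)
      else 0)"
  by pat_completeness auto
termination
proof (relation "measure (\<lambda>(P, x, y). card {z \<in> P. x \<le> z \<and> z \<le> y})", goal_cases)
  case (2 P x y z)
  then have "{w \<in> P. x \<le> w \<and> w \<le> z} \<subseteq> {w \<in> P. x \<le> w \<and> w \<le> y} - {y}"
    by auto
  moreover from 2 have "y \<in> {w \<in> P. x \<le> w \<and> w \<le> y}"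
    by simp
  ultimately have "{w \<in> P. x \<le> w \<and> w \<le> z} \<subset> {w \<in> P. x \<le> w \<and> w \<le> y}"
    by blast
  with 2 show ?case
    by (auto intro: psubset_card_mono)
qed simp

declare moebius.simps [simp del]

definition Q_poly ::
    "('a, 'c) ring_scheme \<Rightarrow> ('m set \<Rightarrow> 'm set \<Rightarrow> int) \<Rightarrow> ('a, 'm, 'd) module_scheme \<Rightarrow> 'a dir" where
  "Q_poly \<Gamma> \<mu> W = (\<lambda>m. \<Sum>U | submodule U \<Gamma> W.
     \<mu> U (carrier W) * dir_monom (mod_class \<Gamma> (quot_module W U)) m)"

end

theory Submission
  imports Defs
begin

text \<open>Let \<open>J\<close> be the radical of the maximal order \<open>\<Lambda>'\<close>. It is an invertible ideal, and left ideals of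
 \<open>A\<close> have complements, so full \<open>\<Lambda>'\<close>-lattices are projective; moreover \<open>W / JW\<close> and \<open>Y / JY\<close> have the
 same composition factors for any two full lattices \<open>W\<close>, \<open>Y\<close> in \<open>V\<close>. Hence \<open>W + N = Y + N\<close> implies that
 there is an isomorphism \<open>W \<rightarrow> Y\<close> that is the identity modulo \<open>N\<close>.

 By Moebius inversion, the product of the finite sum with \<open>\<iota>\<^sup>*Z(L')\<close> counts the pairs \<open>(X, Y)\<close> in which
 \<open>Y\<close> is a \<open>\<Lambda>'\<close>-sublattice of \<open>\<Lambda>'X\<close> with \<open>Y + IL' = \<Lambda>'X\<close>. As \<open>IL' \<subseteq> L\<close>, an isomorphism \<open>\<Lambda>'X \<rightarrow> Y\<close> that is
 the identity modulo \<open>IL'\<close> maps \<open>X\<close> onto a submodule of \<open>L\<close> isomorphic to \<open>M\<close>, and each of these submodules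
 arises from exactly one pair. If \<open>\<Lambda>''\<close> is another maximal order, multiplication by the bimodule
 \<open>\<Lambda>'\<Lambda>''\<close> translates \<open>\<Lambda>''\<close>-lattices into \<open>\<Lambda>'\<close>-lattices and preserves the classes over \<open>\<Lambda>\<close>.\<close>


section \<open>Subquotients of left modules\<close>

text \<open>The invertibility of \<open>J\<close> and of the other lattices rests on one statement:
  a proper two-sided ideal \<open>P\<close> above \<open>J\<close> has a quasi-inverse that is not
  contained in the order. In a Dedekind domain this comes from a shortest product of primes inside a
  principal ideal. Here factors cannot be reordered; instead a long word \<open>PCPC...\<close>
  inside \<open>p\<Lambda>'\<close> is rotated cyclically, and each rotation cancels one factor
  \<open>P\<close>.

  The isomorphism theorem is used twice. With \<open>N = V\<close> it shows that all full
  \<open>\<Lambda>'\<close>-lattices in \<open>V\<close> are isomorphic; hence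
  \<open>\<iota>\<^sup>*Z(U) = \<iota>\<^sup>*Z(L')\<close> for every lattice \<open>U\<close> in
  the Moebius sums, and a single unit can be taken out of all terms. With \<open>N = IL'\<close> it
  gives the bijection between pairs and sublattices of \<open>L\<close>.

  The exponents of the monomials are classes over \<open>\<Lambda>\<close>, which are additive along
  chains of lattices. As \<open>\<Lambda>'X\<close> need not be comparable with \<open>L\<close>,
  all of them are measured from \<open>L'\<close>, and the common factor \<open>[L'/L]\<close> is
  cancelled in the free monoid.\<close>

definition mcong :: "('r, 'm, 'd) module_scheme \<Rightarrow> 'm set \<Rightarrow> 'm \<Rightarrow> 'm \<Rightarrow> bool" where
 "mcong M Y x y \<longleftrightarrow> x \<in> carrier M \<and> y \<in> carrier M \<and> x \<ominus>\<^bsub>M\<^esub> y \<in> Y"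

text \<open>Homomorphisms into a quotient, and isomorphisms of quotients, are represented by maps
 between representatives, so that no quotient has to be formed.\<close>

definition qhom where
 "qhom R M X N Y f \<longleftrightarrow> (\<forall>x\<in>X. f x \<in> carrier N) \<and>
   (\<forall>x\<in>X. \<forall>y\<in>X. mcong N Y (f (x \<oplus>\<^bsub>M\<^esub> y)) (f x \<oplus>\<^bsub>N\<^esub> f y)) \<and>
   (\<forall>a\<in>carrier R. \<forall>x\<in>X. mcong N Y (f (a \<odot>\<^bsub>M\<^esub> x)) (a \<odot>\<^bsub>N\<^esub> f x))"

definition qiso where
 "qiso R M X Y N X' Y' f \<longleftrightarrow> qhom R M X N Y' f \<and> f ` X \<subseteq> X' \<and>
   (\<forall>x\<in>X. f x \<in> Y' \<longleftrightarrow> x \<in> Y) \<and> (\<forall>x'\<in>X'. \<exists>x\<in>X. mcong N Y' x' (f x))"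

abbreviation Qm :: "('r, 'm, 'd) module_scheme \<Rightarrow> 'm set \<Rightarrow> 'm set \<Rightarrow> ('r, 'm set) module" where
 "Qm M X Y \<equiv> quot_module (M\<lparr>carrier := X\<rparr>) Y"

context abelian_group
begin

lemma diff_add_cancel: "\<lbrakk>x \<in> carrier G; y \<in> carrier G\<rbrakk> \<Longrightarrow> (x \<ominus> y) \<oplus> y = x"
 by (simp add: minus_eq a_assoc l_neg)

lemma add_diff_cancel: "\<lbrakk>x \<in> carrier G; y \<in> carrier G\<rbrakk> \<Longrightarrow> (x \<oplus> y) \<ominus> y = x"
 by (simp add: minus_eq a_assoc r_neg)

lemma add_diff_cancel': "\<lbrakk>x \<in> carrier G; y \<in> carrier G\<rbrakk> \<Longrightarrow> (x \<oplus> y) \<ominus> x = y"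
 by (metis add_diff_cancel a_comm)

lemma diff_add_cancel': "\<lbrakk>x \<in> carrier G; y \<in> carrier G\<rbrakk> \<Longrightarrow> y \<oplus> (x \<ominus> y) = x"
 by (metis diff_add_cancel a_comm minus_closed)

lemma diff_diff_add: "\<lbrakk>x \<in> carrier G; y \<in> carrier G; z \<in> carrier G\<rbrakk> \<Longrightarrow> (x \<ominus> y) \<oplus> (y \<ominus> z) = x \<ominus> z"
 by (metis diff_add_cancel a_assoc minus_closed minus_eq a_inv_closed)

end

no_notation Sum_Type.Plus (infixr "<+>" 65)

text \<open>The locale \<open>left_module\<close> with the module instead of the ring as the default structure.\<close>

locale lmod = left_module R M
 for R :: "('r, 'c) ring_scheme" and M :: "('r, 'm, 'd) module_scheme" (structure)

sublocale left_module \<subseteq> lmod ..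

context lmod
begin

abbreviation "sm X \<equiv> submodule X R M"

lemma smult_zero_l: "x \<in> carrier M \<Longrightarrow> \<zero>\<^bsub>R\<^esub> \<odot> x = \<zero>"
 using smult_l_distr[of "\<zero>\<^bsub>R\<^esub>" "\<zero>\<^bsub>R\<^esub>" x] by (simp add: smult_closed)

lemma smult_zero_r: "a \<in> carrier R \<Longrightarrow> a \<odot> \<zero> = \<zero>"
 using smult_r_distr[of a "\<zero>" "\<zero>"] by (simp add: smult_closed)

lemma smult_minus_l: "\<lbrakk>a \<in> carrier R; x \<in> carrier M\<rbrakk> \<Longrightarrow> (\<ominus>\<^bsub>R\<^esub> a) \<odot> x = \<ominus> (a \<odot> x)"
 using smult_l_distr[of "\<ominus>\<^bsub>R\<^esub> a" a x]
 by (simp add: smult_closed smult_zero_l R.l_neg M.minus_equality)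

lemma smult_minus_r: "\<lbrakk>a \<in> carrier R; x \<in> carrier M\<rbrakk> \<Longrightarrow> a \<odot> (\<ominus> x) = \<ominus> (a \<odot> x)"
 using smult_r_distr[of a "\<ominus> x" x]
 by (simp add: smult_closed smult_zero_r M.l_neg M.minus_equality)

lemma smult_diff: "\<lbrakk>a \<in> carrier R; x \<in> carrier M; y \<in> carrier M\<rbrakk> \<Longrightarrow>
  a \<odot> (x \<ominus> y) = a \<odot> x \<ominus> a \<odot> y"
 by (simp add: M.minus_eq smult_r_distr smult_minus_r)

text \<open>Closure under negation comes from the scalar -1.\<close>

lemma submoduleI:
 assumes "H \<subseteq> carrier M" "\<zero> \<in> H"
  and "\<And>x y. \<lbrakk>x \<in> H; y \<in> H\<rbrakk> \<Longrightarrow> x \<oplus> y \<in> H"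
  and "\<And>a x. \<lbrakk>a \<in> carrier R; x \<in> H\<rbrakk> \<Longrightarrow> a \<odot> x \<in> H"
 shows "sm H"
proof (intro submodule.intro subgroup.intro)
 fix x assume x: "x \<in> H"
 have "(\<ominus>\<^bsub>R\<^esub> \<one>\<^bsub>R\<^esub>) \<odot> x \<in> H" using x assms(4) by simp
 then show "inv\<^bsub>add_monoid M\<^esub> x \<in> H"
  using x assms(1) using smult_minus_l[of "\<one>\<^bsub>R\<^esub>" x] by (auto simp: smult_one a_inv_def subset_iff)
qed (use assms in \<open>auto simp: submodule_axioms_def\<close>)

lemma sm_carrier: "sm X \<Longrightarrow> X \<subseteq> carrier M"
 by (metis submodule.axioms(1) subgroup.subset partial_object.select_convs(1))

lemma smD: "\<lbrakk>sm X; x \<in> X\<rbrakk> \<Longrightarrow> x \<in> carrier M"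
 using sm_carrier by blast

lemma sm_zero: "sm X \<Longrightarrow> \<zero> \<in> X"
 using subgroup.one_closed[OF submodule.axioms(1)] by force

lemma sm_add: "\<lbrakk>sm X; x \<in> X; y \<in> X\<rbrakk> \<Longrightarrow> x \<oplus> y \<in> X"
 using subgroup.m_closed[OF submodule.axioms(1)] by force

lemma sm_smult: "\<lbrakk>sm X; a \<in> carrier R; x \<in> X\<rbrakk> \<Longrightarrow> a \<odot> x \<in> X"
 by (rule submodule.smult_closed)

lemma sm_neg: "\<lbrakk>sm X; x \<in> X\<rbrakk> \<Longrightarrow> \<ominus> x \<in> X"
 using subgroup.m_inv_closed[OF submodule.axioms(1)] by (force simp: a_inv_def)

lemma sm_minus: "\<lbrakk>sm X; x \<in> X; y \<in> X\<rbrakk> \<Longrightarrow> x \<ominus> y \<in> X"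
 by (simp add: M.minus_eq sm_add sm_neg)

lemma sm_subgroup: "sm X \<Longrightarrow> subgroup X (add_monoid M)"
 by (rule submodule.axioms(1))

lemma sm_abel: "sm X \<Longrightarrow> abelian_subgroup X M"
 by (intro abelian_subgroupI3 additive_subgroup.intro sm_subgroup M.abelian_group_axioms)

lemma sm_UNIV: "sm (carrier M)"
 by (rule submoduleI) (auto simp: smult_closed)

lemma sm_0: "submodule {\<zero>} R M"
 by (rule submoduleI) (auto simp: smult_zero_r)

lemma sm_Int: "\<lbrakk>sm X; sm Y\<rbrakk> \<Longrightarrow> sm (X \<inter> Y)"
 by (rule submoduleI) (auto simp: sm_zero sm_add sm_smult dest: smD)

lemma sum_iff: "z \<in> X <+> Y \<longleftrightarrow> (\<exists>x\<in>X. \<exists>y\<in>Y. z = x \<oplus> y)"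
 by (auto simp: set_add_def' )

lemma sm_sum: assumes X: "sm X" and Y: "sm Y"
 shows "sm (X <+> Y)"
proof (rule submoduleI)
 show "X <+> Y \<subseteq> carrier M"
  by (rule M.setadd_subset_G) (use X Y sm_carrier in auto)
 show "\<zero> \<in> X <+> Y"
  unfolding sum_iff by (rule bexI[of _ "\<zero>"], rule bexI[of _ "\<zero>"]) (use X Y sm_zero in auto)
 fix u v assume "u \<in> X <+> Y" "v \<in> X <+> Y"
 then obtain x y x' y' where *: "x \<in> X" "y \<in> Y" "x' \<in> X" "y' \<in> Y" "u = x \<oplus> y" "v = x' \<oplus> y'"
  unfolding sum_iff by blast
 then have c: "x \<in> carrier M" "y \<in> carrier M" "x' \<in> carrier M" "y' \<in> carrier M"
  using X Y smD by blast+
 have "u \<oplus> v = (x \<oplus> x') \<oplus> (y \<oplus> y')"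
  using c by (simp add: * M.a_ac)
 then show "u \<oplus> v \<in> X <+> Y"
  unfolding sum_iff using * X Y sm_add by metis
next
 fix a u assume a: "a \<in> carrier R" and "u \<in> X <+> Y"
 then obtain x y where *: "x \<in> X" "y \<in> Y" "u = x \<oplus> y"
  unfolding sum_iff by blast
 then show "a \<odot> u \<in> X <+> Y"
  unfolding sum_iff using X Y a sm_smult smult_r_distr smD by metis
qed

lemma sum_upper1: assumes X: "sm X" and Y: "sm Y"
 shows "X \<subseteq> X <+> Y"
proof
 fix x assume "x \<in> X"
 then show "x \<in> X <+> Y"
  unfolding sum_iff using sm_zero[OF Y] smD[OF X] by (metis M.r_zero)
qed

lemma sum_upper2: assumes X: "sm X" and Y: "sm Y"
 shows "Y \<subseteq> X <+> Y"
proof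
 fix x assume "x \<in> Y"
 then show "x \<in> X <+> Y"
  unfolding sum_iff using sm_zero[OF X] smD[OF Y] by (metis M.l_zero)
qed

lemma sum_least: "\<lbrakk>sm Z; X \<subseteq> Z; Y \<subseteq> Z\<rbrakk> \<Longrightarrow> X <+> Y \<subseteq> Z"
 using sm_add by (fastforce simp: sum_iff)

lemma sum_minus_iff: assumes "sm X" "sm Y"
 shows "z \<in> X <+> Y \<longleftrightarrow> z \<in> carrier M \<and> (\<exists>x\<in>X. z \<ominus> x \<in> Y)"
proof
 assume "z \<in> X <+> Y"
 then obtain x y where *: "x \<in> X" "y \<in> Y" "z = x \<oplus> y"
  unfolding sum_iff by blast
 then have "z \<ominus> x = y" "z \<in> carrier M"
  using assms smD M.add_diff_cancel' by auto
 then show "z \<in> carrier M \<and> (\<exists>x\<in>X. z \<ominus> x \<in> Y)" using *(1,2) by metis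
next
 assume "z \<in> carrier M \<and> (\<exists>x\<in>X. z \<ominus> x \<in> Y)"
 then obtain x where *: "x \<in> X" "z \<ominus> x \<in> Y" "z \<in> carrier M" by blast
 then have "z = x \<oplus> (z \<ominus> x)"
  using assms smD M.diff_add_cancel' by metis
 then show "z \<in> X <+> Y" unfolding sum_iff using * by blast
qed

lemma left_module_sub: assumes X: "sm X"
 shows "left_module R (M\<lparr>carrier := X\<rparr>)"
proof (intro left_module.intro left_module_axioms.intro)
 show "ring R" by (rule R.ring_axioms)
 show "abelian_group (M\<lparr>carrier := X\<rparr>)"
 proof (rule abelian_groupI)
  fix x assume "x \<in> carrier (M\<lparr>carrier := X\<rparr>)"
  then show "\<exists>y\<in>carrier (M\<lparr>carrier := X\<rparr>). y \<oplus>\<^bsub>M\<lparr>carrier := X\<rparr>\<^esub> x = \<zero>\<^bsub>M\<lparr>carrier := X\<rparr>\<^esub>"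
   using X by (auto intro!: bexI[of _ "\<ominus> x"] simp: M.l_neg smD sm_neg)
 qed (use X M.a_assoc M.a_comm in \<open>auto simp: sm_add sm_zero smD\<close>)
qed (use X in \<open>auto simp: sm_smult smult_l_distr smult_r_distr smult_assoc smult_one smD[OF X]\<close>)

lemma submodule_sub_iff: assumes X: "sm X"
 shows "submodule Y R (M\<lparr>carrier := X\<rparr>) \<longleftrightarrow> sm Y \<and> Y \<subseteq> X"
proof
 interpret X: left_module R "M\<lparr>carrier := X\<rparr>" by (rule left_module_sub[OF X])
 assume *: "submodule Y R (M\<lparr>carrier := X\<rparr>)"
 have "Y \<subseteq> X" using X.sm_carrier[OF *] by simp
 then show "sm Y \<and> Y \<subseteq> X"
  using X.sm_add[OF *] X.sm_smult[OF *] X.sm_zero[OF *] sm_carrier[OF X]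
  by (auto intro!: submoduleI)
next
 interpret X: left_module R "M\<lparr>carrier := X\<rparr>" by (rule left_module_sub[OF X])
 assume *: "sm Y \<and> Y \<subseteq> X"
 then show "submodule Y R (M\<lparr>carrier := X\<rparr>)"
  by (intro X.submoduleI) (auto simp: sm_zero sm_add sm_smult)
qed

section \<open>Congruence modulo a submodule\<close>

lemma cong_refl: "\<lbrakk>sm Y; x \<in> carrier M\<rbrakk> \<Longrightarrow> mcong M Y x x"
 by (simp add: mcong_def M.minus_eq M.r_neg sm_zero)

lemma cong_sym: assumes Y: "sm Y" and c: "mcong M Y x y" shows "mcong M Y y x"
proof -
 have "y \<ominus> x = \<ominus> (x \<ominus> y)"
  using c by (simp add: mcong_def M.minus_eq M.minus_add M.a_comm)
 then show ?thesis using c sm_neg[OF Y] by (simp add: mcong_def)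
qed

lemma cong_trans [trans]: assumes Y: "sm Y" and "mcong M Y x y" "mcong M Y y z" shows "mcong M Y x z"
proof -
 have "x \<ominus> z = (x \<ominus> y) \<oplus> (y \<ominus> z)"
  using assms by (simp add: mcong_def M.diff_diff_add)
 then show ?thesis using assms sm_add[OF Y] by (simp add: mcong_def)
qed

lemma cong_add: assumes Y: "sm Y" and "mcong M Y x y" "mcong M Y x' y'"
 shows "mcong M Y (x \<oplus> x') (y \<oplus> y')"
proof -
 have "(x \<oplus> x') \<ominus> (y \<oplus> y') = (x \<ominus> y) \<oplus> (x' \<ominus> y')"
  using assms by (simp add: mcong_def M.minus_eq M.a_ac M.minus_add)
 then show ?thesis using assms sm_add[OF Y] by (simp add: mcong_def)
qed

lemma cong_smult: assumes Y: "sm Y" and "mcong M Y x y" "a \<in> carrier R"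
 shows "mcong M Y (a \<odot> x) (a \<odot> y)"
 using assms sm_smult[OF Y, of a "x \<ominus> y"] by (simp add: mcong_def smult_closed smult_diff)

lemma cong_neg: assumes Y: "sm Y" and "mcong M Y x y"
 shows "mcong M Y (\<ominus> x) (\<ominus> y)"
 using cong_smult[OF assms, of "\<ominus>\<^bsub>R\<^esub> \<one>\<^bsub>R\<^esub>"] assms(2) by (simp add: smult_minus_l smult_one mcong_def)

lemma cong_minus: assumes Y: "sm Y" and "mcong M Y x y" "mcong M Y x' y'"
 shows "mcong M Y (x \<ominus> x') (y \<ominus> y')"
 using cong_add[OF Y assms(2) cong_neg[OF Y assms(3)]] by (simp add: M.minus_eq)

lemma cong_mem: assumes Y: "sm Y" and c: "mcong M Y x y" shows "x \<in> Y \<longleftrightarrow> y \<in> Y"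
proof -
 have "u \<in> Y" if "mcong M Y u v" "v \<in> Y" for u v
 proof -
  have "u = (u \<ominus> v) \<oplus> v"
   using that by (simp add: mcong_def M.diff_add_cancel)
  then show ?thesis using that sm_add[OF Y] by (metis mcong_def)
 qed
 then show ?thesis using c cong_sym[OF Y c] by blast
qed

lemma cong_mono: "\<lbrakk>mcong M Y x y; Y \<subseteq> Z\<rbrakk> \<Longrightarrow> mcong M Z x y"
 by (auto simp: mcong_def)

lemma cong_0: "mcong M {\<zero>} x y \<longleftrightarrow> x \<in> carrier M \<and> x = y"
 using M.diff_add_cancel[of x y] by (auto simp: mcong_def M.minus_eq M.r_neg)

lemma cong_zero: "\<lbrakk>sm Y; x \<in> Y\<rbrakk> \<Longrightarrow> mcong M Y x \<zero>"
 by (simp add: mcong_def smD sm_minus sm_zero)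

lemma cong_memD: "\<lbrakk>sm X; Y \<subseteq> X; mcong M Y x y; y \<in> X\<rbrakk> \<Longrightarrow> x \<in> X"
 using cong_mono cong_mem by blast

section \<open>Cosets and the module structure on \<open>X / Y\<close>\<close>

lemma coset_eq_iff: assumes Y: "sm Y" and "x \<in> carrier M" "y \<in> carrier M"
 shows "Y +> x = Y +> y \<longleftrightarrow> mcong M Y x y"
proof
 assume "Y +> x = Y +> y"
 then have "Y +> (x \<ominus> y) = Y"
  using assms sm_carrier[OF Y] by (simp add: M.a_coset_add_inv2 M.minus_eq)
 then show "mcong M Y x y"
  using assms M.a_coset_join1[OF _ _ sm_subgroup[OF Y]] by (simp add: mcong_def)
next
 assume "mcong M Y x y"
 then have "Y +> (x \<oplus> (\<ominus> y)) = Y"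
  using assms M.a_coset_join2[OF _ sm_subgroup[OF Y]] by (simp add: mcong_def M.minus_eq)
 then show "Y +> x = Y +> y"
  using assms sm_carrier[OF Y] M.a_coset_add_inv1 by blast
qed

lemma coset_self: "\<lbrakk>sm Y; x \<in> carrier M\<rbrakk> \<Longrightarrow> x \<in> Y +> x"
 by (simp add: abelian_subgroup.a_rcos_self sm_abel)

lemma coset_mem_iff: assumes Y: "sm Y" and x: "x \<in> carrier M"
 shows "c \<in> Y +> x \<longleftrightarrow> mcong M Y c x"
proof
 assume "c \<in> Y +> x"
 then have "c \<in> carrier M" "Y +> x = Y +> c"
  using M.a_repr_independence[OF _ x sm_subgroup[OF Y]] M.a_r_coset_subset_G[OF sm_carrier[OF Y] x] by auto
 then show "mcong M Y c x" using coset_eq_iff[OF Y] x by metis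
next
 assume "mcong M Y c x"
 then show "c \<in> Y +> x"
  using coset_eq_iff[OF Y _ x, of c] coset_self[OF Y, of c] by (simp add: mcong_def)
qed

lemma Q_carrier: "carrier (Qm M X Y) = (\<lambda>x. Y +> x) ` X"
 by (auto simp: quot_module_def A_RCOSETS_def' a_r_coset_def')

lemma Q_zero: "\<zero>\<^bsub>Qm M X Y\<^esub> = Y"
 by (simp add: quot_module_def)

lemma Q_add: assumes Y: "sm Y" and "x \<in> carrier M" "y \<in> carrier M"
 shows "(Y +> x) \<oplus>\<^bsub>Qm M X Y\<^esub> (Y +> y) = Y +> (x \<oplus> y)"
 using abelian_subgroup.a_rcos_sum[OF sm_abel[OF Y] assms(2,3)]
 by (simp add: quot_module_def set_add_defs)

lemma Q_smult: assumes Y: "sm Y" and a: "a \<in> carrier R" and x: "x \<in> carrier M"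
 shows "a \<odot>\<^bsub>Qm M X Y\<^esub> (Y +> x) = Y +> (a \<odot> x)"
proof -
 have "a \<odot>\<^bsub>Qm M X Y\<^esub> (Y +> x) = Y <+> ((\<lambda>c. a \<odot> c) ` (Y +> x))"
  by (simp add: quot_module_def set_add_defs)
 also have "\<dots> = Y +> (a \<odot> x)"
 proof (intro equalityI subsetI)
  fix z assume "z \<in> Y <+> ((\<lambda>c. a \<odot> c) ` (Y +> x))"
  then obtain y c where *: "y \<in> Y" "mcong M Y c x" "z = y \<oplus> a \<odot> c"
   using coset_mem_iff[OF Y x] by (auto simp: sum_iff)
  then have "mcong M Y z (\<zero> \<oplus> a \<odot> x)"
   using cong_add[OF Y cong_zero[OF Y]] cong_smult[OF Y _ a] by blast
  then show "z \<in> Y +> (a \<odot> x)"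
   using coset_mem_iff[OF Y] a x by (simp add: smult_closed)
 next
  fix z assume "z \<in> Y +> (a \<odot> x)"
  then obtain y where "y \<in> Y" "z = y \<oplus> a \<odot> x"
   by (auto simp: a_r_coset_def')
  then show "z \<in> Y <+> ((\<lambda>c. a \<odot> c) ` (Y +> x))"
   using coset_self[OF Y x] by (auto simp: sum_iff)
 qed
 finally show ?thesis .
qed

lemma left_module_Q: assumes X: "sm X" and Y: "sm Y" and YX: "Y \<subseteq> X"
 shows "left_module R (Qm M X Y)"
proof (intro left_module.intro left_module_axioms.intro)
 have z: "Y = Y +> \<zero>" using M.a_coset_add_zero sm_carrier[OF Y] by simp
 note [simp] = Q_carrier Q_add[OF Y] Q_smult[OF Y] smD[OF X]
 show "ring R" by (rule R.ring_axioms)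
 show "abelian_group (Qm M X Y)"
 proof (rule abelian_groupI, goal_cases)
  case 2 show ?case
   unfolding Q_zero Q_carrier using z sm_zero[OF X] by blast
 next
  case (6 x)
  then obtain u where u: "x = Y +> u" "u \<in> X" by auto
  then show ?case
   unfolding Q_zero by (auto intro!: bexI[of _ "\<ominus> u"] simp: sm_neg[OF X] M.l_neg z[symmetric])
 next
  case (5 x)
  then obtain u where u: "x = Y +> u" "u \<in> X" by auto
  then show ?case
   using Q_add[OF Y M.zero_closed smD[OF X u(2)], of X, folded z] u by (simp add: Q_zero)
 qed (auto simp: sm_add[OF X] M.a_ac)
qed (auto simp: Q_carrier Q_add[OF Y] Q_smult[OF Y] smD[OF X] sm_smult[OF X] sm_add[OF X]
   smult_closed smult_l_distr smult_r_distr smult_assoc smult_one)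

end

section \<open>Isomorphisms of subquotients\<close>

lemma module_isomorphic_sym:
 assumes "left_module R M" "left_module R N" and MN: "module_isomorphic R M N"
 shows "module_isomorphic R N M"
proof -
 interpret M: left_module R M by fact
 interpret N: left_module R N by fact
 from MN obtain h where h: "h \<in> iso (add_monoid M) (add_monoid N)"
  and hs: "\<And>a x. \<lbrakk>a \<in> carrier R; x \<in> carrier M\<rbrakk> \<Longrightarrow> h (a \<odot>\<^bsub>M\<^esub> x) = a \<odot>\<^bsub>N\<^esub> h x"
  unfolding module_isomorphic_def by auto
 let ?g = "inv_into (carrier M) h"
 have bij: "bij_betw h (carrier M) (carrier N)" using h by (auto simp: iso_def)
 have g: "?g \<in> iso (add_monoid N) (add_monoid M)"
  using group.iso_set_sym[OF M.M.a_group h] by simp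
 have "?g (a \<odot>\<^bsub>N\<^esub> y) = a \<odot>\<^bsub>M\<^esub> ?g y" if a: "a \<in> carrier R" and y: "y \<in> carrier N" for a y
 proof -
  obtain x where x: "x \<in> carrier M" "y = h x" using bij y unfolding bij_betw_def by blast
  then have "h (a \<odot>\<^bsub>M\<^esub> x) = a \<odot>\<^bsub>N\<^esub> y" using hs a by simp
  then show ?thesis using x a bij M.smult_closed
   by (metis bij_betw_inv_into_left)
 qed
 then show ?thesis unfolding module_isomorphic_def using g by blast
qed

lemma module_isomorphic_trans:
 assumes "left_module R M" and MN: "module_isomorphic R M N" and NP: "module_isomorphic R N P"
 shows "module_isomorphic R M P"
proof -
 interpret M: left_module R M by fact
 from MN obtain h where h: "h \<in> iso (add_monoid M) (add_monoid N)"
  and hs: "\<And>a x. \<lbrakk>a \<in> carrier R; x \<in> carrier M\<rbrakk> \<Longrightarrow> h (a \<odot>\<^bsub>M\<^esub> x) = a \<odot>\<^bsub>N\<^esub> h x"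
  unfolding module_isomorphic_def by auto
 from NP obtain g where g: "g \<in> iso (add_monoid N) (add_monoid P)"
  and gs: "\<And>a x. \<lbrakk>a \<in> carrier R; x \<in> carrier N\<rbrakk> \<Longrightarrow> g (a \<odot>\<^bsub>N\<^esub> x) = a \<odot>\<^bsub>P\<^esub> g x"
  unfolding module_isomorphic_def by auto
 have hc: "x \<in> carrier M \<Longrightarrow> h x \<in> carrier N" for x
  using h by (auto simp: iso_def hom_def)
 have "g \<circ> h \<in> iso (add_monoid M) (add_monoid P)"
  using h g by (auto simp: iso_def hom_def Pi_iff intro: bij_betw_trans)
 then show ?thesis unfolding module_isomorphic_def
  by (rule bexI[rotated]) (auto simp: hs gs hc)
qed

lemma iso_class_cong:
 assumes "left_module R M" "left_module R N" "module_isomorphic R M N"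
 shows "iso_class R M = iso_class R N"
proof -
 have "module_isomorphic R M T \<longleftrightarrow> module_isomorphic R N T" for T :: "('a, 'a set) module"
  using module_isomorphic_trans[OF assms(1,3), of T]
   module_isomorphic_trans[OF assms(2) module_isomorphic_sym[OF assms], of T] by blast
 then show ?thesis unfolding iso_class_def by simp
qed

text \<open>Simplicity of \<open>X / Y\<close> (see \<open>simple_Q_iff\<close>). Expressed by the
  submodules between \<open>Y\<close> and \<open>X\<close>, it stays inside \<open>M\<close>, where
  different quotients can be compared.\<close>

definition simpq where
 "simpq R M Y X \<longleftrightarrow> submodule Y R M \<and> submodule X R M \<and> Y \<subseteq> X \<and> Y \<noteq> X \<and>
   (\<forall>Z. submodule Z R M \<longrightarrow> Y \<subseteq> Z \<longrightarrow> Z \<subseteq> X \<longrightarrow> Z = Y \<or> Z = X)"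

definition between where
 "between R M Y X = {Z. submodule Z R M \<and> Y \<subseteq> Z \<and> Z \<subseteq> X}"

text \<open>Finite index by representatives. No scalars occur, so one and the same fact serves for
  modules over an order and over a suborder.\<close>

definition fin_index where
 "fin_index M Y X \<longleftrightarrow> (\<exists>S. finite S \<and> S \<subseteq> X \<and> (\<forall>x\<in>X. \<exists>s\<in>S. mcong M Y x s))"

lemma fin_indexI:
 "\<lbrakk>finite S; S \<subseteq> X; \<And>x. x \<in> X \<Longrightarrow> \<exists>s\<in>S. mcong M Y x s\<rbrakk> \<Longrightarrow> fin_index M Y X"
 by (auto simp: fin_index_def)

locale two_modules = M: left_module R M + N: left_module R N
 for R (structure) and M :: "('a, 'm, 'd) module_scheme" and N :: "('a, 'n, 'e) module_scheme"
begin

lemma qhom_facts: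
 assumes X: "M.sm X" and Y': "N.sm Y'" and f: "qhom R M X N Y' f"
 shows "\<And>x. x \<in> X \<Longrightarrow> f x \<in> carrier N"
  and "\<And>x y. \<lbrakk>x \<in> X; y \<in> X\<rbrakk> \<Longrightarrow> mcong N Y' (f (x \<oplus>\<^bsub>M\<^esub> y)) (f x \<oplus>\<^bsub>N\<^esub> f y)"
  and "\<And>a x. \<lbrakk>a \<in> carrier R; x \<in> X\<rbrakk> \<Longrightarrow> mcong N Y' (f (a \<odot>\<^bsub>M\<^esub> x)) (a \<odot>\<^bsub>N\<^esub> f x)"
  and "\<And>x. x \<in> X \<Longrightarrow> mcong N Y' (f (\<ominus>\<^bsub>M\<^esub> x)) (\<ominus>\<^bsub>N\<^esub> f x)"
  and "\<And>x y. \<lbrakk>x \<in> X; y \<in> X\<rbrakk> \<Longrightarrow> mcong N Y' (f (x \<ominus>\<^bsub>M\<^esub> y)) (f x \<ominus>\<^bsub>N\<^esub> f y)"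
  and "mcong N Y' (f \<zero>\<^bsub>M\<^esub>) \<zero>\<^bsub>N\<^esub>"
proof -
 show c: "\<And>x. x \<in> X \<Longrightarrow> f x \<in> carrier N" using f by (auto simp: qhom_def)
 show add: "\<And>x y. \<lbrakk>x \<in> X; y \<in> X\<rbrakk> \<Longrightarrow> mcong N Y' (f (x \<oplus>\<^bsub>M\<^esub> y)) (f x \<oplus>\<^bsub>N\<^esub> f y)"
  using f by (auto simp: qhom_def)
 show sm: "\<And>a x. \<lbrakk>a \<in> carrier R; x \<in> X\<rbrakk> \<Longrightarrow> mcong N Y' (f (a \<odot>\<^bsub>M\<^esub> x)) (a \<odot>\<^bsub>N\<^esub> f x)"
  using f by (auto simp: qhom_def)
 show neg: "mcong N Y' (f (\<ominus>\<^bsub>M\<^esub> x)) (\<ominus>\<^bsub>N\<^esub> f x)" if "x \<in> X" for x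
  using sm[of "\<ominus>\<^bsub>R\<^esub> \<one>\<^bsub>R\<^esub>" x] that c M.smD[OF X]
  by (simp add: M.smult_minus_l N.smult_minus_l M.smult_one N.smult_one)
 show "mcong N Y' (f (x \<ominus>\<^bsub>M\<^esub> y)) (f x \<ominus>\<^bsub>N\<^esub> f y)" if "x \<in> X" "y \<in> X" for x y
 proof -
  have "mcong N Y' (f (x \<ominus>\<^bsub>M\<^esub> y)) (f x \<oplus>\<^bsub>N\<^esub> f (\<ominus>\<^bsub>M\<^esub> y))"
   using add that M.sm_neg[OF X] by (simp add: M.M.minus_eq)
  moreover have "mcong N Y' (f x \<oplus>\<^bsub>N\<^esub> f (\<ominus>\<^bsub>M\<^esub> y)) (f x \<oplus>\<^bsub>N\<^esub> \<ominus>\<^bsub>N\<^esub> f y)"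
   using that by (intro N.cong_add[OF Y'] N.cong_refl[OF Y'] c neg)
  ultimately show ?thesis using N.cong_trans[OF Y'] by (simp add: N.M.minus_eq)
 qed
 show "mcong N Y' (f \<zero>\<^bsub>M\<^esub>) \<zero>\<^bsub>N\<^esub>"
  using sm[of "\<zero>\<^bsub>R\<^esub>" "\<zero>\<^bsub>M\<^esub>"] M.sm_zero[OF X] c
  by (simp add: M.smult_zero_l N.smult_zero_l)
qed

lemma image_sm:
 assumes X: "M.sm X" and c: "\<And>x. x \<in> X \<Longrightarrow> f x \<in> carrier N"
  and a: "\<And>x y. \<lbrakk>x \<in> X; y \<in> X\<rbrakk> \<Longrightarrow> f (x \<oplus>\<^bsub>M\<^esub> y) = f x \<oplus>\<^bsub>N\<^esub> f y"
  and s: "\<And>r x. \<lbrakk>r \<in> carrier R; x \<in> X\<rbrakk> \<Longrightarrow> f (r \<odot>\<^bsub>M\<^esub> x) = r \<odot>\<^bsub>N\<^esub> f x"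
 shows "N.sm (f ` X)"
proof (rule N.submoduleI)
 have "f (\<zero> \<odot>\<^bsub>M\<^esub> \<zero>\<^bsub>M\<^esub>) = \<zero>\<^bsub>N\<^esub>"
  using s[of \<zero> "\<zero>\<^bsub>M\<^esub>"] M.sm_zero[OF X] N.smult_zero_l[OF c] by simp
 then show "\<zero>\<^bsub>N\<^esub> \<in> f ` X" using M.sm_smult[OF X _ M.sm_zero[OF X], of \<zero>] by force
 show "u \<oplus>\<^bsub>N\<^esub> w \<in> f ` X" if "u \<in> f ` X" "w \<in> f ` X" for u w
  using that a[symmetric] M.sm_add[OF X] by auto
 show "r \<odot>\<^bsub>N\<^esub> u \<in> f ` X" if "r \<in> carrier R" "u \<in> f ` X" for r u
  using that s[symmetric] M.sm_smult[OF X] by auto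
qed (use c in auto)

lemma qiso_cong:
 assumes X: "M.sm X" and Y: "M.sm Y" and Y': "N.sm Y'"
  and f: "qiso R M X Y N X' Y' f" and xy: "x \<in> X" "y \<in> X"
 shows "mcong N Y' (f x) (f y) \<longleftrightarrow> mcong M Y x y"
proof -
 have q: "qhom R M X N Y' f" and i: "\<And>x. x \<in> X \<Longrightarrow> f x \<in> Y' \<longleftrightarrow> x \<in> Y"
  using f by (auto simp: qiso_def)
 have "f x \<ominus>\<^bsub>N\<^esub> f y \<in> Y' \<longleftrightarrow> f (x \<ominus>\<^bsub>M\<^esub> y) \<in> Y'"
  using N.cong_mem[OF Y' qhom_facts(5)[OF X Y' q xy]] by simp
 also have "\<dots> \<longleftrightarrow> x \<ominus>\<^bsub>M\<^esub> y \<in> Y" using i xy M.sm_minus[OF X] by blast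
 finally show ?thesis using xy M.smD[OF X] qhom_facts(1)[OF X Y' q] by (simp add: mcong_def)
qed

lemma qiso_imp_isomorphic:
 assumes X: "M.sm X" and Y: "M.sm Y" and X': "N.sm X'" and Y': "N.sm Y'"
  and f: "qiso R M X Y N X' Y' f"
 shows "module_isomorphic R (Qm M X Y) (Qm N X' Y')"
proof -
 \<comment> \<open>All cosets in this union coincide by \<open>qiso_cong\<close>, so this is the map
   induced by \<open>f\<close>, and no representative has to be chosen.\<close>
 define h where "h C = (\<Union>c\<in>C \<inter> X. Y' +>\<^bsub>N\<^esub> f c)" for C
 have q: "qhom R M X N Y' f" and fX: "f ` X \<subseteq> X'" 
  and sur: "\<And>x'. x' \<in> X' \<Longrightarrow> \<exists>x\<in>X. mcong N Y' x' (f x)"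
  using f by (auto simp: qiso_def)
 note qf = qhom_facts[OF X Y' q]
 have h: "h (Y +>\<^bsub>M\<^esub> x) = Y' +>\<^bsub>N\<^esub> f x" if x: "x \<in> X" for x
 proof -
  have "Y' +>\<^bsub>N\<^esub> f c = Y' +>\<^bsub>N\<^esub> f x" if "c \<in> Y +>\<^bsub>M\<^esub> x" "c \<in> X" for c
   using that x M.coset_mem_iff[OF Y M.smD[OF X x]] qiso_cong[OF X Y Y' f, of c x]
    N.coset_eq_iff[OF Y'] qf(1) by auto
  then show ?thesis unfolding h_def using x M.coset_self[OF Y M.smD[OF X x]] by blast
 qed
 have "h \<in> hom (add_monoid (Qm M X Y)) (add_monoid (Qm N X' Y'))"
 proof (rule homI; simp add: M.Q_carrier N.Q_carrier)
  fix C assume "C \<in> (+>\<^bsub>M\<^esub>) Y ` X"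
  then show "h C \<in> (+>\<^bsub>N\<^esub>) Y' ` X'" using fX h by auto
 next
  fix C D assume "C \<in> (+>\<^bsub>M\<^esub>) Y ` X" "D \<in> (+>\<^bsub>M\<^esub>) Y ` X"
  then obtain c d where cd: "c \<in> X" "d \<in> X" "C = Y +>\<^bsub>M\<^esub> c" "D = Y +>\<^bsub>M\<^esub> d" by auto
  then show "h (C \<oplus>\<^bsub>Qm M X Y\<^esub> D) = h C \<oplus>\<^bsub>Qm N X' Y'\<^esub> h D"
   using M.Q_add[OF Y] N.Q_add[OF Y'] M.smD[OF X] h qf(1,2) M.sm_add[OF X] N.coset_eq_iff[OF Y']
   by simp
 qed
 moreover have "bij_betw h (carrier (Qm M X Y)) (carrier (Qm N X' Y'))"
  unfolding bij_betw_def
 proof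
  show "inj_on h (carrier (Qm M X Y))"
  proof (rule inj_onI; simp add: M.Q_carrier)
   fix C D assume "C \<in> (+>\<^bsub>M\<^esub>) Y ` X" "D \<in> (+>\<^bsub>M\<^esub>) Y ` X" and e: "h C = h D"
   then obtain c d where cd: "c \<in> X" "d \<in> X" "C = Y +>\<^bsub>M\<^esub> c" "D = Y +>\<^bsub>M\<^esub> d" by auto
   then show "C = D" using e h N.coset_eq_iff[OF Y'] qf(1) qiso_cong[OF X Y Y' f] M.coset_eq_iff[OF Y] M.smD[OF X]
    by simp
  qed
  show "h ` carrier (Qm M X Y) = carrier (Qm N X' Y')"
  proof (auto simp: M.Q_carrier N.Q_carrier h)
   fix x assume "x \<in> X" then show "Y' +>\<^bsub>N\<^esub> f x \<in> (+>\<^bsub>N\<^esub>) Y' ` X'" using fX by auto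
  next
   fix x' assume "x' \<in> X'"
   then obtain x where "x \<in> X" "mcong N Y' x' (f x)" using sur by blast
   then show "Y' +>\<^bsub>N\<^esub> x' \<in> h ` (+>\<^bsub>M\<^esub>) Y ` X"
    using h N.coset_eq_iff[OF Y'] by (force simp: mcong_def)
  qed
 qed
 moreover have "h (a \<odot>\<^bsub>Qm M X Y\<^esub> C) = a \<odot>\<^bsub>Qm N X' Y'\<^esub> h C"
  if a: "a \<in> carrier R" and C: "C \<in> carrier (Qm M X Y)" for a C
 proof -
  obtain c where c: "c \<in> X" "C = Y +>\<^bsub>M\<^esub> c" using C by (auto simp: M.Q_carrier)
  then show ?thesis using a M.Q_smult[OF Y] N.Q_smult[OF Y'] M.smD[OF X] h qf(1,3) M.sm_smult[OF X]
    N.coset_eq_iff[OF Y'] N.smult_closed by simp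
 qed
 ultimately show ?thesis unfolding module_isomorphic_def iso_def by auto
qed

lemma isomorphic_imp_qiso:
 assumes X: "M.sm X" and Y: "M.sm Y" "Y \<subseteq> X"
  and X': "N.sm X'" and Y': "N.sm Y'" "Y' \<subseteq> X'"
  and iso: "module_isomorphic R (Qm M X Y) (Qm N X' Y')"
 shows "\<exists>f. qiso R M X Y N X' Y' f"
proof -
 from iso obtain h where hom: "h \<in> hom (add_monoid (Qm M X Y)) (add_monoid (Qm N X' Y'))"
  and bij: "bij_betw h ((+>\<^bsub>M\<^esub>) Y ` X) ((+>\<^bsub>N\<^esub>) Y' ` X')"
  and hs: "\<And>a C. \<lbrakk>a \<in> carrier R; C \<in> carrier (Qm M X Y)\<rbrakk> \<Longrightarrow> h (a \<odot>\<^bsub>Qm M X Y\<^esub> C) = a \<odot>\<^bsub>Qm N X' Y'\<^esub> h C"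
  unfolding module_isomorphic_def by (auto simp: iso_def M.Q_carrier N.Q_carrier)
 have "\<exists>r\<in>X'. h (Y +>\<^bsub>M\<^esub> x) = Y' +>\<^bsub>N\<^esub> r" if "x \<in> X" for x
  using bij that unfolding bij_betw_def by blast
 then obtain f where f: "\<And>x. x \<in> X \<Longrightarrow> f x \<in> X'" "\<And>x. x \<in> X \<Longrightarrow> h (Y +>\<^bsub>M\<^esub> x) = Y' +>\<^bsub>N\<^esub> f x"
  by metis
 have hadd: "h ((Y +>\<^bsub>M\<^esub> x) \<oplus>\<^bsub>Qm M X Y\<^esub> (Y +>\<^bsub>M\<^esub> y)) = h (Y +>\<^bsub>M\<^esub> x) \<oplus>\<^bsub>Qm N X' Y'\<^esub> h (Y +>\<^bsub>M\<^esub> y)"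
  if "x \<in> X" "y \<in> X" for x y
  using hom that by (simp add: hom_def M.Q_carrier)
 have q: "qhom R M X N Y' f"
  unfolding qhom_def
 proof (intro conjI ballI)
  fix x assume x: "x \<in> X"
  show "f x \<in> carrier N" by (rule N.smD[OF X' f(1)[OF x]])
 next
  fix x y assume xy: "x \<in> X" "y \<in> X"
  have "Y' +>\<^bsub>N\<^esub> f (x \<oplus>\<^bsub>M\<^esub> y) = Y' +>\<^bsub>N\<^esub> (f x \<oplus>\<^bsub>N\<^esub> f y)"
   using hadd[OF xy] M.Q_add[OF Y(1)] N.Q_add[OF Y'(1)] xy f M.smD[OF X] N.smD[OF X'] M.sm_add[OF X]
   by simp
  then show "mcong N Y' (f (x \<oplus>\<^bsub>M\<^esub> y)) (f x \<oplus>\<^bsub>N\<^esub> f y)"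
   using N.coset_eq_iff[OF Y'(1)] f xy N.smD[OF X'] M.sm_add[OF X] by simp
 next
  fix a x assume ax: "a \<in> carrier R" "x \<in> X"
  have "Y' +>\<^bsub>N\<^esub> f (a \<odot>\<^bsub>M\<^esub> x) = Y' +>\<^bsub>N\<^esub> (a \<odot>\<^bsub>N\<^esub> f x)"
   using hs[OF ax(1), of "Y +>\<^bsub>M\<^esub> x"] M.Q_smult[OF Y(1)] N.Q_smult[OF Y'(1)] ax f M.smD[OF X] N.smD[OF X'] M.sm_smult[OF X]
   by (simp add: M.Q_carrier)
  then show "mcong N Y' (f (a \<odot>\<^bsub>M\<^esub> x)) (a \<odot>\<^bsub>N\<^esub> f x)"
   using N.coset_eq_iff[OF Y'(1)] f ax N.smD[OF X'] M.sm_smult[OF X] N.smult_closed by simp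
 qed
 note qf = qhom_facts[OF X Y'(1) q]
 have inj: "mcong N Y' (f x) (f y) \<longleftrightarrow> mcong M Y x y" if xy: "x \<in> X" "y \<in> X" for x y
 proof -
  have "mcong N Y' (f x) (f y) \<longleftrightarrow> h (Y +>\<^bsub>M\<^esub> x) = h (Y +>\<^bsub>M\<^esub> y)"
   using N.coset_eq_iff[OF Y'(1)] qf(1) f xy by simp
  also have "\<dots> \<longleftrightarrow> Y +>\<^bsub>M\<^esub> x = Y +>\<^bsub>M\<^esub> y"
   using inj_on_eq_iff[OF bij_betw_imp_inj_on[OF bij]] xy by auto
  also have "\<dots> \<longleftrightarrow> mcong M Y x y" using M.coset_eq_iff[OF Y(1)] xy M.smD[OF X] by simp
  finally show ?thesis .
 qed
 have "qiso R M X Y N X' Y' f" unfolding qiso_def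
 proof (intro conjI ballI q)
  show "f ` X \<subseteq> X'" using f by auto
  fix x assume x: "x \<in> X"
  have "f x \<in> Y' \<longleftrightarrow> mcong N Y' (f x) (f \<zero>\<^bsub>M\<^esub>)"
   using qf(1,6) N.cong_mem[OF Y'(1)] N.cong_zero[OF Y'(1)] N.cong_trans[OF Y'(1)] N.cong_sym[OF Y'(1)] x
    N.sm_zero[OF Y'(1)] by metis
  also have "\<dots> \<longleftrightarrow> mcong M Y x \<zero>\<^bsub>M\<^esub>" using inj x M.sm_zero[OF X] by blast
  also have "\<dots> \<longleftrightarrow> x \<in> Y"
   using M.cong_mem[OF Y(1)] M.cong_zero[OF Y(1)] M.sm_zero[OF Y(1)] by blast
  finally show "f x \<in> Y' \<longleftrightarrow> x \<in> Y" .
 next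
  fix x' assume x': "x' \<in> X'"
  then have "Y' +>\<^bsub>N\<^esub> x' \<in> h ` (+>\<^bsub>M\<^esub>) Y ` X" using bij unfolding bij_betw_def by blast
  then obtain x where "x \<in> X" "h (Y +>\<^bsub>M\<^esub> x) = Y' +>\<^bsub>N\<^esub> x'" by auto
  then show "\<exists>x\<in>X. mcong N Y' x' (f x)"
   using f N.coset_eq_iff[OF Y'(1)] N.smD[OF X'] x' by metis
 qed
 then show ?thesis by auto
qed

lemma qhom_preimage_sm:
 assumes X: "M.sm X" and Y': "N.sm Y'" and U: "N.sm U" "Y' \<subseteq> U"
  and f: "qhom R M X N Y' f"
 shows "submodule {x\<in>X. f x \<in> U} R M"
proof (rule M.submoduleI)
 note qf = qhom_facts[OF X Y' f]
 show "{x\<in>X. f x \<in> U} \<subseteq> carrier M" using M.smD[OF X] by auto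
 show "\<zero>\<^bsub>M\<^esub> \<in> {x\<in>X. f x \<in> U}"
  using N.cong_memD[OF U qf(6)] N.sm_zero[OF U(1)] M.sm_zero[OF X] by simp
 show "x \<oplus>\<^bsub>M\<^esub> y \<in> {x\<in>X. f x \<in> U}" if "x \<in> {x\<in>X. f x \<in> U}" "y \<in> {x\<in>X. f x \<in> U}" for x y
  using that N.cong_memD[OF U qf(2)] N.sm_add[OF U(1)] M.sm_add[OF X] by simp
 show "a \<odot>\<^bsub>M\<^esub> x \<in> {x\<in>X. f x \<in> U}" if "a \<in> carrier R" "x \<in> {x\<in>X. f x \<in> U}" for a x
  using that N.cong_memD[OF U qf(3)] N.sm_smult[OF U(1)] M.sm_smult[OF X] by simp
qed

text \<open>A submodule \<open>U\<close> between \<open>Y'\<close> and \<open>X'\<close> is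
  determined by its preimage under \<open>f\<close>, because \<open>f\<close> is onto modulo
  \<open>Y' \<subseteq> U\<close>.\<close>

lemma simpq_transport:
 assumes X: "M.sm X" and Y: "M.sm Y" and X': "N.sm X'" and Y': "N.sm Y'" "Y' \<subseteq> X'"
  and f: "qiso R M X Y N X' Y' f" and s: "simpq R M Y X"
 shows "simpq R N Y' X'"
proof -
 have q: "qhom R M X N Y' f" and fX: "f ` X \<subseteq> X'" and mem: "\<And>x. x \<in> X \<Longrightarrow> f x \<in> Y' \<longleftrightarrow> x \<in> Y"
  and sur: "\<And>x'. x' \<in> X' \<Longrightarrow> \<exists>x\<in>X. mcong N Y' x' (f x)"
  using f by (auto simp: qiso_def)
 obtain x where x: "x \<in> X" "x \<notin> Y" using s by (auto simp: simpq_def)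
 then have "f x \<in> X'" "f x \<notin> Y'" using fX mem by auto
 then have ne: "Y' \<noteq> X'" by blast
 have "U = Y' \<or> U = X'" if U: "N.sm U" "Y' \<subseteq> U" "U \<subseteq> X'" for U
 proof -
  let ?P = "{x\<in>X. f x \<in> U}"
  have "?P = Y \<or> ?P = X"
   using s qhom_preimage_sm[OF X Y'(1) U(1,2) q] U(2) mem unfolding simpq_def by blast
  moreover have "\<exists>x\<in>X. mcong N Y' u (f x) \<and> (u \<in> U \<longleftrightarrow> f x \<in> U) \<and> (u \<in> Y' \<longleftrightarrow> f x \<in> Y')" if "u \<in> X'" for u
  proof -
   obtain x where x: "x \<in> X" "mcong N Y' u (f x)" using sur[OF \<open>u \<in> X'\<close>] by blast
   then show ?thesis
    using N.cong_mem[OF Y'(1) x(2)] N.cong_mem[OF U(1) N.cong_mono[OF x(2) U(2)]] by auto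
  qed
  ultimately show ?thesis
  proof (elim disjE)
   assume a: "?P = Y" and *: "\<And>u. u \<in> X' \<Longrightarrow> \<exists>x\<in>X. mcong N Y' u (f x) \<and> (u \<in> U \<longleftrightarrow> f x \<in> U) \<and> (u \<in> Y' \<longleftrightarrow> f x \<in> Y')"
   have "u \<in> Y'" if u: "u \<in> U" for u
   proof -
    obtain x where "x \<in> X" "f x \<in> U" "u \<in> Y' \<longleftrightarrow> f x \<in> Y'" using * u U(3) by blast
    then show ?thesis using a mem by auto
   qed
   then show ?thesis using U(2) by auto
  next
   assume a: "?P = X" and *: "\<And>u. u \<in> X' \<Longrightarrow> \<exists>x\<in>X. mcong N Y' u (f x) \<and> (u \<in> U \<longleftrightarrow> f x \<in> U) \<and> (u \<in> Y' \<longleftrightarrow> f x \<in> Y')"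
   have "u \<in> U" if u: "u \<in> X'" for u
   proof -
    obtain x where "x \<in> X" "u \<in> U \<longleftrightarrow> f x \<in> U" using * u by blast
    then show ?thesis using a by auto
   qed
   then show ?thesis using U(3) by auto
  qed
 qed
 then show ?thesis unfolding simpq_def using X' Y' ne by blast
qed

text \<open>The image of \<open>Z\<close>, saturated modulo \<open>Y'\<close>: since
  \<open>f\<close> is additive only modulo \<open>Y'\<close>, the plain image need not be a
  submodule.\<close>

definition qimg where "qimg f X' Y' Z = {x'\<in>X'. \<exists>z\<in>Z. mcong N Y' x' (f z)}"

lemma qimg_facts:
 assumes X: "M.sm X" and Y: "M.sm Y" and X': "N.sm X'" and Y': "N.sm Y'" "Y' \<subseteq> X'"
  and f: "qiso R M X Y N X' Y' f"
 shows "\<And>Z. \<lbrakk>M.sm Z; Y \<subseteq> Z; Z \<subseteq> X\<rbrakk> \<Longrightarrow> N.sm (qimg f X' Y' Z) \<and> Y' \<subseteq> qimg f X' Y' Z \<and> qimg f X' Y' Z \<subseteq> X'"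
  and "qimg f X' Y' X = X'" and "Y \<subseteq> X \<Longrightarrow> qimg f X' Y' Y = Y'"
  and "\<And>Z x. \<lbrakk>M.sm Z; Y \<subseteq> Z; Z \<subseteq> X; x \<in> X\<rbrakk> \<Longrightarrow> f x \<in> qimg f X' Y' Z \<longleftrightarrow> x \<in> Z"
  and "\<And>Z1 Z2. \<lbrakk>M.sm Z1; M.sm Z2; Y \<subseteq> Z1; Z1 \<subseteq> Z2; Z2 \<subseteq> X\<rbrakk> \<Longrightarrow>
     qiso R M Z2 Z1 N (qimg f X' Y' Z2) (qimg f X' Y' Z1) f"
proof -
 have q: "qhom R M X N Y' f" and fX: "f ` X \<subseteq> X'" and mem: "\<And>x. x \<in> X \<Longrightarrow> f x \<in> Y' \<longleftrightarrow> x \<in> Y"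
  and sur: "\<And>x'. x' \<in> X' \<Longrightarrow> \<exists>x\<in>X. mcong N Y' x' (f x)"
  using f by (auto simp: qiso_def)
 note qf = qhom_facts[OF X Y'(1) q]
 show 1: "N.sm (qimg f X' Y' Z) \<and> Y' \<subseteq> qimg f X' Y' Z \<and> qimg f X' Y' Z \<subseteq> X'"
  if Z: "M.sm Z" "Y \<subseteq> Z" "Z \<subseteq> X" for Z
 proof (intro conjI)
  have z: "mcong N Y' x' (f \<zero>\<^bsub>M\<^esub>)" if "x' \<in> Y'" for x'
   using N.cong_trans[OF Y'(1) N.cong_zero[OF Y'(1) that]] N.cong_sym[OF Y'(1) qf(6)] .
  show "Y' \<subseteq> qimg f X' Y' Z"
   using z M.sm_zero[OF Z(1)] Y'(2) by (auto simp: qimg_def)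
  show "qimg f X' Y' Z \<subseteq> X'" by (auto simp: qimg_def)
  show "N.sm (qimg f X' Y' Z)"
  proof (rule N.submoduleI)
   show "qimg f X' Y' Z \<subseteq> carrier N" using N.smD[OF X'] by (auto simp: qimg_def)
   show "\<zero>\<^bsub>N\<^esub> \<in> qimg f X' Y' Z" using \<open>Y' \<subseteq> qimg f X' Y' Z\<close> N.sm_zero[OF Y'(1)] by blast
   fix x y assume "x \<in> qimg f X' Y' Z" "y \<in> qimg f X' Y' Z"
   then obtain u v where uv: "u \<in> Z" "v \<in> Z" "mcong N Y' x (f u)" "mcong N Y' y (f v)" "x \<in> X'" "y \<in> X'"
    by (auto simp: qimg_def)
   have "mcong N Y' (f u \<oplus>\<^bsub>N\<^esub> f v) (f (u \<oplus>\<^bsub>M\<^esub> v))"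
    using uv Z by (auto intro!: N.cong_sym[OF Y'(1) qf(2)])
   then have "mcong N Y' (x \<oplus>\<^bsub>N\<^esub> y) (f (u \<oplus>\<^bsub>M\<^esub> v))"
    using N.cong_trans[OF Y'(1) N.cong_add[OF Y'(1) uv(3,4)]] by blast
   then show "x \<oplus>\<^bsub>N\<^esub> y \<in> qimg f X' Y' Z"
    using uv M.sm_add[OF Z(1)] N.sm_add[OF X'] by (auto simp: qimg_def)
  next
   fix a x assume a: "a \<in> carrier R" and "x \<in> qimg f X' Y' Z"
   then obtain u where u: "u \<in> Z" "mcong N Y' x (f u)" "x \<in> X'"
    by (auto simp: qimg_def)
   have "mcong N Y' (a \<odot>\<^bsub>N\<^esub> f u) (f (a \<odot>\<^bsub>M\<^esub> u))"
    using u a Z by (auto intro!: N.cong_sym[OF Y'(1) qf(3)])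
   then have "mcong N Y' (a \<odot>\<^bsub>N\<^esub> x) (f (a \<odot>\<^bsub>M\<^esub> u))"
    using N.cong_trans[OF Y'(1) N.cong_smult[OF Y'(1) u(2) a]] by blast
   then show "a \<odot>\<^bsub>N\<^esub> x \<in> qimg f X' Y' Z"
    using u a M.sm_smult[OF Z(1)] N.sm_smult[OF X'] by (auto simp: qimg_def)
  qed
 qed
 show "qimg f X' Y' X = X'" using sur by (auto simp: qimg_def)
 show 4: "f x \<in> qimg f X' Y' Z \<longleftrightarrow> x \<in> Z" if Z: "M.sm Z" "Y \<subseteq> Z" "Z \<subseteq> X" and x: "x \<in> X" for Z x
 proof
  assume xZ: "x \<in> Z"
  have "mcong N Y' (f x) (f x)" by (rule N.cong_refl[OF Y'(1) qf(1)[OF x]])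
  then show "f x \<in> qimg f X' Y' Z" using fX x xZ by (auto simp: qimg_def)
 next
  assume "f x \<in> qimg f X' Y' Z"
  then obtain z where "z \<in> Z" "mcong N Y' (f x) (f z)" by (auto simp: qimg_def)
  moreover from \<open>z \<in> Z\<close> Z have "z \<in> X" by auto
  ultimately have "mcong M Y x z" using qiso_cong[OF X Y Y'(1) f x] by simp
  then show "x \<in> Z" by (rule M.cong_memD[OF Z(1,2) _ \<open>z \<in> Z\<close>])
 qed
 show "qimg f X' Y' Y = Y'" if YX: "Y \<subseteq> X"
 proof
  show "Y' \<subseteq> qimg f X' Y' Y" using 1[OF Y order_refl YX] by simp
  show "qimg f X' Y' Y \<subseteq> Y'"
  proof
   fix x' assume "x' \<in> qimg f X' Y' Y"
   then obtain z where "z \<in> Y" "mcong N Y' x' (f z)" by (auto simp: qimg_def)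
   moreover have "f z \<in> Y'" using mem YX \<open>z \<in> Y\<close> by auto
   ultimately show "x' \<in> Y'" using N.cong_mem[OF Y'(1)] by auto
  qed
 qed
 show "qiso R M Z2 Z1 N (qimg f X' Y' Z2) (qimg f X' Y' Z1) f"
  if Z: "M.sm Z1" "M.sm Z2" "Y \<subseteq> Z1" "Z1 \<subseteq> Z2" "Z2 \<subseteq> X" for Z1 Z2
  unfolding qiso_def
 proof (intro conjI ballI)
  have Y1: "Y' \<subseteq> qimg f X' Y' Z1" using 1[OF Z(1,3)] Z(4,5) by auto
  show "qhom R M Z2 N (qimg f X' Y' Z1) f"
   unfolding qhom_def
  proof (intro conjI ballI)
   fix x assume x: "x \<in> Z2"
   then have xX: "x \<in> X" using Z(5) by auto
   then show "f x \<in> carrier N" by (rule qf(1))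
   { fix y assume "y \<in> Z2"
    then have yX: "y \<in> X" using Z(5) by auto
    show "mcong N (qimg f X' Y' Z1) (f (x \<oplus>\<^bsub>M\<^esub> y)) (f x \<oplus>\<^bsub>N\<^esub> f y)"
     by (rule N.cong_mono[OF qf(2)[OF xX yX] Y1]) }
  next
   fix a x assume a: "a \<in> carrier R" and x: "x \<in> Z2"
   then have xX: "x \<in> X" using Z(5) by auto
   show "mcong N (qimg f X' Y' Z1) (f (a \<odot>\<^bsub>M\<^esub> x)) (a \<odot>\<^bsub>N\<^esub> f x)"
    by (rule N.cong_mono[OF qf(3)[OF a xX] Y1])
  qed
  show "f ` Z2 \<subseteq> qimg f X' Y' Z2" using 4[OF Z(2)] Z(3,4,5) by auto
  show "(f x \<in> qimg f X' Y' Z1) = (x \<in> Z1)" if "x \<in> Z2" for x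
   using 4[OF Z(1,3)] Z(4,5) that by auto
  show "\<exists>x\<in>Z2. mcong N (qimg f X' Y' Z1) x' (f x)" if x': "x' \<in> qimg f X' Y' Z2" for x'
  proof -
   obtain z where "z \<in> Z2" "mcong N Y' x' (f z)" using x' by (auto simp: qimg_def)
   then show ?thesis using N.cong_mono[OF _ Y1] by auto
  qed
 qed
qed

end

section \<open>The correspondence theorem and submodules of finite index\<close>

context lmod
begin

lemma sub_Q_sm:
 assumes X: "sm X" and Y: "sm Y" "Y \<subseteq> X"
  and Z: "sm Z" "Z \<subseteq> X"
 shows "submodule ((+>) Y ` Z) R (Qm M X Y)"
proof -
 interpret Q: left_module R "Qm M X Y" by (rule left_module_Q[OF X Y])
 show ?thesis
 proof (rule Q.submoduleI)
  show "(+>) Y ` Z \<subseteq> carrier (Qm M X Y)" using Z by (auto simp: Q_carrier)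
  show "\<zero>\<^bsub>Qm M X Y\<^esub> \<in> (+>) Y ` Z"
   unfolding Q_zero by (rule image_eqI[where x = "\<zero>"]) (simp_all add: M.a_coset_add_zero sm_carrier[OF Y(1)] sm_zero[OF Z(1)])
  fix x y assume "x \<in> (+>) Y ` Z" "y \<in> (+>) Y ` Z"
  then show "x \<oplus>\<^bsub>Qm M X Y\<^esub> y \<in> (+>) Y ` Z"
   using Q_add[OF Y(1)] smD[OF Z(1)] sm_add[OF Z(1)] by auto
 next
  fix a x assume "a \<in> carrier R" "x \<in> (+>) Y ` Z"
  then show "a \<odot>\<^bsub>Qm M X Y\<^esub> x \<in> (+>) Y ` Z"
   using Q_smult[OF Y(1)] smD[OF Z(1)] sm_smult[OF Z(1)] by auto
 qed
qed

lemma bar_mem_iff: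
 assumes Y: "sm Y" and Z: "sm Z" "Y \<subseteq> Z" and x: "x \<in> carrier M"
 shows "Y +> x \<in> (+>) Y ` Z \<longleftrightarrow> x \<in> Z"
proof
 assume "Y +> x \<in> (+>) Y ` Z"
 then obtain z where "z \<in> Z" "Y +> x = Y +> z" by auto
 then show "x \<in> Z" using coset_eq_iff[OF Y x] cong_memD[OF Z] smD[OF Z(1)] by metis
qed auto

lemma bar_subset_iff:
 assumes Y: "sm Y" and Z: "sm Z" "Y \<subseteq> Z" and Z': "sm Z'" "Y \<subseteq> Z'"
 shows "(+>) Y ` Z \<subseteq> (+>) Y ` Z' \<longleftrightarrow> Z \<subseteq> Z'"
 using bar_mem_iff[OF Y Z'] smD[OF Z(1)] by blast

text \<open>The correspondence theorem; the inverse takes \<open>U\<close> to the elements of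
  \<open>X\<close> whose coset lies in \<open>U\<close>.\<close>

lemma sub_Q:
 assumes X: "sm X" and Y: "sm Y" "Y \<subseteq> X"
 shows "{U. submodule U R (Qm M X Y)} = (\<lambda>Z. (+>) Y ` Z) ` between R M Y X"
proof (intro equalityI subsetI)
 interpret Q: left_module R "Qm M X Y" by (rule left_module_Q[OF X Y])
 fix U assume "U \<in> {U. submodule U R (Qm M X Y)}"
 then have U: "submodule U R (Qm M X Y)" by simp
 define Z where "Z = {x\<in>X. Y +> x \<in> U}"
 have "sm Z"
 proof (rule submoduleI)
  show "Z \<subseteq> carrier M" using smD[OF X] by (auto simp: Z_def)
  show "\<zero> \<in> Z" using Q.sm_zero[OF U] sm_zero[OF X] M.a_coset_add_zero[OF sm_carrier[OF Y(1)]] by (simp add: Z_def Q_zero)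
  show "x \<oplus> y \<in> Z" if "x \<in> Z" "y \<in> Z" for x y
   using that Q.sm_add[OF U] Q_add[OF Y(1), of x y X] smD[OF X] sm_add[OF X] by (force simp: Z_def)
  show "a \<odot> x \<in> Z" if "a \<in> carrier R" "x \<in> Z" for a x
   using that Q.sm_smult[OF U] Q_smult[OF Y(1), of a x X] smD[OF X] sm_smult[OF X] by (force simp: Z_def)
 qed
 moreover have "Y \<subseteq> Z"
  using M.a_coset_join2[OF smD[OF Y(1)] sm_subgroup[OF Y(1)]] Q.sm_zero[OF U] Y(2) by (auto simp: Z_def Q_zero)
 moreover have "Z \<subseteq> X" by (auto simp: Z_def)
 ultimately have ZB: "Z \<in> between R M Y X" by (simp add: between_def)
 have "U = (+>) Y ` Z" using Q.sm_carrier[OF U] by (auto simp: Z_def Q_carrier)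
 then show "U \<in> (\<lambda>Z. (+>) Y ` Z) ` between R M Y X" using ZB by (rule image_eqI)
qed (auto simp: between_def intro: sub_Q_sm[OF X Y])

lemma Q_qiso:
 assumes X: "sm X" and Y: "sm Y" "Y \<subseteq> X"
  and Z: "sm Z1" "sm Z2" "Y \<subseteq> Z1" "Z1 \<subseteq> Z2" "Z2 \<subseteq> X"
 shows "qiso R M Z2 Z1 (Qm M X Y) ((+>) Y ` Z2) ((+>) Y ` Z1) (\<lambda>x. Y +> x)"
proof -
 interpret Q: left_module R "Qm M X Y" by (rule left_module_Q[OF X Y])
 have s: "submodule ((+>) Y ` Z1) R (Qm M X Y)" using sub_Q_sm[OF X Y Z(1)] Z by blast
 have c: "x \<in> X \<Longrightarrow> Y +> x \<in> carrier (Qm M X Y)" for x by (simp add: Q_carrier)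
 have c2: "x \<in> Z2 \<Longrightarrow> x \<in> X \<and> x \<in> carrier M" for x using Z smD by blast
 have r: "mcong (Qm M X Y) ((+>) Y ` Z1) (Y +> x) (Y +> x)" if "x \<in> X" for x
  using Q.cong_refl[OF s c[OF that]] .
 show ?thesis
  unfolding qiso_def qhom_def
 proof (intro conjI ballI)
  fix x assume x: "x \<in> Z2"
  show "Y +> x \<in> carrier (Qm M X Y)" using c c2 x by auto
  show "(Y +> x \<in> (+>) Y ` Z1) = (x \<in> Z1)" using bar_mem_iff[OF Y(1) Z(1,3)] c2 x by auto
  { fix y assume "y \<in> Z2"
   then show "mcong (Qm M X Y) ((+>) Y ` Z1) (Y +> (x \<oplus> y)) ((Y +> x) \<oplus>\<^bsub>Qm M X Y\<^esub> (Y +> y))"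
    using r[of "x \<oplus> y"] x c2 Q_add[OF Y(1)] sm_add[OF X] by simp }
  { fix a assume "a \<in> carrier R"
   then show "mcong (Qm M X Y) ((+>) Y ` Z1) (Y +> (a \<odot> x)) (a \<odot>\<^bsub>Qm M X Y\<^esub> (Y +> x))"
    using r[of "a \<odot> x"] x c2 Q_smult[OF Y(1)] sm_smult[OF X] by simp }
 next
  fix x' assume "x' \<in> (+>) Y ` Z2"
  then show "\<exists>x\<in>Z2. mcong (Qm M X Y) ((+>) Y ` Z1) x' (Y +> x)" using r c2 by auto
 qed auto
qed

lemma simple_Q_iff:
 assumes X: "sm X" and Y: "sm Y" "Y \<subseteq> X"
 shows "simple_module R (Qm M X Y) \<longleftrightarrow> simpq R M Y X"
proof -
 interpret Q: left_module R "Qm M X Y" by (rule left_module_Q[OF X Y])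
 let ?b = "\<lambda>Z. (+>) Y ` Z"
 have bY: "?b Y = {Y}"
  using M.a_coset_join2[OF smD[OF Y(1)] sm_subgroup[OF Y(1)]] sm_zero[OF Y(1)] by auto
 have bi: "?b Z = ?b Z' \<longleftrightarrow> Z = Z'" if "Z \<in> between R M Y X" "Z' \<in> between R M Y X" for Z Z'
  using that bar_subset_iff[OF Y(1), of Z Z'] bar_subset_iff[OF Y(1), of Z' Z] unfolding between_def
  by (metis (no_types, lifting) equalityI mem_Collect_eq order_refl)
 have in1: "X \<in> between R M Y X" "Y \<in> between R M Y X" using X Y by (auto simp: between_def)
 have "simple_module R (Qm M X Y) \<longleftrightarrow> ?b X \<noteq> ?b Y \<and> (\<forall>U\<in>{U. submodule U R (Qm M X Y)}. U = ?b Y \<or> U = ?b X)"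
  unfolding simple_module_def Q_carrier Q_zero bY using Q.left_module_axioms by auto
 also have "\<dots> \<longleftrightarrow> X \<noteq> Y \<and> (\<forall>Z\<in>between R M Y X. Z = Y \<or> Z = X)"
  unfolding sub_Q[OF X Y] ball_simps using in1 by (simp add: bi)
 also have "\<dots> \<longleftrightarrow> simpq R M Y X" using X Y by (auto simp: simpq_def between_def)
 finally show ?thesis .
qed

lemma fin_index_iff:
 assumes X: "sm X" and Y: "sm Y"
 shows "finite (carrier (Qm M X Y)) \<longleftrightarrow> fin_index M Y X"
proof
 assume "finite (carrier (Qm M X Y))"
 then have fin: "finite ((+>) Y ` X)" by (simp add: Q_carrier)
 then obtain S where S: "S \<subseteq> X" "finite S" "(+>) Y ` X = (+>) Y ` S"
  using finite_subset_image[OF fin order_refl] by metis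
 have "\<exists>s\<in>S. mcong M Y x s" if x: "x \<in> X" for x
 proof -
  have "Y +> x \<in> (+>) Y ` S" unfolding S(3)[symmetric] using x by (rule imageI)
  then obtain s where s: "s \<in> S" "Y +> x = Y +> s" by auto
  then have "mcong M Y x s" using coset_eq_iff[OF Y smD[OF X x]] smD[OF X] S(1) by auto
  then show ?thesis using s(1) by auto
 qed
 then show "fin_index M Y X" by (rule fin_indexI[OF S(2,1)])
next
 assume "fin_index M Y X"
 then obtain S where S: "finite S" "S \<subseteq> X" "\<And>x. x \<in> X \<Longrightarrow> \<exists>s\<in>S. mcong M Y x s"
  unfolding fin_index_def by blast
 have "(+>) Y ` X \<subseteq> (+>) Y ` S"
 proof
  fix C assume "C \<in> (+>) Y ` X"
  then obtain x where x: "x \<in> X" "C = Y +> x" by auto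
  then obtain s where s: "s \<in> S" "mcong M Y x s" using S by blast
  then have "C = Y +> s" using coset_eq_iff[OF Y, of x s] x by (simp add: mcong_def)
  then show "C \<in> (+>) Y ` S" using s by blast
 qed
 then show "finite (carrier (Qm M X Y))"
  unfolding Q_carrier by (rule finite_subset) (rule finite_imageI[OF S(1)])
qed

text \<open>A submodule containing \<open>Y\<close> is determined by the representatives that it
  contains.\<close>

lemma fin_index_between:
 assumes "fin_index M Y X" shows "finite (between R M Y X)"
proof -
 obtain S where S: "finite S" "S \<subseteq> X" "\<And>x. x \<in> X \<Longrightarrow> \<exists>s\<in>S. mcong M Y x s"
  using assms unfolding fin_index_def by blast
 have "Z \<subseteq> Z'" if Z: "Z \<in> between R M Y X" "Z' \<in> between R M Y X" "Z \<inter> S = Z' \<inter> S" for Z Z'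
 proof
  fix x assume x: "x \<in> Z"
  then have "x \<in> X" using Z(1) by (auto simp: between_def)
  then obtain s where s: "s \<in> S" "mcong M Y x s" using S(3) by blast
  then have "mcong M Z x s" using Z(1) cong_mono by (auto simp: between_def)
  then have "s \<in> Z" using x Z(1) cong_mem[of Z x s] by (simp add: between_def)
  then have "s \<in> Z'" using Z s by blast
  then show "x \<in> Z'" using s Z cong_memD[of Z' Y] by (auto simp: between_def)
 qed
 then have "inj_on (\<lambda>Z. Z \<inter> S) (between R M Y X)" by (intro inj_onI equalityI) auto
 moreover have "(\<lambda>Z. Z \<inter> S) ` between R M Y X \<subseteq> Pow S" by auto
 ultimately show ?thesis using S(1) by (meson finite_Pow_iff inj_on_finite)
qed

lemma fin_index_trans:
 assumes X: "sm X" and Y: "sm Y" and Z: "sm Z" "Z \<subseteq> Y" "Y \<subseteq> X"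
  and 1: "fin_index M Z Y" and 2: "fin_index M Y X"
 shows "fin_index M Z X"
proof -
 obtain S where S: "finite S" "S \<subseteq> Y" "\<And>x. x \<in> Y \<Longrightarrow> \<exists>s\<in>S. mcong M Z x s" using 1 unfolding fin_index_def by blast
 obtain T where T: "finite T" "T \<subseteq> X" "\<And>x. x \<in> X \<Longrightarrow> \<exists>s\<in>T. mcong M Y x s" using 2 unfolding fin_index_def by blast
 let ?U = "(\<lambda>(s, t). s \<oplus> t) ` (S \<times> T)"
 have "\<exists>u\<in>?U. mcong M Z x u" if x: "x \<in> X" for x
 proof -
  obtain t where t: "t \<in> T" "mcong M Y x t" using T x by blast
  then have "x \<ominus> t \<in> Y" by (simp add: mcong_def)
  then obtain s where s: "s \<in> S" "mcong M Z (x \<ominus> t) s" using S(3) by blast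
  have "mcong M Z ((x \<ominus> t) \<oplus> t) (s \<oplus> t)"
   using t by (intro cong_add[OF Z(1) s(2)] cong_refl[OF Z(1)]) (auto simp: mcong_def)
  then have "mcong M Z x (s \<oplus> t)" using t by (simp add: mcong_def M.diff_add_cancel)
  then show ?thesis using s(1) t(1) by (intro bexI[of _ "s \<oplus> t"]) auto
 qed
 moreover have "?U \<subseteq> X" using S(2) T(2) Z(3) sm_add[OF X] by (auto simp: subset_iff)
 ultimately show ?thesis using S(1) T(1) by (intro fin_indexI[of ?U]) auto
qed

lemma fin_index_mono:
 assumes "fin_index M Y X" "Y \<subseteq> Z" shows "fin_index M Z X"
 using assms unfolding fin_index_def by (meson cong_mono)

lemma fin_index_Int:
 assumes X: "sm X" and Y: "sm Y" and Z: "sm Z" "Z \<subseteq> X"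
  and 1: "fin_index M Y X"
 shows "fin_index M (Z \<inter> Y) Z"
proof -
 have sI: "sm (Z \<inter> Y)" using sm_Int Z Y by blast
 have "finite ((+>) Y ` X)" using fin_index_iff[OF X Y] 1 by (simp add: Q_carrier)
 then have "finite ((+>) Y ` Z)" by (rule finite_subset[OF image_mono[OF Z(2)]])
 then obtain S where S: "S \<subseteq> Z" "finite S" "(+>) Y ` Z = (+>) Y ` S"
  using finite_subset_image[OF \<open>finite ((+>) Y ` Z)\<close> order_refl] by metis
 have "\<exists>s\<in>S. mcong M (Z \<inter> Y) x s" if "x \<in> Z" for x
 proof -
  have "Y +> x \<in> (+>) Y ` S" unfolding S(3)[symmetric] using that by (rule imageI)
  then obtain s where s: "s \<in> S" "Y +> x = Y +> s" by auto
  then have "mcong M Y x s" using coset_eq_iff[OF Y] smD[OF Z(1)] that S by blast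
  moreover have "x \<ominus> s \<in> Z" using s(1) S(1) that sm_minus[OF Z(1)] by blast
  ultimately show ?thesis using s(1) by (auto simp: mcong_def)
 qed
 then show ?thesis unfolding fin_index_def using S by blast
qed

end

section \<open>Composition factors\<close>

text \<open>Composition series from \<open>Y\<close> up to \<open>X\<close>, with the classes of
  their factors. The lists that occur in the definition of \<open>mod_class\<close> are turned into
  this relation and back by \<open>series_imp_ci\<close> and \<open>ci_imp_series\<close>, so that
  inductions can run along the series.\<close>

inductive ci :: "('r, 'c) ring_scheme \<Rightarrow> ('r, 'm, 'd) module_scheme \<Rightarrow> 'm set \<Rightarrow> 'm set \<Rightarrow> 'r simple_class multiset \<Rightarrow> bool"
 for R M where
 refl: "submodule Y R M \<Longrightarrow> ci R M Y Y {#}"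
| step: "\<lbrakk>ci R M Y Z m; simpq R M Z X\<rbrakk> \<Longrightarrow> ci R M Y X (add_mset (iso_class R (Qm M X Z)) m)"

text \<open>The class \<open>[X / Y]\<close> as a function of two submodules of a fixed module; in
  this form it is additive along chains (\<open>cl_add\<close>).\<close>

definition cl where "cl R M X Y = mod_class R (Qm M X Y)"

lemma ci_sub: "ci R M Y X m \<Longrightarrow> submodule Y R M \<and> submodule X R M \<and> Y \<subseteq> X"
 by (induction rule: ci.induct) (auto simp: simpq_def)

lemma ci_trans: "ci R M Z X m' \<Longrightarrow> ci R M Y Z m \<Longrightarrow> ci R M Y X (m + m')"
proof (induction rule: ci.induct)
 case (step U V k X)
 then show ?case using ci.step[of R M Y V "m + k" X] by simp
qed simp

lemma ci_empty: "ci R M Y X {#} \<Longrightarrow> Y = X"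
 by (erule ci.cases) auto

context two_modules
begin

lemma iso_class_qiso:
 assumes X: "M.sm X" and Y: "M.sm Y" "Y \<subseteq> X" and X': "N.sm X'" and Y': "N.sm Y'" "Y' \<subseteq> X'"
  and f: "qiso R M X Y N X' Y' f"
 shows "iso_class R (Qm M X Y) = iso_class R (Qm N X' Y')"
 by (rule iso_class_cong[OF M.left_module_Q[OF X Y] N.left_module_Q[OF X' Y']
    qiso_imp_isomorphic[OF X Y(1) X' Y'(1) f]])

lemma ci_transport_aux:
 assumes X: "M.sm X" and Y: "M.sm Y" "Y \<subseteq> X" and X': "N.sm X'" and Y': "N.sm Y'" "Y' \<subseteq> X'"
  and f: "qiso R M X Y N X' Y' f"
 shows "ci R M Y0 Z m \<Longrightarrow> Y0 = Y \<Longrightarrow> Z \<subseteq> X \<Longrightarrow> ci R N Y' (qimg f X' Y' Z) m"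
proof (induction rule: ci.induct)
 case (refl Z)
 note qf = qimg_facts[OF X Y(1) X' Y' f]
 show ?case using qf(3)[OF Y(2)] ci.refl[OF Y'(1)] refl by simp
next
 case (step Y0 Z1 m Z2)
 note qf = qimg_facts[OF X Y(1) X' Y' f]
 have s: "M.sm Z1" "M.sm Z2" "Y \<subseteq> Z1" "Z1 \<subseteq> Z2" "Z2 \<subseteq> X"
  using step ci_sub[OF step.hyps(1)] by (auto simp: simpq_def)
 have q: "qiso R M Z2 Z1 N (qimg f X' Y' Z2) (qimg f X' Y' Z1) f" by (rule qf(5)[OF s])
 have 1: "N.sm (qimg f X' Y' Z1)" "N.sm (qimg f X' Y' Z2)"
  using qf(1)[OF s(1,3)] qf(1)[OF s(2)] s by auto
 have 2: "qimg f X' Y' Z1 \<subseteq> qimg f X' Y' Z2" using s(4) by (auto simp: qimg_def)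
 have "simpq R N (qimg f X' Y' Z1) (qimg f X' Y' Z2)"
  by (rule simpq_transport[OF s(2,1) 1(2,1) 2 q step.hyps(2)])
 moreover have "iso_class R (Qm M Z2 Z1) = iso_class R (Qm N (qimg f X' Y' Z2) (qimg f X' Y' Z1))"
  by (rule iso_class_qiso[OF s(2,1,4) 1(2,1) 2 q])
 moreover have "ci R N Y' (qimg f X' Y' Z1) m" using step s by auto
 ultimately show ?case using ci.step by metis
qed

lemma ci_transport:
 assumes X': "N.sm X'" and Y': "N.sm Y'" "Y' \<subseteq> X'"
  and f: "qiso R M X Y N X' Y' f" and c: "ci R M Y X m"
 shows "ci R N Y' X' m"
proof -
 have s: "M.sm X" "M.sm Y" "Y \<subseteq> X" using ci_sub[OF c] by auto
 show ?thesis using ci_transport_aux[OF s X' Y' f c] qimg_facts(2)[OF s(1,2) X' Y' f] by simp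
qed

end

context lmod
begin

lemma two_self: "two_modules R M M"
 by (simp add: two_modules_def left_module_axioms)

text \<open>Induction on the number of intermediate submodules: a maximal one below \<open>X\<close>
  provides the top factor.\<close>

lemma ci_exists:
 assumes "finite (between R M Y X)" "sm X" "sm Y" "Y \<subseteq> X"
 shows "\<exists>m. ci R M Y X m"
 using assms
proof (induction "card (between R M Y X)" arbitrary: X rule: less_induct)
 case (less X)
 show ?case
 proof (cases "Y = X")
  case True then show ?thesis using less.prems ci.refl by blast
 next
  case False
  let ?B = "between R M Y X - {X}"
  have "Y \<in> ?B" using less.prems False by (auto simp: between_def)
  moreover have "finite ?B" using less.prems by simp
  ultimately obtain Z where Z: "Z \<in> ?B" "\<And>U. U \<in> ?B \<Longrightarrow> Z \<subseteq> U \<Longrightarrow> Z = U"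
   using finite_has_maximal[of ?B] by (metis (no_types, lifting) empty_iff)
  have Zs: "sm Z" "Y \<subseteq> Z" "Z \<subseteq> X" "Z \<noteq> X" using Z(1) by (auto simp: between_def)
  have sub: "between R M Y Z \<subseteq> between R M Y X - {X}" using Zs by (auto simp: between_def)
  then have "card (between R M Y Z) < card (between R M Y X)"
   using less.prems by (intro psubset_card_mono) (auto simp: between_def)
  moreover have "finite (between R M Y Z)" using sub less.prems finite_subset by blast
  ultimately obtain m where m: "ci R M Y Z m" using less.hyps less.prems Zs by blast
  have "simpq R M Z X"
   unfolding simpq_def
  proof (intro conjI allI impI)
   fix U assume U: "sm U" "Z \<subseteq> U" "U \<subseteq> X"
   show "U = Z \<or> U = X"
   proof (cases "U = X")
    case False
    then have "U \<in> ?B" using U Zs by (auto simp: between_def)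
    then show ?thesis using Z(2) U by auto
   qed simp
  qed (use Zs less.prems in auto)
  then show ?thesis using ci.step[OF m] by blast
 qed
qed

lemma sum_comm: assumes "sm X" "sm Y"
 shows "X <+> Y = Y <+> X"
proof -
 have "A <+> B \<subseteq> B <+> A" if "sm A" "sm B" for A B
 proof
  fix z assume "z \<in> A <+> B"
  then obtain a b where ab: "a \<in> A" "b \<in> B" "z = a \<oplus> b" unfolding sum_iff by auto
  then have "z = b \<oplus> a" using M.a_comm smD[OF that(1)] smD[OF that(2)] by auto
  then show "z \<in> B <+> A" using ab unfolding sum_iff by auto
 qed
 then show ?thesis using assms by (intro equalityI) auto
qed

lemma qiso_second:
 assumes X: "sm X" and Y: "sm Y"
 shows "qiso R M X (X \<inter> Y) M (X <+> Y) Y (\<lambda>x. x)"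
 unfolding qiso_def qhom_def
proof (intro conjI ballI)
 note r = cong_refl[OF Y]
 show "(\<lambda>x. x) ` X \<subseteq> X <+> Y" using sum_upper1[OF X Y] by simp
 fix x assume x: "x \<in> X"
 show "x \<in> carrier M" by (rule smD[OF X x])
 show "(x \<in> Y) = (x \<in> X \<inter> Y)" using x by simp
 { fix y assume y: "y \<in> X"
  show "mcong M Y (x \<oplus> y) (x \<oplus> y)" using r smD[OF X] x y by simp }
 { fix a assume "a \<in> carrier R"
  then show "mcong M Y (a \<odot> x) (a \<odot> x)" using r smD[OF X] x smult_closed by simp }
next
 fix z assume "z \<in> X <+> Y"
 then obtain x where "x \<in> X" "z \<ominus> x \<in> Y" "z \<in> carrier M"
  using sum_minus_iff[OF X Y] by auto
 then show "\<exists>x\<in>X. mcong M Y z x" using smD[OF X] by (auto simp: mcong_def)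
qed

text \<open>By the second isomorphism theorem, \<open>Z / (Z \<inter> Z')\<close> is isomorphic to
  the simple module \<open>(Z + Z') / Z'\<close>; the intermediate submodules are compared directly
  by the modular law.\<close>

lemma simpq_second:
 assumes Z: "sm Z" and Z': "sm Z'" and s: "simpq R M Z' (Z <+> Z')"
 shows "simpq R M (Z \<inter> Z') Z"
 unfolding simpq_def
proof (intro conjI allI impI)
 show "sm (Z \<inter> Z')" "sm Z" "Z \<inter> Z' \<subseteq> Z" using sm_Int[OF Z Z'] Z by auto
 show "Z \<inter> Z' \<noteq> Z"
 proof
  assume "Z \<inter> Z' = Z"
  then have "Z <+> Z' \<subseteq> Z'" using Z' by (intro sum_least) auto
  then show False using s by (auto simp: simpq_def)
 qed
 fix U assume U: "sm U" "Z \<inter> Z' \<subseteq> U" "U \<subseteq> Z"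
 have sU: "sm (U <+> Z')" by (rule sm_sum[OF U(1) Z'])
 have "U \<subseteq> Z <+> Z'" using U(3) sum_upper1[OF Z Z'] by simp
 then have "U <+> Z' \<subseteq> Z <+> Z'"
  using sm_sum[OF Z Z'] sum_upper2[OF Z Z'] by (intro sum_least) auto
 then consider "U <+> Z' = Z'" | "U <+> Z' = Z <+> Z'"
  using s sU sum_upper2[OF U(1) Z'] unfolding simpq_def by auto
 then show "U = Z \<inter> Z' \<or> U = Z"
 proof cases
  case 1
  then have "U \<subseteq> Z'" using sum_upper1[OF U(1) Z'] by simp
  then show ?thesis using U by auto
 next
  case 2
  have "z \<in> U" if z: "z \<in> Z" for z
  proof -
   have "z \<in> U <+> Z'" using z 2 sum_upper1[OF Z Z'] by auto
   then obtain u where u: "u \<in> U" "z \<ominus> u \<in> Z'" using sum_minus_iff[OF U(1) Z'] by auto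
   have uZ: "u \<in> Z" using u(1) U(3) by auto
   have "z \<ominus> u \<in> Z" by (rule sm_minus[OF Z z uZ])
   then have "z \<ominus> u \<in> U" using u U by auto
   then have "(z \<ominus> u) \<oplus> u \<in> U" using u sm_add[OF U(1)] by auto
   then show ?thesis using M.diff_add_cancel[OF smD[OF Z z] smD[OF Z uZ]] by simp
  qed
  then show ?thesis using U by auto
 qed
qed

text \<open>Jordan-Hoelder. If the last steps start at different \<open>Z\<close> and
  \<open>Z'\<close>, then \<open>Z + Z' = X\<close>, and both series are compared with series
  through \<open>Z \<inter> Z'\<close>, in which the two top factors are exchanged.\<close>

lemma ci_unique:
 assumes "finite (between R M Y X)" "ci R M Y X m" "ci R M Y X m'"
 shows "m = m'"
 using assms
proof (induction "card (between R M Y X)" arbitrary: X m m' rule: less_induct)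
 case (less X)
 have XY: "sm X" "sm Y" "Y \<subseteq> X" using ci_sub[OF less.prems(2)] by auto
 have smaller: "card (between R M Y Z) < card (between R M Y X) \<and> finite (between R M Y Z)"
  if "Y \<subseteq> Z" "Z \<subseteq> X" "Z \<noteq> X" for Z
 proof
  have sub: "between R M Y Z \<subseteq> between R M Y X - {X}" using that by (auto simp: between_def)
  then show "card (between R M Y Z) < card (between R M Y X)"
   using less.prems(1) XY by (intro psubset_card_mono) (auto simp: between_def)
  show "finite (between R M Y Z)" using sub less.prems finite_subset by blast
 qed
 show ?case
 proof (cases "Y = X")
  case True
  have k: "k = {#}" if "ci R M Y X k" for k
   using that
  proof cases
   case (step Z k)
   then show ?thesis using ci_sub[OF step(2)] True by (auto simp: simpq_def)
  qed
  show ?thesis using k[OF less.prems(2)] k[OF less.prems(3)] by simp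
 next
  case False
  from less.prems(2) False obtain Z k where Z: "ci R M Y Z k" "simpq R M Z X" "m = add_mset (iso_class R (Qm M X Z)) k"
   by cases auto
  from less.prems(3) False obtain Z' k' where Z': "ci R M Y Z' k'" "simpq R M Z' X" "m' = add_mset (iso_class R (Qm M X Z')) k'"
   by cases auto
  have s: "sm Z" "Y \<subseteq> Z" "Z \<subseteq> X" "Z \<noteq> X" "sm Z'" "Y \<subseteq> Z'" "Z' \<subseteq> X" "Z' \<noteq> X"
   using ci_sub[OF Z(1)] ci_sub[OF Z'(1)] Z(2) Z'(2) by (auto simp: simpq_def)
  show ?thesis
  proof (cases "Z = Z'")
   case True
   then show ?thesis using less.hyps[of Z k k'] smaller[of Z] s Z Z' by auto
  next
   case False
   let ?D = "Z \<inter> Z'"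
   have D: "sm ?D" by (rule sm_Int[OF s(1,5)])
   have "Z <+> Z' \<subseteq> X" using XY s by (intro sum_least) auto
   then have S: "Z <+> Z' = Z \<or> Z <+> Z' = X" "Z <+> Z' = Z' \<or> Z <+> Z' = X"
    using Z(2) Z'(2) sm_sum[OF s(1,5)] sum_upper1[OF s(1,5)] sum_upper2[OF s(1,5)]
    unfolding simpq_def by auto
   then have S: "Z <+> Z' = X" using False by auto
   have S': "Z' <+> Z = X" using S sum_comm[OF s(1,5)] by simp
   interpret two_modules R M M by (rule two_self)
   have 1: "simpq R M ?D Z" using simpq_second[OF s(1,5)] Z'(2) S by simp
   have 2: "simpq R M ?D Z'" using simpq_second[OF s(5,1)] Z(2) S' by (simp add: Int_commute)
   have i1: "iso_class R (Qm M Z ?D) = iso_class R (Qm M X Z')"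
    using iso_class_qiso[OF s(1) D _ XY(1) s(5,7), of "\<lambda>x. x"] qiso_second[OF s(1,5)] S by auto
   have i2: "iso_class R (Qm M Z' ?D) = iso_class R (Qm M X Z)"
    using iso_class_qiso[OF s(5) D _ XY(1) s(1,3), of "\<lambda>x. x"] qiso_second[OF s(5,1)] S' by (auto simp: Int_commute)
   have Dsub: "Y \<subseteq> ?D" "?D \<subseteq> X" "?D \<noteq> X" using s by auto
   then have "finite (between R M Y ?D)" using smaller by blast
   then obtain d where d: "ci R M Y ?D d" using ci_exists[OF _ D XY(2) Dsub(1)] by blast
   have "k = add_mset (iso_class R (Qm M X Z')) d"
    using less.hyps[OF _ _ Z(1) ci.step[OF d 1]] smaller[of Z] s i1 by simp
   moreover have "k' = add_mset (iso_class R (Qm M X Z)) d"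
    using less.hyps[OF _ _ Z'(1) ci.step[OF d 2]] smaller[of Z'] s i2 by simp
   ultimately show ?thesis using Z(3) Z'(3) by simp
  qed
 qed
qed

section \<open>From composition series to the class of a module\<close>

lemma series_imp_ci:
 assumes "composition_series R M Xs"
 shows "ci R M {\<zero>} (carrier M) (composition_factors R M Xs)"
proof -
 have ne: "Xs \<noteq> []" and hd: "hd Xs = {\<zero>}" and la: "last Xs = carrier M"
  and sub: "\<And>X. X \<in> set Xs \<Longrightarrow> sm X"
  and st: "\<And>i. Suc i < length Xs \<Longrightarrow> Xs ! i \<subseteq> Xs ! Suc i \<and> simple_module R (Qm M (Xs ! Suc i) (Xs ! i))"
  using assms unfolding composition_series_def by auto
 have "i < length Xs \<Longrightarrow> ci R M {\<zero>} (Xs ! i)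
   (mset (map (\<lambda>i. iso_class R (Qm M (Xs ! Suc i) (Xs ! i))) [0..<i]))" for i
 proof (induction i)
  case 0
  have "Xs ! 0 = {\<zero>}" using hd ne by (simp add: hd_conv_nth)
  then show ?case using ci.refl[OF sm_0] by simp
 next
  case (Suc i)
  have "sm (Xs ! Suc i)" "sm (Xs ! i)" using sub Suc.prems by auto
  then have "simpq R M (Xs ! i) (Xs ! Suc i)" using simple_Q_iff st[OF Suc.prems] by blast
  then show ?case using ci.step[OF Suc.IH] Suc.prems by simp
 qed
 from this[of "length Xs - 1"] ne la show ?thesis
  by (simp add: composition_factors_def last_conv_nth)
qed

lemma ci_imp_series:
 assumes "ci R M Y X m"
 shows "\<exists>Xs. Xs \<noteq> [] \<and> hd Xs = Y \<and> last Xs = X \<and> (\<forall>X \<in> set Xs. sm X) \<and>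
   (\<forall>i. Suc i < length Xs \<longrightarrow> Xs ! i \<subseteq> Xs ! Suc i \<and> simple_module R (Qm M (Xs ! Suc i) (Xs ! i))) \<and>
   composition_factors R M Xs = m"
 using assms
proof (induction rule: ci.induct)
 case (refl Y)
 then show ?case by (intro exI[of _ "[Y]"]) (auto simp: composition_factors_def)
next
 case (step Y Z m X)
 then obtain Xs where Xs: "Xs \<noteq> []" "hd Xs = Y" "last Xs = Z" "\<And>X. X \<in> set Xs \<Longrightarrow> sm X"
  "\<And>i. Suc i < length Xs \<Longrightarrow> Xs ! i \<subseteq> Xs ! Suc i \<and> simple_module R (Qm M (Xs ! Suc i) (Xs ! i))"
  "composition_factors R M Xs = m" by auto
 have sZX: "sm Z" "sm X" "Z \<subseteq> X" using step.hyps(2) by (auto simp: simpq_def)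
 have sm: "simple_module R (Qm M X Z)" using simple_Q_iff[OF sZX(2,1,3)] step.hyps(2) by simp
 have la: "Xs ! (length Xs - 1) = Z" using Xs by (simp add: last_conv_nth)
 have "composition_factors R M (Xs @ [X]) = add_mset (iso_class R (Qm M X Z)) m"
 proof -
  have l: "length Xs = Suc (length Xs - 1)" using Xs(1) by simp
  have "[0..<length Xs] = [0..<length Xs - 1] @ [length Xs - 1]"
   using l by (metis le0 upt_Suc_append)
  moreover have "mset (map (\<lambda>i. iso_class R (Qm M ((Xs @ [X]) ! Suc i) ((Xs @ [X]) ! i))) [0..<length Xs - 1])
   = mset (map (\<lambda>i. iso_class R (Qm M (Xs ! Suc i) (Xs ! i))) [0..<length Xs - 1])"
   by (rule arg_cong[where f = mset], rule map_cong) (auto simp: nth_append)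
  moreover have "(Xs @ [X]) ! Suc (length Xs - 1) = X" "(Xs @ [X]) ! (length Xs - 1) = Z"
   using l la Xs(1) by (auto simp: nth_append)
  ultimately show ?thesis
   using Xs(6) unfolding composition_factors_def by (simp del: mset_map)
 qed
 moreover have "(Xs @ [X]) ! i \<subseteq> (Xs @ [X]) ! Suc i \<and> simple_module R (Qm M ((Xs @ [X]) ! Suc i) ((Xs @ [X]) ! i))"
  if i: "Suc i < length (Xs @ [X])" for i
 proof (cases "Suc i < length Xs")
  case True
  then show ?thesis using Xs(5) by (simp add: nth_append)
 next
  case False
  then have "i = length Xs - 1" "Suc i = length Xs" using i by auto
  then show ?thesis using la sZX sm Xs(1) by (simp add: nth_append)
 qed
 ultimately show ?case
  using Xs sZX by (intro exI[of _ "Xs @ [X]"]) auto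
qed

lemma mod_class_eq:
 assumes "finite (between R M {\<zero>} (carrier M))" and c: "ci R M {\<zero>} (carrier M) m"
 shows "mod_class R M = m"
 unfolding mod_class_def
proof (rule the_equality)
 show "\<exists>Xs. composition_series R M Xs \<and> composition_factors R M Xs = m"
  using ci_imp_series[OF c] unfolding composition_series_def by blast
 show "k = m" if "\<exists>Xs. composition_series R M Xs \<and> composition_factors R M Xs = k" for k
  using that series_imp_ci ci_unique[OF assms(1) _ c] by blast
qed

lemma bar_self: assumes Y: "sm Y" shows "(+>) Y ` Y = {Y}"
 using M.a_coset_join2[OF smD[OF Y] sm_subgroup[OF Y]] sm_zero[OF Y] by auto

text \<open>\<open>mod_class\<close> speaks about series in the module \<open>X / Y\<close>; a
  series in \<open>M\<close> is carried there by the projection.\<close>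

lemma cl_eqI:
 assumes fin: "finite (between R M Y X)" and c: "ci R M Y X m"
 shows "cl R M X Y = m"
proof -
 have s: "sm X" "sm Y" "Y \<subseteq> X" using ci_sub[OF c] by auto
 interpret Q: left_module R "Qm M X Y" by (rule left_module_Q[OF s])
 interpret two_modules R M "Qm M X Y" by (simp add: two_modules_def left_module_axioms Q.left_module_axioms)
 have q: "qiso R M X Y (Qm M X Y) (carrier (Qm M X Y)) {\<zero>\<^bsub>Qm M X Y\<^esub>} (\<lambda>x. Y +> x)"
  using Q_qiso[OF s s(2,1) order_refl s(3) order_refl] by (simp add: Q_carrier Q_zero bar_self[OF s(2)])
 have "ci R (Qm M X Y) {\<zero>\<^bsub>Qm M X Y\<^esub>} (carrier (Qm M X Y)) m"
  by (rule ci_transport[OF Q.sm_UNIV Q.sm_0 _ q c]) simp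
 moreover have "finite (between R (Qm M X Y) {\<zero>\<^bsub>Qm M X Y\<^esub>} (carrier (Qm M X Y)))"
 proof (rule finite_subset)
  show "between R (Qm M X Y) {\<zero>\<^bsub>Qm M X Y\<^esub>} (carrier (Qm M X Y)) \<subseteq> {U. submodule U R (Qm M X Y)}"
   by (auto simp: between_def)
  show "finite {U. submodule U R (Qm M X Y)}" unfolding sub_Q[OF s] using fin by simp
 qed
 ultimately show ?thesis unfolding cl_def by (rule Q.mod_class_eq[rotated])
qed

lemma cl_ci:
 assumes "finite (between R M Y X)" "sm X" "sm Y" "Y \<subseteq> X"
 shows "ci R M Y X (cl R M X Y)"
 using ci_exists[OF assms] cl_eqI[OF assms(1)] by auto

lemma between_mono: "\<lbrakk>finite (between R M Z X); Z \<subseteq> Y; Y \<subseteq> X\<rbrakk> \<Longrightarrow> finite (between R M Z Y) \<and> finite (between R M Y X)"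
 by (auto simp: between_def elim!: rev_finite_subset)

lemma cl_add:
 assumes "finite (between R M Z X)" "sm X" "sm Y" "sm Z" "Z \<subseteq> Y" "Y \<subseteq> X"
 shows "cl R M X Z = cl R M X Y + cl R M Y Z"
proof -
 have f: "finite (between R M Z Y)" "finite (between R M Y X)" using between_mono[OF assms(1,5,6)] by auto
 have "ci R M Z X (cl R M Y Z + cl R M X Y)"
  by (rule ci_trans[OF cl_ci[OF f(2) assms(2,3,6)] cl_ci[OF f(1) assms(3,4,5)]])
 then show ?thesis using cl_eqI[OF assms(1)] by (simp add: add.commute)
qed

lemma cl_refl: "sm X \<Longrightarrow> cl R M X X = {#}"
proof (rule cl_eqI)
 assume "sm X"
 then show "ci R M X X {#}" by (rule ci.refl)
 show "finite (between R M X X)" by (rule finite_subset[of _ "{X}"]) (auto simp: between_def)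
qed

lemma cl_simple: assumes s: "simpq R M Y X" shows "cl R M X Y = {#iso_class R (Qm M X Y)#}"
proof (rule cl_eqI)
 have "sm Y" using s by (simp add: simpq_def)
 then show "ci R M Y X {#iso_class R (Qm M X Y)#}" using ci.step[OF ci.refl s] by simp
 show "finite (between R M Y X)"
  by (rule finite_subset[of _ "{X, Y}"]) (use s in \<open>auto simp: between_def simpq_def\<close>)
qed

lemma cl_empty: "\<lbrakk>finite (between R M Y X); sm X; sm Y; Y \<subseteq> X; cl R M X Y = {#}\<rbrakk> \<Longrightarrow> Y = X"
 using cl_ci[of Y X] ci_empty by metis

lemma ci_member: "ci R M Y X m \<Longrightarrow> s \<in># m \<Longrightarrow>
  \<exists>Z1 Z2. simpq R M Z1 Z2 \<and> Y \<subseteq> Z1 \<and> Z2 \<subseteq> X \<and> iso_class R (Qm M Z2 Z1) = s"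
proof (induction rule: ci.induct)
 case (step Y Z m X)
 have ZX: "Z \<subseteq> X" "Y \<subseteq> Z" using ci_sub[OF step.hyps(1)] step.hyps(2) by (auto simp: simpq_def)
 show ?case
 proof (cases "s \<in># m")
  case True
  then obtain Z1 Z2 where "simpq R M Z1 Z2" "Y \<subseteq> Z1" "Z2 \<subseteq> Z" "iso_class R (Qm M Z2 Z1) = s"
   using step.IH by auto
  then show ?thesis using ZX by (intro exI[of _ Z1] exI[of _ Z2]) auto
 next
  case False
  then have "iso_class R (Qm M X Z) = s" using step.prems by simp
  then show ?thesis using ZX step.hyps(2) by (intro exI[of _ Z] exI[of _ X]) auto
 qed
qed simp

end

section \<open>Invariance of classes under isomorphism\<close>

context two_modules
begin

lemma between_transport:
 assumes X: "M.sm X" and Y: "M.sm Y" "Y \<subseteq> X" and X': "N.sm X'" and Y': "N.sm Y'" "Y' \<subseteq> X'"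
  and f: "qiso R M X Y N X' Y' f" and fin: "finite (between R M Y X)"
 shows "finite (between R N Y' X')"
proof -
 have q: "qhom R M X N Y' f" and mem: "\<And>x. x \<in> X \<Longrightarrow> f x \<in> Y' \<longleftrightarrow> x \<in> Y"
  and sur: "\<And>x'. x' \<in> X' \<Longrightarrow> \<exists>x\<in>X. mcong N Y' x' (f x)"
  using f by (auto simp: qiso_def)
 let ?p = "\<lambda>U. {x\<in>X. f x \<in> U}"
 have "?p ` between R N Y' X' \<subseteq> between R M Y X"
 proof
  fix P assume "P \<in> ?p ` between R N Y' X'"
  then obtain U where U: "N.sm U" "Y' \<subseteq> U" "P = ?p U" by (auto simp: between_def)
  have "M.sm P" unfolding U(3) by (rule qhom_preimage_sm[OF X Y'(1) U(1,2) q])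
  moreover have "Y \<subseteq> P" using U mem Y(2) by auto
  ultimately show "P \<in> between R M Y X" using U(3) by (auto simp: between_def)
 qed
 then have "finite (?p ` between R N Y' X')" using fin by (rule finite_subset)
 moreover have "inj_on ?p (between R N Y' X')"
 proof (rule inj_onI)
  fix U V assume UV: "U \<in> between R N Y' X'" "V \<in> between R N Y' X'" and e: "?p U = ?p V"
  have "A \<subseteq> B" if A: "A \<in> between R N Y' X'" and B: "B \<in> between R N Y' X'" and e: "?p A = ?p B" for A B
  proof
   fix u assume u: "u \<in> A"
   then have "u \<in> X'" using A by (auto simp: between_def)
   then obtain x where x: "x \<in> X" "mcong N Y' u (f x)" using sur by auto
   have "mcong N A u (f x)" using x(2) A N.cong_mono by (auto simp: between_def)
   then have "f x \<in> A" using u A N.cong_mem[of A u "f x"] by (simp add: between_def)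
   then have "f x \<in> B" using e x(1) by blast
   then show "u \<in> B" using N.cong_memD[of B Y' u "f x"] x(2) B by (simp add: between_def)
  qed
  then show "U = V" using UV e by (intro equalityI) auto
 qed
 ultimately show ?thesis by (rule finite_imageD)
qed

lemma cl_qiso:
 assumes X: "M.sm X" and Y: "M.sm Y" "Y \<subseteq> X" and X': "N.sm X'" and Y': "N.sm Y'" "Y' \<subseteq> X'"
  and f: "qiso R M X Y N X' Y' f" and fin: "finite (between R M Y X)"
 shows "cl R M X Y = cl R N X' Y'"
proof -
 have "ci R N Y' X' (cl R M X Y)" by (rule ci_transport[OF X' Y' f M.cl_ci[OF fin X Y]])
 then show ?thesis using N.cl_eqI[OF between_transport[OF assms]] by simp
qed

lemma mod_class_iso:
 assumes i: "module_isomorphic R M N" and fin: "finite (between R M {\<zero>\<^bsub>M\<^esub>} (carrier M))"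
 shows "mod_class R M = mod_class R N"
proof -
 from i obtain h where hom: "h \<in> hom (add_monoid M) (add_monoid N)" and bij: "bij_betw h (carrier M) (carrier N)"
  and hs: "\<And>a x. \<lbrakk>a \<in> carrier R; x \<in> carrier M\<rbrakk> \<Longrightarrow> h (a \<odot>\<^bsub>M\<^esub> x) = a \<odot>\<^bsub>N\<^esub> h x"
  unfolding module_isomorphic_def iso_def by auto
 have hc: "\<And>x. x \<in> carrier M \<Longrightarrow> h x \<in> carrier N" and
  ha: "\<And>x y. \<lbrakk>x \<in> carrier M; y \<in> carrier M\<rbrakk> \<Longrightarrow> h (x \<oplus>\<^bsub>M\<^esub> y) = h x \<oplus>\<^bsub>N\<^esub> h y"
  using hom by (auto simp: hom_def Pi_iff)
 have h0: "h \<zero>\<^bsub>M\<^esub> = \<zero>\<^bsub>N\<^esub>" using hs[of "\<zero>\<^bsub>R\<^esub>" "\<zero>\<^bsub>M\<^esub>"] hc by (simp add: M.smult_zero_l N.smult_zero_l)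
 have h0': "h x = \<zero>\<^bsub>N\<^esub> \<longleftrightarrow> x = \<zero>\<^bsub>M\<^esub>" if "x \<in> carrier M" for x
  using inj_on_eq_iff[OF bij_betw_imp_inj_on[OF bij] that M.M.zero_closed] h0 by simp
 have sur: "h ` carrier M = carrier N" using bij by (simp add: bij_betw_def)
 have q: "qiso R M (carrier M) {\<zero>\<^bsub>M\<^esub>} N (carrier N) {\<zero>\<^bsub>N\<^esub>} h"
  unfolding qiso_def qhom_def N.cong_0
 proof (intro conjI ballI)
  fix x' assume x': "x' \<in> carrier N"
  then have "x' \<in> h ` carrier M" by (simp add: sur)
  then show "\<exists>x\<in>carrier M. x' \<in> carrier N \<and> x' = h x" using x' by auto
 qed (use hc ha hs h0' M.smult_closed N.smult_closed in auto)
 have c: "ci R M {\<zero>\<^bsub>M\<^esub>} (carrier M) (mod_class R M)"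
  using M.ci_exists[OF fin M.sm_UNIV M.sm_0] M.mod_class_eq[OF fin] by auto
 have "ci R N {\<zero>\<^bsub>N\<^esub>} (carrier N) (mod_class R M)"
  by (rule ci_transport[OF N.sm_UNIV N.sm_0 _ q c]) simp
 moreover have "finite (between R N {\<zero>\<^bsub>N\<^esub>} (carrier N))"
  by (rule between_transport[OF M.sm_UNIV M.sm_0 _ N.sm_UNIV N.sm_0 _ q fin]) auto
 ultimately show ?thesis using N.mod_class_eq by simp
qed

end

section \<open>Classes of simple modules and restriction of scalars\<close>

lemma regular_simps [simp]:
 "carrier (regular_module R) = carrier R" "add (regular_module R) = add R"
 "zero (regular_module R) = zero R" "smult (regular_module R) = monoid.mult R"
 by (simp_all add: regular_module_def)

lemma regular_minus [simp]: "a_inv (regular_module R) = a_inv R" "a_minus (regular_module R) = a_minus R"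
 by (simp_all add: a_inv_def a_minus_def regular_module_def fun_eq_iff m_inv_def)

lemma regular_left_module: assumes "ring R" shows "left_module R (regular_module R)"
proof -
 interpret ring R by fact
 show ?thesis
 proof (intro left_module.intro left_module_axioms.intro)
  show "abelian_group (regular_module R)"
   by (rule abelian_groupI) (auto simp: a_ac intro: bexI[of _ "\<ominus>\<^bsub>R\<^esub> _"] l_neg)
 qed (auto simp: l_distr r_distr m_assoc ring_axioms)
qed

context lmod
begin

text \<open>Any element outside \<open>Y\<close> generates the simple module \<open>X / Y\<close>,
  which is therefore the ring modulo the annihilator of that element.\<close>

lemma simpq_generator:
 assumes s: "simpq R M Y X" and x: "x \<in> X" "x \<notin> Y"
 shows "qiso R (regular_module R) (carrier R) {a \<in> carrier R. a \<odot> x \<in> Y} M X Y (\<lambda>a. a \<odot> x)"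
  and "submodule {a \<in> carrier R. a \<odot> x \<in> Y} R (regular_module R)"
proof -
 have X: "sm X" and Y: "sm Y" and YX: "Y \<subseteq> X" using s by (auto simp: simpq_def)
 note xc = smD[OF X x(1)]
 interpret A: left_module R "regular_module R" by (rule regular_left_module[OF R.ring_axioms])
 let ?Z = "{z \<in> X. \<exists>a\<in>carrier R. mcong M Y z (a \<odot> x)}"
 have "sm ?Z"
 proof (rule submoduleI)
  show "?Z \<subseteq> carrier M" using smD[OF X] by auto
  have "mcong M Y \<zero> (\<zero>\<^bsub>R\<^esub> \<odot> x)" using cong_refl[OF Y] smult_zero_l[OF xc] by simp
  then show "\<zero> \<in> ?Z" using sm_zero[OF X] by auto
  fix u v assume "u \<in> ?Z" "v \<in> ?Z"
  then obtain a b where ab: "a \<in> carrier R" "b \<in> carrier R" "mcong M Y u (a \<odot> x)" "mcong M Y v (b \<odot> x)" "u \<in> X" "v \<in> X"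
   by auto
  then have "mcong M Y (u \<oplus> v) ((a \<oplus>\<^bsub>R\<^esub> b) \<odot> x)"
   using cong_add[OF Y ab(3,4)] smult_l_distr[OF ab(1,2) xc] by simp
  then show "u \<oplus> v \<in> ?Z" using ab sm_add[OF X ab(5,6)] by auto
 next
  fix c u assume c: "c \<in> carrier R" and "u \<in> ?Z"
  then obtain a where ab: "a \<in> carrier R" "mcong M Y u (a \<odot> x)" "u \<in> X" by auto
  then have "mcong M Y (c \<odot> u) ((c \<otimes>\<^bsub>R\<^esub> a) \<odot> x)"
   using cong_smult[OF Y ab(2) c] smult_assoc[OF c ab(1) xc] by simp
  then show "c \<odot> u \<in> ?Z" using ab c sm_smult[OF X c ab(3)] by auto
 qed
 moreover have "Y \<subseteq> ?Z"
 proof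
  fix y assume y: "y \<in> Y"
  have "mcong M Y y (\<zero>\<^bsub>R\<^esub> \<odot> x)" using cong_zero[OF Y y] smult_zero_l[OF xc] by simp
  then show "y \<in> ?Z" using y YX by auto
 qed
 moreover have xZ: "x \<in> ?Z" using cong_refl[OF Y xc] x smult_one[OF xc] by (auto intro!: bexI[of _ "\<one>\<^bsub>R\<^esub>"])
 moreover have "?Z \<subseteq> X" by auto
 ultimately have Z: "?Z = X" using s x unfolding simpq_def by (metis (no_types, lifting))
 show "qiso R (regular_module R) (carrier R) {a \<in> carrier R. a \<odot> x \<in> Y} M X Y (\<lambda>a. a \<odot> x)"
  unfolding qiso_def qhom_def regular_simps
 proof (intro conjI ballI)
  show "(\<lambda>a. a \<odot> x) ` carrier R \<subseteq> X" using sm_smult[OF X _ x(1)] by auto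
  fix x' assume "x' \<in> X"
  then have "x' \<in> ?Z" using Z by simp
  then show "\<exists>a\<in>carrier R. mcong M Y x' (a \<odot> x)" by auto
 qed (auto simp: xc smult_closed smult_l_distr smult_assoc cong_refl[OF Y])
 show "submodule {a \<in> carrier R. a \<odot> x \<in> Y} R (regular_module R)"
  by (rule A.submoduleI)
   (auto simp: smult_zero_l xc sm_zero[OF Y] smult_l_distr smult_assoc sm_add[OF Y] sm_smult[OF Y])
qed

text \<open>Classes consist of modules on sets of ring elements. The quotient of the ring by a
  maximal left ideal is such a module, whatever the type of \<open>M\<close>.\<close>

lemma simple_rep:
 assumes s: "simpq R M Y X"
 obtains m where "simpq R (regular_module R) m (carrier R)"
  "module_isomorphic R (Qm M X Y) (Qm (regular_module R) (carrier R) m)"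
proof -
 have X: "sm X" and Y: "sm Y" "Y \<subseteq> X" using s by (auto simp: simpq_def)
 obtain x where x: "x \<in> X" "x \<notin> Y" using s by (auto simp: simpq_def)
 interpret A: left_module R "regular_module R" by (rule regular_left_module[OF R.ring_axioms])
 interpret two_modules R "regular_module R" M by (simp add: two_modules_def A.left_module_axioms left_module_axioms)
 interpret B: two_modules R M "regular_module R" by (simp add: two_modules_def A.left_module_axioms left_module_axioms)
 let ?m = "{a \<in> carrier R. a \<odot> x \<in> Y}"
 note g = simpq_generator[OF s x]
 have c: "submodule (carrier R) R (regular_module R)" using A.sm_UNIV by simp
 have mc: "?m \<subseteq> carrier R" by auto
 have i: "module_isomorphic R (Qm (regular_module R) (carrier R) ?m) (Qm M X Y)"
  by (rule qiso_imp_isomorphic[OF c g(2) X Y(1) g(1)])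
 have i': "module_isomorphic R (Qm M X Y) (Qm (regular_module R) (carrier R) ?m)"
  by (rule module_isomorphic_sym[OF A.left_module_Q[OF c g(2) mc] left_module_Q[OF X Y] i])
 obtain f where "qiso R M X Y (regular_module R) (carrier R) ?m f"
  using B.isomorphic_imp_qiso[OF X Y c g(2) mc i'] by auto
 then have "simpq R (regular_module R) ?m (carrier R)"
  by (rule B.simpq_transport[OF X Y(1) c g(2) mc _ s])
 then show ?thesis using i' that by auto
qed

text \<open>That the class is nonempty is the point: a common member of two equal classes yields an
  isomorphism, as \<open>iso_class_eqD\<close> needs it.\<close>

lemma iso_class_simple:
 assumes s: "simpq R M Y X"
 shows "iso_class R (Qm M X Y) \<in> simple_classes R" and "iso_class R (Qm M X Y) \<noteq> {}"
proof -
 interpret A: left_module R "regular_module R" by (rule regular_left_module[OF R.ring_axioms])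
 obtain m where m: "simpq R (regular_module R) m (carrier R)"
  "module_isomorphic R (Qm M X Y) (Qm (regular_module R) (carrier R) m)"
  by (rule simple_rep[OF s])
 have ms: "submodule (carrier R) R (regular_module R)" "submodule m R (regular_module R)" "m \<subseteq> carrier R"
  using m(1) by (auto simp: simpq_def)
 have X: "sm X" and Y: "sm Y" "Y \<subseteq> X" using s by (auto simp: simpq_def)
 have l: "left_module R (Qm (regular_module R) (carrier R) m)" by (rule A.left_module_Q[OF ms])
 have "simple_module R (Qm (regular_module R) (carrier R) m)" using A.simple_Q_iff[OF ms] m(1) by simp
 moreover have "iso_class R (Qm M X Y) = iso_class R (Qm (regular_module R) (carrier R) m)"
  by (rule iso_class_cong[OF left_module_Q[OF X Y] l m(2)])
 ultimately show "iso_class R (Qm M X Y) \<in> simple_classes R" unfolding simple_classes_def by auto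
 show "iso_class R (Qm M X Y) \<noteq> {}" using l m(2) unfolding iso_class_def by auto
qed

lemma iso_class_eqD:
 assumes s: "simpq R M Y X" and e: "iso_class R (Qm M X Y) = iso_class R (Qm M X' Y')"
  and X': "sm X'" and Y': "sm Y'" "Y' \<subseteq> X'"
 shows "\<exists>f. qiso R M X Y M X' Y' f"
proof -
 have X: "sm X" and Y: "sm Y" "Y \<subseteq> X" using s by (auto simp: simpq_def)
 obtain T where T: "T \<in> iso_class R (Qm M X Y)" using iso_class_simple(2)[OF s] by auto
 then have "left_module R T" "module_isomorphic R (Qm M X Y) T" "module_isomorphic R (Qm M X' Y') T"
  using e by (auto simp: iso_class_def)
 then have "module_isomorphic R (Qm M X Y) (Qm M X' Y')"
  using module_isomorphic_trans[OF left_module_Q[OF X Y]] module_isomorphic_sym[OF left_module_Q[OF X' Y']] by auto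
 then show ?thesis using two_modules.isomorphic_imp_qiso[OF two_self X Y X' Y'] by simp
qed

lemma ci_class_monoid: "ci R M Y X m \<Longrightarrow> m \<in> class_monoid R"
 by (induction rule: ci.induct) (auto simp: class_monoid_def iso_class_simple(1))

lemma cl_class_monoid:
 assumes "finite (between R M Y X)" "sm X" "sm Y" "Y \<subseteq> X"
 shows "cl R M X Y \<in> class_monoid R"
 by (rule ci_class_monoid[OF cl_ci[OF assms]])

end

section \<open>Restriction of scalars to a subring\<close>

lemma left_module_restrict:
 assumes M: "left_module (A\<lparr>carrier := G'\<rparr>) M" and "G \<subseteq> G'" and G: "ring (A\<lparr>carrier := G\<rparr>)"
 shows "left_module (A\<lparr>carrier := G\<rparr>) M"
proof -
 interpret left_module "A\<lparr>carrier := G'\<rparr>" M by fact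
 interpret G: ring "A\<lparr>carrier := G\<rparr>" by fact
 show ?thesis
  using smult_closed smult_l_distr smult_r_distr smult_assoc smult_one assms(2)
  by (intro left_module.intro left_module_axioms.intro G M.abelian_group_axioms) (auto simp: subset_iff)
qed

lemma submodule_restrict: "submodule X (A\<lparr>carrier := G'\<rparr>) M \<Longrightarrow> G \<subseteq> G' \<Longrightarrow> submodule X (A\<lparr>carrier := G\<rparr>) M"
 by (auto simp: submodule_def submodule_axioms_def)

lemma module_isomorphic_restrict:
 assumes "carrier R' \<subseteq> carrier R" "module_isomorphic R M N" shows "module_isomorphic R' M N"
proof -
 obtain h where h: "h \<in> iso (add_monoid M) (add_monoid N)"
  "\<forall>a \<in> carrier R. \<forall>x \<in> carrier M. h (a \<odot>\<^bsub>M\<^esub> x) = a \<odot>\<^bsub>N\<^esub> h x"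
  using assms(2) unfolding module_isomorphic_def by auto
 then show ?thesis using assms(1) unfolding module_isomorphic_def by (intro bexI[of _ h]) auto
qed

text \<open>Both sides are additive along the series, so a single simple factor has to be
  considered. There \<open>the_elem\<close> meets a singleton: all members of the class are
  isomorphic over \<open>G'\<close>, hence over \<open>G\<close>, and finite index makes their
  classes over \<open>G\<close> well defined.\<close>

lemma res_class_ci:
 assumes M: "left_module (A\<lparr>carrier := G'\<rparr>) M" and GG: "G \<subseteq> G'" and G: "ring (A\<lparr>carrier := G\<rparr>)"
 shows "ci (A\<lparr>carrier := G'\<rparr>) M Y X m \<Longrightarrow> fin_index M Y X \<Longrightarrow>
  res_class (A\<lparr>carrier := G\<rparr>) m = cl (A\<lparr>carrier := G\<rparr>) M X Y"
proof (induction rule: ci.induct)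
 interpret M: left_module "A\<lparr>carrier := G'\<rparr>" M by fact
 interpret N: left_module "A\<lparr>carrier := G\<rparr>" M by (rule left_module_restrict[OF M GG G])
 case (refl Y)
 then show ?case using N.cl_refl[OF submodule_restrict[OF refl.hyps GG]] by (simp add: res_class_def)
next
 interpret M: left_module "A\<lparr>carrier := G'\<rparr>" M by fact
 interpret N: left_module "A\<lparr>carrier := G\<rparr>" M by (rule left_module_restrict[OF M GG G])
 case (step Y Z m X)
 let ?s = "iso_class (A\<lparr>carrier := G'\<rparr>) (Qm M X Z)"
 have sZ: "submodule Z (A\<lparr>carrier := G'\<rparr>) M" "submodule X (A\<lparr>carrier := G'\<rparr>) M" "Z \<subseteq> X"
  and sY: "submodule Y (A\<lparr>carrier := G'\<rparr>) M" "Y \<subseteq> Z"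
  using step.hyps(2) ci_sub[OF step.hyps(1)] by (auto simp: simpq_def)
 note r = submodule_restrict[OF _ GG]
 have fZX: "fin_index M Z X" by (rule M.fin_index_mono[OF step.prems sY(2)])
 have "fin_index M (Z \<inter> Y) Z" by (rule M.fin_index_Int[OF sZ(2) sY(1) sZ(1,3) step.prems])
 then have fYZ: "fin_index M Y Z" using sY by (simp add: Int_absorb1)
 have Q: "left_module (A\<lparr>carrier := G\<rparr>) (Qm M X Z)" by (rule N.left_module_Q[OF r[OF sZ(2)] r[OF sZ(1)] sZ(3)])
 have "mod_class (A\<lparr>carrier := G\<rparr>) T = cl (A\<lparr>carrier := G\<rparr>) M X Z" if T: "T \<in> ?s" for T
 proof -
  have T1: "left_module (A\<lparr>carrier := G'\<rparr>) T" "module_isomorphic (A\<lparr>carrier := G'\<rparr>) (Qm M X Z) T"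
   using T by (auto simp: iso_class_def)
  have T2: "left_module (A\<lparr>carrier := G\<rparr>) T" by (rule left_module_restrict[OF T1(1) GG G])
  have T3: "module_isomorphic (A\<lparr>carrier := G\<rparr>) (Qm M X Z) T"
   by (rule module_isomorphic_restrict[OF _ T1(2)]) (use GG in simp)
  interpret T: two_modules "A\<lparr>carrier := G\<rparr>" "Qm M X Z" T using Q T2 by (simp add: two_modules_def)
  have "finite (carrier (Qm M X Z))" using M.fin_index_iff[OF sZ(2,1)] fZX by simp
  then have "finite (Pow (carrier (Qm M X Z)))" by simp
  then have "finite (between (A\<lparr>carrier := G\<rparr>) (Qm M X Z) {\<zero>\<^bsub>Qm M X Z\<^esub>} (carrier (Qm M X Z)))"
   by (rule rev_finite_subset) (auto simp: between_def)
  then show ?thesis using T.mod_class_iso[OF T3] by (simp add: cl_def)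
 qed
 moreover have "?s \<noteq> {}" by (rule M.iso_class_simple(2)[OF step.hyps(2)])
 ultimately have "mod_class (A\<lparr>carrier := G\<rparr>) ` ?s = {cl (A\<lparr>carrier := G\<rparr>) M X Z}" by auto
 then have "res_class (A\<lparr>carrier := G\<rparr>) (add_mset ?s m) = cl (A\<lparr>carrier := G\<rparr>) M X Z + cl (A\<lparr>carrier := G\<rparr>) M Z Y"
  using step.IH[OF fYZ] by (simp add: res_class_def)
 also have "\<dots> = cl (A\<lparr>carrier := G\<rparr>) M X Y"
  by (rule N.cl_add[symmetric, OF N.fin_index_between[OF step.prems] r[OF sZ(2)] r[OF sZ(1)] r[OF sY(1)] sY(2) sZ(3)])
 finally show ?case .
qed

section \<open>The Dirichlet ring\<close>

text \<open>The product of the Dirichlet ring, freed from the record; it is the same function for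
  every \<open>\<Gamma>\<close>.\<close>

definition conv :: "'a dir \<Rightarrow> 'a dir \<Rightarrow> 'a dir" where
 "conv f g m = (\<Sum>k \<in> {k. k \<subseteq># m}. f k * g (m - k))"

lemma Dir_simps:
 "carrier (Dir \<Gamma>) = {f. \<forall>m. f m \<noteq> 0 \<longrightarrow> m \<in> class_monoid \<Gamma>}"
 "f \<otimes>\<^bsub>Dir \<Gamma>\<^esub> g = conv f g" "\<one>\<^bsub>Dir \<Gamma>\<^esub> = dir_monom {#}" "\<zero>\<^bsub>Dir \<Gamma>\<^esub> = (\<lambda>_. 0)"
 "f \<oplus>\<^bsub>Dir \<Gamma>\<^esub> g = (\<lambda>m. f m + g m)"
 by (auto simp: Dir_def conv_def dir_monom_def fun_eq_iff)

lemma finite_multiset_subset: "finite {k. k \<subseteq># (m :: 'x multiset)}"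
proof (induction m)
 case (add x m)
 have "{k. k \<subseteq># add_mset x m} \<subseteq> {k. k \<subseteq># m} \<union> add_mset x ` {k. k \<subseteq># m}"
 proof
  fix k assume "k \<in> {k. k \<subseteq># add_mset x m}"
  then have k: "k \<subseteq># add_mset x m" by simp
  show "k \<in> {k. k \<subseteq># m} \<union> add_mset x ` {k. k \<subseteq># m}"
  proof (cases "x \<in># k")
   case True
   then obtain k' where "k = add_mset x k'" by (metis mset_add)
   then show ?thesis using k by auto
  next
   case False
   then have "k \<subseteq># m" using k by (metis diff_single_trivial subset_eq_diff_conv add_mset_add_single)
   then show ?thesis by simp
  qed
 qed
 then show ?case using add.IH by (meson finite_UnI finite_imageI finite_subset)
qed simp

lemma finite_splits: "finite {(a, b). a + b = (m :: 'x multiset)}"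
proof (rule finite_subset)
 show "{(a, b). a + b = m} \<subseteq> {k. k \<subseteq># m} \<times> {k. k \<subseteq># m}" by auto
qed (simp add: finite_multiset_subset)

text \<open>In this symmetric form, commutativity and associativity are reindexings of finite
  sums.\<close>

lemma conv_eq: "conv f g m = (\<Sum>(a, b) \<in> {(a, b). a + b = m}. f a * g b)"
 unfolding conv_def
 by (rule sum.reindex_bij_witness[of _ fst "\<lambda>k. (k, m - k)"]) auto

lemma conv_comm: "conv f g = conv g f"
 unfolding conv_eq fun_eq_iff
 by (intro allI sum.reindex_bij_witness[of _ "\<lambda>(a, b). (b, a)" "\<lambda>(a, b). (b, a)"]) (auto simp: add.commute)

lemma conv_assoc: "conv (conv f g) h = conv f (conv g h)"
proof
 fix m
 have "conv (conv f g) h m = (\<Sum>(k, c) \<in> {(k, c). k + c = m}. (\<Sum>(a, b) \<in> {(a, b). a + b = k}. f a * g b * h c))"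
  by (simp add: conv_eq sum_distrib_right case_prod_unfold)
 also have "\<dots> = (\<Sum>((k, c), (a, b)) \<in> (SIGMA p:{(k, c). k + c = m}. {(a, b). a + b = fst p}). f a * g b * h c)"
  by (subst sum.Sigma[symmetric]) (auto simp: finite_splits split_beta)
 also have "\<dots> = (\<Sum>((a, l), (b, c)) \<in> (SIGMA p:{(a, l). a + l = m}. {(b, c). b + c = snd p}). f a * g b * h c)"
  by (rule sum.reindex_bij_witness[of _ "\<lambda>((a, l), (b, c)). ((a + b, c), (a, b))" "\<lambda>((k, c), (a, b)). ((a, b + c), (b, c))"])
   (auto simp: add.assoc)
 also have "\<dots> = (\<Sum>(a, l) \<in> {(a, l). a + l = m}. (\<Sum>(b, c) \<in> {(b, c). b + c = l}. f a * g b * h c))"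
  by (subst sum.Sigma[symmetric]) (auto simp: finite_splits split_beta)
 also have "\<dots> = conv f (conv g h) m"
  by (simp add: conv_eq sum_distrib_left case_prod_unfold mult.assoc)
 finally show "conv (conv f g) h m = conv f (conv g h) m" .
qed

lemma conv_monom: "conv (dir_monom a) g m = (if a \<subseteq># m then g (m - a) else 0)"
proof -
 have "conv (dir_monom a) g m = (\<Sum>k \<in> {k. k \<subseteq># m}. if k = a then g (m - a) else 0)"
  unfolding conv_def dir_monom_def by (rule sum.cong) auto
 then show ?thesis by (simp add: finite_multiset_subset sum.delta)
qed

lemma conv_one: "conv (dir_monom {#}) g = g"
 by (simp add: fun_eq_iff conv_monom)

lemma conv_nonzero: "conv f g m \<noteq> 0 \<Longrightarrow> \<exists>a b. a + b = m \<and> f a \<noteq> 0 \<and> g b \<noteq> 0"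
proof (rule ccontr)
 assume 1: "conv f g m \<noteq> 0" and 2: "\<nexists>a b. a + b = m \<and> f a \<noteq> 0 \<and> g b \<noteq> 0"
 then have "conv f g m = 0" unfolding conv_eq by (intro sum.neutral) auto
 then show False using 1 by simp
qed

lemma conv_sum: "finite I \<Longrightarrow> conv (\<lambda>m. \<Sum>i\<in>I. f i m) g m = (\<Sum>i\<in>I. conv (f i) g m)"
 unfolding conv_def by (subst sum.swap) (simp add: sum_distrib_right)

lemma class_monoid_add: "a + b \<in> class_monoid \<Gamma> \<longleftrightarrow> a \<in> class_monoid \<Gamma> \<and> b \<in> class_monoid \<Gamma>"
 by (auto simp: class_monoid_def)

lemma conv_closed:
 assumes "f \<in> carrier (Dir \<Gamma>)" "g \<in> carrier (Dir \<Gamma>)" shows "conv f g \<in> carrier (Dir \<Gamma>)"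
proof -
 have "m \<in> class_monoid \<Gamma>" if m: "conv f g m \<noteq> 0" for m
 proof -
  obtain a b where "a + b = m" "f a \<noteq> 0" "g b \<noteq> 0" using conv_nonzero[OF m] by blast
  then show ?thesis using assms class_monoid_add[of a b \<Gamma>] by (simp add: Dir_simps)
 qed
 then show ?thesis by (simp add: Dir_simps)
qed

lemma Dir_comm_monoid: "comm_monoid (Dir \<Gamma>)"
proof (rule comm_monoidI)
 show "\<one>\<^bsub>Dir \<Gamma>\<^esub> \<in> carrier (Dir \<Gamma>)" by (simp add: Dir_simps dir_monom_def class_monoid_def)
qed (simp_all add: Dir_simps(2,3) conv_closed conv_assoc conv_one, simp add: conv_comm)

lemma Dir_abelian_monoid: "abelian_monoid (Dir \<Gamma>)"
proof (rule abelian_monoidI)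
 show "f \<oplus>\<^bsub>Dir \<Gamma>\<^esub> g \<in> carrier (Dir \<Gamma>)" if "f \<in> carrier (Dir \<Gamma>)" "g \<in> carrier (Dir \<Gamma>)" for f g
  using that by (auto simp: Dir_simps) (metis add_0)
qed (auto simp: Dir_simps fun_eq_iff)

lemma Dir_finsum:
 assumes "finite I" "\<And>i. i \<in> I \<Longrightarrow> f i \<in> carrier (Dir \<Gamma>)"
 shows "(\<Oplus>\<^bsub>Dir \<Gamma>\<^esub>i\<in>I. f i) = (\<lambda>m. \<Sum>i\<in>I. f i m)"
 using assms
proof (induction I)
 case empty
 interpret abelian_monoid "Dir \<Gamma>" by (rule Dir_abelian_monoid)
 show ?case by (simp add: Dir_simps)
next
 case (insert i I)
 interpret abelian_monoid "Dir \<Gamma>" by (rule Dir_abelian_monoid)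
 have "(\<Oplus>\<^bsub>Dir \<Gamma>\<^esub>i\<in>insert i I. f i) = f i \<oplus>\<^bsub>Dir \<Gamma>\<^esub> (\<Oplus>\<^bsub>Dir \<Gamma>\<^esub>i\<in>I. f i)"
  using insert by (intro finsum_insert) auto
 then show ?case using insert by (simp add: Dir_simps(5))
qed

text \<open>The equation \<open>conv (dir_inv f) f = 1\<close>, solved for the coefficient at
  \<open>m\<close>. The formula is meant for series with constant term 1, which keeps the
  coefficients integral.\<close>

function dir_inv :: "'a dir \<Rightarrow> 'a simple_class multiset \<Rightarrow> int" where
 "dir_inv f m = (if m = {#} then 1 else - (\<Sum>k \<in> {k. k \<subset># m}. dir_inv f k * f (m - k)))"
 by pat_completeness auto
termination by (relation "measure (\<lambda>(f, m). size m)") (auto simp: mset_subset_size)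

declare dir_inv.simps [simp del]

lemma conv_dir_inv: assumes "f {#} = 1" shows "conv (dir_inv f) f = dir_monom {#}"
proof
 fix m :: "'a simple_class multiset"
 have "{k. k \<subseteq># m} = insert m {k. k \<subset># m}" by (auto simp: subset_mset.le_less)
 moreover have "finite {k. k \<subset># m}"
  by (rule finite_subset[OF _ finite_multiset_subset[of m]]) (auto simp: subset_mset.le_less)
 ultimately have "conv (dir_inv f) f m = dir_inv f m + (\<Sum>k \<in> {k. k \<subset># m}. dir_inv f k * f (m - k))"
  unfolding conv_def by (simp add: assms)
 then show "conv (dir_inv f) f m = dir_monom {#} m"
  by (subst (asm) (1) dir_inv.simps) (auto simp: dir_monom_def)
qed

lemma dir_inv_closed: assumes "f \<in> carrier (Dir \<Gamma>)" shows "dir_inv f \<in> carrier (Dir \<Gamma>)"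
proof -
 have "dir_inv f m \<noteq> 0 \<Longrightarrow> m \<in> class_monoid \<Gamma>" for m
 proof (induction "size m" arbitrary: m rule: less_induct)
  case less
  show ?case
  proof (cases "m = {#}")
   case False
   then have "(\<Sum>k \<in> {k. k \<subset># m}. dir_inv f k * f (m - k)) \<noteq> 0" using less.prems by (subst (asm) dir_inv.simps) auto
   then obtain k where k: "k \<subset># m" "dir_inv f k * f (m - k) \<noteq> 0" 
    by (rule sum.not_neutral_contains_not_neutral) auto
   then have "k \<in> class_monoid \<Gamma>" using less.hyps mset_subset_size by auto
   moreover have "m - k \<in> class_monoid \<Gamma>" using k(2) assms by (auto simp: Dir_simps)
   ultimately have "k + (m - k) \<in> class_monoid \<Gamma>" by (simp add: class_monoid_add)
   then show ?thesis using k(1) by (simp add: subset_mset.less_imp_le)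
  qed (simp add: class_monoid_def)
 qed
 then show ?thesis by (simp add: Dir_simps)
qed

lemma Dir_UnitI:
 assumes "f \<in> carrier (Dir \<Gamma>)" "f {#} = 1" shows "f \<in> Units (Dir \<Gamma>)"
 unfolding Units_def
 using assms conv_dir_inv[of f] dir_inv_closed[of f \<Gamma>] conv_comm[of f "dir_inv f"] by (auto simp: Dir_simps(2,3))

section \<open>The dual recursion of the Moebius function\<close>

lemma moebius_sum_upper:
 assumes "x \<in> P" "y \<in> P" "x \<le> y" and fin: "finite {z \<in> P. x \<le> z \<and> z \<le> y}"
 shows "(\<Sum>z \<in> {z \<in> P. x \<le> z \<and> z \<le> y}. moebius P x z) = (if x = y then 1 else 0)"
proof (cases "x = y")
 case True
 then have e: "{z \<in> P. x \<le> z \<and> z \<le> y} = {x}" using assms by auto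
 have "moebius P x x = 1" using e True assms by (subst moebius.simps) simp
 then show ?thesis unfolding e using True by simp
next
 case False
 have e: "{z \<in> P. x \<le> z \<and> z \<le> y} = insert y {z \<in> P. x \<le> z \<and> z < y}" using assms by auto
 have "finite {z \<in> P. x \<le> z \<and> z < y}" using fin by (rule rev_finite_subset) auto
 moreover have "moebius P x y = - (\<Sum>z \<in> {z \<in> P. x \<le> z \<and> z < y}. moebius P x z)"
  using False assms by (subst moebius.simps) simp
 ultimately show ?thesis using False by (simp add: e)
qed

text \<open>The recursion says that \<open>moebius\<close> is a one-sided inverse of the zeta
  function of the poset; this is the other side. The sum of
  \<open>moebius P x z * moebius P w y\<close> over \<open>x \<le> z \<le> w \<le> y\<close> is
  evaluated in both orders.\<close>

lemma moebius_sum_lower: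
 assumes "x \<in> P" "y \<in> P" "x \<le> y" "finite {z \<in> P. x \<le> z \<and> z \<le> y}"
 shows "(\<Sum>z \<in> {z \<in> P. x \<le> z \<and> z \<le> y}. moebius P z y) = (if x = y then 1 else 0)"
 using assms
proof (induction "card {z \<in> P. x \<le> z \<and> z \<le> y}" arbitrary: x rule: less_induct)
 case (less x)
 define I where "I a b = {z \<in> P. a \<le> z \<and> z \<le> b}" for a b
 define g where "g a = (\<Sum>z \<in> I a y. moebius P z y)" for a
 have finI: "finite (I a b)" if "x \<le> a" "b \<le> y" for a b
  using less.prems(4) by (rule rev_finite_subset) (use that in \<open>auto simp: I_def intro: order_trans\<close>)
 have xI: "x \<in> I x y" "y \<in> I x y" using less.prems by (auto simp: I_def)
 show ?case
 proof (cases "x = y")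
  case True
  then have e: "{z \<in> P. x \<le> z \<and> z \<le> y} = {y}" using less.prems by auto
  have "moebius P y y = 1" using e True less.prems by (subst moebius.simps) simp
  then show ?thesis unfolding e using True by simp
 next
  case False
  have IH: "g z = (if z = y then 1 else 0)" if z: "z \<in> I x y" "z \<noteq> x" for z
  proof -
   have "I z y \<subseteq> I x y - {x}" using z by (auto simp: I_def intro: order_trans dest: order.antisym)
   then have "I z y \<subset> I x y" using xI by auto
   then have "card (I z y) < card (I x y)" using finI[of x y] by (intro psubset_card_mono) auto
   then show ?thesis using less.hyps[of z] z less.prems finI[of z y] by (simp add: I_def g_def)
  qed
  have "(\<Sum>z \<in> I x y. moebius P x z * g z) = (\<Sum>z \<in> I x y. \<Sum>w \<in> I x y. if z \<le> w then moebius P x z * moebius P w y else 0)"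
  proof (rule sum.cong)
   fix z assume z: "z \<in> I x y"
   have "I z y = {w \<in> I x y. z \<le> w}" using z by (auto simp: I_def intro: order_trans)
   then have "moebius P x z * g z = (\<Sum>w \<in> {w \<in> I x y. z \<le> w}. moebius P x z * moebius P w y)"
    by (simp add: g_def sum_distrib_left)
   also have "\<dots> = (\<Sum>w \<in> I x y. if z \<le> w then moebius P x z * moebius P w y else 0)"
    by (rule sum.inter_filter) (simp add: finI)
   finally show "moebius P x z * g z = (\<Sum>w \<in> I x y. if z \<le> w then moebius P x z * moebius P w y else 0)" .
  qed simp
  also have "\<dots> = (\<Sum>w \<in> I x y. \<Sum>z \<in> I x y. if z \<le> w then moebius P x z * moebius P w y else 0)"
   by (rule sum.swap)
  also have "\<dots> = (\<Sum>w \<in> I x y. if x = w then moebius P w y else 0)"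
  proof (rule sum.cong)
   fix w assume w: "w \<in> I x y"
   have e: "I x w = {z \<in> I x y. z \<le> w}" using w by (auto simp: I_def intro: order_trans)
   have "(\<Sum>z \<in> I x y. if z \<le> w then moebius P x z * moebius P w y else 0) = (\<Sum>z \<in> I x w. moebius P x z * moebius P w y)"
    unfolding e by (rule sum.inter_filter[symmetric]) (simp add: finI)
   also have "\<dots> = (\<Sum>z \<in> I x w. moebius P x z) * moebius P w y" by (simp add: sum_distrib_right)
   also have "(\<Sum>z \<in> I x w. moebius P x z) = (if x = w then 1 else 0)"
    unfolding I_def using w less.prems finI[of x w] by (intro moebius_sum_upper) (auto simp: I_def)
   finally show "(\<Sum>z \<in> I x y. if z \<le> w then moebius P x z * moebius P w y else 0) = (if x = w then moebius P w y else 0)" by simp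
  qed simp
  also have "\<dots> = moebius P x y" using xI finI[of x y] by simp
  finally have 1: "(\<Sum>z \<in> I x y. moebius P x z * g z) = moebius P x y" .
  \<comment> \<open>By the induction hypothesis only \<open>z = x\<close> and \<open>z = y\<close>
    contribute. The second term is already \<open>moebius P x y\<close>, so \<open>g x\<close> must
    vanish.\<close>
  have "(\<Sum>z \<in> I x y. moebius P x z * g z) = moebius P x x * g x + (\<Sum>z \<in> I x y - {x}. moebius P x z * g z)"
   using finI[of x y] xI by (simp add: sum.remove)
  also have "(\<Sum>z \<in> I x y - {x}. moebius P x z * g z) = (\<Sum>z \<in> I x y - {x}. if z = y then moebius P x z else 0)"
   by (rule sum.cong) (auto simp: IH)
  also have "\<dots> = moebius P x y" using finI[of x y] xI False by (simp add: sum.delta)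
  also have "moebius P x x = 1" using less.prems finI[of x x] by (subst moebius.simps) (simp add: I_def)
  finally have "g x = 0" using 1 by simp
  then show ?thesis using False by (simp add: g_def I_def)
 qed
qed

section \<open>Products of scalars and submodules\<close>

context lmod
begin

lemma add_generate_carrier: "H \<subseteq> carrier M \<Longrightarrow> generate (add_monoid M) H \<subseteq> carrier M"
 using M.add.generate_incl by simp

lemma ss_carrier: "\<lbrakk>S \<subseteq> carrier R; X \<subseteq> carrier M\<rbrakk> \<Longrightarrow> set_smult M S X \<subseteq> carrier M"
 unfolding set_smult_def by (rule add_generate_carrier) (auto simp: smult_closed subset_iff)

lemma ss_mem: "\<lbrakk>s \<in> S; x \<in> X\<rbrakk> \<Longrightarrow> s \<odot> x \<in> set_smult M S X"
 unfolding set_smult_def by (rule generate.incl) auto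

lemma ss_zero: "\<zero> \<in> set_smult M S X"
 unfolding set_smult_def using generate.one[of "add_monoid M"] by simp

lemma ss_add: "\<lbrakk>u \<in> set_smult M S X; v \<in> set_smult M S X\<rbrakk> \<Longrightarrow> u \<oplus> v \<in> set_smult M S X"
 unfolding set_smult_def using generate.eng[of u "add_monoid M"] by simp

lemma ss_neg:
 "\<lbrakk>S \<subseteq> carrier R; X \<subseteq> carrier M; u \<in> set_smult M S X\<rbrakk> \<Longrightarrow> \<ominus> u \<in> set_smult M S X"
 unfolding set_smult_def
 using M.add.generate_m_inv_closed[of "{s \<odot> x | s x. s \<in> S \<and> x \<in> X}" u]
 by (fastforce simp: smult_closed subset_iff)

lemma ss_induct [consumes 3, case_names zero mem neg add]:
 assumes "u \<in> set_smult M S X" "S \<subseteq> carrier R" "X \<subseteq> carrier M"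
  and "P \<zero>" "\<And>s x. \<lbrakk>s \<in> S; x \<in> X\<rbrakk> \<Longrightarrow> P (s \<odot> x)"
  and "\<And>s x. \<lbrakk>s \<in> S; x \<in> X; P (s \<odot> x)\<rbrakk> \<Longrightarrow> P (\<ominus> (s \<odot> x))"
  and "\<And>u v. \<lbrakk>u \<in> set_smult M S X; v \<in> set_smult M S X; P u; P v\<rbrakk> \<Longrightarrow> P (u \<oplus> v)"
 shows "P u"
 using assms(1) unfolding set_smult_def
proof (induction rule: generate.induct)
 case one
 show ?case using assms(4) by simp
next
 case (incl h)
 then show ?case using assms(5) by auto
next
 case (inv h)
 then show ?case using assms(5,6) by (auto simp: a_inv_def[symmetric])
next
 case (eng h1 h2)
 then show ?case using assms(7)[of h1 h2] by (simp add: set_smult_def)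
qed

text \<open>The ring \<open>R'\<close> is arbitrary, so that \<open>Z\<close> may be a module over
  any suborder.\<close>

lemma ss_least:
 assumes "S \<subseteq> carrier R" "X \<subseteq> carrier M" and Z: "submodule Z R' M" and "\<And>s x. \<lbrakk>s \<in> S; x \<in> X\<rbrakk> \<Longrightarrow> s \<odot> x \<in> Z"
 shows "set_smult M S X \<subseteq> Z"
proof
 fix u assume "u \<in> set_smult M S X"
 then show "u \<in> Z" using assms(1,2)
 proof (induction rule: ss_induct)
  case zero show ?case using subgroup.one_closed[OF submodule.axioms(1)[OF Z]] by simp
 next
  case (neg s x)
  then show ?case using subgroup.m_inv_closed[OF submodule.axioms(1)[OF Z]] by (simp add: a_inv_def)
 next
  case (add u v)
  then show ?case using subgroup.m_closed[OF submodule.axioms(1)[OF Z]] by simp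
 qed (rule assms(4))
qed

lemma ss_mono: "\<lbrakk>S \<subseteq> S'; X \<subseteq> X'; S' \<subseteq> carrier R; X' \<subseteq> carrier M\<rbrakk> \<Longrightarrow> set_smult M S X \<subseteq> set_smult M S' X'"
proof
 fix u assume s: "S \<subseteq> S'" "X \<subseteq> X'" "S' \<subseteq> carrier R" "X' \<subseteq> carrier M" and u: "u \<in> set_smult M S X"
 have "S \<subseteq> carrier R" "X \<subseteq> carrier M" using s by auto
 with u show "u \<in> set_smult M S' X'"
 proof (induction rule: ss_induct)
  case (mem a x)
  then show ?case using s ss_mem[of a S' x X'] by auto
 next
  case (neg a x)
  then show ?case using s ss_neg by auto
 qed (use ss_zero ss_add in auto)
qed

lemma restrict: "subring G R \<Longrightarrow> left_module (R\<lparr>carrier := G\<rparr>) M"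
 
 by (rule left_module_restrict[where G' = "carrier R"])
  (simp_all add: left_module_axioms R.subring_is_ring subringE(1))

lemma ss_submodule:
 assumes G: "subring G R" and S: "S \<subseteq> carrier R" "X \<subseteq> carrier M"
  and GS: "\<And>g s x. \<lbrakk>g \<in> G; s \<in> S; x \<in> X\<rbrakk> \<Longrightarrow> g \<odot> (s \<odot> x) \<in> set_smult M S X"
 shows "submodule (set_smult M S X) (R\<lparr>carrier := G\<rparr>) M"
proof -
 interpret G: left_module "R\<lparr>carrier := G\<rparr>" M by (rule restrict[OF G])
 have Gc: "G \<subseteq> carrier R" using subringE(1)[OF G] .
 show ?thesis
 proof (rule G.submoduleI)
  show "set_smult M S X \<subseteq> carrier M" by (rule ss_carrier[OF S])
  show "\<zero> \<in> set_smult M S X" by (rule ss_zero)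
  show "u \<oplus> v \<in> set_smult M S X" if "u \<in> set_smult M S X" "v \<in> set_smult M S X" for u v using ss_add that .
  fix g u assume "g \<in> carrier (R\<lparr>carrier := G\<rparr>)" and u: "u \<in> set_smult M S X"
  then have g: "g \<in> G" "g \<in> carrier R" using Gc by auto
  note c = subsetD[OF ss_carrier[OF S]]
  show "g \<odot> u \<in> set_smult M S X"
   using u S
  proof (induction rule: ss_induct)
   case zero then show ?case using g ss_zero by (simp add: smult_zero_r)
  next
   case (mem s x) then show ?case using GS g by simp
  next
   case (neg s x)
   then have "s \<odot> x \<in> carrier M" using S smult_closed by auto
   then show ?case using neg g ss_neg[OF S] by (simp add: smult_minus_r)
  next
   case (add u v) then show ?case using g c ss_add by (simp add: smult_r_distr)
  qed
 qed
qed

lemma ss_one: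
 assumes X: "submodule X (R\<lparr>carrier := G\<rparr>) M" and G: "subring G R"
 shows "set_smult M G X = X"
proof
 interpret G: left_module "R\<lparr>carrier := G\<rparr>" M by (rule restrict[OF G])
 have c: "G \<subseteq> carrier R" "X \<subseteq> carrier M" using subringE(1)[OF G] G.sm_carrier[OF X] by auto
 show "set_smult M G X \<subseteq> X" by (rule ss_least[OF c X]) (use G.sm_smult[OF X] in auto)
 show "X \<subseteq> set_smult M G X"
 proof
  fix x assume x: "x \<in> X"
  have "\<one>\<^bsub>R\<^esub> \<odot> x \<in> set_smult M G X" using ss_mem[OF subringE(3)[OF G] x] .
  then show "x \<in> set_smult M G X" using smult_one[of x] x c by auto
 qed
qed

lemma ss_subgroup: "\<lbrakk>S \<subseteq> carrier R; X \<subseteq> carrier M\<rbrakk> \<Longrightarrow> subgroup (set_smult M S X) (add_monoid M)"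
 unfolding set_smult_def by (rule M.add.generate_is_subgroup) (auto simp: subset_iff smult_closed)

text \<open>Induction over sums of products for an additive map; typically \<open>f\<close> is
  multiplication by a fixed element, on either side.\<close>

lemma ss_map:
 assumes u: "u \<in> set_smult M S X" and S: "S \<subseteq> carrier R" "X \<subseteq> carrier M" and H: "subgroup H (add_monoid N)"
  and N: "abelian_group N" and f: "\<And>x. x \<in> carrier M \<Longrightarrow> f x \<in> carrier N"
   "\<And>x y. \<lbrakk>x \<in> carrier M; y \<in> carrier M\<rbrakk> \<Longrightarrow> f (x \<oplus> y) = f x \<oplus>\<^bsub>N\<^esub> f y"
  and SX: "\<And>s x. \<lbrakk>s \<in> S; x \<in> X\<rbrakk> \<Longrightarrow> f (s \<odot> x) \<in> H"
 shows "f u \<in> H"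
proof -
 interpret N: abelian_group N by fact
 interpret f: group_hom "add_monoid M" "add_monoid N" f
  using f by (intro group_hom.intro group_hom_axioms.intro M.a_group N.a_group homI) auto
 show ?thesis
  using u S
 proof (induction rule: ss_induct)
  case zero
  then show ?case using f.hom_one subgroup.one_closed[OF H] by simp
 next
  case (neg s x)
  have "s \<odot> x \<in> carrier M" using neg S smult_closed by auto
  then show ?case using f.hom_inv subgroup.m_inv_closed[OF H neg(3)] by (simp add: a_inv_def)
 next
  case (add x y)
  have "x \<in> carrier M" "y \<in> carrier M" using add ss_carrier[OF S] by auto
  then show ?case using f(2) subgroup.m_closed[OF H add(3,4)] by simp
 qed (rule SX)
qed

lemma ss_assoc:
 assumes "S \<subseteq> carrier R" "T \<subseteq> carrier R" "X \<subseteq> carrier M"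
 shows "set_smult M (set_smult (regular_module R) S T) X = set_smult M S (set_smult M T X)"
proof
 interpret A: left_module R "regular_module R" by (rule regular_left_module[OF R.ring_axioms])
 have T': "T \<subseteq> carrier (regular_module R)" using assms by simp
 have ST: "set_smult (regular_module R) S T \<subseteq> carrier R" using A.ss_carrier[OF assms(1) T'] by simp
 have TX: "set_smult M T X \<subseteq> carrier M" by (rule ss_carrier[OF assms(2,3)])
 \<comment> \<open>Over an empty set of scalars a submodule is just a subgroup; this is the form
   that \<open>ss_least\<close> asks for.\<close>
 have triv: "submodule (set_smult M U Y) (R\<lparr>carrier := {}\<rparr>) M" if "U \<subseteq> carrier R" "Y \<subseteq> carrier M" for U Y
  using ss_subgroup[OF that] by (simp add: submodule_def submodule_axioms_def)
 note c = subsetD[OF assms(1)] subsetD[OF assms(2)] subsetD[OF assms(3)]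
 show "set_smult M (set_smult (regular_module R) S T) X \<subseteq> set_smult M S (set_smult M T X)"
 proof (rule ss_least[OF ST assms(3) triv[OF assms(1) TX]])
  fix u x assume u: "u \<in> set_smult (regular_module R) S T" and x: "x \<in> X"
  show "u \<odot> x \<in> set_smult M S (set_smult M T X)"
   by (rule A.ss_map[OF u assms(1) T' ss_subgroup[OF assms(1) TX] M.abelian_group_axioms, of "\<lambda>u. u \<odot> x"])
    (use c x ss_mem in \<open>auto simp: smult_closed smult_l_distr smult_assoc\<close>)
 qed
 show "set_smult M S (set_smult M T X) \<subseteq> set_smult M (set_smult (regular_module R) S T) X"
 proof (rule ss_least[OF assms(1) TX triv[OF ST assms(3)]])
  fix s u assume s: "s \<in> S" and u: "u \<in> set_smult M T X"
  have "s \<odot> (t \<odot> x) \<in> set_smult M (set_smult (regular_module R) S T) X" if t: "t \<in> T" "x \<in> X" for t x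
   using ss_mem[OF A.ss_mem[OF s t(1)] t(2)] smult_assoc[OF c(1)[OF s] c(2)[OF t(1)] c(3)[OF t(2)]] by simp
  then show "s \<odot> u \<in> set_smult M (set_smult (regular_module R) S T) X"
   by (rule ss_map[OF u assms(2,3) ss_subgroup[OF ST assms(3)] M.abelian_group_axioms, of "\<lambda>u. s \<odot> u", rotated 2])
    (use c(1)[OF s] in \<open>auto simp: smult_closed smult_r_distr\<close>)
 qed
qed

end

section \<open>Finitely generated submodules over a discrete valuation ring\<close>

text \<open>Recursion on the list of generators: inductions can split off the first generator
  together with its coefficient.\<close>

primrec lspan :: "'a set \<Rightarrow> ('a, 'v, 'e) module_scheme \<Rightarrow> 'v list \<Rightarrow> 'v set" where
 "lspan R0 V [] = {\<zero>\<^bsub>V\<^esub>}"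
| "lspan R0 V (x # xs) = {r \<odot>\<^bsub>V\<^esub> x \<oplus>\<^bsub>V\<^esub> t | r t. r \<in> R0 \<and> t \<in> lspan R0 V xs}"

context lmod
begin

lemma lspan_submodule: "set xs \<subseteq> carrier M \<Longrightarrow> submodule (lspan (carrier R) M xs) R M \<and> set xs \<subseteq> lspan (carrier R) M xs"
proof (induction xs)
 case Nil then show ?case using sm_0 by simp
next
 case (Cons x xs)
 then have x: "x \<in> carrier M" and s: "submodule (lspan (carrier R) M xs) R M" and m: "set xs \<subseteq> lspan (carrier R) M xs" by auto
 have "submodule (lspan (carrier R) M (x # xs)) R M"
 proof (rule submoduleI)
  show "lspan (carrier R) M (x # xs) \<subseteq> carrier M" using x smD[OF s]  smult_closed by auto
  show "\<zero> \<in> lspan (carrier R) M (x # xs)"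
   using sm_zero[OF s] R.zero_closed smult_zero_l[OF x] by (force intro!: exI[of _ "\<zero>\<^bsub>R\<^esub>"] exI[of _ "\<zero>"])
  fix u v assume "u \<in> lspan (carrier R) M (x # xs)" "v \<in> lspan (carrier R) M (x # xs)"
  then obtain r t r' t' where *: "r \<in> carrier R" "t \<in> lspan (carrier R) M xs" "u = r \<odot> x \<oplus> t" "r' \<in> carrier R" "t' \<in> lspan (carrier R) M xs" "v = r' \<odot> x \<oplus> t'"
   by auto
  have tc: "t \<in> carrier M" "t' \<in> carrier M" using * smD[OF s] by auto
  have "u \<oplus> v = (r \<oplus>\<^bsub>R\<^esub> r') \<odot> x \<oplus> (t \<oplus> t')"
   using * tc x  smult_closed by (simp add: smult_l_distr M.a_ac)
  moreover have "r \<oplus>\<^bsub>R\<^esub> r' \<in> carrier R" "t \<oplus> t' \<in> lspan (carrier R) M xs"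
   using * sm_add[OF s] R.a_closed by auto
  ultimately show "u \<oplus> v \<in> lspan (carrier R) M (x # xs)" by auto
 next
  fix a u assume "a \<in> carrier R" "u \<in> lspan (carrier R) M (x # xs)"
  then obtain r t where *: "a \<in> carrier R" "r \<in> carrier R" "t \<in> lspan (carrier R) M xs" "u = r \<odot> x \<oplus> t" by auto
  have "a \<odot> u = (a \<otimes>\<^bsub>R\<^esub> r) \<odot> x \<oplus> a \<odot> t"
   using * smD[OF s] x  smult_closed by (simp add: smult_r_distr smult_assoc)
  moreover have "a \<otimes>\<^bsub>R\<^esub> r \<in> carrier R" "a \<odot> t \<in> lspan (carrier R) M xs"
   using * sm_smult[OF s] R.m_closed by auto
  ultimately show "a \<odot> u \<in> lspan (carrier R) M (x # xs)" by auto
 qed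
 moreover have "x \<in> lspan (carrier R) M (x # xs)"
  using sm_zero[OF s] R.one_closed x smult_one[OF x] by (force intro!: exI[of _ "\<one>\<^bsub>R\<^esub>"] exI[of _ "\<zero>"])
 moreover have "lspan (carrier R) M xs \<subseteq> lspan (carrier R) M (x # xs)"
 proof
  fix t assume t: "t \<in> lspan (carrier R) M xs"
  have "t = \<zero>\<^bsub>R\<^esub> \<odot> x \<oplus> t" using t smD[OF s] smult_zero_l[OF x] by simp
  then show "t \<in> lspan (carrier R) M (x # xs)" using t R.zero_closed by auto
 qed
 ultimately show ?case using m by auto
qed

end

definition fg where "fg R0 V X \<longleftrightarrow> (\<exists>xs. set xs \<subseteq> carrier V \<and> X = lspan R0 V xs)"

text \<open>The condition \<open>KX = V\<close>, without \<open>K\<close> and without sums: each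
  vector enters \<open>X\<close> after multiplication by a power of the uniformizer
  (\<open>absb_iff\<close>).\<close>

definition absb where "absb A p V X \<longleftrightarrow> (\<forall>v\<in>carrier V. \<exists>k::nat. (p [^]\<^bsub>A\<^esub> k) \<odot>\<^bsub>V\<^esub> v \<in> X)"

definition lat where "lat A R0 p V X \<longleftrightarrow> submodule X (A\<lparr>carrier := R0\<rparr>) V \<and> fg R0 V X \<and> absb A p V X"

definition ord where "ord A R0 p G \<longleftrightarrow> subring G A \<and> R0 \<subseteq> G \<and> lat A R0 p (regular_module A) G"

text \<open>\<open>R0\<close> is the image of the valuation ring in the center of \<open>A\<close>, and \<open>p\<close> that of a uniformizer.\<close>

locale order_setting = ring A for A :: "('a, 'c) ring_scheme" (structure) +
 fixes R0 :: "'a set" and p pinv :: 'a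
 assumes R0: "subring R0 A"
  and central: "\<lbrakk>r \<in> R0; a \<in> carrier A\<rbrakk> \<Longrightarrow> r \<otimes> a = a \<otimes> r"
  and p: "p \<in> R0" "pinv \<in> carrier A" "p \<otimes> pinv = \<one>"
  and dvr: "\<lbrakk>r \<in> R0; r \<noteq> \<zero>\<rbrakk> \<Longrightarrow> \<exists>k::nat. \<exists>u\<in>R0. \<exists>w\<in>R0. u \<otimes> w = \<one> \<and> r = p [^] k \<otimes> u"
  and local: "r \<in> R0 \<Longrightarrow> \<exists>u\<in>R0. u \<otimes> (\<one> \<ominus> p \<otimes> r) = \<one>"
  and resfin: "\<exists>S. finite S \<and> S \<subseteq> R0 \<and> (\<forall>r\<in>R0. \<exists>s\<in>S. \<exists>t\<in>R0. r = s \<oplus> p \<otimes> t)"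
begin

abbreviation amult (infixl "\<cdot>" 70) where "x \<cdot> y \<equiv> x \<otimes> y"
abbreviation "pp \<equiv> \<lambda>k::nat. p [^] k"
abbreviation "pv \<equiv> \<lambda>k::nat. pinv [^] k"

lemma R0c: "r \<in> R0 \<Longrightarrow> r \<in> carrier A" using subringE(1)[OF R0] by auto
lemma R0_closed: "\<zero> \<in> R0" "\<one> \<in> R0" "\<lbrakk>r \<in> R0; s \<in> R0\<rbrakk> \<Longrightarrow> r \<oplus> s \<in> R0" "\<lbrakk>r \<in> R0; s \<in> R0\<rbrakk> \<Longrightarrow> r \<cdot> s \<in> R0"
 "r \<in> R0 \<Longrightarrow> \<ominus> r \<in> R0"
 using subringE[OF R0] by auto

lemma pow_R0: "pp k \<in> R0"
 by (induction k) (auto simp: R0_closed p)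

lemma pc [simp]: "p \<in> carrier A" "pinv \<in> carrier A" "pp k \<in> carrier A" "pv k \<in> carrier A"
 using R0c[OF p(1)] p(2) by auto

lemma p_central: "a \<in> carrier A \<Longrightarrow> pp k \<cdot> a = a \<cdot> pp k"
 by (rule central[OF pow_R0])

lemma pinv_p: "pinv \<cdot> p = \<one>" using p(3) central[OF p(1) p(2)] by simp

lemma pinv_pow: "pv k \<cdot> pp k = \<one>" "pp k \<cdot> pv k = \<one>"
proof (induction k)
 case (Suc k)
 have "pv (Suc k) \<cdot> pp (Suc k) = pv k \<cdot> (pinv \<cdot> p) \<cdot> pp k"
  using p_central[of p k] by (simp add: m_assoc)
 then show "pv (Suc k) \<cdot> pp (Suc k) = \<one>" using Suc by (simp add: pinv_p)
 have "pp (Suc k) \<cdot> pv (Suc k) = pp k \<cdot> (p \<cdot> pinv) \<cdot> pv k"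
  using nat_pow_comm[of pinv k 1] by (simp add: m_assoc)
 then show "pp (Suc k) \<cdot> pv (Suc k) = \<one>" using Suc by (simp add: p)
qed simp_all

lemma pinv_central: assumes a: "a \<in> carrier A" shows "pv k \<cdot> a = a \<cdot> pv k"
proof -
 have "pv k \<cdot> a = pv k \<cdot> a \<cdot> (pp k \<cdot> pv k)" using a by (simp add: pinv_pow)
 also have "\<dots> = pv k \<cdot> (pp k \<cdot> a) \<cdot> pv k" using a p_central[OF a, of k] by (simp add: m_assoc)
 also have "\<dots> = (pv k \<cdot> pp k) \<cdot> a \<cdot> pv k" using a by (simp add: m_assoc)
 finally show ?thesis using a by (simp add: pinv_pow)
qed

end

locale order_module = order_setting A R0 p pinv + V: left_module A V
 for A :: "('a, 'c) ring_scheme" and R0 p pinv and V :: "('a, 'v, 'e) module_scheme" (structure)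
begin

abbreviation "full \<equiv> lat A R0 p V"

abbreviation "smR X \<equiv> submodule X (A\<lparr>carrier := R0\<rparr>) V"

sublocale VR: left_module "A\<lparr>carrier := R0\<rparr>" V
 by (rule V.restrict[OF R0])

lemma smR_smult: "\<lbrakk>smR X; r \<in> R0; x \<in> X\<rbrakk> \<Longrightarrow> r \<odot> x \<in> X"
 using VR.sm_smult by simp

lemma pw: "v \<in> carrier V \<Longrightarrow> pp (j + k :: nat) \<odot> v = pp j \<odot> (pp k \<odot> v)"
 by (simp add: nat_pow_mult[symmetric] V.smult_assoc)

lemma pw_cancel: "v \<in> carrier V \<Longrightarrow> pv k \<odot> (pp k \<odot> v) = v"
 "v \<in> carrier V \<Longrightarrow> pp k \<odot> (pv k \<odot> v) = v"
 by (simp_all add: V.smult_assoc[symmetric] pinv_pow V.smult_one)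

lemma pw_comm: "\<lbrakk>a \<in> carrier A; v \<in> carrier V\<rbrakk> \<Longrightarrow> pp k \<odot> (a \<odot> v) = a \<odot> (pp k \<odot> v)"
 by (simp add: V.smult_assoc[symmetric] p_central)

lemma pw_mem: "\<lbrakk>smR X; x \<in> X\<rbrakk> \<Longrightarrow> pp k \<odot> x \<in> X"
 by (rule smR_smult[OF _ pow_R0])

lemma pw_le: "\<lbrakk>smR X; v \<in> carrier V; pp j \<odot> v \<in> X; j \<le> k\<rbrakk> \<Longrightarrow> pp k \<odot> v \<in> X"
 using pw_mem[of X "pp j \<odot> v" "k - j"] pw[of v "k - j" j] by simp

lemma lspan_sm: "set xs \<subseteq> carrier V \<Longrightarrow> smR (lspan R0 V xs) \<and> set xs \<subseteq> lspan R0 V xs"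
 using VR.lspan_submodule[of xs] by simp

lemma lspan_least: "\<lbrakk>smR Y; set xs \<subseteq> Y\<rbrakk> \<Longrightarrow> lspan R0 V xs \<subseteq> Y"
 by (induction xs) (auto simp: VR.sm_zero VR.sm_add smR_smult subset_iff)

lemma fg_sm: "fg R0 V X \<Longrightarrow> smR X"
 using lspan_sm by (auto simp: fg_def)

lemma lspan_eq_ss: assumes xs: "set xs \<subseteq> carrier V" shows "lspan R0 V xs = set_smult V R0 (set xs)"
proof
 have R0c': "R0 \<subseteq> carrier A" using R0c by auto
 have s: "smR (set_smult V R0 (set xs))"
 proof (rule V.ss_submodule[OF R0 R0c' xs])
  fix g s x assume *: "g \<in> R0" "s \<in> R0" "x \<in> set xs"
  then have "g \<odot> (s \<odot> x) = (g \<cdot> s) \<odot> x" using V.smult_assoc R0c xs by (metis subsetD)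
  then show "g \<odot> (s \<odot> x) \<in> set_smult V R0 (set xs)" using V.ss_mem[OF R0_closed(4)[OF *(1,2)] *(3)] by simp
 qed
 have "set xs \<subseteq> set_smult V R0 (set xs)"
 proof
  fix x assume x: "x \<in> set xs"
  then show "x \<in> set_smult V R0 (set xs)" using V.ss_mem[OF R0_closed(2) x] V.smult_one[of x] xs by auto
 qed
 then show "lspan R0 V xs \<subseteq> set_smult V R0 (set xs)" by (rule lspan_least[OF s])
 show "set_smult V R0 (set xs) \<subseteq> lspan R0 V xs"
  using lspan_sm[OF xs] by (intro V.ss_least[OF R0c' xs, where R' = "A\<lparr>carrier := R0\<rparr>"]) (auto intro: smR_smult)
qed

lemma fg_iff: "fg R0 V X \<longleftrightarrow> (\<exists>S. finite S \<and> S \<subseteq> carrier V \<and> set_smult V R0 S = X)"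
proof
 assume "fg R0 V X"
 then show "\<exists>S. finite S \<and> S \<subseteq> carrier V \<and> set_smult V R0 S = X"
  using lspan_eq_ss unfolding fg_def by (metis List.finite_set)
next
 assume "\<exists>S. finite S \<and> S \<subseteq> carrier V \<and> set_smult V R0 S = X"
 then obtain S where "finite S" "S \<subseteq> carrier V" "set_smult V R0 S = X" by auto
 moreover then obtain xs where "set xs = S" using finite_list by auto
 ultimately show "fg R0 V X" using lspan_eq_ss[of xs] unfolding fg_def by auto
qed

text \<open>Induction on the number of generators. The coefficients of the first generator in
  elements of \<open>Y\<close> are the multiples of one power of \<open>p\<close>. An element
  attaining this power, together with generators of the intersection with the span of the other
  generators, generates \<open>Y\<close>.\<close>

lemma noeth: assumes "fg R0 V X" and "smR Y" "Y \<subseteq> X" shows "fg R0 V Y"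
proof -
 have "set xs \<subseteq> carrier V \<Longrightarrow> smR Y \<Longrightarrow> Y \<subseteq> lspan R0 V xs \<Longrightarrow> fg R0 V Y" for xs Y
 proof (induction xs arbitrary: Y)
  case Nil
  then have "Y = {\<zero>}" using VR.sm_zero by auto
  then show ?case unfolding fg_def by (intro exI[of _ "[]"]) auto
 next
  case (Cons x xs)
  then have x: "x \<in> carrier V" and xs: "set xs \<subseteq> carrier V" and Y: "smR Y" by auto
  let ?T = "lspan R0 V xs"
  have T: "smR ?T" using lspan_sm[OF xs] by simp
  have fT: "fg R0 V (Y \<inter> ?T)" using Cons.IH[OF xs VR.sm_Int[OF Y T]] by auto
  have xc: "r \<odot> x \<in> carrier V" if "r \<in> R0" for r using V.smult_closed[OF R0c[OF that] x] .
  \<comment> \<open>These \<open>r\<close> are the coefficients of \<open>x\<close> in elements of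
    \<open>Y\<close>, modulo the span of the other generators.\<close>
  define Q where "Q r \<longleftrightarrow> r \<in> R0 \<and> (\<exists>y\<in>Y. mcong V ?T y (r \<odot> x))" for r
  have dec: "\<exists>r. Q r \<and> mcong V ?T y (r \<odot> x)" if y: "y \<in> Y" for y
  proof -
   obtain r t where rt: "r \<in> R0" "t \<in> ?T" "y = r \<odot> x \<oplus> t" using y Cons.prems(3) by auto
   have tc: "t \<in> carrier V" by (rule VR.smD[OF T rt(2)])
   have "mcong V ?T y (r \<odot> x)"
    using V.M.add_diff_cancel'[OF xc[OF rt(1)] tc] xc[OF rt(1)] tc rt by (simp add: mcong_def)
   then show ?thesis using rt(1) y by (auto simp: Q_def)
  qed
  \<comment> \<open>Multiplication by the inverse of the unit part of \<open>r\<close> shows that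
    the power of \<open>p\<close> in \<open>r\<close> is itself such a coefficient.\<close>
  have power: "\<exists>k. Q (pp k) \<and> (\<exists>u\<in>R0. r = u \<cdot> pp k)" if r: "Q r" "r \<noteq> \<zero>\<^bsub>A\<^esub>" for r
  proof -
   obtain y where y: "y \<in> Y" "mcong V ?T y (r \<odot> x)" and rR: "r \<in> R0" using r(1) by (auto simp: Q_def)
   obtain k u w where u: "u \<in> R0" "w \<in> R0" "u \<cdot> w = \<one>\<^bsub>A\<^esub>" "r = pp k \<cdot> u" using dvr[OF rR r(2)] by blast
   note c = R0c[OF u(1)] R0c[OF u(2)]
   have e: "w \<cdot> r = pp k" unfolding u(4) using u(3) central[OF u(2), of "pp k \<cdot> u"] c by (simp add: m_assoc)
   have "w \<odot> (r \<odot> x) = pp k \<odot> x" using V.smult_assoc[OF c(2) R0c[OF rR] x] e by simp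
   then have "mcong V ?T (w \<odot> y) (pp k \<odot> x)" using VR.cong_smult[OF T y(2), of w] u(2) by simp
   then have "Q (pp k)" using smR_smult[OF Y u(2) y(1)] pow_R0 by (auto simp: Q_def)
   moreover have "r = u \<cdot> pp k" using u(4) central[OF u(1), of "pp k"] by simp
   ultimately show ?thesis using u(1) by blast
  qed
  show ?case
  proof (cases "\<exists>k. Q (pp k)")
   case False
   have "Y \<subseteq> ?T"
   proof
    fix y assume y: "y \<in> Y"
    obtain r where r: "Q r" "mcong V ?T y (r \<odot> x)" using dec[OF y] by auto
    then have "r = \<zero>\<^bsub>A\<^esub>" using power[OF r(1)] False by blast
    then show "y \<in> ?T" using VR.cong_mem[OF T r(2)] V.smult_zero_l[OF x] VR.sm_zero[OF T] by simp
   qed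
   then show ?thesis using fT by (simp add: Int_absorb2)
  next
   case True
   define k where "k = (LEAST k. Q (pp k))"
   have Qk: "Q (pp k)" and kle: "\<And>j. Q (pp j) \<Longrightarrow> k \<le> j"
    unfolding k_def using True by (auto intro: LeastI Least_le)
   obtain y0 where y0: "y0 \<in> Y" "mcong V ?T y0 (pp k \<odot> x)" using Qk by (auto simp: Q_def)
   obtain ys where ys: "set ys \<subseteq> carrier V" "Y \<inter> ?T = lspan R0 V ys" using fT by (auto simp: fg_def)
   have "Y \<subseteq> lspan R0 V (y0 # ys)"
   proof
    fix y assume y: "y \<in> Y"
    obtain r where r: "Q r" "mcong V ?T y (r \<odot> x)" using dec[OF y] by auto
    have "\<exists>c\<in>R0. r = c \<cdot> pp k"
    proof (cases "r = \<zero>\<^bsub>A\<^esub>")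
     case True then show ?thesis using R0_closed(1) by (intro bexI[of _ "\<zero>\<^bsub>A\<^esub>"]) auto
    next
     case False
     then obtain j u where j: "Q (pp j)" "u \<in> R0" "r = u \<cdot> pp j" using power[OF r(1)] by blast
     have "pp j = pp (j - k) \<cdot> pp k" using kle[OF j(1)] by (simp add: nat_pow_mult)
     then have "r = (u \<cdot> pp (j - k)) \<cdot> pp k" using j R0c by (simp add: m_assoc)
     then show ?thesis using R0_closed(4)[OF j(2) pow_R0] by blast
    qed
    then obtain c where c: "c \<in> R0" "r = c \<cdot> pp k" by auto
    have "mcong V ?T (c \<odot> y0) (r \<odot> x)"
     using VR.cong_smult[OF T y0(2), of c] c V.smult_assoc[OF R0c[OF c(1)] pc(3) x] by simp
    from VR.cong_trans[OF T r(2) VR.cong_sym[OF T this]]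
    have "y \<ominus> c \<odot> y0 \<in> Y \<inter> ?T" using VR.sm_minus[OF Y y smR_smult[OF Y c(1) y0(1)]] by (simp add: mcong_def)
    moreover have "y = c \<odot> y0 \<oplus> (y \<ominus> c \<odot> y0)"
     using V.M.diff_add_cancel'[OF VR.smD[OF Y y] VR.smD[OF Y smR_smult[OF Y c(1) y0(1)]]] by simp
    ultimately show "y \<in> lspan R0 V (y0 # ys)" using ys(2) c(1) by auto
   qed
   moreover have "lspan R0 V (y0 # ys) \<subseteq> Y" using y0 ys lspan_sm[OF ys(1)] by (intro lspan_least[OF Y]) auto
   ultimately show ?thesis unfolding fg_def using ys VR.smD[OF Y y0(1)] by (intro exI[of _ "y0 # ys"]) auto
  qed
 qed
 then show ?thesis using assms unfolding fg_def by auto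
qed

text \<open>Generators are eliminated one at a time. From \<open>x \<equiv> p(rx + t)\<close> modulo
  \<open>Y\<close> follows \<open>x \<equiv> p(ut)\<close>, where \<open>u\<close> is the inverse of
  \<open>1 - pr\<close>. Substituting this for \<open>x\<close> leaves the same hypothesis for the
  remaining generators.\<close>

lemma nakayama:
 assumes "fg R0 V X" and "smR Y" and "\<And>x. x \<in> X \<Longrightarrow> \<exists>x'\<in>X. mcong V Y x (p \<odot> x')"
 shows "X \<subseteq> Y"
proof -
 have "set xs \<subseteq> carrier V \<Longrightarrow> (\<And>x. x \<in> lspan R0 V xs \<Longrightarrow> \<exists>x'\<in>lspan R0 V xs. mcong V Y x (p \<odot> x')) \<Longrightarrow> lspan R0 V xs \<subseteq> Y" for xs
 proof (induction xs)
  case Nil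
  then show ?case using VR.sm_zero[OF assms(2)] by simp
 next
  case (Cons x xs)
  then have x: "x \<in> carrier V" and xs: "set xs \<subseteq> carrier V" by auto
  note Y = assms(2)
  let ?T = "lspan R0 V xs"
  have T: "smR ?T" and T': "smR (lspan R0 V (x # xs))" using lspan_sm[OF xs] lspan_sm[of "x # xs"] Cons by auto
  have sub: "?T \<subseteq> lspan R0 V (x # xs)" using lspan_sm[of "x # xs"] Cons.prems(1) by (intro lspan_least) auto
  have "x \<in> lspan R0 V (x # xs)" using lspan_sm[of "x # xs"] Cons.prems(1) by auto
  then obtain z where "z \<in> lspan R0 V (x # xs)" "mcong V Y x (p \<odot> z)" using Cons.prems(2) by blast
  then obtain r t where rt: "r \<in> R0" "t \<in> ?T" "mcong V Y x (p \<odot> (r \<odot> x \<oplus> t))" by auto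
  have tc: "t \<in> carrier V" using rt VR.smD[OF T] by auto
  obtain u where u: "u \<in> R0" "u \<cdot> (\<one>\<^bsub>A\<^esub> \<ominus>\<^bsub>A\<^esub> p \<cdot> r) = \<one>\<^bsub>A\<^esub>" using local[OF rt(1)] by auto
  note c = R0c[OF rt(1)] R0c[OF u(1)]
  have "mcong V Y (x \<ominus> (p \<cdot> r) \<odot> x) (p \<odot> (r \<odot> x \<oplus> t) \<ominus> (p \<cdot> r) \<odot> x)"
   using x c V.smult_closed by (intro VR.cong_minus[OF Y rt(3)] VR.cong_refl[OF Y]) auto
  moreover have "x \<ominus> (p \<cdot> r) \<odot> x = (\<one>\<^bsub>A\<^esub> \<ominus>\<^bsub>A\<^esub> p \<cdot> r) \<odot> x"
   using x c by (simp add: minus_eq V.M.minus_eq V.smult_l_distr V.smult_minus_l V.smult_one)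
  moreover have "p \<odot> (r \<odot> x \<oplus> t) \<ominus> (p \<cdot> r) \<odot> x = p \<odot> t"
   using x c tc V.smult_closed by (simp add: V.smult_r_distr V.smult_assoc V.M.add_diff_cancel')
  ultimately have "mcong V Y ((\<one>\<^bsub>A\<^esub> \<ominus>\<^bsub>A\<^esub> p \<cdot> r) \<odot> x) (p \<odot> t)" by simp
  from VR.cong_smult[OF Y this, of u]
  have "mcong V Y (u \<odot> ((\<one>\<^bsub>A\<^esub> \<ominus>\<^bsub>A\<^esub> p \<cdot> r) \<odot> x)) (u \<odot> (p \<odot> t))" using u by simp
  moreover have "u \<odot> ((\<one>\<^bsub>A\<^esub> \<ominus>\<^bsub>A\<^esub> p \<cdot> r) \<odot> x) = x" using u x c by (simp add: V.smult_assoc[symmetric] V.smult_one)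
  moreover have "u \<odot> (p \<odot> t) = p \<odot> (u \<odot> t)"
   using central[OF p(1) c(2)] c tc by (simp add: V.smult_assoc[symmetric])
  ultimately have xc: "mcong V Y x (p \<odot> (u \<odot> t))" by simp
  have ut: "u \<odot> t \<in> ?T" using smR_smult[OF T u(1) rt(2)] .
  have TY: "?T \<subseteq> Y"
  proof (rule Cons.IH[OF xs])
   fix s assume s: "s \<in> ?T"
   then obtain z where "z \<in> lspan R0 V (x # xs)" "mcong V Y s (p \<odot> z)" using Cons.prems(2) sub by blast
   then obtain r' t' where rt': "r' \<in> R0" "t' \<in> ?T" "mcong V Y s (p \<odot> (r' \<odot> x \<oplus> t'))" by auto
   \<comment> \<open>Here \<open>x\<close> is replaced by \<open>p(ut)\<close>, which stays in the
     span of the remaining generators.\<close>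
   let ?z = "r' \<odot> (p \<odot> (u \<odot> t)) \<oplus> t'"
   have "?z \<in> ?T" using smR_smult[OF T p(1) ut] smR_smult[OF T rt'(1)] VR.sm_add[OF T _ rt'(2)] by blast
   moreover have "mcong V Y (p \<odot> (r' \<odot> x \<oplus> t')) (p \<odot> ?z)"
    using rt' p(1) VR.smD[OF T rt'(2)] by (intro VR.cong_smult[OF Y] VR.cong_add[OF Y] VR.cong_refl[OF Y] xc) auto
   ultimately show "\<exists>x'\<in>?T. mcong V Y s (p \<odot> x')" using VR.cong_trans[OF Y rt'(3)] by blast
  qed
  have "p \<odot> (u \<odot> t) \<in> Y" using ut TY smR_smult[OF Y p(1)] by auto
  then have "x \<in> Y" using VR.cong_mem[OF Y xc] by simp
  then show ?case using TY by (auto intro!: VR.sm_add[OF Y] smR_smult[OF Y])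
 qed
 then show ?thesis using assms unfolding fg_def by auto
qed

end

section \<open>Lattices\<close>

lemma lspan_map:
 assumes V: "order_module A R0 p pinv V" and U: "order_module A R0 p pinv U"
  and fa: "\<And>x y. \<lbrakk>x \<in> X; y \<in> X\<rbrakk> \<Longrightarrow> f (x \<oplus>\<^bsub>V\<^esub> y) = f x \<oplus>\<^bsub>U\<^esub> f y"
  and fs: "\<And>r x. \<lbrakk>r \<in> R0; x \<in> X\<rbrakk> \<Longrightarrow> f (r \<odot>\<^bsub>V\<^esub> x) = r \<odot>\<^bsub>U\<^esub> f x"
  and fc: "\<And>x. x \<in> X \<Longrightarrow> f x \<in> carrier U"
  and X: "submodule X (A\<lparr>carrier := R0\<rparr>) V"
 shows "set xs \<subseteq> X \<Longrightarrow> f ` lspan R0 V xs = lspan R0 U (map f xs)"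
proof (induction xs)
 interpret V: order_module A R0 p pinv V by fact
 interpret U: order_module A R0 p pinv U by fact
 case Nil
 have z: "\<zero>\<^bsub>V\<^esub> \<in> X" using V.VR.sm_zero[OF X] .
 have "f (\<zero>\<^bsub>A\<^esub> \<odot>\<^bsub>V\<^esub> \<zero>\<^bsub>V\<^esub>) = \<zero>\<^bsub>U\<^esub>" using fs[OF V.R0_closed(1) z] fc[OF z] U.V.smult_zero_l by simp
 then show ?case using V.V.smult_zero_l by simp
next
 interpret V: order_module A R0 p pinv V by fact
 case (Cons x xs)
 then have x: "x \<in> X" and xs: "set xs \<subseteq> X" and IH: "f ` lspan R0 V xs = lspan R0 U (map f xs)" by auto
 have T: "lspan R0 V xs \<subseteq> X" using V.lspan_least[OF X xs] .
 have e: "f (r \<odot>\<^bsub>V\<^esub> x \<oplus>\<^bsub>V\<^esub> t) = r \<odot>\<^bsub>U\<^esub> f x \<oplus>\<^bsub>U\<^esub> f t" if "r \<in> R0" "t \<in> lspan R0 V xs" for r t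
  using fa[OF V.smR_smult[OF X that(1) x], of t] fs[OF that(1) x] T that(2) by auto
 show ?case
 proof (intro equalityI subsetI)
  fix u assume "u \<in> f ` lspan R0 V (x # xs)"
  then obtain r t where rt: "r \<in> R0" "t \<in> lspan R0 V xs" "u = f (r \<odot>\<^bsub>V\<^esub> x \<oplus>\<^bsub>V\<^esub> t)" by auto
  have "f t \<in> lspan R0 U (map f xs)" using IH rt by auto
  then show "u \<in> lspan R0 U (map f (x # xs))" using rt e by auto
 next
  fix u assume "u \<in> lspan R0 U (map f (x # xs))"
  then obtain r s where rs: "r \<in> R0" "s \<in> lspan R0 U (map f xs)" "u = r \<odot>\<^bsub>U\<^esub> f x \<oplus>\<^bsub>U\<^esub> s" by auto
  then obtain t where t: "t \<in> lspan R0 V xs" "s = f t" using IH by auto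
  then have "u = f (r \<odot>\<^bsub>V\<^esub> x \<oplus>\<^bsub>V\<^esub> t)" using e rs by simp
  then show "u \<in> f ` lspan R0 V (x # xs)" using rs t by auto
 qed
qed

lemma fg_image:
 assumes V: "order_module A R0 p pinv V" and U: "order_module A R0 p pinv U"
  and fX: "fg R0 V X"
  and fa: "\<And>x y. \<lbrakk>x \<in> X; y \<in> X\<rbrakk> \<Longrightarrow> f (x \<oplus>\<^bsub>V\<^esub> y) = f x \<oplus>\<^bsub>U\<^esub> f y"
  and fs: "\<And>r x. \<lbrakk>r \<in> R0; x \<in> X\<rbrakk> \<Longrightarrow> f (r \<odot>\<^bsub>V\<^esub> x) = r \<odot>\<^bsub>U\<^esub> f x"
  and fc: "\<And>x. x \<in> X \<Longrightarrow> f x \<in> carrier U"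
 shows "fg R0 U (f ` X)"
proof -
 interpret V: order_module A R0 p pinv V by fact
 obtain xs where xs: "set xs \<subseteq> carrier V" "X = lspan R0 V xs" using fX by (auto simp: fg_def)
 have s: "submodule X (A\<lparr>carrier := R0\<rparr>) V" "set xs \<subseteq> X" using V.lspan_sm[OF xs(1)] xs(2) by auto
 have "f ` X = lspan R0 U (map f xs)" using lspan_map[OF V U fa fs fc s(1,2)] xs(2) by simp
 moreover have "set (map f xs) \<subseteq> carrier U" using fc s by auto
 ultimately show ?thesis unfolding fg_def by (intro exI[of _ "map f xs"]) auto
qed

context order_setting
begin

abbreviation "RA \<equiv> regular_module A"

lemma reg: "order_module A R0 p pinv (regular_module A)"
 by (intro order_module.intro order_setting_axioms regular_left_module ring_axioms)

end

context order_module
begin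

lemma om: "order_module A R0 p pinv V" by (rule order_module_axioms)

abbreviation "pX k X \<equiv> (\<lambda>x. pp k \<odot> x) ` X"

lemma pX_sub: "smR X \<Longrightarrow> pX k X \<subseteq> X" using pw_mem by auto

lemma fg_pX: "fg R0 V X \<Longrightarrow> fg R0 V (pX k X)"
proof (rule fg_image[OF om om])
 assume f: "fg R0 V X"
 note c = VR.smD[OF fg_sm[OF f]]
 fix x y assume "x \<in> X" "y \<in> X"
 then show "pp k \<odot> (x \<oplus> y) = pp k \<odot> x \<oplus> pp k \<odot> y" using c V.smult_r_distr by simp
 show "pp k \<odot> x \<in> carrier V" using c \<open>x \<in> X\<close> V.smult_closed by simp
 fix r assume "r \<in> R0"
 then show "pp k \<odot> (r \<odot> x) = r \<odot> (pp k \<odot> x)" using c \<open>x \<in> X\<close> pw_comm R0c by simp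
qed

text \<open>\<open>p\<close> acts invertibly on \<open>V\<close>. Modules that are only known to be
  bounded, such as \<open>L'\<close> or the inverse of a lattice, become finitely generated in this
  way.\<close>

lemma fg_pinvX: assumes f: "fg R0 V (pX k X)" and X: "X \<subseteq> carrier V" shows "fg R0 V X"
proof -
 have c: "x \<in> pX k X \<Longrightarrow> x \<in> carrier V" for x using X V.smult_closed by auto
 have "fg R0 V ((\<lambda>x. pv k \<odot> x) ` pX k X)"
 proof (rule fg_image[OF om om f])
  fix x y assume "x \<in> pX k X" "y \<in> pX k X"
  then show "pv k \<odot> (x \<oplus> y) = pv k \<odot> x \<oplus> pv k \<odot> y" using c V.smult_r_distr by simp
  show "pv k \<odot> x \<in> carrier V" using c \<open>x \<in> pX k X\<close> V.smult_closed by simp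
  fix r assume "r \<in> R0"
  then show "pv k \<odot> (r \<odot> x) = r \<odot> (pv k \<odot> x)"
   using c[OF \<open>x \<in> pX k X\<close>] R0c[of r] by (simp add: V.smult_assoc[symmetric] pinv_central)
 qed
 moreover have "(\<lambda>x. pv k \<odot> x) ` pX k X = X"
  unfolding image_image using X pw_cancel(1)[of _ k] by (auto simp: subset_iff image_iff)
 ultimately show ?thesis by simp
qed

text \<open>Finiteness of the residue field enters here: each coefficient is replaced by one of
  finitely many representatives modulo \<open>p\<close>.\<close>

lemma fin_index_p: assumes "fg R0 V X" shows "fin_index V (pX 1 X) X"
proof -
 have pc1: "pp 1 = p" by simp
 have "set xs \<subseteq> carrier V \<Longrightarrow> \<exists>S. finite S \<and> S \<subseteq> lspan R0 V xs \<and>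
   (\<forall>x\<in>lspan R0 V xs. \<exists>s\<in>S. \<exists>t\<in>lspan R0 V xs. x = s \<oplus> p \<odot> t)" for xs
 proof (induction xs)
  case Nil
  show ?case by (intro exI[of _ "{\<zero>}"]) (simp add: V.smult_zero_r)
 next
  case (Cons x xs)
  then have x: "x \<in> carrier V" and xs: "set xs \<subseteq> carrier V" by auto
  obtain S where S: "finite S" "S \<subseteq> lspan R0 V xs"
   "\<And>x. x \<in> lspan R0 V xs \<Longrightarrow> \<exists>s\<in>S. \<exists>t\<in>lspan R0 V xs. x = s \<oplus> p \<odot> t" using Cons.IH[OF xs] by auto
  obtain S0 where S0: "finite S0" "S0 \<subseteq> R0" "\<And>r. r \<in> R0 \<Longrightarrow> \<exists>s\<in>S0. \<exists>t\<in>R0. r = s \<oplus>\<^bsub>A\<^esub> p \<cdot> t" using resfin by auto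
  have T: "smR (lspan R0 V xs)" using lspan_sm[OF xs] by simp
  let ?S = "(\<lambda>(r, s). r \<odot> x \<oplus> s) ` (S0 \<times> S)"
  have "\<exists>s\<in>?S. \<exists>t\<in>lspan R0 V (x # xs). z = s \<oplus> p \<odot> t" if "z \<in> lspan R0 V (x # xs)" for z
  proof -
   obtain r t where rt: "r \<in> R0" "t \<in> lspan R0 V xs" "z = r \<odot> x \<oplus> t" using \<open>z \<in> _\<close> by auto
   obtain r1 r2 where r: "r1 \<in> S0" "r2 \<in> R0" "r = r1 \<oplus>\<^bsub>A\<^esub> p \<cdot> r2" using S0(3)[OF rt(1)] by auto
   obtain t1 t2 where t: "t1 \<in> S" "t2 \<in> lspan R0 V xs" "t = t1 \<oplus> p \<odot> t2" using S(3)[OF rt(2)] by auto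
   have c: "r1 \<in> carrier A" "r2 \<in> carrier A" "t1 \<in> carrier V" "t2 \<in> carrier V"
    using r t S0(2) S(2) R0c VR.smD[OF T] by auto
   have "z = (r1 \<odot> x \<oplus> t1) \<oplus> p \<odot> (r2 \<odot> x \<oplus> t2)"
    unfolding rt(3) r(3) t(3) using c x V.smult_closed
    by (simp add: V.smult_l_distr V.smult_r_distr V.smult_assoc V.M.a_ac)
   moreover have "r2 \<odot> x \<oplus> t2 \<in> lspan R0 V (x # xs)" using r t by auto
   ultimately show ?thesis using r(1) t(1) by force
  qed
  moreover have "?S \<subseteq> lspan R0 V (x # xs)" using S0(2) S(2) by auto
  moreover have "finite ?S" using S(1) S0(1) by simp
  ultimately show ?case by (intro exI[of _ ?S]) blast
 qed
 moreover obtain xs where "set xs \<subseteq> carrier V" "X = lspan R0 V xs" using assms by (auto simp: fg_def)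
 ultimately obtain S where S: "finite S" "S \<subseteq> X" "\<And>x. x \<in> X \<Longrightarrow> \<exists>s\<in>S. \<exists>t\<in>X. x = s \<oplus> p \<odot> t"
  by metis
 note c = VR.smD[OF fg_sm[OF assms]]
 show ?thesis
 proof (rule fin_indexI[OF S(1,2)])
  fix x assume x: "x \<in> X"
  obtain s t where st: "s \<in> S" "t \<in> X" "x = s \<oplus> p \<odot> t" using S(3)[OF x] by auto
  have "x \<ominus> s = p \<odot> t" using st S(2) c V.smult_closed by (auto simp: V.M.add_diff_cancel')
  then have "mcong V (pX 1 X) x s" using st S(2) c x unfolding mcong_def pc1 by auto
  then show "\<exists>s\<in>S. mcong V (pX 1 X) x s" using st by auto
 qed
qed

lemma pX_add: "X \<subseteq> carrier V \<Longrightarrow> pX (j + k) X = pX j (pX k X)"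
 unfolding image_image by (rule image_cong) (auto simp: pw subset_iff)

lemma smR_pX: "smR X \<Longrightarrow> smR (pX k X)"
proof (rule VR.submoduleI)
 assume X: "smR X"
 note c = VR.smD[OF X]
 show "pX k X \<subseteq> carrier V" using c V.smult_closed by auto
 show "\<zero> \<in> pX k X" using VR.sm_zero[OF X] V.smult_zero_r by (force intro: image_eqI[of _ _ "\<zero>"])
 fix u v assume "u \<in> pX k X" "v \<in> pX k X"
 then obtain x y where "x \<in> X" "y \<in> X" "u = pp k \<odot> x" "v = pp k \<odot> y" by auto
 then show "u \<oplus> v \<in> pX k X" using c VR.sm_add[OF X] V.smult_r_distr by (intro image_eqI[of _ _ "x \<oplus> y"]) auto
next
 assume X: "smR X"
 fix a u assume a: "a \<in> carrier (A\<lparr>carrier := R0\<rparr>)" and "u \<in> pX k X"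
 then obtain x where "x \<in> X" "u = pp k \<odot> x" by auto
 then show "a \<odot> u \<in> pX k X" using a VR.smD[OF X] smR_smult[OF X] pw_comm[of a x k] R0c by (intro image_eqI[of _ _ "a \<odot> x"]) auto
qed

lemma fin_index_pk: assumes f: "fg R0 V X" shows "fin_index V (pX k X) X"
proof (induction k)
 note X = fg_sm[OF f]
 case 0
 have "pX 0 X = X" using VR.smD[OF X] V.smult_one by (auto simp: image_iff)
 moreover have "fin_index V X X"
  by (rule fin_indexI[of "{\<zero>}"]) (auto simp: VR.sm_zero[OF X] VR.cong_zero[OF X])
 ultimately show ?case by simp
next
 note X = fg_sm[OF f]
 case (Suc k)
 have e: "pX (Suc k) X = pX 1 (pX k X)" using pX_add[of X 1 k] VR.sm_carrier[OF X] by simp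
 have "fin_index V (pX 1 (pX k X)) (pX k X)" by (rule fin_index_p[OF fg_pX[OF f]])
 then show ?case unfolding e
  by (rule VR.fin_index_trans[OF X smR_pX[OF X] smR_pX[OF smR_pX[OF X]] pX_sub[OF smR_pX[OF X]] pX_sub[OF X] _ Suc])
qed

text \<open>The largest of the exponents for the generators works for all of
  \<open>X\<close>.\<close>

lemma fg_absorb:
 assumes "fg R0 V X" and Y: "smR Y" and "\<And>x. x \<in> X \<Longrightarrow> \<exists>k::nat. pp k \<odot> x \<in> Y"
 shows "\<exists>k::nat. pX k X \<subseteq> Y"
proof -
 have "set xs \<subseteq> carrier V \<Longrightarrow> (\<And>x. x \<in> set xs \<Longrightarrow> \<exists>k::nat. pp k \<odot> x \<in> Y) \<Longrightarrow> \<exists>k::nat. \<forall>x\<in>lspan R0 V xs. pp k \<odot> x \<in> Y" for xs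
 proof (induction xs)
  case Nil then show ?case using VR.sm_zero[OF Y] V.smult_zero_r by simp
 next
  case (Cons x xs)
  then obtain k where k: "\<And>x. x\<in>lspan R0 V xs \<Longrightarrow> pp k \<odot> x \<in> Y" by auto
  obtain j where j: "pp j \<odot> x \<in> Y" using Cons.prems(2)[of x] by auto
  have x: "x \<in> carrier V" and T: "smR (lspan R0 V xs)" using Cons.prems(1) lspan_sm by auto
  have "pp (max j k) \<odot> z \<in> Y" if "z \<in> lspan R0 V (x # xs)" for z
  proof -
   obtain r t where rt: "r \<in> R0" "t \<in> lspan R0 V xs" "z = r \<odot> x \<oplus> t" using \<open>z \<in> _\<close> by auto
   have tc: "t \<in> carrier V" using rt VR.smD[OF T] by auto
   have e: "pp (max j k) \<odot> z = r \<odot> (pp (max j k) \<odot> x) \<oplus> pp (max j k) \<odot> t"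
    using rt R0c x tc V.smult_closed pw_comm[of r x] by (simp add: V.smult_r_distr)
   have "pp (max j k) \<odot> x \<in> Y" "pp (max j k) \<odot> t \<in> Y"
    using pw_le[OF Y x j, of "max j k"] pw_le[OF Y tc k[OF rt(2)], of "max j k"] by auto
   then show ?thesis unfolding e using VR.sm_add[OF Y] smR_smult[OF Y rt(1)] by auto
  qed
  then show ?case by auto
 qed
 moreover obtain xs where xs: "set xs \<subseteq> carrier V" "X = lspan R0 V xs" using assms by (auto simp: fg_def)
 moreover have "set xs \<subseteq> X" using lspan_sm[OF xs(1)] xs(2) by simp
 ultimately have "\<exists>k::nat. \<forall>x\<in>X. pp k \<odot> x \<in> Y" using assms(3) by blast
 then show ?thesis by auto
qed

lemma fin_index_lat: "\<lbrakk>fg R0 V X; smR Y; pX k X \<subseteq> Y\<rbrakk> \<Longrightarrow> fin_index V Y X"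
 using VR.fin_index_mono[OF fin_index_pk] by blast

lemma lat_sm: "full X \<Longrightarrow> smR X" and lat_fg: "full X \<Longrightarrow> fg R0 V X"
 and lat_absb: "\<lbrakk>full X; v \<in> carrier V\<rbrakk> \<Longrightarrow> \<exists>k::nat. pp k \<odot> v \<in> X"
 by (auto simp: lat_def absb_def)

lemma lat_absorb: "\<lbrakk>fg R0 V X; full Y\<rbrakk> \<Longrightarrow> \<exists>k::nat. pX k X \<subseteq> Y"
 by (rule fg_absorb) (auto simp: lat_sm VR.smD[OF fg_sm] intro!: lat_absb)

lemma lat_fin_index: "\<lbrakk>fg R0 V X; full Y\<rbrakk> \<Longrightarrow> fin_index V Y X"
 using lat_absorb fin_index_lat lat_sm by blast

lemma latI_sub: assumes X: "full X" and Y: "smR Y" "Y \<subseteq> X" "pX k X \<subseteq> Y" shows "full Y"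
proof -
 have "fg R0 V Y" by (rule noeth[OF lat_fg[OF X] Y(1,2)])
 moreover have "\<exists>k::nat. pp k \<odot> v \<in> Y" if v: "v \<in> carrier V" for v
 proof -
  obtain j where "pp j \<odot> v \<in> X" using lat_absb[OF X v] by auto
  then have "pp (k + j) \<odot> v \<in> Y" using Y(3) pw[OF v, of k j] by auto
  then show ?thesis by auto
 qed
 ultimately show ?thesis using Y(1) by (simp add: lat_def absb_def)
qed

lemma lat_Int: assumes X: "full X" and Y: "full Y" shows "full (X \<inter> Y)"
proof -
 obtain k where k: "pX k X \<subseteq> Y" using lat_absorb[OF lat_fg[OF X] Y] by auto
 show ?thesis
  by (rule latI_sub[OF X VR.sm_Int[OF lat_sm[OF X] lat_sm[OF Y]], of k]) (use k pX_sub[OF lat_sm[OF X]] in auto)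
qed

end

section \<open>The radical of an order\<close>

definition jac where
 "jac A G = {a \<in> G. \<forall>m. simpq (A\<lparr>carrier := G\<rparr>) (regular_module A) m G \<longrightarrow> a \<in> m}"

locale order_in = order_module A R0 p pinv V
 for A :: "('a, 'c) ring_scheme" and R0 p pinv and V :: "('a, 'v, 'e) module_scheme" (structure) +
 fixes G
 assumes G: "subring G A" and R0G: "R0 \<subseteq> G"
begin

abbreviation "AG \<equiv> A\<lparr>carrier := G\<rparr>"
abbreviation "smG X \<equiv> submodule X AG V"

sublocale VG: left_module AG V by (rule V.restrict[OF G])

lemma Gc: "a \<in> G \<Longrightarrow> a \<in> carrier A" using subringE(1)[OF G] by auto

lemma G_closed: "\<zero>\<^bsub>A\<^esub> \<in> G" "\<one>\<^bsub>A\<^esub> \<in> G" "\<lbrakk>r \<in> G; s \<in> G\<rbrakk> \<Longrightarrow> r \<oplus>\<^bsub>A\<^esub> s \<in> G" "\<lbrakk>r \<in> G; s \<in> G\<rbrakk> \<Longrightarrow> r \<cdot> s \<in> G" "r \<in> G \<Longrightarrow> \<ominus>\<^bsub>A\<^esub> r \<in> G"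
 "\<lbrakk>r \<in> G; s \<in> G\<rbrakk> \<Longrightarrow> r \<ominus>\<^bsub>A\<^esub> s \<in> G"
 using subringE[OF G] by (auto simp: minus_eq)

lemma smG_smult: "\<lbrakk>smG X; g \<in> G; x \<in> X\<rbrakk> \<Longrightarrow> g \<odot> x \<in> X"
 using VG.sm_smult by simp

lemma smG_smR: "smG X \<Longrightarrow> smR X"
 using R0G by (rule submodule_restrict[rotated])

lemma pG: "pp k \<in> G" using pow_R0 R0G by auto

lemma smG_pX: assumes X: "smG X" shows "smG (pX k X)"
proof (rule VG.submoduleI)
 note s = smR_pX[OF smG_smR[OF X], of k]
 show "pX k X \<subseteq> carrier V" "\<zero> \<in> pX k X" using VR.sm_carrier[OF s] VR.sm_zero[OF s] by auto
 show "u \<oplus> v \<in> pX k X" if "u \<in> pX k X" "v \<in> pX k X" for u v using VR.sm_add[OF s that] .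
 fix a u assume a: "a \<in> carrier AG" and "u \<in> pX k X"
 then obtain x where "x \<in> X" "u = pp k \<odot> x" by auto
 then show "a \<odot> u \<in> pX k X"
  using a VG.smD[OF X] smG_smult[OF X] pw_comm[of a x k] Gc by (intro image_eqI[of _ _ "a \<odot> x"]) auto
qed

text \<open>If \<open>pX\<close> were not inside the maximal submodule \<open>Y\<close>, then
  \<open>pX + Y = X\<close>, and Nakayama's lemma would give \<open>X = Y\<close>.\<close>

lemma simpq_p: assumes f: "fg R0 V X" and s: "simpq AG V Y X" shows "pX 1 X \<subseteq> Y"
proof -
 have X: "smG X" and Y: "smG Y" "Y \<subseteq> X" "Y \<noteq> X" using s by (auto simp: simpq_def)
 let ?Z = "pX 1 X <+> Y"
 have pXs: "smG (pX 1 X)" by (rule smG_pX[OF X])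
 have Z: "smG ?Z" by (rule VG.sm_sum[OF pXs Y(1)])
 have "?Z \<subseteq> X" using VG.sum_least[OF X pX_sub[OF smG_smR[OF X]] Y(2)] .
 then have "?Z = Y \<or> ?Z = X" using s Z VG.sum_upper2[OF pXs Y(1)] unfolding simpq_def by auto
 then show ?thesis
 proof
  assume "?Z = Y" then show ?thesis using VG.sum_upper1[OF pXs Y(1)] by simp
 next
  assume ZX: "?Z = X"
  have "X \<subseteq> Y"
  proof (rule nakayama[OF f smG_smR[OF Y(1)]])
   fix x assume "x \<in> X"
   then have "x \<in> ?Z" using ZX by simp
   then obtain u where u: "u \<in> pX 1 X" "x \<ominus> u \<in> Y" "x \<in> carrier V"
    unfolding VG.sum_minus_iff[OF pXs Y(1)] by blast
   then obtain x' where "x' \<in> X" "u = p \<odot> x'" by auto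
   then show "\<exists>x'\<in>X. mcong V Y x (p \<odot> x')" using u VG.smD[OF pXs] by (auto simp: mcong_def)
  qed
  then show ?thesis using Y by auto
 qed
qed

lemma regG: "order_in A R0 p pinv RA G"
 by (intro order_in.intro order_in_axioms.intro reg G R0G)

text \<open>\<open>X / Y\<close> is \<open>G\<close> modulo the annihilator of \<open>x\<close>, so
  this annihilator is a maximal left ideal. This links the definition of the radical to arbitrary
  simple subquotients.\<close>

lemma simpq_gen:
 assumes s: "simpq AG V Y X" and x: "x \<in> X" "x \<notin> Y"
 shows "simpq AG RA {a \<in> G. a \<odot> x \<in> Y} G"
  and "\<And>z. z \<in> X \<Longrightarrow> \<exists>a\<in>G. mcong V Y z (a \<odot> x)"
  and "submodule {a \<in> G. a \<odot> x \<in> Y} AG RA"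
proof -
 interpret W: order_in A R0 p pinv RA G by (rule regG)
 have X: "smG X" and Y: "smG Y" "Y \<subseteq> X" using s by (auto simp: simpq_def)
 have xc: "x \<in> carrier V" using VG.smD[OF X x(1)] .
 let ?m = "{a \<in> G. a \<odot> x \<in> Y}"
 have gen: "\<exists>a\<in>G. mcong V Y z (a \<odot> y)" if "y \<in> X" "y \<notin> Y" "z \<in> X" for y z
  using VG.simpq_generator(1)[OF s that(1,2)] that(3) by (auto simp: qiso_def)
 show "\<And>z. z \<in> X \<Longrightarrow> \<exists>a\<in>G. mcong V Y z (a \<odot> x)" using gen[OF x] .
 show m: "submodule ?m AG RA"
  by (rule W.VG.submoduleI)
   (use Gc G_closed xc VG.sm_zero[OF Y(1)] VG.sm_add[OF Y(1)] smG_smult[OF Y(1)] in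
    \<open>auto simp: V.smult_zero_l V.smult_l_distr V.smult_assoc\<close>)
 show "simpq AG RA ?m G"
  unfolding simpq_def
 proof (intro conjI allI impI)
  show "submodule ?m AG RA" by (rule m)
  show "submodule G AG RA" by (rule W.VG.submoduleI) (use Gc G_closed in auto)
  show "?m \<subseteq> G" by auto
  have "\<one>\<^bsub>A\<^esub> \<notin> ?m" using x V.smult_one[OF xc] by simp
  then show "?m \<noteq> G" using G_closed(2) by blast
  fix E assume E: "submodule E AG RA" "?m \<subseteq> E" "E \<subseteq> G"
  show "E = ?m \<or> E = G"
  proof (cases "E = ?m")
   case False
   then obtain c where c: "c \<in> E" "c \<notin> ?m" using E by auto
   have cG: "c \<in> G" using c E by auto
   have "c \<odot> x \<in> X" "c \<odot> x \<notin> Y" using smG_smult[OF X cG x(1)] c cG by auto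
   then obtain a where a: "a \<in> G" "mcong V Y x (a \<odot> (c \<odot> x))" using gen x(1) by blast
   have "x \<ominus> (a \<cdot> c) \<odot> x \<in> Y" using a(2) V.smult_assoc[OF Gc[OF a(1)] Gc[OF cG] xc] by (simp add: mcong_def)
   then have "(\<one>\<^bsub>A\<^esub> \<ominus>\<^bsub>A\<^esub> a \<cdot> c) \<odot> x \<in> Y"
    using Gc[OF a(1)] Gc[OF cG] xc by (simp add: minus_eq V.M.minus_eq V.smult_l_distr V.smult_minus_l V.smult_one)
   then have "\<one>\<^bsub>A\<^esub> \<ominus>\<^bsub>A\<^esub> a \<cdot> c \<in> E" using E(2) G_closed(2,4,6) a(1) cG by auto
   moreover have "a \<cdot> c \<in> E" using W.smG_smult[OF E(1) a(1) c(1)] by simp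
   ultimately have "(\<one>\<^bsub>A\<^esub> \<ominus>\<^bsub>A\<^esub> a \<cdot> c) \<oplus>\<^bsub>A\<^esub> a \<cdot> c \<in> E" using W.VG.sm_add[OF E(1)] by simp
   then have "\<one>\<^bsub>A\<^esub> \<in> E" using diff_add_cancel[of "\<one>\<^bsub>A\<^esub>" "a \<cdot> c"] Gc[OF a(1)] Gc[OF cG] by simp
   then have "g \<in> E" if "g \<in> G" for g using W.smG_smult[OF E(1) that, of "\<one>\<^bsub>A\<^esub>"] Gc[OF that] by simp
   then show ?thesis using E(3) by auto
  qed simp
 qed
qed

section \<open>The radical and its action on modules\<close>

abbreviation "J \<equiv> jac A G"

lemma J_sub: "J \<subseteq> G" by (auto simp: jac_def)

lemma Jc: "a \<in> J \<Longrightarrow> a \<in> carrier A" using J_sub Gc by auto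

lemma J_ann: assumes s: "simpq AG V Y X" and a: "a \<in> J" and x: "x \<in> X" shows "a \<odot> x \<in> Y"
proof (cases "x \<in> Y")
 case True
 have Y: "smG Y" using s by (auto simp: simpq_def)
 show ?thesis using smG_smult[OF Y _ True] a J_sub by auto
next
 case False
 then have "a \<in> {a \<in> G. a \<odot> x \<in> Y}" using simpq_gen(1)[OF s x False] a unfolding jac_def by blast
 then show ?thesis by simp
qed

lemma J_left: "submodule J AG RA"
proof -
 interpret W: order_in A R0 p pinv RA G by (rule regG)
 show ?thesis
 proof (rule W.VG.submoduleI)
  show "J \<subseteq> carrier RA" using Jc by auto
  show "\<zero>\<^bsub>RA\<^esub> \<in> J" using G_closed(1) W.VG.sm_zero by (auto simp: jac_def simpq_def)
  show "x \<oplus>\<^bsub>RA\<^esub> y \<in> J" if "x \<in> J" "y \<in> J" for x y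
   using that G_closed(3) W.VG.sm_add by (auto simp: jac_def simpq_def)
  show "a \<odot>\<^bsub>RA\<^esub> x \<in> J" if "a \<in> carrier AG" "x \<in> J" for a x
   using that G_closed(4) W.smG_smult by (auto simp: jac_def simpq_def)
 qed
qed

text \<open>\<open>J\<close> annihilates each simple module \<open>G / m\<close>, so
  \<open>JG\<close> lies in every maximal left ideal.\<close>

lemma J_right: assumes "a \<in> J" "b \<in> G" shows "a \<cdot> b \<in> J"
proof -
 interpret W: order_in A R0 p pinv RA G by (rule regG)
 have "a \<cdot> b \<in> m" if "simpq AG RA m G" for m using W.J_ann[OF that assms] by simp
 then show ?thesis using assms J_sub G_closed(4) by (auto simp: jac_def)
qed

lemma p_J: assumes "fg R0 RA G" shows "p \<in> J"
proof -
 interpret W: order_in A R0 p pinv RA G by (rule regG)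
 have "p \<in> m" if "simpq AG RA m G" for m
  using W.simpq_p[OF assms that] G_closed(2) by force
 then show ?thesis using p(1) R0G by (auto simp: jac_def)
qed

abbreviation "JX X \<equiv> set_smult V J X"

lemma smG_JX: assumes X: "smG X" shows "smG (JX X)"
proof (rule V.ss_submodule[OF G])
 interpret W: order_in A R0 p pinv RA G by (rule regG)
 show "J \<subseteq> carrier A" "X \<subseteq> carrier V" using Jc VG.smD[OF X] by auto
 fix g s x assume *: "g \<in> G" "s \<in> J" "x \<in> X"
 then have "g \<cdot> s \<in> J" using W.smG_smult[OF J_left] by simp
 then show "g \<odot> (s \<odot> x) \<in> JX X"
  using V.ss_mem[of "g \<cdot> s" J x X] * V.smult_assoc[of g s x] Gc Jc VG.smD[OF X] by simp
qed

lemma JX_sub: assumes X: "smG X" shows "JX X \<subseteq> X"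
 by (rule V.ss_least[OF _ VG.sm_carrier[OF X] X]) (use Jc J_sub smG_smult[OF X] in auto)

lemma JX_le: assumes s: "simpq AG V Y X" shows "JX X \<subseteq> Y"
proof -
 have X: "smG X" and Y: "smG Y" using s by (auto simp: simpq_def)
 show ?thesis by (rule V.ss_least[OF _ VG.sm_carrier[OF X] Y]) (use Jc J_ann[OF s] in auto)
qed

lemma JX_mono: "\<lbrakk>X \<subseteq> Y; Y \<subseteq> carrier V\<rbrakk> \<Longrightarrow> JX X \<subseteq> JX Y"
 by (rule V.ss_mono) (use Jc in auto)

lemma pX_JX: assumes f: "fg R0 RA G" shows "pX 1 X \<subseteq> JX X"
 using V.ss_mem[OF p_J[OF f]] by auto

lemma fin_index_JX: "\<lbrakk>fg R0 RA G; fg R0 V X; smG X\<rbrakk> \<Longrightarrow> fin_index V (JX X) X"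
 using fin_index_lat[OF _ smG_smR[OF smG_JX] pX_JX] by blast

text \<open>Each composition factor is killed by \<open>J\<close>, hence each step of the series
  costs one factor \<open>J\<close>.\<close>

lemma ci_Jpow: "ci AG V Y X m \<Longrightarrow> ((\<lambda>Z. JX Z) ^^ size m) X \<subseteq> Y"
proof (induction rule: ci.induct)
 case (step Y Z m X)
 have Z: "smG Z" using step.hyps by (auto simp: simpq_def)
 have mono: "A \<subseteq> B \<Longrightarrow> B \<subseteq> carrier V \<Longrightarrow> ((\<lambda>Z. JX Z) ^^ n) A \<subseteq> ((\<lambda>Z. JX Z) ^^ n) B \<and> ((\<lambda>Z. JX Z) ^^ n) B \<subseteq> carrier V" for n A B
 proof (induction n)
  case (Suc n)
  then show ?case using JX_mono[of "((\<lambda>Z. JX Z) ^^ n) A" "((\<lambda>Z. JX Z) ^^ n) B"]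
    V.ss_carrier[of J "((\<lambda>Z. JX Z) ^^ n) B"] Jc by auto
 qed simp
 have "((\<lambda>Z. JX Z) ^^ size m) (JX X) \<subseteq> ((\<lambda>Z. JX Z) ^^ size m) Z"
  using mono[OF JX_le[OF step.hyps(2)] VG.sm_carrier[OF Z]] by simp
 then show ?case using step.IH by (simp add: funpow_swap1)
qed simp

text \<open>The same with \<open>p\<close>. It bounds the sublattices of a given class from below,
  which makes the coefficients of the zeta functions finite.\<close>

lemma ci_ppow: "ci AG V Y X m \<Longrightarrow> fg R0 V X \<Longrightarrow> pX (size m) X \<subseteq> Y"
proof (induction rule: ci.induct)
 case (refl Y)
 then show ?case using VG.smD V.smult_one by auto
next
 case (step Y Z m X)
 have XZ: "smG Z" "smG X" "Z \<subseteq> X" using step.hyps by (auto simp: simpq_def)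
 have fZ: "fg R0 V Z" by (rule noeth[OF step.prems smG_smR[OF XZ(1)] XZ(3)])
 have "pX (size m) (pX 1 X) \<subseteq> pX (size m) Z" using simpq_p[OF step.prems step.hyps(2)] by (rule image_mono)
 then show ?case using step.IH[OF fZ] pX_add[of X "size m" 1] VG.sm_carrier[OF XZ(2)] by simp
qed

lemma ex_max: assumes f: "finite (between AG V Y X)" and X: "smG X" and Y: "smG Y" "Y \<subseteq> X" "Y \<noteq> X"
 shows "\<exists>Z. simpq AG V Z X \<and> Y \<subseteq> Z"
proof -
 obtain m where "ci AG V Y X m" using VG.ci_exists[OF f X Y(1,2)] by auto
 then show ?thesis using Y(3) by cases (auto dest: ci_sub)
qed

text \<open>This expresses that \<open>G / J\<close> is semisimple: no proper left ideal contains
  all of its simple left ideals. Among the finitely many left ideals above \<open>J\<close> that are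
  not inside \<open>D\<close>, a minimal one is simple over \<open>J\<close>.\<close>

lemma soc:
 assumes f: "fg R0 RA G" and D: "submodule D AG RA" "J \<subseteq> D" "D \<subseteq> G" "D \<noteq> G"
 shows "\<exists>E. simpq AG RA J E \<and> E \<subseteq> G \<and> \<not> E \<subseteq> D"
proof -
 interpret W: order_in A R0 p pinv RA G by (rule regG)
 have GG: "submodule G AG RA" by (rule W.VG.submoduleI) (use Gc G_closed in auto)
 have JG: "set_smult RA J G \<subseteq> J"
  by (rule W.V.ss_least[OF _ _ J_left]) (use Jc Gc J_right in auto)
 have "fin_index RA J G" using W.VR.fin_index_mono[OF W.fin_index_JX[OF f f GG] JG] .
 then have fin: "finite (between AG RA J G)" by (rule W.VG.fin_index_between)
 let ?S = "{E \<in> between AG RA J G. \<not> E \<subseteq> D}"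
 have "G \<in> ?S" using GG D J_sub by (auto simp: between_def)
 moreover have "finite ?S" using fin by simp
 ultimately obtain E where E: "E \<in> ?S" and min: "\<And>E'. E' \<in> ?S \<Longrightarrow> E' \<subseteq> E \<Longrightarrow> E = E'"
  using finite_has_minimal[of ?S] by (metis (no_types, lifting) empty_iff)
 have Es: "submodule E AG RA" "J \<subseteq> E" "E \<subseteq> G" "\<not> E \<subseteq> D" using E by (auto simp: between_def)
 have small: "E' \<subseteq> D" if "submodule E' AG RA" "J \<subseteq> E'" "E' \<subseteq> E" "E' \<noteq> E" for E'
  using min[of E'] that Es(3) by (auto simp: between_def)
 have "E' = J" if E': "submodule E' AG RA" "J \<subseteq> E'" "E' \<subseteq> E" "E' \<noteq> E" for E'
 proof (rule ccontr)
  assume "E' \<noteq> J"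
  then obtain a where a: "a \<in> E'" "a \<notin> J" using E' by auto
  have E'D: "E' \<subseteq> D" by (rule small[OF E'])
  have "a \<in> G" using a E' Es by auto
  \<comment> \<open>A maximal left ideal \<open>m\<close> avoiding \<open>a\<close> satisfies
    \<open>E' + m = G\<close>, so \<open>E\<close> is the sum of \<open>E'\<close> and
    \<open>E \<inter> m\<close>. Both are smaller than \<open>E\<close>, hence inside
    \<open>D\<close>, a contradiction.\<close>
  then obtain m where m: "simpq AG RA m G" "a \<notin> m" using a unfolding jac_def by auto
  have ms: "submodule m AG RA" "m \<subseteq> G" using m by (auto simp: simpq_def)
  have Jm: "J \<subseteq> m" using m(1) by (auto simp: jac_def)
  have s: "submodule (E' <+>\<^bsub>RA\<^esub> m) AG RA" by (rule W.VG.sm_sum[OF E'(1) ms(1)])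
  have "E' <+>\<^bsub>RA\<^esub> m \<subseteq> G" using E' Es ms by (intro W.VG.sum_least[OF GG]) auto
  moreover have "E' <+>\<^bsub>RA\<^esub> m \<noteq> m" using W.VG.sum_upper1[OF E'(1) ms(1)] a m by auto
  ultimately have sG: "E' <+>\<^bsub>RA\<^esub> m = G"
   using m(1) s W.VG.sum_upper2[OF E'(1) ms(1)] unfolding simpq_def by auto
  have "a \<in> E" using a E' by auto
  then have "E \<inter> m \<noteq> E" using m(2) by auto
  then have "E \<inter> m \<subseteq> D" using small[OF W.VG.sm_Int[OF Es(1) ms(1)]] Es(2) Jm by auto
  moreover have "\<exists>u\<in>E'. e \<ominus>\<^bsub>RA\<^esub> u \<in> m" if "e \<in> E" for e
   using W.VG.sum_minus_iff[OF E'(1) ms(1), of e] sG Es(3) that by auto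
  moreover have "e \<ominus>\<^bsub>RA\<^esub> u \<in> E" if "e \<in> E" "u \<in> E'" for e u using W.VG.sm_minus[OF Es(1)] that E' by blast
  ultimately have "\<exists>u\<in>D. e \<ominus>\<^bsub>RA\<^esub> u \<in> D" if "e \<in> E" for e using that E'D by blast
  then have "e \<in> D" if "e \<in> E" for e
   using that W.VG.sum_minus_iff[OF D(1) D(1), of e] W.VG.sum_least[OF D(1) order_refl order_refl] W.VG.smD[OF Es(1)] by auto
  then show False using Es by auto
 qed
 moreover have "J \<noteq> E" using Es D by auto
 ultimately have "simpq AG RA J E" using Es J_left unfolding simpq_def by blast
 then show ?thesis using Es by auto
qed

text \<open>A module killed by \<open>J\<close> is semisimple. Take \<open>C\<close> maximal with
  \<open>X \<inter> C = Y\<close>. For an element \<open>f\<close> outside \<open>X + C\<close>, the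
  \<open>c\<close> with \<open>cf \<in> X + C\<close> form a proper left ideal; by
  \<open>soc\<close> there is a simple left ideal \<open>E\<close> over \<open>J\<close> outside it,
  and \<open>Ef\<close> could be added to \<open>C\<close>.\<close>

lemma complement:
 assumes fG: "fg R0 RA G" and fF: "fg R0 V F" and F: "smG F" and X: "smG X" and Y: "smG Y"
  and s: "JX F \<subseteq> Y" "Y \<subseteq> X" "X \<subseteq> F"
 shows "\<exists>C. smG C \<and> Y \<subseteq> C \<and> C \<subseteq> F \<and> X \<inter> C = Y \<and> X <+> C = F"
proof -
 interpret W: order_in A R0 p pinv RA G by (rule regG)
 have "fin_index V Y F" using VR.fin_index_mono[OF fin_index_JX[OF fG fF F] s(1)] .
 then have fin: "finite (between AG V Y F)" by (rule VG.fin_index_between)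
 let ?S = "{C \<in> between AG V Y F. X \<inter> C = Y}"
 have "Y \<in> ?S" using Y s by (auto simp: between_def)
 moreover have "finite ?S" using fin by simp
 ultimately obtain C where C: "C \<in> ?S" and max: "\<And>C'. C' \<in> ?S \<Longrightarrow> C \<subseteq> C' \<Longrightarrow> C = C'"
  using finite_has_maximal[of ?S] by (metis (no_types, lifting) empty_iff)
 have Cs: "smG C" "Y \<subseteq> C" "C \<subseteq> F" "X \<inter> C = Y" using C by (auto simp: between_def)
 have XC: "smG (X <+> C)" by (rule VG.sm_sum[OF X Cs(1)])
 have "F \<subseteq> X <+> C"
 proof (rule ccontr)
  assume "\<not> F \<subseteq> X <+> C"
  then obtain f where f: "f \<in> F" "f \<notin> X <+> C" by auto
  have fc: "f \<in> carrier V" using f VG.smD[OF F] by auto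
  define D where "D = {c \<in> G. c \<odot> f \<in> X <+> C}"
  have D: "submodule D AG RA"
   unfolding D_def by (rule W.VG.submoduleI)
    (use Gc G_closed fc VG.sm_zero[OF XC] VG.sm_add[OF XC] smG_smult[OF XC] in
     \<open>auto simp: V.smult_zero_l V.smult_l_distr V.smult_assoc\<close>)
  have JfY: "a \<odot> f \<in> Y" if "a \<in> J" for a using V.ss_mem[OF that f(1)] s(1) by auto
  have JD: "J \<subseteq> D" using J_sub JfY s(2) VG.sum_upper1[OF X Cs(1)] by (auto simp: D_def)
  have "\<one>\<^bsub>A\<^esub> \<notin> D" using f V.smult_one[OF fc] by (simp add: D_def)
  then have "D \<noteq> G" using G_closed(2) by auto
  then obtain E where E: "simpq AG RA J E" "E \<subseteq> G" "\<not> E \<subseteq> D" using soc[OF fG D JD] by (auto simp: D_def)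
  have Es: "submodule E AG RA" "J \<subseteq> E" using E by (auto simp: simpq_def)
  have ED: "E \<inter> D = J" using E(1,3) W.VG.sm_Int[OF Es(1) D] JD Es(2) unfolding simpq_def by (metis inf_le1 inf_le2 le_inf_iff)
  let ?Ef = "(\<lambda>e. e \<odot> f) ` E"
  have Ef: "smG ?Ef"
  proof (rule two_modules.image_sm[OF _ Es(1)])
   show "two_modules AG RA V" by (simp add: two_modules_def VG.left_module_axioms W.VG.left_module_axioms)
  qed (use E(2) Gc fc in \<open>auto simp: V.smult_closed V.smult_l_distr V.smult_assoc subset_iff\<close>)
  let ?C = "C <+> ?Ef"
  have C': "smG ?C" by (rule VG.sm_sum[OF Cs(1) Ef])
  have "?Ef \<subseteq> F" using smG_smult[OF F] E(2) f(1) by auto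
  then have C'F: "?C \<subseteq> F" using VG.sum_least[OF F Cs(3)] by simp
  have CC': "C \<subseteq> ?C" by (rule VG.sum_upper1[OF Cs(1) Ef])
  have "X \<inter> ?C \<subseteq> Y"
  proof
   fix z assume z: "z \<in> X \<inter> ?C"
   then obtain c e where ce: "c \<in> C" "e \<in> E" "z = c \<oplus> e \<odot> f" by (auto simp: VG.sum_iff)
   have cc: "c \<in> carrier V" "e \<odot> f \<in> carrier V" "z \<in> carrier V"
    using ce VG.smD[OF Cs(1)] VG.smD[OF X] z E(2) Gc fc V.smult_closed by auto
   have "e \<odot> f = z \<ominus> c" using ce(3) cc V.M.add_diff_cancel' by simp
   moreover have "z \<in> X <+> C" "c \<in> X <+> C" using z ce VG.sum_upper1[OF X Cs(1)] VG.sum_upper2[OF X Cs(1)] by auto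
   ultimately have "e \<odot> f \<in> X <+> C" using VG.sm_minus[OF XC] by simp
   then have "e \<in> J" using ED ce(2) E(2) by (auto simp: D_def)
   then have "e \<odot> f \<in> C" using JfY Cs(2) by auto
   then have "z \<in> C" using ce VG.sm_add[OF Cs(1)] by simp
   then show "z \<in> Y" using z Cs(4) by auto
  qed
  then have "?C \<in> ?S" using C' C'F CC' Cs(2) s(2) by (auto simp: between_def)
  then have "C = ?C" using max CC' by blast
  then have "?Ef \<subseteq> C" using VG.sum_upper2[OF Cs(1) Ef] by auto
  moreover obtain e where "e \<in> E" "e \<notin> D" using E(3) by auto
  ultimately have "e \<odot> f \<in> X <+> C" using VG.sum_upper2[OF X Cs(1)] by auto
  then show False using \<open>e \<in> E\<close> \<open>e \<notin> D\<close> E(2) by (auto simp: D_def)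
 qed
 moreover have "X <+> C \<subseteq> F" by (rule VG.sum_least[OF F s(3) Cs(3)])
 ultimately show ?thesis using Cs by auto
qed

text \<open>The map \<open>a \<mapsto> ax\<close> from \<open>D\<close> to \<open>X / Y\<close> is
  nonzero. Its kernel is \<open>J\<close> because \<open>D / J\<close> is simple, and it is onto
  because \<open>X / Y\<close> is simple.\<close>

lemma simple_from_left_ideal:
 assumes D: "simpq AG RA J D" "D \<subseteq> G" and s: "simpq AG V Y X" and x: "x \<in> X" and d: "d \<in> D" "d \<odot> x \<notin> Y"
 shows "cl AG V X Y = cl AG RA D J"
proof -
 interpret W: order_in A R0 p pinv RA G by (rule regG)
 interpret T: two_modules AG RA V by (simp add: two_modules_def W.VG.left_module_axioms VG.left_module_axioms)
 have X: "smG X" and Y: "smG Y" "Y \<subseteq> X" using s by (auto simp: simpq_def)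
 have Ds: "submodule D AG RA" "J \<subseteq> D" using D by (auto simp: simpq_def)
 have xc: "x \<in> carrier V" using VG.smD[OF X x] .
 have dX: "d \<odot> x \<in> X" using smG_smult[OF X _ x] d D by auto
 let ?K = "{a \<in> D. a \<odot> x \<in> Y}"
 have "submodule ?K AG RA"
  by (rule W.VG.submoduleI)
   (use Gc D(2) W.VG.sm_zero[OF Ds(1)] W.VG.sm_add[OF Ds(1)] W.smG_smult[OF Ds(1)] xc VG.sm_zero[OF Y(1)] VG.sm_add[OF Y(1)] smG_smult[OF Y(1)] in
    \<open>auto simp: V.smult_zero_l V.smult_l_distr V.smult_assoc subset_iff\<close>)
 moreover have "J \<subseteq> ?K" using Ds J_ann[OF s _ x] by auto
 moreover have "?K \<noteq> D" "?K \<subseteq> D" using d by auto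
 ultimately have K: "?K = J" using D(1) unfolding simpq_def by (metis (no_types, lifting))
 have q: "qiso AG RA D J V X Y (\<lambda>a. a \<odot> x)"
  unfolding qiso_def qhom_def
 proof (intro conjI ballI)
  fix z assume "z \<in> X"
  then obtain a where a: "a \<in> G" "mcong V Y z (a \<odot> (d \<odot> x))" using simpq_gen(2)[OF s dX d(2)] by blast
  then have "mcong V Y z ((a \<cdot> d) \<odot> x)" using V.smult_assoc Gc D(2) d(1) xc by auto
  moreover have "a \<cdot> d \<in> D" using W.smG_smult[OF Ds(1) a(1) d(1)] by simp
  ultimately show "\<exists>a\<in>D. mcong V Y z (a \<odot> x)" by auto
 next
  fix a assume a: "a \<in> D"
  then have ac: "a \<in> carrier A" "a \<in> G" using D(2) Gc by auto
  then show c: "a \<odot> x \<in> carrier V" using xc V.smult_closed by simp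
  show "(a \<odot> x \<in> Y) = (a \<in> J)" using K a by auto
  { fix b assume "b \<in> D"
   then have "b \<in> carrier A" using D(2) Gc by auto
   then show "mcong V Y ((a \<oplus>\<^bsub>RA\<^esub> b) \<odot> x) (a \<odot> x \<oplus> b \<odot> x)"
    using VG.cong_refl[OF Y(1)] ac xc V.smult_closed by (simp add: V.smult_l_distr) }
  { fix g assume "g \<in> carrier AG"
   then have "g \<in> carrier A" using Gc by auto
   then show "mcong V Y ((g \<odot>\<^bsub>RA\<^esub> a) \<odot> x) (g \<odot> (a \<odot> x))"
    using VG.cong_refl[OF Y(1)] ac xc V.smult_closed by (simp add: V.smult_assoc) }
 qed (use smG_smult[OF X _ x] D(2) in auto)
 have "finite (between AG RA J D)"
  by (rule finite_subset[of _ "{J, D}"]) (use D in \<open>auto simp: between_def simpq_def\<close>)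
 from T.cl_qiso[OF Ds(1) J_left Ds(2) X Y q this] show ?thesis by simp
qed

text \<open>A simple module over the semisimple ring \<open>G / J\<close> is determined by its
  annihilator. If \<open>m\<close> annihilates \<open>x'\<close> modulo \<open>Y'\<close>, a
  complement \<open>D\<close> of \<open>m\<close> over \<open>J\<close> is simple. Some
  \<open>d\<close> in \<open>D\<close> does not kill \<open>X' / Y'\<close>, hence does not kill
  \<open>X / Y\<close>, and both modules are isomorphic to \<open>D / J\<close>.\<close>

lemma schur_ann:
 assumes fG: "fg R0 RA G" and s: "simpq AG V Y X" and s': "simpq AG V Y' X'"
  and ann: "\<And>a. \<lbrakk>a \<in> G; \<And>x. x \<in> X \<Longrightarrow> a \<odot> x \<in> Y\<rbrakk> \<Longrightarrow> (\<And>x. x \<in> X' \<Longrightarrow> a \<odot> x \<in> Y')"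
 shows "cl AG V X Y = cl AG V X' Y'"
proof -
 interpret W: order_in A R0 p pinv RA G by (rule regG)
 obtain x' where x': "x' \<in> X'" "x' \<notin> Y'" using s' by (auto simp: simpq_def)
 let ?m = "{a \<in> G. a \<odot> x' \<in> Y'}"
 have m: "simpq AG RA ?m G" "submodule ?m AG RA" using simpq_gen(1,3)[OF s' x'] by auto
 have GG: "submodule G AG RA" by (rule W.VG.submoduleI) (use Gc G_closed in auto)
 have JG: "set_smult RA J G \<subseteq> J"
  by (rule W.V.ss_least[OF _ _ J_left]) (use Jc Gc J_right in auto)
 have Jm: "J \<subseteq> ?m" using J_ann[OF s' _ x'(1)] J_sub by auto
 obtain D where D: "submodule D AG RA" "J \<subseteq> D" "D \<subseteq> G" "?m \<inter> D = J" "?m <+>\<^bsub>RA\<^esub> D = G"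
  using W.complement[OF fG fG GG m(2) J_left JG Jm] by auto
 have "simpq AG RA (D \<inter> ?m) D"
  by (rule W.VG.simpq_second[OF D(1) m(2)]) (use m(1) D(5) W.VG.sum_comm[OF D(1) m(2)] in simp)
 moreover have "D \<inter> ?m = J" using D(4) by auto
 ultimately have sD: "simpq AG RA J D" by metis
 have "\<not> D \<subseteq> ?m" using D(4) sD by (auto simp: simpq_def)
 then obtain d where d: "d \<in> D" "d \<odot> x' \<notin> Y'" using D(3) by auto
 have "\<exists>x\<in>X. d \<odot> x \<notin> Y" using ann[of d x'] d x'(1) D(3) by blast
 then obtain x where x: "x \<in> X" "d \<odot> x \<notin> Y" by auto
 show ?thesis
  using simple_from_left_ideal[OF sD D(3) s x(1) d(1) x(2)] simple_from_left_ideal[OF sD D(3) s' x'(1) d] by simp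
qed

end

section \<open>Invertibility of lattices over maximal orders\<close>

definition maxord where
 "maxord A R0 p G \<longleftrightarrow> ord A R0 p G \<and> (\<forall>H. ord A R0 p H \<longrightarrow> G \<subseteq> H \<longrightarrow> H = G)"

text \<open>If the left and the right order of a lattice \<open>X\<close> are maximal, \<open>qinv A X\<close> is its inverse.\<close>

definition qinv :: "('a, 'c) ring_scheme \<Rightarrow> 'a set \<Rightarrow> 'a set" where
 "qinv A X = {a \<in> carrier A. \<forall>x\<in>X. \<forall>y\<in>X. x \<otimes>\<^bsub>A\<^esub> a \<otimes>\<^bsub>A\<^esub> y \<in> X}"

text \<open>Two-sided ideals of \<open>G\<close> that are full lattices: containing a power of
  \<open>p\<close> expresses fullness (\<open>tsiD\<close>).\<close>

definition tsi where
 "tsi A p G B \<longleftrightarrow> submodule B (A\<lparr>carrier := G\<rparr>) (regular_module A) \<and> B \<subseteq> G \<and>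
   (\<forall>b\<in>B. \<forall>g\<in>G. b \<otimes>\<^bsub>A\<^esub> g \<in> B) \<and> (\<exists>k::nat. p [^]\<^bsub>A\<^esub> k \<in> B)"

context order_setting
begin

abbreviation "prd S T \<equiv> set_smult RA S T"
abbreviation "latA X \<equiv> lat A R0 p RA X"

sublocale AA: order_module A R0 p pinv RA by (rule reg)

lemma ordD: assumes "ord A R0 p G"
 shows "order_in A R0 p pinv RA G" "latA G" "fg R0 RA G" "subring G A" "R0 \<subseteq> G"
 using assms by (auto simp: ord_def lat_def intro!: order_in.intro order_in_axioms.intro reg)

lemma lat_carrier: "latA X \<Longrightarrow> X \<subseteq> carrier A"
 using AA.VR.sm_carrier[OF AA.lat_sm] by auto

lemma lat_p: assumes "latA X" shows "\<exists>k::nat. pp k \<in> X"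
proof -
 obtain k where "pp k \<odot>\<^bsub>RA\<^esub> \<one> \<in> X" using AA.lat_absb[OF assms, of \<one>] by auto
 then show ?thesis by auto
qed

lemma bounded_fg:
 assumes B: "AA.smR B" and b: "\<And>b. b \<in> B \<Longrightarrow> pp k \<cdot> b \<in> X" and X: "fg R0 RA X"
 shows "fg R0 RA B"
proof -
 have "fg R0 RA (AA.pX k B)" by (rule AA.noeth[OF X AA.smR_pX[OF B]]) (use b in auto)
 then show ?thesis by (rule AA.fg_pinvX[OF _ AA.VR.sm_carrier[OF B]])
qed

lemma right_mult_absorb:
 assumes X: "fg R0 RA X" and Y: "latA Y" and a: "a \<in> carrier A"
 shows "\<exists>k::nat. \<forall>x\<in>X. x \<cdot> (pp k \<cdot> a) \<in> Y"
proof -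
 have c: "x \<in> X \<Longrightarrow> x \<in> carrier A" for x using AA.VR.smD[OF AA.fg_sm[OF X]] by simp
 have "fg R0 RA ((\<lambda>x. x \<cdot> a) ` X)"
  by (rule fg_image[OF reg reg X]) (use a c R0c in \<open>auto simp: l_distr m_assoc\<close>)
 then obtain k where k: "AA.pX k ((\<lambda>x. x \<cdot> a) ` X) \<subseteq> Y" using AA.lat_absorb[OF _ Y] by blast
 have "x \<cdot> (pp k \<cdot> a) \<in> Y" if "x \<in> X" for x
  using k that p_central[of x k] c a by (force simp: m_assoc[symmetric])
 then show ?thesis by auto
qed

lemma left_mult_absorb:
 assumes X: "fg R0 RA X" and Y: "latA Y" and a: "a \<in> carrier A"
 shows "\<exists>k::nat. \<forall>x\<in>X. (pp k \<cdot> a) \<cdot> x \<in> Y"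
proof -
 have c: "x \<in> X \<Longrightarrow> x \<in> carrier A" for x using AA.VR.smD[OF AA.fg_sm[OF X]] by simp
 have "fg R0 RA ((\<lambda>x. a \<cdot> x) ` X)"
 proof (rule fg_image[OF reg reg X])
  fix r x assume "r \<in> R0" "x \<in> X"
  then show "a \<cdot> (r \<odot>\<^bsub>RA\<^esub> x) = r \<odot>\<^bsub>RA\<^esub> (a \<cdot> x)"
   using central[of r a] a c R0c by (simp add: m_assoc[symmetric])
 qed (use a c in \<open>auto simp: r_distr\<close>)
 then obtain k where k: "AA.pX k ((\<lambda>x. a \<cdot> x) ` X) \<subseteq> Y" using AA.lat_absorb[OF _ Y] by blast
 have "(pp k \<cdot> a) \<cdot> x \<in> Y" if "x \<in> X" for x
  using k that c a by (force simp: m_assoc)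
 then show ?thesis by auto
qed

lemma ordI:
 assumes H: "subring H A" "R0 \<subseteq> H" and X: "fg R0 RA X" and b: "\<And>b. b \<in> H \<Longrightarrow> pp k \<cdot> b \<in> X"
  and ab: "\<And>a. a \<in> carrier A \<Longrightarrow> \<exists>k::nat. pp k \<cdot> a \<in> H"
 shows "ord A R0 p H"
proof -
 have "AA.smR H"
  by (rule AA.VR.submoduleI) (use subringE[OF H(1)] H(2) in auto)
 then show ?thesis using bounded_fg[OF _ b X] H ab by (auto simp: ord_def lat_def absb_def)
qed

text \<open>A power \<open>p^k\<close> in \<open>X\<close> bounds the ring, since
  \<open>p^ka \<in> X\<close> for each of its elements \<open>a\<close>. Conversely, a power of
  \<open>p\<close> moves \<open>Xa\<close> into \<open>X\<close> for any \<open>a\<close> in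
  \<open>A\<close>, which gives fullness.\<close>

lemma right_order: assumes X: "latA X" shows "ord A R0 p {a \<in> carrier A. \<forall>x\<in>X. x \<cdot> a \<in> X}"
proof -
 have c: "x \<in> X \<Longrightarrow> x \<in> carrier A" for x using lat_carrier[OF X] by auto
 note s = AA.lat_sm[OF X]
 obtain k where k: "pp k \<in> X" using lat_p[OF X] by auto
 show ?thesis
 proof (rule ordI[OF _ _ AA.lat_fg[OF X], of _ k])
  show "subring {a \<in> carrier A. \<forall>x\<in>X. x \<cdot> a \<in> X} A"
   using c AA.VR.sm_add[OF s] AA.VR.sm_neg[OF s]
   by (intro subringI) (auto simp: r_distr r_minus m_assoc[symmetric])
  show "R0 \<subseteq> {a \<in> carrier A. \<forall>x\<in>X. x \<cdot> a \<in> X}"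
  proof
   fix r assume r: "r \<in> R0"
   have "x \<cdot> r \<in> X" if "x \<in> X" for x using AA.smR_smult[OF s r that] central[OF r c[OF that]] by simp
   then show "r \<in> {a \<in> carrier A. \<forall>x\<in>X. x \<cdot> a \<in> X}" using R0c[OF r] by simp
  qed
  show "\<exists>k::nat. pp k \<cdot> a \<in> {a \<in> carrier A. \<forall>x\<in>X. x \<cdot> a \<in> X}" if "a \<in> carrier A" for a
   using right_mult_absorb[OF AA.lat_fg[OF X] X that] that by auto
 qed (use k in auto)
qed

lemma left_order: assumes X: "latA X" shows "ord A R0 p {a \<in> carrier A. \<forall>x\<in>X. a \<cdot> x \<in> X}"
proof -
 have c: "x \<in> X \<Longrightarrow> x \<in> carrier A" for x using lat_carrier[OF X] by auto
 note s = AA.lat_sm[OF X]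
 obtain k where k: "pp k \<in> X" using lat_p[OF X] by auto
 show ?thesis
 proof (rule ordI[OF _ _ AA.lat_fg[OF X], of _ k])
  show "subring {a \<in> carrier A. \<forall>x\<in>X. a \<cdot> x \<in> X} A"
   using c AA.VR.sm_add[OF s] AA.VR.sm_neg[OF s]
   by (intro subringI) (auto simp: l_distr l_minus m_assoc)
  show "R0 \<subseteq> {a \<in> carrier A. \<forall>x\<in>X. a \<cdot> x \<in> X}"
   using AA.smR_smult[OF s] R0c by auto
  show "\<exists>k::nat. pp k \<cdot> a \<in> {a \<in> carrier A. \<forall>x\<in>X. a \<cdot> x \<in> X}" if "a \<in> carrier A" for a
   using left_mult_absorb[OF AA.lat_fg[OF X] X that] that by auto
  show "pp k \<cdot> b \<in> X" if "b \<in> {a \<in> carrier A. \<forall>x\<in>X. a \<cdot> x \<in> X}" for b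
   using that k p_central[of b k] by simp
 qed
qed

lemma qinv_lat: assumes X: "latA X" shows "latA (qinv A X)"
proof -
 have c: "x \<in> X \<Longrightarrow> x \<in> carrier A" for x using lat_carrier[OF X] by auto
 note s = AA.lat_sm[OF X]
 have sq: "AA.smR (qinv A X)"
 proof (rule AA.VR.submoduleI)
  show "qinv A X \<subseteq> carrier RA" by (auto simp: qinv_def)
  show "\<zero>\<^bsub>RA\<^esub> \<in> qinv A X" using AA.VR.sm_zero[OF s] c by (simp add: qinv_def)
  show "u \<oplus>\<^bsub>RA\<^esub> v \<in> qinv A X" if "u \<in> qinv A X" "v \<in> qinv A X" for u v
   using that c AA.VR.sm_add[OF s] by (simp add: qinv_def l_distr r_distr)
  show "r \<odot>\<^bsub>RA\<^esub> u \<in> qinv A X" if "r \<in> carrier (A\<lparr>carrier := R0\<rparr>)" "u \<in> qinv A X" for r u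
  proof -
   have r: "r \<in> R0" "r \<in> carrier A" and u: "u \<in> carrier A" using that R0c by (auto simp: qinv_def)
   have "x \<cdot> (r \<cdot> u) \<cdot> y = r \<cdot> (x \<cdot> u \<cdot> y)" if "x \<in> X" "y \<in> X" for x y
    using central[OF r(1), of x] c that r u by (simp add: m_assoc[symmetric])
   then show ?thesis using that AA.smR_smult[OF s r(1)] r u by (simp add: qinv_def)
  qed
 qed
 obtain k where k: "pp k \<in> X" using lat_p[OF X] by auto
 \<comment> \<open>The element \<open>p^k\<close> of \<open>X\<close> is used on both sides of
   \<open>b\<close>.\<close>
 have "pp (k + k) \<cdot> b \<in> X" if b: "b \<in> qinv A X" for b
 proof -
  have bc: "b \<in> carrier A" using b by (simp add: qinv_def)
  have "pp k \<cdot> b \<cdot> pp k \<in> X" using b k by (simp add: qinv_def)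
  moreover have "pp k \<cdot> b \<cdot> pp k = pp k \<cdot> (pp k \<cdot> b)"
   using bc by (simp add: m_assoc p_central[OF bc, symmetric])
  moreover have "\<dots> = pp (k + k) \<cdot> b" using bc by (simp add: m_assoc[symmetric] nat_pow_mult)
  ultimately show ?thesis by simp
 qed
 then have "fg R0 RA (qinv A X)" by (rule bounded_fg[OF sq _ AA.lat_fg[OF X]])
 moreover have "\<exists>k::nat. pp k \<cdot> a \<in> qinv A X" if a: "a \<in> carrier A" for a
 proof -
  obtain k where k: "\<And>x. x \<in> X \<Longrightarrow> x \<cdot> (pp k \<cdot> a) \<in> {a \<in> carrier A. \<forall>x\<in>X. a \<cdot> x \<in> X}"
   using right_mult_absorb[OF AA.lat_fg[OF X] ordD(2)[OF left_order[OF X]] a] by auto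
  then show ?thesis using a by (intro exI[of _ k]) (auto simp: qinv_def)
 qed
 ultimately show ?thesis using sq by (simp add: lat_def absb_def)
qed

lemma prd_right_closed:
 assumes S: "S \<subseteq> carrier A" and T: "T \<subseteq> carrier A" and g: "g \<in> carrier A"
  and Tg: "\<And>t. t \<in> T \<Longrightarrow> t \<cdot> g \<in> T" and u: "u \<in> prd S T"
 shows "u \<cdot> g \<in> prd S T"
proof -
 have T': "T \<subseteq> carrier RA" using T by simp
 have m: "s \<cdot> t \<cdot> g \<in> prd S T" if st: "s \<in> S" "t \<in> T" for s t
  using AA.V.ss_mem[OF st(1) Tg[OF st(2)]] m_assoc[OF subsetD[OF S st(1)] subsetD[OF T st(2)] g] by simp
 show ?thesis
  by (rule AA.V.ss_map[OF u S T' AA.V.ss_subgroup[OF S T'] AA.V.M.abelian_group_axioms, where f = "\<lambda>u. u \<cdot> g"])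
   (use g m in \<open>simp_all add: l_distr\<close>)
qed

end

locale order_ring = order_setting A R0 p pinv
 for A :: "('a, 'c) ring_scheme" (structure) and R0 p pinv +
 fixes G
 assumes ordG: "ord A R0 p G"
begin

sublocale W: order_in A R0 p pinv RA G by (rule ordD(1)[OF ordG])

abbreviation "TSI B \<equiv> tsi A p G B"
abbreviation "JJ \<equiv> jac A G"

lemma fG: "fg R0 RA G" by (rule ordD(3)[OF ordG])

lemma GG: "W.smG G"
 by (rule W.VG.submoduleI) (use W.Gc W.G_closed in auto)

lemma tsiD: assumes "TSI B" shows "W.smG B" "B \<subseteq> G" "\<And>b g. \<lbrakk>b \<in> B; g \<in> G\<rbrakk> \<Longrightarrow> b \<cdot> g \<in> B"
 "\<exists>k::nat. pp k \<in> B" "B \<subseteq> carrier A" "\<And>b g. \<lbrakk>b \<in> B; g \<in> G\<rbrakk> \<Longrightarrow> g \<cdot> b \<in> B" "latA B"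
proof -
 show s: "W.smG B" and BG: "B \<subseteq> G" and r: "\<And>b g. \<lbrakk>b \<in> B; g \<in> G\<rbrakk> \<Longrightarrow> b \<cdot> g \<in> B"
  and k: "\<exists>k::nat. pp k \<in> B" using assms by (auto simp: tsi_def)
 show "B \<subseteq> carrier A" using BG W.Gc by auto
 show "\<And>b g. \<lbrakk>b \<in> B; g \<in> G\<rbrakk> \<Longrightarrow> g \<cdot> b \<in> B" using W.smG_smult[OF s] by simp
 obtain k where k: "pp k \<in> B" using k by auto
 show "latA B" by (rule AA.latI_sub[OF ordD(2)[OF ordG] W.smG_smR[OF s] BG, of k]) (use r k in auto)
qed

lemma prd_left: assumes S: "W.smG S" and T: "T \<subseteq> carrier A" shows "W.smG (prd S T)"
proof (rule AA.V.ss_submodule[OF W.G])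
 show "S \<subseteq> carrier A" "T \<subseteq> carrier RA" using W.VG.sm_carrier[OF S] T by auto
 fix g s x assume *: "g \<in> G" "s \<in> S" "x \<in> T"
 then have "g \<cdot> s \<in> S" using W.smG_smult[OF S] by simp
 then show "g \<odot>\<^bsub>RA\<^esub> (s \<odot>\<^bsub>RA\<^esub> x) \<in> prd S T"
  using AA.V.ss_mem[of "g \<cdot> s" S x T] * m_assoc[of g s x] W.Gc T W.VG.smD[OF S] by auto
qed

lemma tsi_prd: assumes B: "TSI B" and C: "TSI C" shows "TSI (prd B C)"
proof -
 note b = tsiD[OF B] and c = tsiD[OF C]
 obtain j k where "pp j \<in> B" "pp k \<in> C" using b(4) c(4) by auto
 then have "pp (j + k) \<in> prd B C" using AA.V.ss_mem[of "pp j" B "pp k" C] by (simp add: nat_pow_mult[symmetric])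
 moreover have "prd B C \<subseteq> G"
  by (rule AA.V.ss_least[OF b(5) _ GG]) (simp_all add: c(5) W.G_closed(4) subsetD[OF b(2)] subsetD[OF c(2)])
 moreover have "u \<cdot> g \<in> prd B C" if "u \<in> prd B C" "g \<in> G" for u g
  by (rule prd_right_closed[OF b(5) c(5) W.Gc[OF that(2)] _ that(1)]) (use c(3) that in auto)
 ultimately show ?thesis using prd_left[OF b(1) c(5)] by (auto simp: tsi_def)
qed

lemma tsi_prdI:
 assumes X: "W.smG X" and Y: "Y \<subseteq> carrier A" and XY: "\<And>x y. \<lbrakk>x \<in> X; y \<in> Y\<rbrakk> \<Longrightarrow> x \<cdot> y \<in> G"
  and YG: "\<And>y g. \<lbrakk>y \<in> Y; g \<in> G\<rbrakk> \<Longrightarrow> y \<cdot> g \<in> Y" and L: "latA X" "latA Y"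
 shows "TSI (prd X Y)"
proof -
 have Xc: "X \<subseteq> carrier A" using W.VG.sm_carrier[OF X] by simp
 have "prd X Y \<subseteq> G" by (rule AA.V.ss_least[OF Xc _ GG]) (use Y XY in auto)
 moreover have "u \<cdot> g \<in> prd X Y" if "u \<in> prd X Y" "g \<in> G" for u g
  by (rule prd_right_closed[OF Xc Y W.Gc[OF that(2)] YG[OF _ that(2)] that(1)])
 moreover obtain j k where "pp j \<in> X" "pp k \<in> Y" using lat_p L by blast
 then have "pp (j + k) \<in> prd X Y" using AA.V.ss_mem by (force simp: nat_pow_mult[symmetric])
 ultimately show ?thesis using prd_left[OF X Y] by (auto simp: tsi_def)
qed

lemma tsi_G: "TSI G"
 using GG W.G_closed W.pG by (auto simp: tsi_def)

lemma tsi_J: "TSI JJ"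
proof -
 have "pp 1 \<in> JJ" using W.p_J[OF fG] by simp
 then show ?thesis using W.J_left W.J_right W.J_sub unfolding tsi_def by blast
qed

lemma prd_assoc: "\<lbrakk>S \<subseteq> carrier A; T \<subseteq> carrier A; X \<subseteq> carrier A\<rbrakk> \<Longrightarrow> prd (prd S T) X = prd S (prd T X)"
 using AA.V.ss_assoc[of S T X] by simp

lemma prd_carrier: "\<lbrakk>S \<subseteq> carrier A; T \<subseteq> carrier A\<rbrakk> \<Longrightarrow> prd S T \<subseteq> carrier A"
 using AA.V.ss_carrier[of S T] by simp

lemma prd_mono: "\<lbrakk>S \<subseteq> S'; X \<subseteq> X'; S' \<subseteq> carrier A; X' \<subseteq> carrier A\<rbrakk> \<Longrightarrow> prd S X \<subseteq> prd S' X'"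
 using AA.V.ss_mono by simp

text \<open>As \<open>G / J\<close> is semisimple, \<open>P / J\<close> has a complement given by a
  left ideal \<open>C0\<close>. Since \<open>P C0 \<subseteq> P \<inter> C0 = J\<close>, also
  \<open>P C0 G \<subseteq> J\<close>, and \<open>C0 G\<close> is a two-sided ideal.\<close>

lemma coprime_complement:
 assumes P: "TSI P" "JJ \<subseteq> P"
 shows "\<exists>C a b. TSI C \<and> JJ \<subseteq> C \<and> prd P C \<subseteq> JJ \<and> a \<in> P \<and> b \<in> C \<and> \<one> = a \<oplus> b"
proof -
 note P' = tsiD[OF P(1)] and J' = tsiD[OF tsi_J]
 have JG: "prd JJ G \<subseteq> JJ"
  by (rule AA.V.ss_least[OF J'(5) _ J'(1)]) (use W.Gc J'(3) in auto)
 obtain C0 where C0: "W.smG C0" "JJ \<subseteq> C0" "C0 \<subseteq> G" "P \<inter> C0 = JJ" "P <+>\<^bsub>RA\<^esub> C0 = G"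
  using W.complement[OF fG fG GG P'(1) J'(1) JG P(2) P'(2)] by auto
 have C0c: "C0 \<subseteq> carrier A" and Gc: "G \<subseteq> carrier A" using C0(3) W.Gc by auto
 let ?C = "prd C0 G"
 have sub: "C0 \<subseteq> ?C"
 proof
  fix c assume "c \<in> C0"
  then show "c \<in> ?C" using AA.V.ss_mem[of c C0 \<one> G] W.G_closed(2) C0c by auto
 qed
 have "?C \<subseteq> G" by (rule AA.V.ss_least[OF C0c _ GG]) (use C0(3) Gc W.G_closed in auto)
 moreover have "u \<cdot> g \<in> ?C" if "u \<in> ?C" "g \<in> G" for u g
  by (rule prd_right_closed[OF C0c Gc W.Gc[OF that(2)] _ that(1)]) (use W.G_closed that in auto)
 moreover have "\<exists>k::nat. pp k \<in> ?C" using J'(4) C0(2) sub by auto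
 ultimately have tC: "TSI ?C" using prd_left[OF C0(1) Gc] by (auto simp: tsi_def)
 have "prd P C0 \<subseteq> JJ"
 proof (rule AA.V.ss_least[OF P'(5) _ J'(1)])
  fix x c assume x: "x \<in> P" and c: "c \<in> C0"
  have "x \<cdot> c \<in> P" by (rule P'(3)[OF x subsetD[OF C0(3) c]])
  moreover have "x \<cdot> c \<in> C0" using W.smG_smult[OF C0(1) subsetD[OF P'(2) x] c] by simp
  ultimately show "x \<odot>\<^bsub>RA\<^esub> c \<in> JJ" using C0(4) by auto
 qed (use C0c in simp)
 then have "prd (prd P C0) G \<subseteq> prd JJ G" using Gc J'(5) by (intro prd_mono) auto
 then have PC: "prd P ?C \<subseteq> JJ" using JG prd_assoc[OF P'(5) C0c Gc] by simp
 have "\<one> \<in> P <+>\<^bsub>RA\<^esub> C0" using C0(5) W.G_closed(2) by simp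
 then obtain a b where "a \<in> P" "b \<in> C0" "\<one> = a \<oplus> b" unfolding AA.V.sum_iff by auto
 then show ?thesis using tC PC C0(2) sub by blast
qed

end

section \<open>Inverses of ideals and lattices over a maximal order\<close>

locale max_order = order_ring +
 assumes maxG: "\<And>H. \<lbrakk>ord A R0 p H; G \<subseteq> H\<rbrakk> \<Longrightarrow> H = G"
begin

lemma right_orderG: assumes X: "latA X" "\<And>x g. \<lbrakk>x \<in> X; g \<in> G\<rbrakk> \<Longrightarrow> x \<cdot> g \<in> X"
 and a: "a \<in> carrier A" "\<And>x. x \<in> X \<Longrightarrow> x \<cdot> a \<in> X"
 shows "a \<in> G"
proof -
 have "G \<subseteq> {a \<in> carrier A. \<forall>x\<in>X. x \<cdot> a \<in> X}" using X(2) W.Gc by auto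
 then have "{a \<in> carrier A. \<forall>x\<in>X. x \<cdot> a \<in> X} = G" by (rule maxG[OF right_order[OF X(1)]])
 then show ?thesis using a by auto
qed

lemma left_orderG: assumes X: "latA X" "\<And>x g. \<lbrakk>x \<in> X; g \<in> G\<rbrakk> \<Longrightarrow> g \<cdot> x \<in> X"
 and a: "a \<in> carrier A" "\<And>x. x \<in> X \<Longrightarrow> a \<cdot> x \<in> X"
 shows "a \<in> G"
proof -
 have "G \<subseteq> {a \<in> carrier A. \<forall>x\<in>X. a \<cdot> x \<in> X}" using X(2) W.Gc by auto
 then have "{a \<in> carrier A. \<forall>x\<in>X. a \<cdot> x \<in> X} = G" by (rule maxG[OF left_order[OF X(1)]])
 then show ?thesis using a by auto
qed

text \<open>For \<open>t = p^(-1)db\<close> and \<open>x\<close> in \<open>P\<close> one has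
  \<open>Bxt \<subseteq> B\<close>, because \<open>cxd\<close> is divisible by \<open>p\<close> for
  every \<open>c\<close> in \<open>B\<close>. So \<open>xt\<close> is in the right order of
  \<open>B\<close>, which is \<open>G\<close>. Thus \<open>Pt \<subseteq> G\<close>, whence
  \<open>t\<close> is in the quasi-inverse of \<open>P\<close> and therefore in \<open>G\<close>;
  and \<open>db = pt\<close>.\<close>

lemma cyclic_shift:
 assumes P: "TSI P" "qinv A P \<subseteq> G" and B: "TSI B" and D: "TSI D"
  and w: "prd B (prd P D) \<subseteq> AA.pX 1 G"
 shows "prd D B \<subseteq> AA.pX 1 G"
proof (rule AA.V.ss_least[OF tsiD(5)[OF D] _ AA.smR_pX[OF W.smG_smR[OF GG]]])
 show "B \<subseteq> carrier RA" using tsiD(5)[OF B] by simp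
 fix d b assume d: "d \<in> D" and b: "b \<in> B"
 note P' = tsiD[OF P(1)] and B' = tsiD[OF B] and D' = tsiD[OF D]
 have dbc: "d \<in> carrier A" "b \<in> carrier A" using d b B'(5) D'(5) by auto
 let ?t = "pinv \<cdot> (d \<cdot> b)"
 have tc: "?t \<in> carrier A" using dbc by simp
 have xt: "x \<cdot> ?t \<in> G" if x: "x \<in> P" for x
 proof (rule right_orderG[OF B'(7) B'(3)])
  have xc: "x \<in> carrier A" using x P'(5) by auto
  show "x \<cdot> ?t \<in> carrier A" using xc tc by simp
  fix c assume c: "c \<in> B"
  have cc: "c \<in> carrier A" using c B'(5) by auto
  have "c \<cdot> (x \<cdot> d) \<in> prd B (prd P D)"
   using AA.V.ss_mem[OF c AA.V.ss_mem[OF x d]] by simp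
  then obtain g where g: "g \<in> G" "c \<cdot> (x \<cdot> d) = p \<cdot> g" using w by auto
  have pv: "pinv \<cdot> u = u \<cdot> pinv" if "u \<in> carrier A" for u using pinv_central[OF that, of 1] by simp
  have "c \<cdot> (x \<cdot> ?t) = pinv \<cdot> (c \<cdot> (x \<cdot> d)) \<cdot> b"
   using cc xc dbc pv[of "c \<cdot> x"] by (simp add: m_assoc[symmetric])
  also have "\<dots> = (pinv \<cdot> p) \<cdot> g \<cdot> b" unfolding g(2) using W.Gc[OF g(1)] by (simp add: m_assoc)
  also have "\<dots> = g \<cdot> b" using W.Gc[OF g(1)] by (simp add: pinv_p)
  finally show "c \<cdot> (x \<cdot> ?t) \<in> B" using B'(6)[OF b g(1)] by simp
 qed
 have "?t \<in> qinv A P" using tc P'(6) xt by (auto simp: qinv_def)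
 then have "?t \<in> G" using P(2) by auto
 moreover have "p \<cdot> ?t = d \<cdot> b" using dbc by (simp add: m_assoc[symmetric] p)
 ultimately show "d \<odot>\<^bsub>RA\<^esub> b \<in> AA.pX 1 G" by (intro image_eqI[of _ _ ?t]) auto
qed

text \<open>Suppose the quasi-inverse is inside \<open>G\<close>. For a coprime \<open>C\<close>
  with \<open>PC \<subseteq> J\<close>, a long word \<open>PCPC...\<close> lies in a power of
  \<open>J\<close> and so in \<open>pG\<close>. Each cyclic shift removes one \<open>P\<close>,
  until only factors \<open>C\<close> are left. But \<open>C\<close> contains an element
  \<open>b\<close> congruent to 1 modulo \<open>P\<close>, so a power of \<open>b\<close> lies in
  \<open>pG \<subseteq> P\<close>, and then so does 1.\<close>

lemma inverse_not_sub:
 assumes P: "TSI P" "JJ \<subseteq> P" "\<one> \<notin> P"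
 shows "\<exists>a\<in>qinv A P. a \<notin> G"
proof (rule ccontr)
 assume "\<not> ?thesis"
 then have qP: "qinv A P \<subseteq> G" by auto
 obtain C a b where C: "TSI C" "JJ \<subseteq> C" "prd P C \<subseteq> JJ" and ab: "a \<in> P" "b \<in> C" "\<one> = a \<oplus> b"
  using coprime_complement[OF P(1,2)] by auto
 note P' = tsiD[OF P(1)] and C' = tsiD[OF C(1)] and J' = tsiD[OF tsi_J]
 have ac: "a \<in> carrier A" "b \<in> carrier A" using ab P'(5) C'(5) by auto
 \<comment> \<open>The word of \<open>n\<close> factors \<open>PC\<close> followed by a tail
   \<open>Z\<close>; each shift moves a leading \<open>C\<close> to the end of the tail.\<close>
 define wd where "wd n Z = ((\<lambda>Z. prd P (prd C Z)) ^^ n) Z" for n Z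
 have wd_tsi: "TSI Z \<Longrightarrow> TSI (wd n Z)" for n Z
  by (induction n) (auto simp: wd_def intro: tsi_prd P(1) C(1))
 have wd_assoc: "prd (wd n Z) C = wd n (prd Z C)" if Z: "TSI Z" for n Z
 proof (induction n)
  case (Suc n)
  have c: "wd n Z \<subseteq> carrier A" using tsiD(5)[OF wd_tsi[OF Z]] .
  have "prd (wd (Suc n) Z) C = prd (prd P (prd C (wd n Z))) C" by (simp add: wd_def)
  also have "\<dots> = prd P (prd (prd C (wd n Z)) C)" by (rule prd_assoc[OF P'(5) prd_carrier[OF C'(5) c] C'(5)])
  also have "prd (prd C (wd n Z)) C = prd C (prd (wd n Z) C)" by (rule prd_assoc[OF C'(5) c C'(5)])
  finally show ?case using Suc by (simp add: wd_def)
 qed (simp add: wd_def)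
 have key: "TSI Z \<Longrightarrow> b [^] (m::nat) \<in> Z \<Longrightarrow> prd C (wd n Z) \<subseteq> AA.pX 1 G \<Longrightarrow> \<exists>m::nat. b [^] m \<in> AA.pX 1 G" for n m Z
 proof (induction n arbitrary: Z m)
  case 0
  have "b \<cdot> b [^] m \<in> prd C Z" using AA.V.ss_mem[OF ab(2) 0(2)] by simp
  then have "b [^] Suc m \<in> AA.pX 1 G" using 0(3) nat_pow_comm[of b m 1] ac by (auto simp: wd_def)
  then show ?case by blast
 next
  case (Suc n)
  have "prd C (prd P (prd C (wd n Z))) \<subseteq> AA.pX 1 G" using Suc.prems(3) by (simp add: wd_def)
  then have "prd (prd C (wd n Z)) C \<subseteq> AA.pX 1 G"
   by (rule cyclic_shift[OF P(1) qP C(1) tsi_prd[OF C(1) wd_tsi[OF Suc.prems(1)]]])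
  moreover have "prd (prd C (wd n Z)) C = prd C (prd (wd n Z) C)"
   by (rule prd_assoc[OF C'(5) tsiD(5)[OF wd_tsi[OF Suc.prems(1)]] C'(5)])
  ultimately have "prd C (wd n (prd Z C)) \<subseteq> AA.pX 1 G" using wd_assoc[OF Suc.prems(1)] by simp
  moreover have "b [^] Suc m \<in> prd Z C" using AA.V.ss_mem[OF Suc.prems(2) ab(2)] by simp
  ultimately show ?case using Suc.IH[OF tsi_prd[OF Suc.prems(1) C(1)]] by blast
 qed
 have fin: "finite (between W.AG RA (AA.pX 1 G) G)"
  by (rule W.VG.fin_index_between[OF AA.fin_index_pk[OF fG]])
 obtain m where m: "ci W.AG RA (AA.pX 1 G) G m"
  using W.VG.ci_exists[OF fin GG W.smG_pX[OF GG] AA.pX_sub[OF W.smG_smR[OF GG]]] by auto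
 \<comment> \<open>The length of \<open>G / pG\<close>: this power of \<open>J\<close> lies in
   \<open>pG\<close>.\<close>
 let ?N = "size m"
 have wJ: "wd n G \<subseteq> ((\<lambda>Z. prd JJ Z) ^^ n) G \<and> ((\<lambda>Z. prd JJ Z) ^^ n) G \<subseteq> carrier A" for n
 proof (induction n)
  case 0 then show ?case using W.Gc by (auto simp: wd_def)
 next
  case (Suc n)
  have c: "wd n G \<subseteq> carrier A" using Suc by auto
  have "wd (Suc n) G = prd (prd P C) (wd n G)" using prd_assoc[OF P'(5) C'(5) c] by (simp add: wd_def)
  also have "\<dots> \<subseteq> prd JJ (((\<lambda>Z. prd JJ Z) ^^ n) G)" using Suc C(3) J'(5) by (intro prd_mono) auto
  finally show ?case using prd_carrier[OF J'(5)] Suc by simp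
 qed
 have "wd ?N G \<subseteq> AA.pX 1 G" using wJ[of ?N] W.ci_Jpow[OF m] by auto
 moreover have "prd C (AA.pX 1 G) \<subseteq> AA.pX 1 G"
 proof (rule AA.V.ss_least[OF C'(5) _ W.smG_pX[OF GG]])
  show "AA.pX 1 G \<subseteq> carrier RA" by (rule W.VG.sm_carrier[OF W.smG_pX[OF GG]])
  show "s \<odot>\<^bsub>RA\<^esub> x \<in> AA.pX 1 G" if "s \<in> C" "x \<in> AA.pX 1 G" for s x
   by (rule W.smG_smult[OF W.smG_pX[OF GG] subsetD[OF C'(2) that(1)] that(2)])
 qed
 moreover have "prd C (wd ?N G) \<subseteq> prd C (AA.pX 1 G)" if "wd ?N G \<subseteq> AA.pX 1 G"
  by (rule prd_mono) (use that C'(5) W.VG.sm_carrier[OF W.smG_pX[OF GG, of 1]] in simp_all)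
 ultimately have "prd C (wd ?N G) \<subseteq> AA.pX 1 G" by blast
 then have "\<exists>n::nat. b [^] n \<in> AA.pX 1 G" by (rule key[OF tsi_G, of 0, rotated]) (use W.G_closed(2) in simp)
 then obtain n where "b [^] (n::nat) \<in> AA.pX 1 G" by blast
 moreover have "AA.pX 1 G \<subseteq> P" using W.p_J[OF fG] P(2) P'(3) by auto
 ultimately have "b [^] n \<in> P" by auto
 \<comment> \<open>As \<open>1 = a + b\<close> with \<open>a\<close> in \<open>P\<close>, membership
   in \<open>P\<close> descends from \<open>b^(n+1)\<close> to \<open>b^n\<close> and finally to
   \<open>b^0 = 1\<close>.\<close>
 then have "\<one> \<in> P"
 proof (induction n)
  case (Suc n)
  have bn: "b [^] n \<in> G" using C'(2) ab(2) W.G_closed by (induction n) auto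
  have "b [^] n = b [^] n \<cdot> (a \<oplus> b)" using ac ab(3)[symmetric] by simp
  also have "\<dots> = b [^] n \<cdot> a \<oplus> b [^] Suc n" using ac by (simp add: r_distr)
  finally have e: "b [^] n = b [^] n \<cdot> a \<oplus> b [^] Suc n" .
  have "b [^] n \<cdot> a \<oplus> b [^] Suc n \<in> P"
   using W.VG.sm_add[OF P'(1) P'(6)[OF ab(1) bn] Suc.prems] by simp
  then have "b [^] n \<in> P" using e by metis
  then show ?case by (rule Suc.IH)
 qed simp
 then show False using P(3) by simp
qed

lemma qinv_closed:
 assumes X: "X \<subseteq> carrier A" and a: "a \<in> qinv A X" and g: "g \<in> G"
 shows "(\<And>x. x \<in> X \<Longrightarrow> g \<cdot> x \<in> X) \<Longrightarrow> a \<cdot> g \<in> qinv A X" and "(\<And>x. x \<in> X \<Longrightarrow> x \<cdot> g \<in> X) \<Longrightarrow> g \<cdot> a \<in> qinv A X"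
proof -
 have c: "a \<in> carrier A" "g \<in> carrier A" using a g W.Gc by (auto simp: qinv_def)
 { assume *: "\<And>x. x \<in> X \<Longrightarrow> g \<cdot> x \<in> X"
  have "x \<cdot> (a \<cdot> g) \<cdot> y \<in> X" if "x \<in> X" "y \<in> X" for x y
  proof -
   have "x \<cdot> (a \<cdot> g) \<cdot> y = x \<cdot> a \<cdot> (g \<cdot> y)" using c that X by (auto simp: m_assoc subset_iff)
   then show ?thesis using a *[OF that(2)] that by (simp add: qinv_def)
  qed
  then show "a \<cdot> g \<in> qinv A X" using c by (simp add: qinv_def) }
 { assume *: "\<And>x. x \<in> X \<Longrightarrow> x \<cdot> g \<in> X"
  have "x \<cdot> (g \<cdot> a) \<cdot> y \<in> X" if "x \<in> X" "y \<in> X" for x y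
  proof -
   have "x \<cdot> (g \<cdot> a) \<cdot> y = (x \<cdot> g) \<cdot> a \<cdot> y" using c that X by (auto simp: m_assoc subset_iff)
   then show ?thesis using a *[OF that(1)] that by (simp add: qinv_def)
  qed
  then show "g \<cdot> a \<in> qinv A X" using c by (simp add: qinv_def) }
qed

text \<open>If \<open>T\<close> is proper, so is \<open>T + J\<close>: by Nakayama's lemma
  \<open>T + pG\<close> lies in a maximal left ideal, which contains \<open>J\<close> as well. Then
  \<open>inverse_not_sub\<close> for \<open>T + J\<close> contradicts \<open>inv\<close>.\<close>

lemma tsi_unit:
 assumes T: "TSI T" and inv: "\<And>P a. \<lbrakk>TSI P; T \<subseteq> P; a \<in> qinv A P\<rbrakk> \<Longrightarrow> a \<in> G"
 shows "\<one> \<in> T"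
proof (rule ccontr)
 assume n: "\<one> \<notin> T"
 note T' = tsiD[OF T] and J' = tsiD[OF tsi_J]
 have pG: "W.smG (AA.pX 1 G)" by (rule W.smG_pX[OF GG])
 let ?S = "T <+>\<^bsub>RA\<^esub> AA.pX 1 G"
 have S: "W.smG ?S" by (rule W.VG.sm_sum[OF T'(1) pG])
 have SG: "?S \<subseteq> G" by (rule W.VG.sum_least[OF GG T'(2) AA.pX_sub[OF W.smG_smR[OF GG]]])
 have "?S \<noteq> G"
 proof
  assume e: "?S = G"
  have "G \<subseteq> T"
  proof (rule AA.nakayama[OF fG W.smG_smR[OF T'(1)]])
   fix g assume g: "g \<in> G"
   then have "g \<in> AA.pX 1 G <+>\<^bsub>RA\<^esub> T" using e W.VG.sum_comm[OF T'(1) pG] by simp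
   then obtain u where "u \<in> AA.pX 1 G" "g \<ominus>\<^bsub>RA\<^esub> u \<in> T" unfolding W.VG.sum_minus_iff[OF pG T'(1)] by blast
   then show "\<exists>x'\<in>G. mcong RA T g (p \<odot>\<^bsub>RA\<^esub> x')" using g W.Gc by (auto simp: mcong_def)
  qed
  then show False using n W.G_closed(2) by auto
 qed
 have pS: "AA.pX 1 G \<subseteq> ?S" by (rule W.VG.sum_upper2[OF T'(1) pG])
 have "finite (between W.AG RA ?S G)"
  by (rule W.VG.fin_index_between[OF AA.VR.fin_index_mono[OF AA.fin_index_pk[OF fG] pS]])
 then obtain m where m: "simpq W.AG RA m G" "?S \<subseteq> m" using W.ex_max[OF _ GG S SG \<open>?S \<noteq> G\<close>] by auto
 have ms: "W.smG m" "m \<subseteq> G" "m \<noteq> G" using m by (auto simp: simpq_def)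
 have "JJ \<subseteq> m" using m(1) by (auto simp: jac_def)
 let ?P = "T <+>\<^bsub>RA\<^esub> JJ"
 have Pm: "?P \<subseteq> m" by (rule W.VG.sum_least[OF ms(1) subset_trans[OF W.VG.sum_upper1[OF T'(1) pG] m(2)] \<open>JJ \<subseteq> m\<close>])
 have "\<one> \<notin> m"
 proof
  assume "\<one> \<in> m"
  then have "g \<in> m" if "g \<in> G" for g using W.smG_smult[OF ms(1) that, of \<one>] W.Gc[OF that] by simp
  then show False using ms by auto
 qed
 then have P1: "\<one> \<notin> ?P" using Pm by auto
 have TP: "T \<subseteq> ?P" and JP: "JJ \<subseteq> ?P"
  using W.VG.sum_upper1[OF T'(1) J'(1)] W.VG.sum_upper2[OF T'(1) J'(1)] by auto
 have "u \<cdot> g \<in> ?P" if u: "u \<in> ?P" and g: "g \<in> G" for u g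
 proof -
  obtain t x where tx: "t \<in> T" "x \<in> JJ" "u = t \<oplus> x" using u unfolding W.VG.sum_iff by auto
  moreover have "u \<cdot> g = t \<cdot> g \<oplus> x \<cdot> g"
   unfolding tx(3) by (rule l_distr[OF subsetD[OF T'(5) tx(1)] subsetD[OF J'(5) tx(2)] W.Gc[OF g]])
  ultimately show ?thesis unfolding W.VG.sum_iff
   by (intro bexI[OF _ T'(3)[OF tx(1) g]] bexI[OF _ J'(3)[OF tx(2) g]]) simp
 qed
 moreover have "?P \<subseteq> G" using Pm ms by auto
 moreover have "\<exists>k::nat. pp k \<in> ?P" using T'(4) TP by auto
 ultimately have P: "TSI ?P" using W.VG.sm_sum[OF T'(1) J'(1)] by (auto simp: tsi_def)
 obtain a where a: "a \<in> qinv A ?P" "a \<notin> G" using inverse_not_sub[OF P JP P1] by auto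
 then show False using inv[OF P TP] by simp
qed

text \<open>By \<open>tsi_unit\<close> it suffices that every ideal \<open>P\<close> containing the
  product of \<open>X\<close> and \<open>qinv A X\<close> has its quasi-inverse in \<open>G\<close>.
  For \<open>a\<close> in that quasi-inverse and \<open>y\<close> in \<open>qinv A X\<close>, one
  has \<open>XyaX \<subseteq> PaX \<subseteq> GX \<subseteq> X\<close>. So \<open>a\<close> is in
  the right order of \<open>qinv A X\<close>, which is \<open>G\<close>.\<close>

lemma inverse_left:
 assumes X: "latA X" and GX: "\<And>x g. \<lbrakk>x \<in> X; g \<in> G\<rbrakk> \<Longrightarrow> g \<cdot> x \<in> X"
 shows "\<one> \<in> prd X (qinv A X)" and "\<And>x a. \<lbrakk>x \<in> X; a \<in> qinv A X\<rbrakk> \<Longrightarrow> x \<cdot> a \<in> G"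
proof -
 let ?Y = "qinv A X"
 let ?T = "prd X ?Y"
 have Xc: "X \<subseteq> carrier A" and Yc: "?Y \<subseteq> carrier A" using lat_carrier[OF X] by (auto simp: qinv_def)
 show XY: "x \<cdot> a \<in> G" if "x \<in> X" "a \<in> ?Y" for x a
  by (rule left_orderG[OF X GX]) (use that Xc in \<open>auto simp: qinv_def\<close>)
 have XG: "W.smG X"
  by (rule W.VG.submoduleI) (use Xc GX AA.VR.sm_zero[OF AA.lat_sm[OF X]] AA.VR.sm_add[OF AA.lat_sm[OF X]] in auto)
 have YG: "a \<cdot> g \<in> ?Y" if "a \<in> ?Y" "g \<in> G" for a g by (rule qinv_closed(1)[OF Xc that GX[OF _ that(2)]])
 have T: "TSI ?T" by (rule tsi_prdI[OF XG Yc XY YG X qinv_lat[OF X]])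
 show "\<one> \<in> ?T"
 proof (rule tsi_unit[OF T])
  fix P a assume P: "TSI P" and TP: "?T \<subseteq> P" and a: "a \<in> qinv A P"
  have ac: "a \<in> carrier A" using a by (simp add: qinv_def)
  have Pa: "x \<cdot> a \<in> G" if x: "x \<in> P" for x
   by (rule left_orderG[OF tsiD(7,6)[OF P]]) (use x a tsiD(5)[OF P] in \<open>auto simp: qinv_def\<close>)
  show "a \<in> G"
  proof (rule right_orderG[OF qinv_lat[OF X] YG ac])
   fix y assume y: "y \<in> ?Y"
   have yc: "y \<in> carrier A" using y by (simp add: qinv_def)
   have "x \<cdot> (y \<cdot> a) \<cdot> z \<in> X" if xz: "x \<in> X" "z \<in> X" for x z
   proof -
    have "x \<cdot> y \<in> P" using AA.V.ss_mem[OF xz(1) y] TP by auto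
    then have "(x \<cdot> y \<cdot> a) \<cdot> z \<in> X" by (rule GX[OF xz(2) Pa])
    then show ?thesis using xz Xc yc ac by (simp add: m_assoc subset_iff)
   qed
   then show "y \<cdot> a \<in> ?Y" using yc ac by (simp add: qinv_def)
  qed
 qed
qed

text \<open>The mirror image of \<open>inverse_left\<close>, for lattices with right order
  \<open>G\<close>. It also makes the bimodule between two maximal orders invertible.\<close>

lemma inverse_right:
 assumes X: "latA X" and GX: "\<And>x g. \<lbrakk>x \<in> X; g \<in> G\<rbrakk> \<Longrightarrow> x \<cdot> g \<in> X"
 shows "\<one> \<in> prd (qinv A X) X" and "\<And>x a. \<lbrakk>x \<in> X; a \<in> qinv A X\<rbrakk> \<Longrightarrow> a \<cdot> x \<in> G"
proof -
 let ?Y = "qinv A X"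
 let ?T = "prd ?Y X"
 have Xc: "X \<subseteq> carrier A" and Yc: "?Y \<subseteq> carrier A" using lat_carrier[OF X] by (auto simp: qinv_def)
 note L = qinv_lat[OF X]
 show YX: "a \<cdot> x \<in> G" if "x \<in> X" "a \<in> ?Y" for x a
 proof (rule right_orderG[OF X GX])
  show "a \<cdot> x \<in> carrier A" using that Xc Yc by auto
  show "z \<cdot> (a \<cdot> x) \<in> X" if "z \<in> X" for z
   using that \<open>x \<in> X\<close> \<open>a \<in> ?Y\<close> subsetD[OF Xc] by (simp add: qinv_def m_assoc[symmetric])
 qed
 have YG: "g \<cdot> a \<in> ?Y" if "a \<in> ?Y" "g \<in> G" for a g by (rule qinv_closed(2)[OF Xc that GX[OF _ that(2)]])
 have YG': "W.smG ?Y"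
  by (rule W.VG.submoduleI) (use Yc YG AA.VR.sm_zero[OF AA.lat_sm[OF L]] AA.VR.sm_add[OF AA.lat_sm[OF L]] in auto)
 have T: "TSI ?T" by (rule tsi_prdI[OF YG' Xc YX GX L X])
 show "\<one> \<in> ?T"
 proof (rule tsi_unit[OF T])
  fix P a assume P: "TSI P" and TP: "?T \<subseteq> P" and a: "a \<in> qinv A P"
  have ac: "a \<in> carrier A" using a by (simp add: qinv_def)
  have aP: "a \<cdot> x \<in> G" if x: "x \<in> P" for x
   by (rule right_orderG[OF tsiD(7,3)[OF P]]) (use x a subsetD[OF tsiD(5)[OF P]] in \<open>simp_all add: qinv_def m_assoc[symmetric]\<close>)
  show "a \<in> G"
  proof (rule left_orderG[OF L YG ac])
   fix y assume y: "y \<in> ?Y"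
   have yc: "y \<in> carrier A" using y by (simp add: qinv_def)
   have "x \<cdot> (a \<cdot> y) \<cdot> z \<in> X" if xz: "x \<in> X" "z \<in> X" for x z
   proof -
    have "y \<cdot> z \<in> P" using AA.V.ss_mem[OF y xz(2)] TP by auto
    then have "x \<cdot> (a \<cdot> (y \<cdot> z)) \<in> X" by (rule GX[OF xz(1) aP])
    then show ?thesis using xz Xc yc ac by (simp add: m_assoc subset_iff)
   qed
   then show "a \<cdot> y \<in> ?Y" using yc ac by (simp add: qinv_def)
  qed
 qed
qed

lemma tsi_inverse:
 assumes P: "TSI P"
 shows "\<one> \<in> prd P (qinv A P)" and "\<And>x a. \<lbrakk>x \<in> P; a \<in> qinv A P\<rbrakk> \<Longrightarrow> x \<cdot> a \<in> G"
  and "\<one> \<in> prd (qinv A P) P" and "\<And>x a. \<lbrakk>x \<in> P; a \<in> qinv A P\<rbrakk> \<Longrightarrow> a \<cdot> x \<in> G"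
proof -
 note P' = tsiD(7,3,6)[OF P]
 show "\<one> \<in> prd P (qinv A P)" by (rule inverse_left(1)[OF P'(1)]) (rule P'(3))
 show "x \<cdot> a \<in> G" if "x \<in> P" "a \<in> qinv A P" for x a
  by (rule inverse_left(2)[OF P'(1) _ that]) (rule P'(3))
 show "\<one> \<in> prd (qinv A P) P" by (rule inverse_right(1)[OF P'(1)]) (rule P'(2))
 show "a \<cdot> x \<in> G" if "x \<in> P" "a \<in> qinv A P" for x a
  by (rule inverse_right(2)[OF P'(1) _ that]) (rule P'(2))
qed

text \<open>Conjugation by the invertible \<open>P\<close> preserves \<open>C\<close>: if
  \<open>z = xcy\<close> with \<open>y\<close> in the inverse of \<open>P\<close>, then
  \<open>za\<close> and \<open>zb\<close> lie in \<open>C\<close>, hence so does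
  \<open>z = za + zb\<close>. Writing 1 as a sum of products \<open>yq\<close> turns
  \<open>xc\<close> into an element of \<open>CP\<close>.\<close>

lemma prd_coprime:
 assumes P: "TSI P" and C: "TSI C" and ab: "a \<in> P" "b \<in> C" "\<one> = a \<oplus> b"
 shows "prd P C \<subseteq> prd C P"
proof -
 note P' = tsiD[OF P] and C' = tsiD[OF C]
 let ?Pi = "qinv A P"
 have Pic: "?Pi \<subseteq> carrier A" by (auto simp: qinv_def)
 note il = tsi_inverse(1,2)[OF P] and ir = tsi_inverse(3,4)[OF P]
 have ac: "a \<in> carrier A" "b \<in> carrier A" using ab P'(5) C'(5) by auto
 show ?thesis
 proof (rule AA.V.ss_least[OF P'(5) _ prd_left[OF C'(1) P'(5)]])
  show "C \<subseteq> carrier RA" using C'(5) by simp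
  fix x c assume x: "x \<in> P" and c: "c \<in> C"
  have xc: "x \<in> carrier A" "c \<in> carrier A" using x c P'(5) C'(5) by auto
  have yC: "x \<cdot> c \<cdot> y \<in> C" if y: "y \<in> ?Pi" for y
  proof -
   have yc: "y \<in> carrier A" using y Pic by auto
   let ?z = "x \<cdot> c \<cdot> y"
   have cG: "c \<in> G" using c C'(2) by auto
   have "c \<cdot> y \<in> ?Pi" by (rule qinv_closed(2)[OF P'(5) y cG]) (use P'(3) cG in auto)
   then have "x \<cdot> (c \<cdot> y) \<in> G" by (rule il(2)[OF x])
   then have zG: "?z \<in> G" using xc yc by (simp add: m_assoc)
   have "y \<cdot> a \<in> G" by (rule ir(2)[OF ab(1) y])
   moreover have "x \<cdot> c \<in> C" using C'(6)[OF c] x P'(2) by auto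
   ultimately have "x \<cdot> c \<cdot> (y \<cdot> a) \<in> C" using C'(3) by blast
   then have "?z \<cdot> a \<in> C" using xc yc ac by (simp add: m_assoc)
   moreover have "?z \<cdot> b \<in> C" using C'(6)[OF ab(2) zG] .
   ultimately have "?z \<cdot> a \<oplus> ?z \<cdot> b \<in> C" using W.VG.sm_add[OF C'(1)] by simp
   moreover have "?z = ?z \<cdot> (a \<oplus> b)" using xc yc ab(3)[symmetric] by simp
   moreover have "?z \<cdot> (a \<oplus> b) = ?z \<cdot> a \<oplus> ?z \<cdot> b" using xc yc ac by (intro r_distr) auto
   ultimately show ?thesis by simp
  qed
  have P1: "P \<subseteq> carrier RA" using P'(5) by simp
  have m: "x \<cdot> c \<cdot> (y \<cdot> q) \<in> prd C P" if yq: "y \<in> ?Pi" "q \<in> P" for y q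
  proof -
   have "q \<in> carrier A" "y \<in> carrier A" using yq P'(5) Pic by auto
   then show ?thesis using AA.V.ss_mem[OF yC[OF yq(1)] yq(2)] xc by (simp add: m_assoc)
  qed
  have "x \<cdot> c \<cdot> t \<in> prd C P" if t: "t \<in> prd ?Pi P" for t
   by (rule AA.V.ss_map[OF t Pic P1 AA.V.ss_subgroup[OF C'(5) P1] AA.V.M.abelian_group_axioms, where f = "\<lambda>t. x \<cdot> c \<cdot> t"])
    (use xc m in \<open>simp_all add: r_distr\<close>)
  from this[OF ir(1)] show "x \<odot>\<^bsub>RA\<^esub> c \<in> prd C P" using xc by simp
 qed
qed

text \<open>\<open>P\<close> commutes with its complement \<open>C\<close>, and
  \<open>J = PC = CP\<close>; so \<open>PJ = PCP = JP\<close>.\<close>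

lemma J_commutes:
 assumes P: "TSI P" "JJ \<subseteq> P"
 shows "prd P JJ = prd JJ P"
proof -
 obtain C a b where C: "TSI C" "JJ \<subseteq> C" "prd P C \<subseteq> JJ" and ab: "a \<in> P" "b \<in> C" "\<one> = a \<oplus> b"
  using coprime_complement[OF P] by auto
 note P' = tsiD[OF P(1)] and C' = tsiD[OF C(1)] and J' = tsiD[OF tsi_J]
 have ac: "a \<in> carrier A" "b \<in> carrier A" using ab P'(5) C'(5) by auto
 have "\<one> = b \<oplus> a" using ab(3) ac by (simp add: a_comm)
 then have PC: "prd P C = prd C P"
  using prd_coprime[OF P(1) C(1) ab] prd_coprime[OF C(1) P(1) ab(2,1)] by auto
 have "JJ \<subseteq> prd P C"
 proof
  fix j assume j: "j \<in> JJ"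
  have jc: "j \<in> carrier A" using j J'(5) by auto
  have "j = j \<cdot> (a \<oplus> b)" using ab(3)[symmetric] jc by simp
  then have "j = j \<cdot> a \<oplus> j \<cdot> b" using jc ac by (simp add: r_distr)
  moreover have "j \<cdot> a \<in> prd P C" using AA.V.ss_mem[of j C a P] j C(2) ab PC by auto
  moreover have "j \<cdot> b \<in> prd P C" using AA.V.ss_mem[of j P b C] j P(2) ab by auto
  ultimately show "j \<in> prd P C" using AA.V.ss_add[of "j \<cdot> a" P C "j \<cdot> b"] by simp
 qed
 then have J: "JJ = prd P C" using C(3) by auto
 have "prd P JJ = prd P (prd C P)" using J PC by simp
 also have "\<dots> = prd JJ P" using prd_assoc[OF P'(5) C'(5) P'(5)] J by simp
 finally show ?thesis .
qed

abbreviation "Ji \<equiv> qinv A JJ"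

lemma Ji_carrier: "Ji \<subseteq> carrier A" by (auto simp: qinv_def)

lemma Ji_inv: "prd Ji JJ = G" "prd JJ Ji = G"
proof -
 note J' = tsiD[OF tsi_J]
 note il = tsi_inverse(1,2)[OF tsi_J] and ir = tsi_inverse(3,4)[OF tsi_J]
 have s: "W.smG Ji"
  by (rule W.VG.submoduleI)
   (use AA.VR.sm_zero[OF AA.lat_sm[OF qinv_lat[OF J'(7)]]] AA.VR.sm_add[OF AA.lat_sm[OF qinv_lat[OF J'(7)]]]
    Ji_carrier qinv_closed(2)[OF J'(5)] J'(3) in auto)
 have full: "H = G" if H: "W.smG H" "\<one> \<in> H" "H \<subseteq> G" for H
 proof -
  have "g \<in> H" if "g \<in> G" for g using W.smG_smult[OF H(1) that H(2)] W.Gc[OF that] by simp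
  then show ?thesis using H(3) by auto
 qed
 show "prd Ji JJ = G"
 proof (rule full[OF prd_left[OF s J'(5)] ir(1)])
  show "prd Ji JJ \<subseteq> G" by (rule AA.V.ss_least[OF Ji_carrier _ GG]) (use ir(2) J'(5) in auto)
 qed
 show "prd JJ Ji = G"
 proof (rule full[OF prd_left[OF J'(1) Ji_carrier] il(1)])
  show "prd JJ Ji \<subseteq> G" by (rule AA.V.ss_least[OF J'(5) _ GG]) (use il(2) Ji_carrier in auto)
 qed
qed

end

section \<open>Projectivity of lattices\<close>

definition ghom where
 "ghom A G U X V Y f \<longleftrightarrow> (\<forall>x\<in>X. f x \<in> Y) \<and> (\<forall>x\<in>X. \<forall>y\<in>X. f (x \<oplus>\<^bsub>U\<^esub> y) = f x \<oplus>\<^bsub>V\<^esub> f y) \<and>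
   (\<forall>a\<in>G. \<forall>x\<in>X. f (a \<odot>\<^bsub>U\<^esub> x) = a \<odot>\<^bsub>V\<^esub> f x)"

text \<open>The sums of maps \<open>x \<mapsto> \<phi> x y\<close> with \<open>\<phi>\<close> a linear form. By the dual basis criterion, \<open>X\<close> is
 projective if the identity of \<open>X\<close> is among them.\<close>

inductive fr for A :: "('a, 'c) ring_scheme" and G :: "'a set"
  and U :: "('a, 'u, 'd) module_scheme" and X :: "'u set" and V :: "('a, 'v, 'e) module_scheme" and Y :: "'v set" where
 zero: "fr A G U X V Y (\<lambda>x. \<zero>\<^bsub>V\<^esub>)"
| step: "\<lbrakk>ghom A G U X (regular_module A) G \<phi>; y \<in> Y; fr A G U X V Y h\<rbrakk> \<Longrightarrow>
  fr A G U X V Y (\<lambda>x. \<phi> x \<odot>\<^bsub>V\<^esub> y \<oplus>\<^bsub>V\<^esub> h x)"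

definition proj where "proj A G V X \<longleftrightarrow> (\<exists>h. fr A G V X V X h \<and> (\<forall>x\<in>X. h x = x))"

lemma ghomD: assumes "ghom A G U X V Y f"
 shows "x \<in> X \<Longrightarrow> f x \<in> Y" "\<lbrakk>x \<in> X; y \<in> X\<rbrakk> \<Longrightarrow> f (x \<oplus>\<^bsub>U\<^esub> y) = f x \<oplus>\<^bsub>V\<^esub> f y"
  "\<lbrakk>a \<in> G; x \<in> X\<rbrakk> \<Longrightarrow> f (a \<odot>\<^bsub>U\<^esub> x) = a \<odot>\<^bsub>V\<^esub> f x"
 using assms by (auto simp: ghom_def)

context order_in
begin

abbreviation "gh X Y \<equiv> ghom A G V X V Y"
abbreviation "frV X Y \<equiv> fr A G V X V Y"

lemma fr_mem: "fr A G U X V Y h \<Longrightarrow> smG Y \<Longrightarrow> x \<in> X \<Longrightarrow> h x \<in> Y"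
 by (induction rule: fr.induct) (auto simp: VG.sm_zero VG.sm_add smG_smult ghom_def)

lemma fr_mono: "fr A G U X V Y h \<Longrightarrow> Y \<subseteq> Z \<Longrightarrow> fr A G U X V Z h"
 by (induction rule: fr.induct) (auto intro: fr.intros)

lemma ghom_restrict: "ghom A G U X T Z f \<Longrightarrow> X' \<subseteq> X \<Longrightarrow> ghom A G U X' T Z f"
 by (simp add: ghom_def subset_iff)

lemma fr_restrict: "fr A G U X V Y h \<Longrightarrow> X' \<subseteq> X \<Longrightarrow> fr A G U X' V Y h"
 by (induction rule: fr.induct) (auto intro: fr.intros ghom_restrict)

lemma fr_comp: "fr A G U X V Y h \<Longrightarrow> ghom A G T W U X g \<Longrightarrow> fr A G T W V Y (\<lambda>x. h (g x))"
proof (induction rule: fr.induct)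
 case (step \<phi> y h)
 have "ghom A G T W RA G (\<lambda>x. \<phi> (g x))" using step.hyps(1) step.prems by (auto simp: ghom_def)
 then show ?case using fr.step[OF _ step.hyps(2) step.IH[OF step.prems]] by blast
qed (rule fr.zero)

lemma fr_add:
 assumes "fr A G U X V Y h" "fr A G U X V Y k" and Y: "smG Y"
 shows "\<exists>l. fr A G U X V Y l \<and> (\<forall>x\<in>X. l x = h x \<oplus> k x)"
 using assms(1)
proof (induction rule: fr.induct)
 case zero
 have "k x \<in> carrier V" if "x \<in> X" for x using fr_mem[OF assms(2) Y that] VG.smD[OF Y] by blast
 then show ?case using assms(2) by (intro exI[of _ k]) simp
next
 case (step \<phi> y h)
 then obtain l where l: "fr A G U X V Y l" "\<And>x. x \<in> X \<Longrightarrow> l x = h x \<oplus> k x" by auto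
 have c: "\<phi> x \<odot> y \<in> carrier V" "h x \<in> carrier V" "k x \<in> carrier V" if x: "x \<in> X" for x
 proof -
  show "h x \<in> carrier V" using fr_mem[OF step.hyps(3) Y x] VG.smD[OF Y] by blast
  show "k x \<in> carrier V" using fr_mem[OF assms(2) Y x] VG.smD[OF Y] by blast
  have "\<phi> x \<in> carrier A" using ghomD(1)[OF step.hyps(1) x] Gc by auto
  then show "\<phi> x \<odot> y \<in> carrier V" using VG.smD[OF Y step.hyps(2)] V.smult_closed by simp
 qed
 show ?case
  by (rule exI[of _ "\<lambda>x. \<phi> x \<odot> y \<oplus> l x"])
   (use fr.step[OF step.hyps(1,2) l(1)] l(2) c V.M.a_assoc in auto)
qed

lemma fr_split:
 assumes "fr A G U X V (Y <+> Z) h" and Y: "smG Y" and Z: "smG Z"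
 shows "\<exists>k l. fr A G U X V Y k \<and> fr A G U X V Z l \<and> (\<forall>x\<in>X. h x = k x \<oplus> l x)"
 using assms(1)
proof (induction rule: fr.induct)
 case zero
 show ?case by (rule exI[of _ "\<lambda>x. \<zero>"], rule exI[of _ "\<lambda>x. \<zero>"]) (auto intro: fr.zero)
next
 case (step \<phi> w h)
 then obtain k l where kl: "fr A G U X V Y k" "fr A G U X V Z l" "\<And>x. x \<in> X \<Longrightarrow> h x = k x \<oplus> l x" by auto
 obtain y z where yz: "y \<in> Y" "z \<in> Z" "w = y \<oplus> z" using step.hyps(2) unfolding VG.sum_iff by auto
 have "\<phi> x \<odot> w \<oplus> h x = (\<phi> x \<odot> y \<oplus> k x) \<oplus> (\<phi> x \<odot> z \<oplus> l x)" if x: "x \<in> X" for x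
 proof -
  have c: "\<phi> x \<in> carrier A" "y \<in> carrier V" "z \<in> carrier V" "k x \<in> carrier V" "l x \<in> carrier V"
   using ghomD(1)[OF step.hyps(1) x] Gc VG.smD[OF Y yz(1)] VG.smD[OF Z yz(2)]
    VG.smD[OF Y fr_mem[OF kl(1) Y x]] VG.smD[OF Z fr_mem[OF kl(2) Z x]] by auto
  then show ?thesis unfolding yz(3) kl(3)[OF x] by (simp add: V.smult_r_distr V.smult_closed V.M.a_ac)
 qed
 then show ?case using fr.step[OF step.hyps(1) yz(1) kl(1)] fr.step[OF step.hyps(1) yz(2) kl(2)] by blast
qed

end

text \<open>Projectivity in use: a preimage is chosen for each of the finitely many
  \<open>y\<close>, and the linear forms are kept. As \<open>f\<close> is additive only modulo
  \<open>N\<close>, so is the conclusion.\<close>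

lemma fr_lift:
 assumes V: "order_in A R0 p pinv V G" and T: "order_in A R0 p pinv T G"
  and h: "fr A G U X V Y h" and Y: "submodule Y (A\<lparr>carrier := G\<rparr>) V" and Z: "submodule Z (A\<lparr>carrier := G\<rparr>) T"
  and N: "submodule N (A\<lparr>carrier := G\<rparr>) T"
  and f: "qhom (A\<lparr>carrier := G\<rparr>) V Y T N f" and s: "\<And>y. y \<in> Y \<Longrightarrow> \<exists>z\<in>Z. mcong T N z (f y)"
 shows "\<exists>k. fr A G U X T Z k \<and> (\<forall>x\<in>X. mcong T N (k x) (f (h x)))"
 using h
proof (induction rule: fr.induct)
 interpret V: order_in A R0 p pinv V G by fact
 interpret T: order_in A R0 p pinv T G by fact
 interpret two_modules "A\<lparr>carrier := G\<rparr>" V T by (simp add: two_modules_def V.VG.left_module_axioms T.VG.left_module_axioms)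
 note qf = qhom_facts[OF Y N f]
 {
  case zero
  then show ?case using T.VG.cong_sym[OF N qf(6)] by (intro exI[of _ "\<lambda>x. \<zero>\<^bsub>T\<^esub>"]) (auto intro: fr.zero)
 next
  case (step \<phi> y h)
  then obtain k where k: "fr A G U X T Z k" "\<And>x. x \<in> X \<Longrightarrow> mcong T N (k x) (f (h x))" by auto
  obtain z where z: "z \<in> Z" "mcong T N z (f y)" using s[OF step.hyps(2)] by auto
  have "mcong T N (\<phi> x \<odot>\<^bsub>T\<^esub> z \<oplus>\<^bsub>T\<^esub> k x) (f (\<phi> x \<odot>\<^bsub>V\<^esub> y \<oplus>\<^bsub>V\<^esub> h x))" if x: "x \<in> X" for x
  proof -
   have p: "\<phi> x \<in> G" using ghomD(1)[OF step.hyps(1) x] .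
   have hY: "h x \<in> Y" by (rule V.fr_mem[OF step.hyps(3) Y x])
   have py: "\<phi> x \<odot>\<^bsub>V\<^esub> y \<in> Y" by (rule V.smG_smult[OF Y p step.hyps(2)])
   have 1: "mcong T N (f (\<phi> x \<odot>\<^bsub>V\<^esub> y \<oplus>\<^bsub>V\<^esub> h x)) (f (\<phi> x \<odot>\<^bsub>V\<^esub> y) \<oplus>\<^bsub>T\<^esub> f (h x))" by (rule qf(2)[OF py hY])
   have 2: "mcong T N (f (\<phi> x \<odot>\<^bsub>V\<^esub> y)) (\<phi> x \<odot>\<^bsub>T\<^esub> f y)" using qf(3)[of "\<phi> x" y] p step.hyps(2) by simp
   have 3: "mcong T N (\<phi> x \<odot>\<^bsub>T\<^esub> z) (\<phi> x \<odot>\<^bsub>T\<^esub> f y)" using T.VG.cong_smult[OF N z(2), of "\<phi> x"] p by simp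
   have "mcong T N (\<phi> x \<odot>\<^bsub>T\<^esub> z) (f (\<phi> x \<odot>\<^bsub>V\<^esub> y))" by (rule T.VG.cong_trans[OF N 3 T.VG.cong_sym[OF N 2]])
   from T.VG.cong_add[OF N this k(2)[OF x]] show ?thesis by (rule T.VG.cong_trans[OF N _ T.VG.cong_sym[OF N 1]])
  qed
  then show ?case using fr.step[OF step.hyps(1) z(1) k(1)]
   by (intro exI[of _ "\<lambda>x. \<phi> x \<odot>\<^bsub>T\<^esub> z \<oplus>\<^bsub>T\<^esub> k x"]) auto
 }
qed

lemma fr_ghom:
 assumes U: "order_in A R0 p pinv U G" and V: "order_in A R0 p pinv V G"
  and h: "fr A G U X V Y h" and X: "submodule X (A\<lparr>carrier := G\<rparr>) U" and Y: "submodule Y (A\<lparr>carrier := G\<rparr>) V"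
 shows "ghom A G U X V Y h"
 using h
proof (induction rule: fr.induct)
 interpret U: order_in A R0 p pinv U G by fact
 interpret V: order_in A R0 p pinv V G by fact
 {
  case zero
  show ?case using V.VG.sm_zero[OF Y] V.Gc by (auto simp: ghom_def V.V.smult_zero_r)
 next
  case (step \<phi> y h)
  note g = ghomD[OF step.hyps(1)] and k = ghomD[OF step.IH]
  have yc: "y \<in> carrier V" using V.VG.smD[OF Y step.hyps(2)] .
  have pc: "\<phi> x \<in> carrier A" if "x \<in> X" for x using g(1)[OF that] V.Gc by auto
  have hc: "h x \<in> carrier V" if "x \<in> X" for x using k(1)[OF that] V.VG.smD[OF Y] by auto
  show ?case unfolding ghom_def
  proof (intro conjI ballI)
   fix x assume x: "x \<in> X"
   show "\<phi> x \<odot>\<^bsub>V\<^esub> y \<oplus>\<^bsub>V\<^esub> h x \<in> Y"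
    by (rule V.VG.sm_add[OF Y V.smG_smult[OF Y g(1)[OF x] step.hyps(2)] k(1)[OF x]])
   { fix x' assume x': "x' \<in> X"
    have e: "\<phi> (x \<oplus>\<^bsub>U\<^esub> x') = \<phi> x \<oplus>\<^bsub>A\<^esub> \<phi> x'" using g(2)[OF x x'] by simp
    show "\<phi> (x \<oplus>\<^bsub>U\<^esub> x') \<odot>\<^bsub>V\<^esub> y \<oplus>\<^bsub>V\<^esub> h (x \<oplus>\<^bsub>U\<^esub> x') = \<phi> x \<odot>\<^bsub>V\<^esub> y \<oplus>\<^bsub>V\<^esub> h x \<oplus>\<^bsub>V\<^esub> (\<phi> x' \<odot>\<^bsub>V\<^esub> y \<oplus>\<^bsub>V\<^esub> h x')"
     unfolding e k(2)[OF x x'] using pc x x' hc yc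
     by (simp add: V.V.smult_l_distr V.V.smult_closed V.V.M.a_ac) }
   { fix a assume a: "a \<in> G"
    have e: "\<phi> (a \<odot>\<^bsub>U\<^esub> x) = a \<otimes>\<^bsub>A\<^esub> \<phi> x" using g(3)[OF a x] by simp
    show "\<phi> (a \<odot>\<^bsub>U\<^esub> x) \<odot>\<^bsub>V\<^esub> y \<oplus>\<^bsub>V\<^esub> h (a \<odot>\<^bsub>U\<^esub> x) = a \<odot>\<^bsub>V\<^esub> (\<phi> x \<odot>\<^bsub>V\<^esub> y \<oplus>\<^bsub>V\<^esub> h x)"
     unfolding e k(3)[OF a x] using pc x hc yc V.Gc[OF a]
     by (simp add: V.V.smult_r_distr V.V.smult_assoc V.V.smult_closed) }
  qed
 }
qed

lemma fr_lift_surj: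
 assumes V: "order_in A R0 p pinv V G" and T: "order_in A R0 p pinv T G"
  and h: "fr A G U X T Y h" and Z: "submodule Z (A\<lparr>carrier := G\<rparr>) V" and Y: "submodule Y (A\<lparr>carrier := G\<rparr>) T" and F: "ghom A G V Z T Y F" and s: "\<And>y. y \<in> Y \<Longrightarrow> \<exists>z\<in>Z. F z = y"
 shows "\<exists>k. fr A G U X V Z k \<and> (\<forall>x\<in>X. F (k x) = h x)"
 using h
proof (induction rule: fr.induct)
 interpret V: order_in A R0 p pinv V G by fact
 interpret T: order_in A R0 p pinv T G by fact
 {
  case zero
  have "F (\<zero>\<^bsub>A\<^esub> \<odot>\<^bsub>V\<^esub> \<zero>\<^bsub>V\<^esub>) = \<zero>\<^bsub>A\<^esub> \<odot>\<^bsub>T\<^esub> F \<zero>\<^bsub>V\<^esub>" by (rule ghomD(3)[OF F V.G_closed(1) V.VG.sm_zero[OF Z]])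
  moreover have "F \<zero>\<^bsub>V\<^esub> \<in> carrier T" using T.VG.smD[OF Y ghomD(1)[OF F V.VG.sm_zero[OF Z]]] .
  ultimately have "F \<zero>\<^bsub>V\<^esub> = \<zero>\<^bsub>T\<^esub>" by (simp add: V.V.smult_zero_l T.V.smult_zero_l)
  then show ?case by (intro exI[of _ "\<lambda>x. \<zero>\<^bsub>V\<^esub>"]) (auto intro: fr.zero)
 next
  case (step \<phi> y h)
  then obtain k where k: "fr A G U X V Z k" "\<And>x. x \<in> X \<Longrightarrow> F (k x) = h x" by auto
  obtain z where z: "z \<in> Z" "F z = y" using s[OF step.hyps(2)] by auto
  have "F (\<phi> x \<odot>\<^bsub>V\<^esub> z \<oplus>\<^bsub>V\<^esub> k x) = \<phi> x \<odot>\<^bsub>T\<^esub> y \<oplus>\<^bsub>T\<^esub> h x" if x: "x \<in> X" for x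
  proof -
   have p: "\<phi> x \<in> G" using ghomD(1)[OF step.hyps(1) x] .
   have "k x \<in> Z" by (rule V.fr_mem[OF k(1) Z x])
   then show ?thesis using ghomD(2)[OF F V.smG_smult[OF Z p z(1)], of "k x"] ghomD(3)[OF F p z(1)] k(2)[OF x] z(2) by simp
  qed
  then show ?case using fr.step[OF step.hyps(1) z(1) k(1)]
   by (intro exI[of _ "\<lambda>x. \<phi> x \<odot>\<^bsub>V\<^esub> z \<oplus>\<^bsub>V\<^esub> k x"]) auto
 }
qed

section \<open>Projectivity passes from a lattice to its maximal submodules\<close>

locale max_order_module = max_order A R0 p pinv G + order_in A R0 p pinv V G
 for A :: "('a, 'c) ring_scheme" and R0 p pinv G and V :: "('a, 'v, 'e) module_scheme" (structure)
begin

lemma oiV: "order_in A R0 p pinv V G" by (rule order_in_axioms)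

lemma ghom_J: assumes F: "smG F" and f: "ghom A G V F RA G \<phi>" and w: "w \<in> JX F" shows "w \<in> F \<and> \<phi> w \<in> JJ"
proof -
 have Jc': "JJ \<subseteq> carrier A" using Jc by auto
 have z0: "\<phi> \<zero> = \<zero>\<^bsub>A\<^esub>"
 proof -
  have "\<phi> (\<zero>\<^bsub>A\<^esub> \<odot> \<zero>) = \<zero>\<^bsub>A\<^esub> \<cdot> \<phi> \<zero>" using ghomD(3)[OF f G_closed(1) VG.sm_zero[OF F]] by simp
  then show ?thesis using ghomD(1)[OF f VG.sm_zero[OF F]] Gc by (simp add: V.smult_zero_l)
 qed
 show ?thesis
  using w Jc' VG.sm_carrier[OF F]
 proof (induction rule: V.ss_induct)
  case zero then show ?case using VG.sm_zero[OF F] z0 W.VG.sm_zero[OF W.J_left] by simp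
 next
  case (mem s x)
  have sG: "s \<in> G" using mem J_sub by auto
  then show ?case using smG_smult[OF F sG mem(2)] ghomD(3)[OF f sG mem(2)] W.J_right[OF mem(1) ghomD(1)[OF f mem(2)]] by simp
 next
  case (neg s x)
  have sG: "\<ominus>\<^bsub>A\<^esub> s \<in> G" "s \<in> G" using neg J_sub G_closed(5) by auto
  have "\<ominus> (s \<odot> x) = (\<ominus>\<^bsub>A\<^esub> s) \<odot> x" using V.smult_minus_l Gc[OF sG(2)] VG.smD[OF F neg(2)] by simp
  moreover have "\<ominus>\<^bsub>A\<^esub> s \<in> JJ" using W.VG.sm_neg[OF W.J_left neg(1)] by simp
  ultimately show ?case
   using smG_smult[OF F sG(1) neg(2)] ghomD(3)[OF f sG(1) neg(2)] W.J_right[OF _ ghomD(1)[OF f neg(2)]] by simp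
 next
  case (add u v)
  then show ?case using VG.sm_add[OF F] ghomD(2)[OF f] W.VG.sm_add[OF W.J_left] by simp
 qed
qed

text \<open>Write 1 as a sum of products \<open>ba\<close> with \<open>b\<close> in the inverse of
  \<open>J\<close> and \<open>a\<close> in \<open>J\<close>. Since \<open>\<phi>(w) \<in> J\<close>
  for \<open>w\<close> in \<open>JF\<close>, the map \<open>w \<mapsto> \<phi>(w)b\<close> is a
  linear form on \<open>JF\<close>, and \<open>au\<close> lies in \<open>JF\<close>. So
  \<open>\<phi>(w)u\<close> is a sum of terms of the required shape.\<close>

lemma fr_JX_step:
 assumes F: "smG F" and f: "ghom A G V F RA G \<phi>" and u: "u \<in> F"
 shows "\<exists>h. frV (JX F) (JX F) h \<and> (\<forall>w\<in>JX F. h w = \<phi> w \<odot> u)"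
proof -
 have JF: "smG (JX F)" by (rule smG_JX[OF F])
 have uc: "u \<in> carrier V" using VG.smD[OF F u] .
 have pw: "\<phi> w \<in> JJ" "w \<in> F" "\<phi> w \<in> carrier A" if "w \<in> JX F" for w using ghom_J[OF F f that] Jc by auto
 have Jc': "JJ \<subseteq> carrier RA" using Jc by auto
 have step1: "\<exists>h. frV (JX F) (JX F) h \<and> (\<forall>w\<in>JX F. h w = (\<phi> w \<cdot> b) \<odot> y)"
  if b: "b \<in> Ji" and y: "y \<in> JX F" for b y
 proof -
  have bc: "b \<in> carrier A" using b Ji_carrier by auto
  have g: "ghom A G V (JX F) RA G (\<lambda>w. \<phi> w \<cdot> b)"
   unfolding ghom_def
  proof (intro conjI ballI)
   fix w assume w: "w \<in> JX F"
   show "\<phi> w \<cdot> b \<in> G" by (rule tsi_inverse(2)[OF tsi_J pw(1)[OF w] b])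
   { fix w' assume w': "w' \<in> JX F"
    show "\<phi> (w \<oplus> w') \<cdot> b = \<phi> w \<cdot> b \<oplus>\<^bsub>RA\<^esub> \<phi> w' \<cdot> b"
     using ghomD(2)[OF f pw(2)[OF w] pw(2)[OF w']] pw(3)[OF w] pw(3)[OF w'] bc by (simp add: l_distr) }
   { fix a assume a: "a \<in> G"
    show "\<phi> (a \<odot> w) \<cdot> b = a \<odot>\<^bsub>RA\<^esub> (\<phi> w \<cdot> b)"
     using ghomD(3)[OF f a pw(2)[OF w]] pw(3)[OF w] bc Gc[OF a] by (simp add: m_assoc) }
  qed
  have yc: "y \<in> carrier V" using VG.smD[OF JF y] .
  show ?thesis
   by (rule exI[of _ "\<lambda>w. (\<phi> w \<cdot> b) \<odot> y \<oplus> \<zero>"])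
    (use fr.step[OF g y fr.zero] pw(3) bc yc V.smult_closed in auto)
 qed
 have main: "\<exists>h. frV (JX F) (JX F) h \<and> (\<forall>w\<in>JX F. h w = (\<phi> w \<cdot> t) \<odot> u)" if t: "t \<in> prd Ji JJ" for t
  using t Ji_carrier Jc'
 proof (induction rule: AA.V.ss_induct)
  case zero
  then show ?case using pw(3) uc by (intro exI[of _ "\<lambda>w. \<zero>"]) (auto intro: fr.zero simp: V.smult_zero_l)
 next
  case (mem b a)
  have c: "b \<in> carrier A" "a \<in> carrier A" using mem Ji_carrier Jc by auto
  obtain h where "frV (JX F) (JX F) h" "\<And>w. w \<in> JX F \<Longrightarrow> h w = (\<phi> w \<cdot> b) \<odot> (a \<odot> u)"
   using step1[OF mem(1) V.ss_mem[OF mem(2) u]] by auto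
  then show ?case using pw(3) c uc by (intro exI[of _ h]) (simp add: V.smult_assoc[symmetric] m_assoc)
 next
  case (neg b a)
  have c: "b \<in> carrier A" "a \<in> carrier A" using neg Ji_carrier Jc by auto
  have "\<ominus>\<^bsub>A\<^esub> a \<in> JJ" using W.VG.sm_neg[OF W.J_left neg(2)] by simp
  then obtain h where "frV (JX F) (JX F) h" "\<And>w. w \<in> JX F \<Longrightarrow> h w = (\<phi> w \<cdot> b) \<odot> ((\<ominus>\<^bsub>A\<^esub> a) \<odot> u)"
   using step1[OF neg(1) V.ss_mem[OF _ u]] by blast
  then show ?case using pw(3) c uc by (intro exI[of _ h]) (simp add: V.smult_assoc[symmetric] m_assoc r_minus)
 next
  case (add s t)
  then obtain h k where hk: "frV (JX F) (JX F) h" "\<And>w. w \<in> JX F \<Longrightarrow> h w = (\<phi> w \<cdot> s) \<odot> u"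
   "frV (JX F) (JX F) k" "\<And>w. w \<in> JX F \<Longrightarrow> k w = (\<phi> w \<cdot> t) \<odot> u" by auto
  have c: "s \<in> carrier A" "t \<in> carrier A" using add(1,2) prd_carrier[OF Ji_carrier, of JJ] Jc by auto
  obtain l where "frV (JX F) (JX F) l" "\<And>w. w \<in> JX F \<Longrightarrow> l w = h w \<oplus> k w"
   using fr_add[OF hk(1,3) JF] by auto
  then show ?case using hk(2,4) pw(3) c uc by (intro exI[of _ l]) (simp add: V.smult_l_distr r_distr)
 qed
 have "\<one>\<^bsub>A\<^esub> \<in> prd Ji JJ" using Ji_inv(1) G_closed(2) by simp
 from main[OF this] show ?thesis using pw(3) by auto
qed

lemma proj_JX: assumes F: "smG F" and P: "proj A G V F" shows "proj A G V (JX F)"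
proof -
 have JF: "smG (JX F)" by (rule smG_JX[OF F])
 obtain h where h: "frV F F h" "\<And>x. x \<in> F \<Longrightarrow> h x = x" using P by (auto simp: proj_def)
 have "\<exists>k. frV (JX F) (JX F) k \<and> (\<forall>w\<in>JX F. k w = h w)"
  using h(1)
 proof (induction rule: fr.induct)
  case zero then show ?case by (intro exI[of _ "\<lambda>x. \<zero>"]) (auto intro: fr.zero)
 next
  case (step \<phi> y h)
  then obtain k where k: "frV (JX F) (JX F) k" "\<And>w. w \<in> JX F \<Longrightarrow> k w = h w" by auto
  obtain l where l: "frV (JX F) (JX F) l" "\<And>w. w \<in> JX F \<Longrightarrow> l w = \<phi> w \<odot> y"
   using fr_JX_step[OF F step.hyps(1,2)] by auto
  obtain m where "frV (JX F) (JX F) m" "\<And>w. w \<in> JX F \<Longrightarrow> m w = l w \<oplus> k w"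
   using fr_add[OF l(1) k(1) JF] by auto
  then show ?case using k(2) l(2) by (intro exI[of _ m]) auto
 qed
 then show ?thesis using h(2) JX_sub[OF F] unfolding proj_def by fastforce
qed

text \<open>Let \<open>Z\<close> be a complement of \<open>X\<close> in \<open>F\<close> over
  \<open>JF\<close>. The identity of \<open>F\<close> splits as \<open>k + l\<close> with values in
  \<open>X\<close> and \<open>Z\<close>. On \<open>X\<close>, the part \<open>l\<close> has values
  in \<open>X \<inter> Z = JF\<close>; composed with the dual basis of \<open>JF\<close> it involves
  only elements of \<open>X\<close>.\<close>

lemma proj_maximal:
 assumes fF: "fg R0 V F" and P: "proj A G V F" and s: "simpq AG V X F"
 shows "proj A G V X"
proof -
 have F: "smG F" and X: "smG X" "X \<subseteq> F" using s by (auto simp: simpq_def)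
 have JF: "smG (JX F)" by (rule smG_JX[OF F])
 obtain Z where Z: "smG Z" "JX F \<subseteq> Z" "Z \<subseteq> F" "X \<inter> Z = JX F" "X <+> Z = F"
  using complement[OF fG fF F X(1) JF order_refl JX_le[OF s] X(2)] by auto
 obtain h where h: "frV F F h" "\<And>x. x \<in> F \<Longrightarrow> h x = x" using P by (auto simp: proj_def)
 obtain k l where kl: "frV F X k" "frV F Z l" "\<And>x. x \<in> F \<Longrightarrow> h x = k x \<oplus> l x"
  using fr_split[of V F X Z h] h(1) Z X(1) by auto
 have kX: "frV X X k" by (rule fr_restrict[OF kl(1) X(2)])
 have lZ: "frV X Z l" by (rule fr_restrict[OF kl(2) X(2)])
 have e: "x = k x \<oplus> l x" if "x \<in> X" for x using kl(3) h(2) that X(2) by (metis subsetD)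
 have lX: "l x \<in> JX F" if x: "x \<in> X" for x
 proof -
  have kx: "k x \<in> X" by (rule fr_mem[OF kX X(1) x])
  have lx: "l x \<in> Z" by (rule fr_mem[OF lZ Z(1) x])
  have "l x = x \<ominus> k x" using e[OF x] V.M.add_diff_cancel'[OF VG.smD[OF X(1) kx] VG.smD[OF Z(1) lx]] by metis
  then have "l x \<in> X" using VG.sm_minus[OF X(1) x kx] by simp
  then show ?thesis using lx Z(4) by auto
 qed
 have "gh X Z l" by (rule fr_ghom[OF oiV oiV lZ X(1) Z(1)])
 then have gl: "gh X (JX F) l" using lX by (auto simp: ghom_def)
 obtain j where j: "frV (JX F) (JX F) j" "\<And>w. w \<in> JX F \<Longrightarrow> j w = w" using proj_JX[OF F P] by (auto simp: proj_def)
 have "frV X (JX F) (\<lambda>x. j (l x))" by (rule fr_comp[OF j(1) gl])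
 then have "frV X X (\<lambda>x. j (l x))" by (rule fr_mono[OF _ JX_le[OF s]])
 then obtain m where "frV X X m" "\<And>x. x \<in> X \<Longrightarrow> m x = k x \<oplus> j (l x)"
  using fr_add[OF kX _ X(1)] by blast
 then show ?thesis using e j(2) lX unfolding proj_def by (intro exI[of _ m]) auto
qed

lemma proj_ci: "ci AG V X F m \<Longrightarrow> fg R0 V F \<Longrightarrow> proj A G V F \<Longrightarrow> proj A G V X"
proof (induction rule: ci.induct)
 case (step Y Z m X)
 have s: "smG Z" "Z \<subseteq> X" using step.hyps(2) by (auto simp: simpq_def)
 show ?case by (rule step.IH[OF noeth[OF step.prems(1) smG_smR[OF s(1)] s(2)] proj_maximal[OF step.prems step.hyps(2)]])
qed

end

section \<open>Projectivity of left ideals in a semisimple algebra\<close>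

locale hereditary = max_order +
 assumes compl: "submodule B A RA \<Longrightarrow> \<exists>C. submodule C A RA \<and> B \<inter> C = {\<zero>} \<and> B <+>\<^bsub>RA\<^esub> C = carrier A"
begin

sublocale WM: max_order_module A R0 p pinv G RA
 by (intro max_order_module.intro max_order_axioms W.order_in_axioms)

lemma proj_G: "proj A G RA G"
proof -
 have "ghom A G RA G RA G (\<lambda>x. x)" by (auto simp: ghom_def)
 then have "fr A G RA G RA G (\<lambda>x. x \<odot>\<^bsub>RA\<^esub> \<one> \<oplus>\<^bsub>RA\<^esub> \<zero>\<^bsub>RA\<^esub>)" by (rule fr.step[OF _ W.G_closed(2) fr.zero])
 then show ?thesis unfolding proj_def using W.Gc by (intro exI[of _ "\<lambda>x. x \<odot>\<^bsub>RA\<^esub> \<one> \<oplus>\<^bsub>RA\<^esub> \<zero>\<^bsub>RA\<^esub>"]) auto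
qed

text \<open>\<open>Y\<close> may span a proper left ideal of \<open>A\<close>, so that it is not
  reached from \<open>G\<close> by successive maximal submodules. Let \<open>e\<close> be the
  projection of \<open>A\<close> onto \<open>AY\<close>. The left ideal of all \<open>g\<close> in
  \<open>G\<close> with \<open>ge \<in> p^kY\<close> has finite index in \<open>G\<close> and is
  projective; \<open>Y\<close> is a retract of it by \<open>y \<mapsto> p^ky\<close> and
  \<open>z \<mapsto> p^(-k)ze\<close>.\<close>

lemma proj_left_ideal:
 assumes Y: "W.smG Y" and fY: "fg R0 RA Y"
 shows "proj A G RA Y"
proof -
 have Yc: "Y \<subseteq> carrier A" using W.VG.sm_carrier[OF Y] by simp
 note sY = W.smG_smR[OF Y]
 let ?B = "{a \<in> carrier A. \<exists>k::nat. pp k \<cdot> a \<in> Y}"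
 have B: "submodule ?B A RA"
 proof (rule AA.V.submoduleI)
  show "\<zero>\<^bsub>RA\<^esub> \<in> ?B" using W.VG.sm_zero[OF Y] by auto
  fix x y assume "x \<in> ?B" "y \<in> ?B"
  then obtain j k where jk: "pp j \<cdot> x \<in> Y" "pp k \<cdot> y \<in> Y" and c: "x \<in> carrier A" "y \<in> carrier A" by auto
  have "pp (max j k) \<cdot> x \<in> Y" "pp (max j k) \<cdot> y \<in> Y"
   using AA.pw_le[OF sY, of x j "max j k"] AA.pw_le[OF sY, of y k "max j k"] jk c by auto
  then have "pp (max j k) \<cdot> (x \<oplus> y) \<in> Y" using W.VG.sm_add[OF Y] c by (simp add: r_distr)
  then show "x \<oplus>\<^bsub>RA\<^esub> y \<in> ?B" using c by auto
 next
  fix a x assume a: "a \<in> carrier A" and "x \<in> ?B"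
  then obtain k where k: "pp k \<cdot> x \<in> Y" and c: "x \<in> carrier A" by auto
  obtain j where j: "pp j \<cdot> a \<in> G" using AA.lat_absb[OF ordD(2)[OF ordG], of a] a by auto
  have "(pp j \<cdot> a) \<cdot> (pp k \<cdot> x) \<in> Y" using W.smG_smult[OF Y j k] by simp
  moreover have "(pp j \<cdot> a) \<cdot> (pp k \<cdot> x) = pp (j + k) \<cdot> (a \<cdot> x)"
  proof -
   have "(pp j \<cdot> a) \<cdot> (pp k \<cdot> x) = pp j \<cdot> (a \<cdot> pp k) \<cdot> x" using a c by (simp add: m_assoc)
   also have "\<dots> = pp j \<cdot> (pp k \<cdot> a) \<cdot> x" using p_central[OF a, of k] by simp
   also have "\<dots> = pp (j + k) \<cdot> (a \<cdot> x)" using a c by (simp add: m_assoc nat_pow_mult[symmetric])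
   finally show ?thesis .
  qed
  ultimately have "pp (j + k) \<cdot> (a \<cdot> x) \<in> Y" by simp
  then show "a \<odot>\<^bsub>RA\<^esub> x \<in> ?B" using a c by auto
 qed auto
 obtain C where C: "submodule C A RA" "?B \<inter> C = {\<zero>}" "?B <+>\<^bsub>RA\<^esub> C = carrier A" using compl[OF B] by blast
 have YB: "y \<in> ?B" if "y \<in> Y" for y using that Yc by (auto intro!: exI[of _ "0::nat"])
 text \<open>Right multiplication by the component \<open>e\<close> of \<open>1\<close> is the projection onto \<open>AY\<close>.\<close>
 have "\<one> \<in> ?B <+>\<^bsub>RA\<^esub> C" using C(3) by simp
 then obtain e f where ef: "e \<in> ?B" "f \<in> C" "\<one> = e \<oplus> f" unfolding AA.V.sum_iff by auto
 have ec: "e \<in> carrier A" "f \<in> carrier A" using ef(1) AA.V.smD[OF C(1) ef(2)] by auto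
 obtain j where j: "pp j \<cdot> e \<in> Y" using ef(1) by auto
 have ye: "y \<cdot> e = y" if y: "y \<in> Y" for y
 proof -
  have yc: "y \<in> carrier A" using y Yc by auto
  have sum: "y = y \<cdot> e \<oplus> y \<cdot> f" using r_distr[OF ec yc] unfolding ef(3)[symmetric] using yc by simp
  have "y \<cdot> f = y \<ominus> y \<cdot> e" using add_diff_cancel'[of "y \<cdot> e" "y \<cdot> f"] sum yc ec by simp
  moreover have "y \<cdot> e \<in> ?B" using AA.V.sm_smult[OF B, of y e] ef(1) yc by simp
  ultimately have "y \<cdot> f \<in> ?B" using AA.V.sm_minus[OF B YB[OF y]] by simp
  moreover have "y \<cdot> f \<in> C" using AA.V.sm_smult[OF C(1), of y f] ef(2) yc by simp
  ultimately have "y \<cdot> f = \<zero>" using C(2) by auto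
  then show ?thesis using sum yc ec by simp
 qed
 obtain k where k: "AA.pX k Y \<subseteq> G" using AA.lat_absorb[OF fY ordD(2)[OF ordG]] by auto
 have pY: "W.smG (AA.pX k Y)" by (rule W.smG_pX[OF Y])
 let ?Z = "{g \<in> G. g \<cdot> e \<in> AA.pX k Y}"
 have Z: "W.smG ?Z"
  by (rule W.VG.submoduleI)
   (use W.Gc W.G_closed ec W.VG.sm_zero[OF pY] W.VG.sm_add[OF pY] W.smG_smult[OF pY] in \<open>auto simp: l_distr m_assoc simp del: image_iff\<close>)
 \<comment> \<open>The exponents add up: \<open>p^je\<close> lies in \<open>Y\<close>, and
   \<open>p^k\<close> moves \<open>Y\<close> into \<open>p^kY\<close>.\<close>
 have "AA.pX (k + j) G \<subseteq> ?Z"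
 proof
  fix x assume "x \<in> AA.pX (k + j) G"
  then obtain g where g: "g \<in> G" "x = pp (k + j) \<cdot> g" by auto
  have gc: "g \<in> carrier A" by (rule W.Gc[OF g(1)])
  have "x \<cdot> e = pp k \<cdot> (pp j \<cdot> g) \<cdot> e" using g(2) gc by (simp add: nat_pow_mult[symmetric] m_assoc)
  also have "\<dots> = pp k \<cdot> (g \<cdot> (pp j \<cdot> e))" using gc ec p_central[OF gc, of j] by (simp add: m_assoc)
  finally have "x \<cdot> e \<in> AA.pX k Y" using W.smG_smult[OF Y g(1) j] by auto
  then show "x \<in> ?Z" using W.G_closed(4)[OF W.pG g(1)] g(2) by simp
 qed
 then have "finite (between W.AG RA ?Z G)"
  by (intro W.VG.fin_index_between AA.fin_index_lat[OF fG W.smG_smR[OF Z]])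
 then obtain m where "ci W.AG RA ?Z G m" using W.VG.ci_exists[OF _ GG Z] by auto
 then have "proj A G RA ?Z" by (rule WM.proj_ci[OF _ fG proj_G])
 then obtain h where h: "fr A G RA ?Z RA ?Z h" "\<And>x. x \<in> ?Z \<Longrightarrow> h x = x" by (auto simp: proj_def)
 have kZ: "pp k \<cdot> y \<in> ?Z" if y: "y \<in> Y" for y
 proof -
  have "(pp k \<cdot> y) \<cdot> e = pp k \<cdot> y" using ye[OF y] y Yc ec by (auto simp: m_assoc)
  moreover have "pp k \<cdot> y \<in> AA.pX k Y" using y by auto
  ultimately show ?thesis using k by auto
 qed
 have g1: "ghom A G RA Y RA ?Z (\<lambda>y. pp k \<cdot> y)"
  unfolding ghom_def
 proof (intro conjI ballI)
  fix y assume y: "y \<in> Y"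
  then have yc: "y \<in> carrier A" using Yc by auto
  show "pp k \<cdot> y \<in> ?Z" by (rule kZ[OF y])
  show "pp k \<cdot> (y \<oplus>\<^bsub>RA\<^esub> y') = pp k \<cdot> y \<oplus>\<^bsub>RA\<^esub> pp k \<cdot> y'" if "y' \<in> Y" for y'
   using yc that Yc by (auto simp: r_distr)
  show "pp k \<cdot> (a \<odot>\<^bsub>RA\<^esub> y) = a \<odot>\<^bsub>RA\<^esub> (pp k \<cdot> y)" if "a \<in> G" for a
   using yc AA.pw_comm[of a y k] W.Gc[OF that] by auto
 qed
 note fr1 = W.fr_comp[OF h(1) g1]
 define q where "q z = pv k \<cdot> (z \<cdot> e)" for z
 have qY: "q z \<in> Y" if "z \<in> ?Z" for z using that Yc AA.pw_cancel(1)[of _ k] by (auto simp: q_def)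
 have pcm: "pv k \<cdot> (a \<cdot> u) = a \<cdot> (pv k \<cdot> u)" if "a \<in> carrier A" "u \<in> carrier A" for a u
  using that pinv_central[of a k] by (simp add: m_assoc[symmetric])
 have qh: "qhom W.AG RA ?Z RA {\<zero>\<^bsub>RA\<^esub>} q"
  unfolding qhom_def W.VG.cong_0 q_def using W.Gc ec pcm by (auto simp: l_distr r_distr m_assoc)
 have qs: "\<exists>z\<in>Y. mcong RA {\<zero>\<^bsub>RA\<^esub>} z (q y)" if "y \<in> ?Z" for y
  using qY[OF that] Yc unfolding W.VG.cong_0 by auto
 have "\<exists>l. fr A G RA Y RA Y l \<and> (\<forall>x\<in>Y. mcong RA {\<zero>\<^bsub>RA\<^esub>} (l x) (q (h (pp k \<cdot> x))))"
  by (rule fr_lift[OF ordD(1)[OF ordG] ordD(1)[OF ordG] fr1 Z Y W.VG.sm_0 qh qs])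
 then obtain l where l: "fr A G RA Y RA Y l" "\<And>x. x \<in> Y \<Longrightarrow> l x = q (h (pp k \<cdot> x))"
  unfolding W.VG.cong_0 by auto
 have "l x = x" if x: "x \<in> Y" for x
 proof -
  have xc: "x \<in> carrier A" using x Yc by auto
  have "(pp k \<cdot> x) \<cdot> e = pp k \<cdot> x" using ye[OF x] xc ec by (simp add: m_assoc)
  then show ?thesis using l(2)[OF x] h(2)[OF kZ[OF x]] AA.pw_cancel(1)[of x k] xc by (simp add: q_def)
 qed
 then show ?thesis unfolding proj_def using l(1) by auto
qed

end

section \<open>Isomorphisms between lattices over a maximal order\<close>

context order_in
begin

lemma pX_qiso: assumes X: "smG X" and Z: "smG Z" "Z \<subseteq> X"
 shows "qiso AG V X Z V (pX k X) (pX k Z) (\<lambda>x. pp k \<odot> x)"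
proof -
 have pZ: "smG (pX k Z)" by (rule smG_pX[OF Z(1)])
 note r = VG.cong_refl[OF pZ] and Xc = VG.smD[OF X]
 have inj: "x = y" if "pp k \<odot> x = pp k \<odot> y" "x \<in> carrier V" "y \<in> carrier V" for x y
  by (metis pw_cancel(1) that)
 show ?thesis
  unfolding qiso_def qhom_def
 proof (intro conjI ballI)
  fix x assume x: "x \<in> X"
  show "pp k \<odot> x \<in> carrier V" using Xc x V.smult_closed by simp
  show "(pp k \<odot> x \<in> pX k Z) = (x \<in> Z)"
  proof
   assume "pp k \<odot> x \<in> pX k Z"
   then obtain z where "z \<in> Z" "pp k \<odot> x = pp k \<odot> z" by auto
   then show "x \<in> Z" using inj[of x z] Xc[OF x] VG.smD[OF Z(1)] by auto
  qed auto
  { fix y assume "y \<in> X"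
   then show "mcong V (pX k Z) (pp k \<odot> (x \<oplus> y)) (pp k \<odot> x \<oplus> pp k \<odot> y)"
    using r Xc x V.smult_closed by (simp add: V.smult_r_distr) }
  { fix a assume "a \<in> carrier AG"
   then have ac: "a \<in> carrier A" using Gc by simp
   show "mcong V (pX k Z) (pp k \<odot> (a \<odot> x)) (a \<odot> (pp k \<odot> x))"
    unfolding pw_comm[OF ac Xc[OF x]] using r Xc[OF x] ac V.smult_closed by simp }
 next
  fix x' assume "x' \<in> pX k X"
  then obtain x where x: "x \<in> X" "x' = pp k \<odot> x" by auto
  have "pp k \<odot> x \<in> carrier V" using Xc[OF x(1)] V.smult_closed by simp
  from r[OF this] show "\<exists>x\<in>X. mcong V (pX k Z) x' (pp k \<odot> x)" using x by blast
 qed auto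
qed

end

locale hereditary_module = hereditary A R0 p pinv G + max_order_module A R0 p pinv G V
 for A :: "('a, 'c) ring_scheme" and R0 p pinv G and V :: "('a, 'v, 'e) module_scheme" (structure) +
 assumes gens: "\<exists>vs. set vs \<subseteq> carrier V \<and> lspan (carrier A) V vs = carrier V"
begin

text \<open>Induction on the number of generators of \<open>V\<close> over \<open>A\<close>. Let
  \<open>C\<close> be a complement of the annihilator of \<open>v\<close> modulo the span
  \<open>V'\<close> of the others; then each element of \<open>X\<close> has a unique coefficient of
  \<open>v\<close> in \<open>C\<close>. These coefficients form a finitely generated
  \<open>G\<close>-submodule of \<open>A\<close>, which is projective, so \<open>X\<close> splits
  into it and \<open>X \<inter> V'\<close>.\<close>

lemma proj_lattice:
 assumes X: "smG X" and fX: "fg R0 V X"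
 shows "proj A G V X"
proof -
 have "set vs \<subseteq> carrier V \<Longrightarrow> smG X \<Longrightarrow> fg R0 V X \<Longrightarrow> X \<subseteq> lspan (carrier A) V vs \<Longrightarrow> proj A G V X" for vs X
 proof (induction vs arbitrary: X)
  case Nil
  then have "X = {\<zero>}" using VG.sm_zero by auto
  then show ?case unfolding proj_def by (intro exI[of _ "\<lambda>x. \<zero>"]) (auto intro: fr.zero)
 next
  case (Cons v vs)
  then have v: "v \<in> carrier V" and vs: "set vs \<subseteq> carrier V" and X: "smG X" by auto
  let ?V' = "lspan (carrier A) V vs"
  have V': "submodule ?V' A V" using V.lspan_submodule[OF vs] by simp
  let ?m = "{a \<in> carrier A. a \<odot> v \<in> ?V'}"
  have m: "submodule ?m A RA"
   by (rule AA.V.submoduleI)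
    (use v V.sm_zero[OF V'] V.sm_add[OF V'] V.sm_smult[OF V'] in
     \<open>auto simp: V.smult_zero_l V.smult_l_distr V.smult_assoc\<close>)
  obtain C where C: "submodule C A RA" "?m \<inter> C = {\<zero>\<^bsub>A\<^esub>}" "?m <+>\<^bsub>RA\<^esub> C = carrier A" using compl[OF m] by auto
  have Cc: "C \<subseteq> carrier A" using AA.V.sm_carrier[OF C(1)] by simp
  have ex: "\<exists>c\<in>C. mcong V ?V' x (c \<odot> v)" if x: "x \<in> X" for x
  proof -
   have "x \<in> lspan (carrier A) V (v # vs)" using Cons.prems(4) x by auto
   then obtain a t where at: "a \<in> carrier A" "t \<in> ?V'" "x = a \<odot> v \<oplus> t" by auto
   have "a \<in> ?m <+>\<^bsub>RA\<^esub> C" using at C(3) by simp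
   then obtain b c where bc: "b \<in> ?m" "c \<in> C" "a = b \<oplus>\<^bsub>RA\<^esub> c" unfolding AA.V.sum_iff by blast
   have cc: "b \<in> carrier A" "c \<in> carrier A" "t \<in> carrier V" using bc Cc V.smD[OF V' at(2)] by auto
   have "x = c \<odot> v \<oplus> (b \<odot> v \<oplus> t)"
    unfolding at(3) bc(3) using cc v by (simp add: V.smult_l_distr V.smult_closed V.M.a_ac)
   then have "x \<ominus> c \<odot> v = b \<odot> v \<oplus> t"
    using V.M.add_diff_cancel'[of "c \<odot> v" "b \<odot> v \<oplus> t"] cc v V.smult_closed by simp
   moreover have "b \<odot> v \<oplus> t \<in> ?V'" using V.sm_add[OF V'] bc at by auto
   ultimately have "mcong V ?V' x (c \<odot> v)" using VG.smD[OF X x] cc v V.smult_closed by (simp add: mcong_def)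
   then show ?thesis using bc by auto
  qed
  then obtain F where F: "\<And>x. x \<in> X \<Longrightarrow> F x \<in> C" "\<And>x. x \<in> X \<Longrightarrow> mcong V ?V' x (F x \<odot> v)" by metis
  \<comment> \<open>The difference of two such coefficients annihilates \<open>v\<close> modulo
    \<open>V'\<close> and lies in \<open>C\<close>, so it is 0.\<close>
  have uniq: "c = c'" if "c \<in> C" "c' \<in> C" "mcong V ?V' (c \<odot> v) (c' \<odot> v)" for c c'
  proof -
   have cc: "c \<in> carrier A" "c' \<in> carrier A" using that Cc by auto
   have "(c \<ominus>\<^bsub>A\<^esub> c') \<odot> v \<in> ?V'" using that(3) cc v
    by (simp add: mcong_def minus_eq V.M.minus_eq V.smult_l_distr V.smult_minus_l)
   moreover have "c \<ominus>\<^bsub>A\<^esub> c' \<in> C" using AA.V.sm_minus[OF C(1) that(1,2)] by simp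
   ultimately have "c \<ominus>\<^bsub>A\<^esub> c' \<in> ?m \<inter> C" using cc by simp
   then have "c \<ominus>\<^bsub>A\<^esub> c' = \<zero>\<^bsub>A\<^esub>" using C(2) by auto
   then show ?thesis using diff_add_cancel[OF cc] cc by simp
  qed
  have Fg: "ghom A G V X RA (F ` X) F"
   unfolding ghom_def
  proof (intro conjI ballI)
   fix x assume x: "x \<in> X"
   show "F x \<in> F ` X" using x by simp
   { fix y assume y: "y \<in> X"
    have "mcong V ?V' (x \<oplus> y) ((F x \<oplus>\<^bsub>A\<^esub> F y) \<odot> v)"
     using V.cong_add[OF V' F(2)[OF x] F(2)[OF y]] F(1)[OF x] F(1)[OF y] Cc v by (simp add: V.smult_l_distr subset_iff)
    moreover have "mcong V ?V' (x \<oplus> y) (F (x \<oplus> y) \<odot> v)" by (rule F(2)[OF VG.sm_add[OF X x y]])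
    ultimately have "mcong V ?V' (F (x \<oplus> y) \<odot> v) ((F x \<oplus>\<^bsub>A\<^esub> F y) \<odot> v)"
     using V.cong_trans[OF V' V.cong_sym[OF V']] by blast
    moreover have "F x \<oplus>\<^bsub>A\<^esub> F y \<in> C" using AA.V.sm_add[OF C(1) F(1)[OF x] F(1)[OF y]] by simp
    ultimately show "F (x \<oplus> y) = F x \<oplus>\<^bsub>RA\<^esub> F y" using uniq[OF F(1)[OF VG.sm_add[OF X x y]]] by simp }
   { fix a assume a: "a \<in> G"
    have ax: "a \<odot> x \<in> X" by (rule smG_smult[OF X a x])
    have "mcong V ?V' (a \<odot> x) ((a \<cdot> F x) \<odot> v)"
     using V.cong_smult[OF V' F(2)[OF x] Gc[OF a]] F(1)[OF x] Cc v Gc[OF a] by (simp add: V.smult_assoc subset_iff)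
    then have "mcong V ?V' (F (a \<odot> x) \<odot> v) ((a \<cdot> F x) \<odot> v)"
     using V.cong_trans[OF V' V.cong_sym[OF V' F(2)[OF ax]]] by blast
    moreover have "a \<cdot> F x \<in> C" using AA.V.sm_smult[OF C(1) Gc[OF a] F(1)[OF x]] by simp
    ultimately show "F (a \<odot> x) = a \<odot>\<^bsub>RA\<^esub> F x" using uniq[OF F(1)[OF ax]] by simp }
  qed
  note g = ghomD[OF Fg]
  let ?Y = "F ` X"
  have Y: "W.smG ?Y"
  proof (rule two_modules.image_sm[OF _ X])
   show "two_modules AG V RA" by (simp add: two_modules_def VG.left_module_axioms W.VG.left_module_axioms)
  qed (use g F(1) Cc in auto)
  have fY: "fg R0 RA ?Y"
   by (rule fg_image[OF om reg Cons.prems(3)]) (use g R0G F(1) Cc in auto)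
  obtain h where h: "fr A G RA ?Y RA ?Y h" "\<And>y. y \<in> ?Y \<Longrightarrow> h y = y"
   using proj_left_ideal[OF Y fY] by (auto simp: proj_def)
  have hF: "fr A G V X RA ?Y (\<lambda>x. h (F x))" by (rule W.fr_comp[OF h(1) Fg])
  obtain k where k: "frV X X k" "\<And>x. x \<in> X \<Longrightarrow> F (k x) = h (F x)"
   using fr_lift_surj[OF oiV W.order_in_axioms hF X Y Fg] by blast
  have Fk: "F (k x) = F x" if "x \<in> X" for x using k(2)[OF that] h(2) that by auto
  let ?X' = "X \<inter> ?V'"
  have V'G: "smG ?V'"
   by (rule VG.submoduleI)
    (use V.sm_carrier[OF V'] V.sm_zero[OF V'] V.sm_add[OF V'] V.sm_smult[OF V'] Gc in auto)
  have X': "smG ?X'" by (rule VG.sm_Int[OF X V'G])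
  have fX': "fg R0 V ?X'" by (rule noeth[OF Cons.prems(3) smG_smR[OF X']]) auto
  have "proj A G V ?X'" by (rule Cons.IH[OF vs X' fX']) auto
  then obtain j where j: "frV ?X' ?X' j" "\<And>x. x \<in> ?X' \<Longrightarrow> j x = x" by (auto simp: proj_def)
  have kg: "gh X X k" by (rule fr_ghom[OF oiV oiV k(1) X X])
  have kc: "k x \<in> carrier V" if "x \<in> X" for x using VG.smD[OF X ghomD(1)[OF kg that]] .
  have rX: "x \<ominus> k x \<in> ?X'" if x: "x \<in> X" for x
  proof -
   have kx: "k x \<in> X" by (rule ghomD(1)[OF kg x])
   have "mcong V ?V' (k x) (F x \<odot> v)" using F(2)[OF kx] Fk[OF x] by simp
   then have "mcong V ?V' x (k x)" using V.cong_trans[OF V' F(2)[OF x] V.cong_sym[OF V']] by blast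
   then show ?thesis using VG.sm_minus[OF X x kx] by (simp add: mcong_def)
  qed
  have "gh X ?X' (\<lambda>x. x \<ominus> k x)"
   unfolding ghom_def
  proof (intro conjI ballI)
   fix x assume x: "x \<in> X"
   show "x \<ominus> k x \<in> ?X'" by (rule rX[OF x])
   note xc = VG.smD[OF X x] kc[OF x]
   { fix y assume y: "y \<in> X"
    note yc = VG.smD[OF X y] kc[OF y]
    show "x \<oplus> y \<ominus> k (x \<oplus> y) = x \<ominus> k x \<oplus> (y \<ominus> k y)"
     unfolding ghomD(2)[OF kg x y] using xc yc by (simp add: V.M.minus_eq V.M.minus_add V.M.a_ac) }
   { fix a assume a: "a \<in> G"
    show "a \<odot> x \<ominus> k (a \<odot> x) = a \<odot> (x \<ominus> k x)"
     unfolding ghomD(3)[OF kg a x] using xc Gc[OF a] by (simp add: V.smult_diff) }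
  qed
  then have "frV X ?X' (\<lambda>x. j (x \<ominus> k x))" by (rule fr_comp[OF j(1)])
  then have "frV X X (\<lambda>x. j (x \<ominus> k x))" by (rule fr_mono) auto
  then obtain l where l: "frV X X l" "\<And>x. x \<in> X \<Longrightarrow> l x = k x \<oplus> j (x \<ominus> k x)"
   using fr_add[OF k(1) _ X] by blast
  have "l x = x" if x: "x \<in> X" for x
   using l(2)[OF x] j(2)[OF rX[OF x]] V.M.diff_add_cancel'[OF VG.smD[OF X x] kc[OF x]] by simp
  then show ?case unfolding proj_def using l(1) by auto
 qed
 then show ?thesis using gens assms VG.sm_carrier[OF X] by blast
qed

text \<open>Multiplication by \<open>J\<close> and by its inverse are mutually inverse and monotone
  on submodules, so \<open>JX / JZ\<close> is simple. The annihilator of \<open>X / Z\<close>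
  commutes with \<open>J\<close>, hence kills \<open>JX / JZ\<close> too, and
  \<open>schur_ann\<close> applies.\<close>

lemma JX_simple:
 assumes s: "simpq AG V Z X" and fX: "fg R0 V X"
 shows "simpq AG V (JX Z) (JX X)" and "cl AG V (JX X) (JX Z) = cl AG V X Z"
proof -
 have X: "smG X" and Z: "smG Z" "Z \<subseteq> X" "Z \<noteq> X" using s by (auto simp: simpq_def)
 have Xc: "X \<subseteq> carrier V" and Zc: "Z \<subseteq> carrier V" using VG.sm_carrier X Z by auto
 have Jc': "JJ \<subseteq> carrier A" using Jc by auto
 have JXc: "JX Y \<subseteq> carrier V" if "Y \<subseteq> carrier V" for Y by (rule V.ss_carrier[OF Jc' that])
 have inv1: "set_smult V Ji (JX Y) = Y" if Y: "smG Y" for Y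
  using V.ss_assoc[OF Ji_carrier Jc' VG.sm_carrier[OF Y]] Ji_inv(1) V.ss_one[OF Y G] by simp
 have inv2: "JX (set_smult V Ji Y) = Y" if Y: "smG Y" for Y
  using V.ss_assoc[OF Jc' Ji_carrier VG.sm_carrier[OF Y]] Ji_inv(2) V.ss_one[OF Y G] by simp
 have JiG: "smG (set_smult V Ji Y)" if Y: "smG Y" for Y
 proof (rule V.ss_submodule[OF G Ji_carrier VG.sm_carrier[OF Y]])
  fix g s x assume *: "g \<in> G" "s \<in> Ji" "x \<in> Y"
  have "g \<cdot> s \<in> Ji" by (rule qinv_closed(2)[OF Jc' *(2,1)]) (rule W.J_right[OF _ *(1)])
  moreover have "s \<in> carrier A" using *(2) Ji_carrier by auto
  ultimately show "g \<odot> (s \<odot> x) \<in> set_smult V Ji Y"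
   using V.ss_mem[of "g \<cdot> s" Ji x Y] * V.smult_assoc[of g s x] Gc VG.smD[OF Y] by simp
 qed
 show s': "simpq AG V (JX Z) (JX X)"
  unfolding simpq_def
 proof (intro conjI allI impI)
  show "smG (JX Z)" "smG (JX X)" using smG_JX X Z by auto
  show "JX Z \<subseteq> JX X" by (rule JX_mono[OF Z(2) Xc])
  show "JX Z \<noteq> JX X" using inv1[OF X] inv1[OF Z(1)] Z(3) by metis
  fix U assume U: "smG U" "JX Z \<subseteq> U" "U \<subseteq> JX X"
  have "set_smult V Ji (JX Z) \<subseteq> set_smult V Ji U" by (rule V.ss_mono[OF order_refl U(2) Ji_carrier VG.sm_carrier[OF U(1)]])
  moreover have "set_smult V Ji U \<subseteq> set_smult V Ji (JX X)" by (rule V.ss_mono[OF order_refl U(3) Ji_carrier JXc[OF Xc]])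
  ultimately have "set_smult V Ji U = Z \<or> set_smult V Ji U = X"
   using s JiG[OF U(1)] unfolding inv1[OF X] inv1[OF Z(1)] simpq_def by auto
  then show "U = JX Z \<or> U = JX X" using inv2[OF U(1)] by auto
 qed
 let ?P = "{a \<in> G. \<forall>x\<in>X. a \<odot> x \<in> Z}"
 have "pX 1 X \<subseteq> Z" by (rule simpq_p[OF fX s])
 then have pP: "pp 1 \<in> ?P" using pG[of 1] by auto
 have P: "TSI ?P"
  unfolding tsi_def
 proof (intro conjI)
  show "W.smG ?P"
   by (rule W.VG.submoduleI)
    (use Gc G_closed Xc VG.sm_zero[OF Z(1)] VG.sm_add[OF Z(1)] smG_smult[OF Z(1)] in
     \<open>auto simp: V.smult_zero_l V.smult_l_distr V.smult_assoc subset_iff\<close>)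
  show "\<forall>b\<in>?P. \<forall>g\<in>G. b \<cdot> g \<in> ?P"
   using Gc G_closed Xc smG_smult[OF X] by (auto simp: V.smult_assoc subset_iff)
  show "\<exists>k::nat. pp k \<in> ?P" using pP by blast
 qed auto
 have JP: "JJ \<subseteq> ?P" using J_ann[OF s] J_sub by auto
 note PJ = J_commutes[OF P JP]
 have Pc: "?P \<subseteq> carrier A" using Gc by auto
 have PXZ: "set_smult V ?P X \<subseteq> Z" by (rule V.ss_least[OF Pc Xc Z(1)]) auto
 have "set_smult V ?P (JX X) = set_smult V (prd ?P JJ) X" using V.ss_assoc[OF Pc Jc' Xc] by simp
 also have "\<dots> = JX (set_smult V ?P X)" unfolding PJ by (rule V.ss_assoc[OF Jc' Pc Xc])
 also have "\<dots> \<subseteq> JX Z" by (rule JX_mono[OF PXZ Zc])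
 finally have PJX: "set_smult V ?P (JX X) \<subseteq> JX Z" .
 have "cl AG V X Z = cl AG V (JX X) (JX Z)"
 proof (rule schur_ann[OF fG s s'])
  fix a x assume "a \<in> G" "\<And>x. x \<in> X \<Longrightarrow> a \<odot> x \<in> Z" "x \<in> JX X"
  then show "a \<odot> x \<in> JX Z" using V.ss_mem[of a ?P x "JX X"] PJX by auto
 qed
 then show "cl AG V (JX X) (JX Z) = cl AG V X Z" by simp
qed

lemma fin_JX: "\<lbrakk>fg R0 V X; smG X; JX X \<subseteq> Z\<rbrakk> \<Longrightarrow> finite (between AG V Z X)"
 using VG.fin_index_between[OF VR.fin_index_mono[OF fin_index_JX[OF fG]]] by blast

lemma fin_lat: "\<lbrakk>fg R0 V X; full Z\<rbrakk> \<Longrightarrow> finite (between AG V Z X)"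
 using VG.fin_index_between[OF lat_fin_index] by blast

text \<open>For a maximal submodule \<open>Z\<close> of \<open>X\<close>, the chain
  \<open>X\<close>, \<open>Z\<close>, \<open>JX\<close>, \<open>JZ\<close> gives
  \<open>[X/JX] = [X/Z][Z/JX]\<close> and \<open>[Z/JZ] = [Z/JX][JX/JZ]\<close>, where
  \<open>[X/Z] = [JX/JZ]\<close>.\<close>

lemma cl_JX_ci: "ci AG V Z X m \<Longrightarrow> fg R0 V X \<Longrightarrow> cl AG V X (JX X) = cl AG V Z (JX Z)"
proof (induction rule: ci.induct)
 case (step Y Z m X)
 have s: "smG Z" "smG X" "Z \<subseteq> X" using step.hyps(2) by (auto simp: simpq_def)
 have fZ: "fg R0 V Z" by (rule noeth[OF step.prems smG_smR[OF s(1)] s(3)])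
 note js = JX_simple[OF step.hyps(2) step.prems]
 have le: "JX X \<subseteq> Z" by (rule JX_le[OF step.hyps(2)])
 have le2: "JX Z \<subseteq> JX X" by (rule JX_mono[OF s(3) VG.sm_carrier[OF s(2)]])
 have "cl AG V X (JX X) = cl AG V X Z + cl AG V Z (JX X)"
  by (rule VG.cl_add[OF fin_JX[OF step.prems s(2) order_refl] s(2,1) smG_JX[OF s(2)] le s(3)])
 moreover have "cl AG V Z (JX Z) = cl AG V Z (JX X) + cl AG V (JX X) (JX Z)"
  by (rule VG.cl_add[OF fin_JX[OF fZ s(1) order_refl] s(1) smG_JX[OF s(2)] smG_JX[OF s(1)] le2 le])
 ultimately show ?case using step.IH[OF fZ] js(2) by (simp add: add.commute)
qed simp

text \<open>Both lattices are compared with their intersection, which is again full.\<close>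

lemma cl_JX_lat:
 assumes X: "full X" "smG X" and Y: "full Y" "smG Y"
 shows "cl AG V X (JX X) = cl AG V Y (JX Y)"
proof -
 have I: "full (X \<inter> Y)" "smG (X \<inter> Y)" using lat_Int[OF X(1) Y(1)] VG.sm_Int[OF X(2) Y(2)] by auto
 have "cl AG V Z (JX Z) = cl AG V (X \<inter> Y) (JX (X \<inter> Y))" if Z: "full Z" "smG Z" "X \<inter> Y \<subseteq> Z" for Z
 proof -
  obtain m where "ci AG V (X \<inter> Y) Z m"
   using VG.ci_exists[OF fin_lat[OF lat_fg[OF Z(1)] I(1)] Z(2) I(2) Z(3)] by auto
  then show ?thesis by (rule cl_JX_ci[OF _ lat_fg[OF Z(1)]])
 qed
 from this[OF X] this[OF Y] show ?thesis by simp
qed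

text \<open>As before, with \<open>[X/Z] = [pX/pZ]\<close> given by multiplication by
  \<open>p\<close>. This is what later forces a surjection of full lattices to be injective.\<close>

lemma cl_pX_lat:
 assumes X: "full X" "smG X" and Y: "full Y" "smG Y"
 shows "cl AG V X (pX 1 X) = cl AG V Y (pX 1 Y)"
proof -
 have I: "full (X \<inter> Y)" "smG (X \<inter> Y)" using lat_Int[OF X(1) Y(1)] VG.sm_Int[OF X(2) Y(2)] by auto
 have "cl AG V Z (pX 1 Z) = cl AG V (X \<inter> Y) (pX 1 (X \<inter> Y))" if Z: "full Z" "smG Z" "X \<inter> Y \<subseteq> Z" for Z
 proof -
  interpret T: two_modules AG V V by (rule VG.two_self)
  have pI: "full (pX 1 (X \<inter> Y))" "smG (pX 1 (X \<inter> Y))"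
   by (rule latI_sub[OF I(1) smR_pX[OF smG_smR[OF I(2)]] pX_sub[OF smG_smR[OF I(2)]] order_refl], rule smG_pX[OF I(2)])
  have le: "pX 1 Z \<subseteq> Z" "pX 1 (X \<inter> Y) \<subseteq> X \<inter> Y" "pX 1 (X \<inter> Y) \<subseteq> pX 1 Z"
   by (rule pX_sub[OF smG_smR[OF Z(2)]], rule pX_sub[OF smG_smR[OF I(2)]], rule image_mono[OF Z(3)])
  have fin: "finite (between AG V (pX 1 (X \<inter> Y)) Z)" by (rule fin_lat[OF lat_fg[OF Z(1)] pI(1)])
  have "cl AG V Z (pX 1 Z) + cl AG V (pX 1 Z) (pX 1 (X \<inter> Y)) = cl AG V Z (X \<inter> Y) + cl AG V (X \<inter> Y) (pX 1 (X \<inter> Y))"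
   using VG.cl_add[OF fin Z(2) smG_pX[OF Z(2)] pI(2) le(3,1)] VG.cl_add[OF fin Z(2) I(2) pI(2) le(2) Z(3)] by simp
  moreover have "cl AG V Z (X \<inter> Y) = cl AG V (pX 1 Z) (pX 1 (X \<inter> Y))"
   by (rule T.cl_qiso[OF Z(2) I(2) Z(3) smG_pX[OF Z(2)] pI(2) le(3) pX_qiso[OF Z(2) I(2) Z(3)] fin_lat[OF lat_fg[OF Z(1)] I(1)]])
  ultimately show ?thesis by simp
 qed
 from this[OF X] this[OF Y] show ?thesis by simp
qed

end

section \<open>Homomorphisms between lattices in \<open>V\<close>\<close>

context order_in
begin

lemma ghom_img_sm: assumes f: "gh X Y f" and X: "smG X" and Y: "smG Y" shows "smG (f ` X)"
 by (rule two_modules.image_sm[OF VG.two_self X]) (use ghomD[OF f] VG.smD[OF Y] in auto)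

lemma ghom_zero: assumes f: "gh X Y f" and X: "smG X" and Y: "smG Y" shows "f \<zero> = \<zero>"
proof -
 note g = ghomD[OF f]
 have "f (\<zero>\<^bsub>A\<^esub> \<odot> \<zero>) = \<zero>\<^bsub>A\<^esub> \<odot> f \<zero>" by (rule g(3)[OF G_closed(1) VG.sm_zero[OF X]])
 then show "f \<zero> = \<zero>" using VG.smD[OF Y g(1)[OF VG.sm_zero[OF X]]] by (simp add: V.smult_zero_l)
qed

lemma ghom_minus: assumes f: "gh X Y f" and X: "smG X" and Y: "smG Y" and xy: "x \<in> X" "y \<in> X"
 shows "f (x \<ominus> y) = f x \<ominus> f y"
proof -
 note g = ghomD[OF f]
 have d: "x \<ominus> y \<in> X" by (rule VG.sm_minus[OF X xy])
 have "f x = f ((x \<ominus> y) \<oplus> y)" using V.M.diff_add_cancel VG.smD[OF X] xy by simp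
 also have "\<dots> = f (x \<ominus> y) \<oplus> f y" by (rule g(2)[OF d xy(2)])
 finally show ?thesis
  using V.M.add_diff_cancel[OF VG.smD[OF Y g(1)[OF d]] VG.smD[OF Y g(1)[OF xy(2)]]] by simp
qed

lemma ghom_qiso:
 assumes f: "gh X Y f" and X: "smG X" and Y: "smG Y" and Z: "smG Z" "Z \<subseteq> T" and T: "smG T" "T \<subseteq> Y"
  and im: "f ` X \<subseteq> T" and onto: "\<And>t. t \<in> T \<Longrightarrow> \<exists>x\<in>X. mcong V Z t (f x)" and k: "\<And>x. x \<in> X \<Longrightarrow> f x \<in> Z \<longleftrightarrow> x \<in> K"
 shows "qiso AG V X K V T Z f"
proof -
 note g = ghomD[OF f]
 have fc: "x \<in> X \<Longrightarrow> f x \<in> carrier V" for x using VG.smD[OF Y g(1)] .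
 note r = VG.cong_refl[OF Z(1)]
 show ?thesis
  unfolding qiso_def qhom_def
 proof (intro conjI ballI)
  fix x assume x: "x \<in> X"
  show "f x \<in> carrier V" by (rule fc[OF x])
  show "(f x \<in> Z) = (x \<in> K)" by (rule k[OF x])
  { fix y assume y: "y \<in> X"
   show "mcong V Z (f (x \<oplus> y)) (f x \<oplus> f y)" unfolding g(2)[OF x y] using r fc x y by simp }
  { fix a assume "a \<in> carrier AG"
   then have a: "a \<in> G" by simp
   show "mcong V Z (f (a \<odot> x)) (a \<odot> f x)" unfolding g(3)[OF a x] using r fc x Gc[OF a] V.smult_closed by simp }
 qed (use im onto in auto)
qed

end

context hereditary_module
begin

text \<open>Nakayama's lemma for \<open>J\<close>. If \<open>T + pY\<close> is proper, a maximal
  submodule above it contains \<open>JY\<close> as well; otherwise Nakayama's lemma for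
  \<open>p\<close> applies.\<close>

lemma cover_by_radical:
 assumes fY: "fg R0 V Y" and Y: "smG Y" and T: "smG T" "T \<subseteq> Y" and c: "T <+> JX Y = Y"
 shows "T = Y"
proof -
 let ?B = "T <+> pX 1 Y"
 have pY: "smG (pX 1 Y)" by (rule smG_pX[OF Y])
 have B: "smG ?B" by (rule VG.sm_sum[OF T(1) pY])
 have BY: "?B \<subseteq> Y" by (rule VG.sum_least[OF Y T(2) pX_sub[OF smG_smR[OF Y]]])
 have pB: "pX 1 Y \<subseteq> ?B" by (rule VG.sum_upper2[OF T(1) pY])
 have "?B = Y"
 proof (rule ccontr)
  assume "?B \<noteq> Y"
  moreover have "finite (between AG V ?B Y)"
   by (rule VG.fin_index_between[OF VR.fin_index_mono[OF fin_index_pk[OF fY] pB]])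
  ultimately obtain M where M: "simpq AG V M Y" "?B \<subseteq> M" using ex_max[OF _ Y B BY] by auto
  have Ms: "smG M" "M \<subseteq> Y" "M \<noteq> Y" using M(1) by (auto simp: simpq_def)
  have "T <+> JX Y \<subseteq> M"
   by (rule VG.sum_least[OF Ms(1) subset_trans[OF VG.sum_upper1[OF T(1) pY] M(2)] JX_le[OF M(1)]])
  then show False using c Ms by auto
 qed
 have "Y \<subseteq> T"
 proof (rule nakayama[OF fY smG_smR[OF T(1)]])
  fix y assume y: "y \<in> Y"
  have "y \<in> pX 1 Y <+> T" using \<open>?B = Y\<close> y VG.sum_comm[OF T(1) pY] by simp
  then obtain u where "u \<in> pX 1 Y" "y \<ominus> u \<in> T" unfolding VG.sum_minus_iff[OF pY T(1)] by blast
  then show "\<exists>x'\<in>Y. mcong V T y (p \<odot> x')" using VG.smD[OF Y y] VG.smD[OF Y] V.smult_closed by (auto simp: mcong_def)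
 qed
 then show ?thesis using T(2) by auto
qed

text \<open>One step of the construction of an isomorphism \<open>W \<rightarrow> Y\<close>: the semisimple quotients \<open>W / JW\<close> and
 \<open>Y / JY\<close> have the same composition factors, so a simple constituent of the cokernel modulo the
 radical also occurs in the kernel, and the map can be modified there.\<close>

lemma enlarge_image:
 assumes Wl: "full W" "smG W" and Yl: "full Y" "smG Y" and N: "smG N"
  and eq: "W <+> N = Y <+> N"
  and th: "gh W Y \<theta>" "\<And>w. w \<in> W \<Longrightarrow> mcong V N (\<theta> w) w"
  and ne: "\<theta> ` W <+> JX Y \<noteq> Y"
 shows "\<exists>\<theta>'. gh W Y \<theta>' \<and> (\<forall>w\<in>W. mcong V N (\<theta>' w) w) \<and>
  \<theta> ` W <+> JX Y \<subset> \<theta>' ` W <+> JX Y"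
proof -
 interpret T: two_modules AG V V by (rule VG.two_self)
 note fW = lat_fg[OF Wl(1)] and fY = lat_fg[OF Yl(1)]
 note g = ghomD[OF th(1)]
 have JY: "smG (JX Y)" and JW: "smG (JX W)" using smG_JX Wl Yl by auto
 have JYY: "JX Y \<subseteq> Y" and JWW: "JX W \<subseteq> W" using JX_sub Wl Yl by auto
 have tW: "smG (\<theta> ` W)" by (rule ghom_img_sm[OF th(1) Wl(2) Yl(2)])
 have tWY: "\<theta> ` W \<subseteq> Y" using g(1) by auto
 let ?Y1 = "\<theta> ` W <+> JX Y"
 have Y1: "smG ?Y1" by (rule VG.sm_sum[OF tW JY])
 have Y1Y: "?Y1 \<subseteq> Y" by (rule VG.sum_least[OF Yl(2) tWY JYY])
 have JY1: "JX Y \<subseteq> ?Y1" by (rule VG.sum_upper2[OF tW JY])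
 have tc: "w \<in> W \<Longrightarrow> \<theta> w \<in> carrier V" for w using VG.smD[OF Yl(2) g(1)] .
 \<comment> \<open>The kernel of the map induced into \<open>Y / JY\<close>. It contains
   \<open>JW\<close>; as \<open>[W/JW] = [Y/JY]\<close>, its class over \<open>JW\<close> is that of
   the cokernel (\<open>ker_coker\<close>).\<close>
 let ?W1 = "{w \<in> W. \<theta> w \<in> JX Y}"
 have q0: "qiso AG V W ?W1 V ?Y1 (JX Y) \<theta>"
 proof (rule ghom_qiso[OF th(1) Wl(2) Yl(2) JY JY1 Y1 Y1Y])
  show "\<theta> ` W \<subseteq> ?Y1" by (rule VG.sum_upper1[OF tW JY])
  show "\<exists>w\<in>W. mcong V (JX Y) t (\<theta> w)" if "t \<in> ?Y1" for t
   using that unfolding VG.sum_minus_iff[OF tW JY] using tc by (auto simp: mcong_def)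
 qed auto
 have qh: "qhom AG V W V (JX Y) \<theta>" using q0 by (simp add: qiso_def)
 have W1: "smG ?W1" by (rule T.qhom_preimage_sm[OF Wl(2) JY JY order_refl qh])
 have W1W: "?W1 \<subseteq> W" by auto
 have JW1: "JX W \<subseteq> ?W1"
 proof (rule V.ss_least[OF _ VG.sm_carrier[OF Wl(2)] W1])
  show "J \<subseteq> carrier A" using Jc by auto
  fix s x assume s: "s \<in> J" and x: "x \<in> W"
  have sG: "s \<in> G" using s J_sub by auto
  have "\<theta> (s \<odot> x) \<in> JX Y" unfolding g(3)[OF sG x] by (rule V.ss_mem[OF s g(1)[OF x]])
  then show "s \<odot> x \<in> ?W1" using smG_smult[OF Wl(2) sG x] by simp
 qed
 have fin: "finite (between AG V (JX Y) Y)" "finite (between AG V (JX W) W)"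
  using fin_JX[OF fY Yl(2) order_refl] fin_JX[OF fW Wl(2) order_refl] by auto
 have "finite (between AG V ?W1 W)" using VG.between_mono[OF fin(2) JW1 W1W] by simp
 then have c1: "cl AG V W ?W1 = cl AG V ?Y1 (JX Y)" by (rule T.cl_qiso[OF Wl(2) W1 W1W Y1 JY JY1 q0])
 have "cl AG V W ?W1 + cl AG V ?W1 (JX W) = cl AG V Y ?Y1 + cl AG V ?Y1 (JX Y)"
  using VG.cl_add[OF fin(2) Wl(2) W1 JW JW1 W1W] VG.cl_add[OF fin(1) Yl(2) Y1 JY JY1 Y1Y] cl_JX_lat[OF Wl Yl] by simp
 then have ker_coker: "cl AG V ?W1 (JX W) = cl AG V Y ?Y1" using c1 by simp
 \<comment> \<open>The correction of \<open>\<theta>\<close> must have values in \<open>N\<close>,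
   so that the map stays the identity modulo \<open>N\<close>. Because of
   \<open>W + N = Y + N\<close>, the module \<open>N \<inter> Y\<close> reaches the whole cokernel
   (\<open>span\<close>).\<close>
 let ?NY = "N \<inter> Y"
 have NY: "smG ?NY" by (rule VG.sm_Int[OF N Yl(2)])
 let ?N1 = "?NY <+> JX Y"
 have N1: "smG ?N1" by (rule VG.sm_sum[OF NY JY])
 have JN1: "JX Y \<subseteq> ?N1" by (rule VG.sum_upper2[OF NY JY])
 have N1Y: "?N1 \<subseteq> Y" by (rule VG.sum_least[OF Yl(2) _ JYY]) auto
 have span: "Y \<subseteq> ?Y1 <+> ?N1"
 proof
  fix y assume y: "y \<in> Y"
  have yc: "y \<in> carrier V" using VG.smD[OF Yl(2) y] .
  have "y \<in> W <+> N" using eq VG.sum_upper1[OF Yl(2) N] y by auto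
  then obtain w where w: "w \<in> W" "y \<ominus> w \<in> N" unfolding VG.sum_minus_iff[OF Wl(2) N] by blast
  have "mcong V N y w" using w yc VG.smD[OF Wl(2)] by (simp add: mcong_def)
  then have "mcong V N y (\<theta> w)" using VG.cong_trans[OF N _ VG.cong_sym[OF N th(2)[OF w(1)]]] by blast
  then have "y \<ominus> \<theta> w \<in> ?NY" using VG.sm_minus[OF Yl(2) y g(1)[OF w(1)]] by (simp add: mcong_def)
  then have 1: "y \<ominus> \<theta> w \<in> ?N1" using VG.sum_upper1[OF NY JY] by auto
  have 2: "\<theta> w \<in> ?Y1" using VG.sum_upper1[OF tW JY] w(1) by auto
  show "y \<in> ?Y1 <+> ?N1" unfolding VG.sum_minus_iff[OF Y1 N1] using yc 1 2 by blast
 qed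
 let ?I = "?N1 \<inter> ?Y1"
 have I: "smG ?I" by (rule VG.sm_Int[OF N1 Y1])
 have fN1: "fg R0 V ?N1" by (rule noeth[OF fY smG_smR[OF N1] N1Y])
 have JJN1: "JX ?N1 \<subseteq> JX Y" by (rule JX_mono[OF N1Y VG.sm_carrier[OF Yl(2)]])
 have JI: "JX Y \<subseteq> ?I" using JN1 JY1 by auto
 have IN1: "?I \<subseteq> ?N1" by auto
 \<comment> \<open>\<open>C\<close> complements the part of \<open>N1\<close> that is already in the
   image, so a simple submodule \<open>D\<close> of \<open>C\<close> over \<open>JY\<close> embeds
   into the cokernel.\<close>
 obtain C where C: "smG C" "JX Y \<subseteq> C" "C \<subseteq> ?N1" "?I \<inter> C = JX Y" "?I <+> C = ?N1"
  using complement[OF fG fN1 N1 I JY JJN1 JI IN1] by auto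
 have CY: "C \<subseteq> Y" using C(3) N1Y by auto
 have CJ: "C \<noteq> JX Y"
 proof
  assume "C = JX Y"
  then have "?N1 \<subseteq> ?I" using C(5) VG.sum_least[OF I order_refl JI] by simp
  then have "?Y1 <+> ?N1 \<subseteq> ?Y1" by (intro VG.sum_least[OF Y1 order_refl]) auto
  then show False using span Y1Y ne by auto
 qed
 have finC: "finite (between AG V (JX Y) C)" using VG.between_mono[OF fin(1) C(2) CY] by simp
 let ?S = "between AG V (JX Y) C - {JX Y}"
 have "C \<in> ?S" using C CJ by (auto simp: between_def)
 moreover have "finite ?S" using finC by simp
 ultimately obtain D where D: "D \<in> ?S" and Dmin: "\<And>U. U \<in> ?S \<Longrightarrow> U \<subseteq> D \<Longrightarrow> D = U"
  using finite_has_minimal[of ?S] by (metis (no_types, lifting) empty_iff)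
 have Ds: "smG D" "JX Y \<subseteq> D" "D \<subseteq> C" "D \<noteq> JX Y" using D by (auto simp: between_def)
 have sD: "simpq AG V (JX Y) D"
  unfolding simpq_def
 proof (intro conjI allI impI)
  fix U assume U: "smG U" "JX Y \<subseteq> U" "U \<subseteq> D"
  show "U = JX Y \<or> U = D"
  proof (cases "U = JX Y")
   case False
   then have "U \<in> ?S" using U Ds(3) by (auto simp: between_def)
   then show ?thesis using Dmin U(3) by auto
  qed simp
 qed (use JY Ds in auto)
 have DY: "D \<subseteq> Y" using Ds CY by auto
 have DY1: "D \<inter> ?Y1 = JX Y" using C(3,4) Ds JY1 by auto
 let ?s = "iso_class AG (Qm V D (JX Y))"
 have "cl AG V D (D \<inter> ?Y1) = cl AG V (D <+> ?Y1) ?Y1"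
 proof (rule T.cl_qiso[OF Ds(1) _ _ VG.sm_sum[OF Ds(1) Y1] Y1 VG.sum_upper2[OF Ds(1) Y1] VG.qiso_second[OF Ds(1) Y1]])
  show "smG (D \<inter> ?Y1)" "D \<inter> ?Y1 \<subseteq> D" unfolding DY1 using JY Ds by auto
  show "finite (between AG V (D \<inter> ?Y1) D)" unfolding DY1 using VG.between_mono[OF fin(1) Ds(2) DY] by simp
 qed
 then have cD: "cl AG V (D <+> ?Y1) ?Y1 = {#?s#}" unfolding DY1 VG.cl_simple[OF sD] by simp
 have DY1Y: "D <+> ?Y1 \<subseteq> Y" by (rule VG.sum_least[OF Yl(2) DY Y1Y])
 have "finite (between AG V ?Y1 Y)" using VG.between_mono[OF fin(1) JY1 Y1Y] by simp
 then have "cl AG V Y ?Y1 = cl AG V Y (D <+> ?Y1) + {#?s#}"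
  using VG.cl_add[OF _ Yl(2) VG.sm_sum[OF Ds(1) Y1] Y1 VG.sum_upper2[OF Ds(1) Y1] DY1Y] cD by simp
 then have sin: "?s \<in># cl AG V ?W1 (JX W)" using ker_coker by simp
 have "finite (between AG V (JX W) ?W1)" using VG.between_mono[OF fin(2) JW1 W1W] by simp
 then have "ci AG V (JX W) ?W1 (cl AG V ?W1 (JX W))" by (rule VG.cl_ci[OF _ W1 JW JW1])
 then obtain Z1 Z2 where Z: "simpq AG V Z1 Z2" "JX W \<subseteq> Z1" "Z2 \<subseteq> ?W1" "iso_class AG (Qm V Z2 Z1) = ?s"
  using VG.ci_member[OF _ sin] by blast
 have Zs: "smG Z1" "smG Z2" "Z1 \<subseteq> Z2" using Z(1) by (auto simp: simpq_def)
 have Z2W: "Z2 \<subseteq> W" using Z(3) by auto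
 have fZ2: "fg R0 V Z2" by (rule noeth[OF fW smG_smR[OF Zs(2)] Z2W])
 \<comment> \<open>The constituent \<open>Z2 / Z1\<close> of the kernel with the class of
   \<open>D / JY\<close> is split off as a simple submodule \<open>E\<close> over \<open>JW\<close>,
   on which \<open>\<theta>\<close> vanishes modulo \<open>JY\<close>.\<close>
 obtain E where E: "smG E" "JX W \<subseteq> E" "E \<subseteq> Z2" "Z1 \<inter> E = JX W" "Z1 <+> E = Z2"
  using complement[OF fG fZ2 Zs(2) Zs(1) JW JX_mono[OF Z2W VG.sm_carrier[OF Wl(2)]] Z(2) Zs(3)] by auto
 have EW: "E \<subseteq> W" and EW1: "E \<subseteq> ?W1" using E(3) Z2W Z(3) by auto
 have EZ: "E \<inter> Z1 = JX W" "E <+> Z1 = Z2" using E(4,5) VG.sum_comm[OF E(1) Zs(1)] by auto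
 have sE: "simpq AG V (JX W) E" using VG.simpq_second[OF E(1) Zs(1)] Z(1) EZ by simp
 have "iso_class AG (Qm V E (JX W)) = iso_class AG (Qm V Z2 Z1)"
  using T.iso_class_qiso[OF E(1) JW E(2) Zs(2,1,3)] VG.qiso_second[OF E(1) Zs(1)] EZ by simp
 then have isE: "iso_class AG (Qm V E (JX W)) = ?s" using Z(4) by simp
 obtain f where f: "qiso AG V E (JX W) V D (JX Y) f" using VG.iso_class_eqD[OF sE isE Ds(1) JY Ds(2)] by auto
 have fq: "qhom AG V E V (JX Y) f" and fD: "f ` E \<subseteq> D" and fk: "\<And>x. x \<in> E \<Longrightarrow> f x \<in> JX Y \<longleftrightarrow> x \<in> JX W"
  and fs: "\<And>d. d \<in> D \<Longrightarrow> \<exists>x\<in>E. mcong V (JX Y) d (f x)" using f by (auto simp: qiso_def)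
 note qf = T.qhom_facts[OF E(1) JY fq]
 obtain H where H: "smG H" "JX W \<subseteq> H" "H \<subseteq> W" "E \<inter> H = JX W" "E <+> H = W"
  using complement[OF fG fW Wl(2) E(1) JW order_refl E(2) EW] by auto
 have "\<exists>e\<in>E. mcong V H w e" if w: "w \<in> W" for w
 proof -
  have "w \<in> E <+> H" using H(5) w by simp
  then show ?thesis unfolding VG.sum_minus_iff[OF E(1) H(1)] using VG.smD[OF E(1)] by (auto simp: mcong_def)
 qed
 \<comment> \<open>\<open>e\<close> is the projection of \<open>W\<close> onto \<open>E\<close>
   along \<open>H\<close>, determined modulo \<open>JW\<close> only; \<open>f (e w)\<close> is then
   determined modulo \<open>JY\<close>.\<close>
 then obtain e where e: "\<And>w. w \<in> W \<Longrightarrow> e w \<in> E" "\<And>w. w \<in> W \<Longrightarrow> mcong V H w (e w)" by metis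
 have eJ: "mcong V (JX W) x y" if "x \<in> E" "y \<in> E" "mcong V H x y" for x y
  using that VG.sm_minus[OF E(1) that(1,2)] H(4) by (auto simp: mcong_def)
 have fcong: "mcong V (JX Y) (f x) (f y)" if "x \<in> E" "y \<in> E" "mcong V H x y" for x y
  using T.qiso_cong[OF E(1) JW JY f that(1,2)] eJ[OF that] by simp
 have fe: "f (e w) \<in> D" if "w \<in> W" for w using fD e(1)[OF that] by auto
 have qd: "qhom AG V W V (JX Y) (\<lambda>w. f (e w))"
  unfolding qhom_def
 proof (intro conjI ballI)
  fix x assume x: "x \<in> W"
  show "f (e x) \<in> carrier V" by (rule qf(1)[OF e(1)[OF x]])
  { fix y assume y: "y \<in> W"
   note xy = VG.sm_add[OF Wl(2) x y] VG.sm_add[OF E(1) e(1)[OF x] e(1)[OF y]]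
   have "mcong V H (e (x \<oplus> y)) (e x \<oplus> e y)"
    using VG.cong_trans[OF H(1) VG.cong_sym[OF H(1) e(2)[OF xy(1)]] VG.cong_add[OF H(1) e(2)[OF x] e(2)[OF y]]] .
   then have "mcong V (JX Y) (f (e (x \<oplus> y))) (f (e x \<oplus> e y))" by (rule fcong[OF e(1)[OF xy(1)] xy(2)])
   then show "mcong V (JX Y) (f (e (x \<oplus> y))) (f (e x) \<oplus> f (e y))"
    by (rule VG.cong_trans[OF JY _ qf(2)[OF e(1)[OF x] e(1)[OF y]]]) }
  { fix a assume a: "a \<in> carrier AG"
   note ax = VG.sm_smult[OF Wl(2) a x] VG.sm_smult[OF E(1) a e(1)[OF x]]
   have "mcong V H (e (a \<odot> x)) (a \<odot> e x)"
    using VG.cong_trans[OF H(1) VG.cong_sym[OF H(1) e(2)[OF ax(1)]] VG.cong_smult[OF H(1) e(2)[OF x] a]] .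
   then have "mcong V (JX Y) (f (e (a \<odot> x))) (f (a \<odot> e x))" by (rule fcong[OF e(1)[OF ax(1)] ax(2)])
   then show "mcong V (JX Y) (f (e (a \<odot> x))) (a \<odot> f (e x))"
    by (rule VG.cong_trans[OF JY _ qf(3)[OF a e(1)[OF x]]]) }
 qed
 have lift: "\<exists>z\<in>?NY. mcong V (JX Y) z (f (e w))" if w: "w \<in> W" for w
 proof -
  have "f (e w) \<in> ?N1" using fe[OF w] Ds(3) C(3) by auto
  then obtain z where "z \<in> ?NY" "f (e w) \<ominus> z \<in> JX Y" "f (e w) \<in> carrier V" unfolding VG.sum_minus_iff[OF NY JY] by blast
  then have "mcong V (JX Y) (f (e w)) z" using VG.smD[OF NY] by (auto simp: mcong_def)
  then show ?thesis using VG.cong_sym[OF JY] \<open>z \<in> ?NY\<close> by blast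
 qed
 obtain h where h: "frV W W h" "\<And>w. w \<in> W \<Longrightarrow> h w = w" using proj_lattice[OF Wl(2) fW] by (auto simp: proj_def)
 \<comment> \<open>Projectivity of \<open>W\<close> lifts this map, which is additive only modulo
   \<open>JY\<close>, to a homomorphism into \<open>N \<inter> Y\<close>.\<close>
 have "\<exists>d. frV W ?NY d \<and> (\<forall>w\<in>W. mcong V (JX Y) (d w) (f (e (h w))))"
  by (rule fr_lift[OF oiV oiV h(1) Wl(2) NY JY qd lift])
 then obtain d where d: "frV W ?NY d" "\<And>w. w \<in> W \<Longrightarrow> mcong V (JX Y) (d w) (f (e w))" using h(2) by auto
 have dg: "gh W ?NY d" by (rule fr_ghom[OF oiV oiV d(1) Wl(2) NY])
 note gd = ghomD[OF dg]
 have dc: "w \<in> W \<Longrightarrow> d w \<in> carrier V" for w using VG.smD[OF NY gd(1)] .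
 let ?t = "\<lambda>w. \<theta> w \<oplus> d w"
 have tg: "gh W Y ?t"
  unfolding ghom_def
 proof (intro conjI ballI)
  fix x assume x: "x \<in> W"
  show "?t x \<in> Y" using VG.sm_add[OF Yl(2) g(1)[OF x]] gd(1)[OF x] by auto
  { fix y assume y: "y \<in> W"
   show "?t (x \<oplus> y) = ?t x \<oplus> ?t y"
    unfolding g(2)[OF x y] gd(2)[OF x y] using tc dc x y by (simp add: V.M.a_ac) }
  { fix a assume a: "a \<in> G"
   show "?t (a \<odot> x) = a \<odot> ?t x"
    unfolding g(3)[OF a x] gd(3)[OF a x] using tc dc x Gc[OF a] by (simp add: V.smult_r_distr) }
 qed
 have tN: "mcong V N (?t w) w" if w: "w \<in> W" for w
 proof -
  have "mcong V N (d w) \<zero>" using VG.cong_zero[OF N] gd(1)[OF w] by auto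
  from VG.cong_add[OF N th(2)[OF w] this] show ?thesis using VG.smD[OF Wl(2) w] by simp
 qed
 have tW': "smG (?t ` W)" by (rule ghom_img_sm[OF tg Wl(2) Yl(2)])
 let ?Y2 = "?t ` W <+> JX Y"
 have Y2: "smG ?Y2" by (rule VG.sm_sum[OF tW' JY])
 have JY2: "JX Y \<subseteq> ?Y2" by (rule VG.sum_upper2[OF tW' JY])
 have inY2: "y \<in> ?Y2" if "w \<in> W" "mcong V (JX Y) y (?t w)" for y w
  unfolding VG.sum_minus_iff[OF tW' JY] using that by (auto simp: mcong_def)
 \<comment> \<open>On \<open>H\<close> the correction is trivial modulo \<open>JY\<close>, and on
   \<open>E\<close> the old map is; hence the new image contains both the old one and
   \<open>D\<close>.\<close>
 have tH: "\<theta> w \<in> ?Y2" if w: "w \<in> H" for w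
 proof -
  have wW: "w \<in> W" using w H(3) by auto
  have "e w \<in> H" using VG.cong_mem[OF H(1) e(2)[OF wW]] w by simp
  then have "e w \<in> JX W" using H(4) e(1)[OF wW] by auto
  then have "f (e w) \<in> JX Y" using fk[OF e(1)[OF wW]] by simp
  then have "d w \<in> JX Y" using VG.cong_mem[OF JY d(2)[OF wW]] by simp
  then have "mcong V (JX Y) \<zero> (d w)" using VG.cong_sym[OF JY VG.cong_zero[OF JY]] by simp
  from VG.cong_add[OF JY VG.cong_refl[OF JY tc[OF wW]] this]
  have "mcong V (JX Y) (\<theta> w) (?t w)" using tc[OF wW] by simp
  then show ?thesis by (rule inY2[OF wW])
 qed
 have tE: "\<theta> w \<in> JX Y" if "w \<in> E" for w using that EW1 by auto
 have "\<theta> ` W \<subseteq> ?Y2"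
 proof
  fix y assume "y \<in> \<theta> ` W"
  then obtain w where w: "w \<in> W" "y = \<theta> w" by auto
  then obtain u v where uv: "u \<in> E" "v \<in> H" "w = u \<oplus> v" using H(5) unfolding VG.sum_iff[symmetric] by (metis VG.sum_iff)
  have "y = \<theta> u \<oplus> \<theta> v" unfolding w(2) uv(3) using g(2) uv EW H(3) by blast
  then show "y \<in> ?Y2" using VG.sm_add[OF Y2] tE[OF uv(1)] JY2 tH[OF uv(2)] by auto
 qed
 then have sub: "?Y1 \<subseteq> ?Y2" by (rule VG.sum_least[OF Y2 _ JY2])
 have DY2: "D \<subseteq> ?Y2"
 proof
  fix x assume x: "x \<in> D"
  obtain w where w: "w \<in> E" "mcong V (JX Y) x (f w)" using fs[OF x] by auto
  have wW: "w \<in> W" using w EW by auto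
  have 1: "mcong V (JX Y) (f w) (f (e w))" by (rule fcong[OF w(1) e(1)[OF wW] e(2)[OF wW]])
  have 2: "mcong V (JX Y) (f w) (d w)" by (rule VG.cong_trans[OF JY 1 VG.cong_sym[OF JY d(2)[OF wW]]])
  have "mcong V (JX Y) \<zero> (\<theta> w)" using VG.cong_sym[OF JY VG.cong_zero[OF JY tE[OF w(1)]]] .
  from VG.cong_add[OF JY this 2] have "mcong V (JX Y) (f w) (?t w)" using qf(1)[OF w(1)] by simp
  then show "x \<in> ?Y2" using inY2[OF wW] VG.cong_trans[OF JY w(2)] by blast
 qed
 have "\<not> D \<subseteq> ?Y1" using DY1 Ds by auto
 then have "?Y1 \<subset> ?Y2" using sub DY2 by auto
 then show ?thesis using tg tN by blast
qed

text \<open>A map with maximal image modulo \<open>JY\<close> is onto by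
  \<open>enlarge_image\<close> and \<open>cover_by_radical\<close>. Its kernel \<open>K\<close> lies
  in \<open>pW\<close>, because \<open>W / pW\<close> and \<open>Y / pY\<close> have the same class.
  As \<open>V\<close> has no \<open>p\<close>-torsion, \<open>K = pK\<close>, and Nakayama's lemma
  gives \<open>K = 0\<close>.\<close>

lemma lattice_iso:
 assumes Wl: "full W" "smG W" and Yl: "full Y" "smG Y" and N: "smG N"
  and eq: "W <+> N = Y <+> N"
 shows "\<exists>\<theta>. gh W Y \<theta> \<and> bij_betw \<theta> W Y \<and> (\<forall>w\<in>W. mcong V N (\<theta> w) w)"
proof -
 interpret T: two_modules AG V V by (rule VG.two_self)
 note fW = lat_fg[OF Wl(1)] and fY = lat_fg[OF Yl(1)]
 have JY: "smG (JX Y)" using smG_JX Yl by auto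
 define good where "good \<theta> \<longleftrightarrow> gh W Y \<theta> \<and> (\<forall>w\<in>W. mcong V N (\<theta> w) w)" for \<theta>
 have "\<exists>\<theta>. good \<theta>"
 proof -
  obtain h where h: "frV W W h" "\<And>w. w \<in> W \<Longrightarrow> h w = w" using proj_lattice[OF Wl(2) fW] by (auto simp: proj_def)
  have q: "qhom AG V W V N (\<lambda>w. w)"
   unfolding qhom_def using VG.cong_refl[OF N] VG.smD[OF Wl(2)] V.smult_closed Gc by auto
  have s: "\<exists>y\<in>Y. mcong V N y w" if w: "w \<in> W" for w
  proof -
   have wc: "w \<in> carrier V" using VG.smD[OF Wl(2) w] .
   have "w \<in> Y <+> N" using eq VG.sum_upper1[OF Wl(2) N] w by auto
   then obtain y where y: "y \<in> Y" "w \<ominus> y \<in> N" unfolding VG.sum_minus_iff[OF Yl(2) N] by blast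
   then have "mcong V N w y" using wc VG.smD[OF Yl(2)] by (simp add: mcong_def)
   then show ?thesis using VG.cong_sym[OF N] y(1) by blast
  qed
  have "\<exists>k. frV W Y k \<and> (\<forall>x\<in>W. mcong V N (k x) (h x))"
   by (rule fr_lift[OF oiV oiV h(1) Wl(2) Yl(2) N q s])
  then obtain k where k: "frV W Y k" "\<And>x. x \<in> W \<Longrightarrow> mcong V N (k x) x" using h(2) by auto
  then show ?thesis unfolding good_def using fr_ghom[OF oiV oiV k(1) Wl(2) Yl(2)] by blast
 qed
 moreover define im where "im \<theta> = \<theta> ` W <+> JX Y" for \<theta>
 ultimately have "im ` {\<theta>. good \<theta>} \<noteq> {}" by auto
 \<comment> \<open>The images lie in the finite interval from \<open>JY\<close> to \<open>Y\<close>,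
   so a maximal one exists.\<close>
 moreover have "finite (im ` {\<theta>. good \<theta>})"
 proof (rule finite_subset[OF _ fin_JX[OF fY Yl(2) order_refl]])
  show "im ` {\<theta>. good \<theta>} \<subseteq> between AG V (JX Y) Y"
  proof (clarsimp simp: good_def)
   fix \<theta> assume th: "gh W Y \<theta>"
   have tW: "smG (\<theta> ` W)" by (rule ghom_img_sm[OF th Wl(2) Yl(2)])
   have "\<theta> ` W \<subseteq> Y" using ghomD(1)[OF th] by auto
   then show "im \<theta> \<in> between AG V (JX Y) Y"
    unfolding im_def between_def
    using VG.sm_sum[OF tW JY] VG.sum_upper2[OF tW JY] VG.sum_least[OF Yl(2) _ JX_sub[OF Yl(2)]] by auto
  qed
 qed
 ultimately obtain I where I: "I \<in> im ` {\<theta>. good \<theta>}" "\<And>I'. I' \<in> im ` {\<theta>. good \<theta>} \<Longrightarrow> I \<subseteq> I' \<Longrightarrow> I = I'"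
  using finite_has_maximal[of "im ` {\<theta>. good \<theta>}"] by (metis (no_types, lifting))
 obtain \<theta> where th: "good \<theta>" "I = im \<theta>" using I(1) by auto
 have tg: "gh W Y \<theta>" and tN: "\<And>w. w \<in> W \<Longrightarrow> mcong V N (\<theta> w) w" using th(1) by (auto simp: good_def)
 note g = ghomD[OF tg]
 have "im \<theta> = Y"
 proof (rule ccontr)
  assume "im \<theta> \<noteq> Y"
  then obtain \<theta>' where t': "gh W Y \<theta>'" "\<forall>w\<in>W. mcong V N (\<theta>' w) w" "im \<theta> \<subset> im \<theta>'"
   using enlarge_image[OF Wl Yl N eq tg tN] unfolding im_def by blast
  then have "good \<theta>'" by (simp add: good_def)
  then show False using I(2)[of "im \<theta>'"] t'(3) th(2) by auto
 qed
 then have onto: "\<theta> ` W = Y"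
  using cover_by_radical[OF fY Yl(2) ghom_img_sm[OF tg Wl(2) Yl(2)]] g(1) unfolding im_def by auto
 let ?K = "{w \<in> W. \<theta> w \<in> {\<zero>}}"
 have q0: "qiso AG V W ?K V Y {\<zero>} \<theta>"
 proof (rule ghom_qiso[OF tg Wl(2) Yl(2) VG.sm_0 _ Yl(2) order_refl])
  show "{\<zero>} \<subseteq> Y" using VG.sm_zero[OF Yl(2)] by simp
  show "\<exists>x\<in>W. mcong V {\<zero>} t (\<theta> x)" if "t \<in> Y" for t
   using that onto VG.smD[OF Yl(2)] unfolding VG.cong_0 by auto
 qed (use g(1) in auto)
 have K: "smG ?K"
  by (rule T.qhom_preimage_sm[OF Wl(2) VG.sm_0 VG.sm_0 order_refl]) (use q0 in \<open>simp add: qiso_def\<close>)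
 \<comment> \<open>This is the preimage of \<open>pY\<close> (\<open>preP\<close>). Equality of
   classes forces it down to \<open>pW\<close>.\<close>
 let ?P = "?K <+> pX 1 W"
 have pW: "smG (pX 1 W)" and pY: "smG (pX 1 Y)" by (rule smG_pX[OF Wl(2)], rule smG_pX[OF Yl(2)])
 have pWW: "pX 1 W \<subseteq> W" and pYY: "pX 1 Y \<subseteq> Y"
  by (rule pX_sub[OF smG_smR[OF Wl(2)]], rule pX_sub[OF smG_smR[OF Yl(2)]])
 have P: "smG ?P" by (rule VG.sm_sum[OF K pW])
 have PW: "?P \<subseteq> W" by (rule VG.sum_least[OF Wl(2) _ pWW]) auto
 have pP: "pX 1 W \<subseteq> ?P" by (rule VG.sum_upper2[OF K pW])
 have tp: "\<theta> (p \<odot> w) = p \<odot> \<theta> w" if "w \<in> W" for w using g(3)[of p w] pG[of 1] that by simp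
 have preP: "\<theta> w \<in> pX 1 Y \<longleftrightarrow> w \<in> ?P" if w: "w \<in> W" for w
 proof
  assume "\<theta> w \<in> pX 1 Y"
  then obtain y where y: "y \<in> Y" "\<theta> w = p \<odot> y" by auto
  then obtain w' where w': "w' \<in> W" "y = \<theta> w'" using onto by auto
  have pw': "p \<odot> w' \<in> W" using smG_smult[OF Wl(2) _ w'(1)] pG[of 1] by simp
  have "\<theta> (w \<ominus> p \<odot> w') = \<theta> w \<ominus> \<theta> (p \<odot> w')" by (rule ghom_minus[OF tg Wl(2) Yl(2) w pw'])
  also have "\<dots> = \<zero>" using tp[OF w'(1)] y(2) w'(2) VG.smD[OF Yl(2) g(1)[OF w]] by (simp add: V.M.minus_eq V.M.r_neg)
  finally have "w \<ominus> p \<odot> w' \<in> ?K" using VG.sm_minus[OF Wl(2) w pw'] by simp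
  moreover have "p \<odot> w' \<in> pX 1 W" using w'(1) by auto
  ultimately have "w \<in> pX 1 W <+> ?K" unfolding VG.sum_minus_iff[OF pW K] using VG.smD[OF Wl(2) w] by blast
  then show "w \<in> ?P" using VG.sum_comm[OF K pW] by simp
 next
  assume "w \<in> ?P"
  then obtain k u where ku: "k \<in> ?K" "u \<in> pX 1 W" "w = k \<oplus> u" unfolding VG.sum_iff by auto
  obtain w' where w': "w' \<in> W" "u = p \<odot> w'" using ku(2) by auto
  have "\<theta> w = \<theta> k \<oplus> \<theta> u" unfolding ku(3) using g(2)[of k u] ku pWW by auto
  then have "\<theta> w = p \<odot> \<theta> w'" using ku(1) tp[OF w'(1)] w'(2) V.smult_closed[of p] VG.smD[OF Yl(2) g(1)[OF w'(1)]] by simp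
  then show "\<theta> w \<in> pX 1 Y" using g(1)[OF w'(1)] by auto
 qed
 have q1: "qiso AG V W ?P V Y (pX 1 Y) \<theta>"
 proof (rule ghom_qiso[OF tg Wl(2) Yl(2) pY pYY Yl(2) order_refl])
  show "\<exists>x\<in>W. mcong V (pX 1 Y) t (\<theta> x)" if "t \<in> Y" for t
   using that onto VG.cong_refl[OF pY] VG.smD[OF Yl(2)] by (auto simp: image_iff)
 qed (use g(1) preP in auto)
 have finW: "finite (between AG V (pX 1 W) W)" by (rule VG.fin_index_between[OF fin_index_pk[OF fW]])
 have "cl AG V W ?P = cl AG V Y (pX 1 Y)"
  by (rule T.cl_qiso[OF Wl(2) P PW Yl(2) pY pYY q1]) (use VG.between_mono[OF finW pP PW] in simp)
 moreover have "cl AG V W (pX 1 W) = cl AG V W ?P + cl AG V ?P (pX 1 W)"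
  by (rule VG.cl_add[OF finW Wl(2) P pW pP PW])
 ultimately have "cl AG V ?P (pX 1 W) = {#}" using cl_pX_lat[OF Wl Yl] by simp
 then have "pX 1 W = ?P" by (rule VG.cl_empty[rotated 4]) (use VG.between_mono[OF finW pP PW] P pW pP in auto)
 then have KpW: "?K \<subseteq> pX 1 W" using VG.sum_upper1[OF K pW] by simp
 have "?K \<subseteq> {\<zero>}"
 proof (rule nakayama[OF noeth[OF fW smG_smR[OF K]] VR.sm_0])
  fix x assume x: "x \<in> ?K"
  then obtain w where w: "w \<in> W" "x = p \<odot> w" using KpW by auto
  have tw: "\<theta> w \<in> carrier V" using VG.smD[OF Yl(2) g(1)[OF w(1)]] .
  have "p \<odot> \<theta> w = \<zero>" using x tp[OF w(1)] w(2) by simp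
  then have "\<theta> w = \<zero>" using pw_cancel(1)[OF tw, of 1] V.smult_zero_r by simp
  then have "w \<in> ?K" using w by simp
  then show "\<exists>x'\<in>?K. mcong V {\<zero>} x (p \<odot> x')" using w VG.smD[OF K x] unfolding VG.cong_0 by blast
 qed auto
 then have ker: "x = \<zero>" if "x \<in> W" "\<theta> x = \<zero>" for x using that by auto
 have "inj_on \<theta> W"
 proof (rule inj_onI)
  fix x y assume xy: "x \<in> W" "y \<in> W" "\<theta> x = \<theta> y"
  have "\<theta> (x \<ominus> y) = \<zero>"
   using ghom_minus[OF tg Wl(2) Yl(2) xy(1,2)] xy(3) VG.smD[OF Yl(2) g(1)[OF xy(2)]] by (simp add: V.M.minus_eq V.M.r_neg)
  then have "x \<ominus> y = \<zero>" by (rule ker[OF VG.sm_minus[OF Wl(2) xy(1,2)]])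
  then show "x = y" using V.M.diff_add_cancel[of x y] VG.smD[OF Wl(2)] xy by simp
 qed
 then have "bij_betw \<theta> W Y" using onto by (simp add: bij_betw_def)
 then show ?thesis using tg tN by blast
qed

end

section \<open>Coefficients of zeta functions\<close>

lemma dir_sum_monom: "dir_sum J (\<lambda>j. dir_monom (c j)) m = int (card {j \<in> J. c j = m})"
proof -
 have e: "{j \<in> J. dir_monom (c j) m \<noteq> 0} = {j \<in> J. c j = m}" by (auto simp: dir_monom_def)
 have "dir_sum J (\<lambda>j. dir_monom (c j)) m = (\<Sum>j\<in>{j \<in> J. c j = m}. 1)"
  unfolding dir_sum_def e by (intro sum.cong) (auto simp: dir_monom_def)
 then show ?thesis by simp
qed

lemma dir_res_sum:
 assumes S: "finite S" "S \<subseteq> class_monoid \<Gamma>'"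
  and f: "\<And>m. m \<in> class_monoid \<Gamma>' \<Longrightarrow> res_class \<Gamma> m = k \<Longrightarrow> f m \<noteq> 0 \<Longrightarrow> m \<in> S"
 shows "dir_res \<Gamma>' \<Gamma> f k = (\<Sum>m\<in>S. f m * dir_monom (res_class \<Gamma> m) k)"
 unfolding dir_res_def dir_sum_def
 by (rule sum.mono_neutral_left) (use S f in \<open>auto simp: dir_monom_def split: if_splits\<close>)

text \<open>The members of \<open>J\<close> are grouped by their class over
  \<open>\<Gamma>'\<close>; only finitely many groups restrict to \<open>k\<close>.\<close>

lemma dir_res_count:
 assumes c: "\<And>j. j \<in> J \<Longrightarrow> c j \<in> class_monoid \<Gamma>'" and fin: "finite {j \<in> J. res_class \<Gamma> (c j) = k}"
 shows "dir_res \<Gamma>' \<Gamma> (dir_sum J (\<lambda>j. dir_monom (c j))) k = int (card {j \<in> J. res_class \<Gamma> (c j) = k})"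
proof -
 let ?T = "{j \<in> J. res_class \<Gamma> (c j) = k}"
 have "dir_res \<Gamma>' \<Gamma> (dir_sum J (\<lambda>j. dir_monom (c j))) k
   = (\<Sum>m\<in>c ` ?T. int (card {j \<in> J. c j = m}) * dir_monom (res_class \<Gamma> m) k)"
  unfolding dir_sum_monom[symmetric, abs_def]
 proof (rule dir_res_sum)
  fix m assume m: "res_class \<Gamma> m = k" "dir_sum J (\<lambda>j. dir_monom (c j)) m \<noteq> 0"
  then have "{j \<in> J. c j = m} \<noteq> {}" unfolding dir_sum_monom by (metis card.empty of_nat_0)
  then show "m \<in> c ` ?T" using m(1) by auto
 qed (use c fin in auto)
 also have "\<dots> = (\<Sum>m\<in>c ` ?T. int (card {j \<in> ?T. c j = m}))"
 proof (rule sum.cong[OF HOL.refl])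
  fix m assume "m \<in> c ` ?T"
  then have m: "res_class \<Gamma> m = k" by auto
  then have "{j \<in> J. c j = m} = {j \<in> ?T. c j = m}" by auto
  then show "int (card {j \<in> J. c j = m}) * dir_monom (res_class \<Gamma> m) k = int (card {j \<in> ?T. c j = m})"
   using m by (simp add: dir_monom_def)
 qed
 also have "\<dots> = int (card ?T)"
  using sum.image_gen[OF fin, of "\<lambda>_. 1::nat" c] by simp
 finally show ?thesis .
qed

lemma dir_res_poly:
 assumes I: "finite I" and c: "\<And>i. i \<in> I \<Longrightarrow> c i \<in> class_monoid \<Gamma>'"
 shows "dir_res \<Gamma>' \<Gamma> (\<lambda>m. \<Sum>i\<in>I. w i * dir_monom (c i) m) k = (\<Sum>i\<in>I. w i * dir_monom (res_class \<Gamma> (c i)) k)"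
proof -
 have "dir_res \<Gamma>' \<Gamma> (\<lambda>m. \<Sum>i\<in>I. w i * dir_monom (c i) m) k
   = (\<Sum>m\<in>c ` I. (\<Sum>i\<in>I. w i * dir_monom (c i) m) * dir_monom (res_class \<Gamma> m) k)"
 proof (rule dir_res_sum)
  fix m assume "(\<Sum>i\<in>I. w i * dir_monom (c i) m) \<noteq> 0"
  then obtain i where "i \<in> I" "w i * dir_monom (c i) m \<noteq> 0" by (rule sum.not_neutral_contains_not_neutral)
  then show "m \<in> c ` I" by (auto simp: dir_monom_def split: if_splits)
 qed (use I c in auto)
 also have "\<dots> = (\<Sum>i\<in>I. \<Sum>m\<in>c ` I. w i * dir_monom (c i) m * dir_monom (res_class \<Gamma> m) k)"
  unfolding sum_distrib_right by (rule sum.swap)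
 also have "\<dots> = (\<Sum>i\<in>I. w i * dir_monom (res_class \<Gamma> (c i)) k)"
 proof (rule sum.cong[OF HOL.refl])
  fix i assume i: "i \<in> I"
  have "(\<Sum>m\<in>c ` I. w i * dir_monom (c i) m * dir_monom (res_class \<Gamma> m) k)
    = (\<Sum>m\<in>c ` I. if m = c i then w i * dir_monom (res_class \<Gamma> (c i)) k else 0)"
   by (intro sum.cong) (auto simp: dir_monom_def)
  then show "(\<Sum>m\<in>c ` I. w i * dir_monom (c i) m * dir_monom (res_class \<Gamma> m) k) = w i * dir_monom (res_class \<Gamma> (c i)) k"
   using I i by (simp add: sum.delta)
 qed
 finally show ?thesis .
qed

section \<open>Sublattices of finite index and the coefficients that count them\<close>

context order_in
begin

definition subs where "subs U = {Y. smG Y \<and> Y \<subseteq> U \<and> fin_index V Y U}"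

lemma subs_eq: "smG U \<Longrightarrow> {X. submodule X AG (V\<lparr>carrier := U\<rparr>) \<and> finite (carrier (Qm V U X))} = subs U"
 unfolding subs_def using VG.submodule_sub_iff VG.fin_index_iff by blast

lemma zeta_eq: "smG U \<Longrightarrow> zeta AG (V\<lparr>carrier := U\<rparr>) = dir_sum (subs U) (\<lambda>X. dir_monom (cl AG V U X))"
 unfolding zeta_def by (simp add: subs_eq cl_def)

lemma partial_zeta_eq: assumes U: "smG U"
 shows "partial_zeta AG (V\<lparr>carrier := U\<rparr>) N
  = dir_sum {X \<in> subs U. module_isomorphic AG (V\<lparr>carrier := X\<rparr>) N} (\<lambda>X. dir_monom (cl AG V U X))"
proof -
 have "{X. submodule X AG (V\<lparr>carrier := U\<rparr>) \<and> finite (carrier (Qm V U X)) \<and> module_isomorphic AG (V\<lparr>carrier := U, carrier := X\<rparr>) N}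
   = {X \<in> subs U. module_isomorphic AG (V\<lparr>carrier := X\<rparr>) N}"
  using subs_eq[OF U] by auto
 then show ?thesis by (simp add: partial_zeta_def cl_def)
qed

lemma subs_between: "Y \<in> subs U \<Longrightarrow> finite (between AG V Y U)"
 unfolding subs_def using VG.fin_index_between by auto

lemma subs_ppow: assumes "fg R0 V U" "smG U" "Y \<in> subs U" shows "pX (size (cl AG V U Y)) U \<subseteq> Y"
 by (rule ci_ppow[OF VG.cl_ci[OF subs_between[OF assms(3)] assms(2)] assms(1)]) (use assms(3) in \<open>auto simp: subs_def\<close>)

text \<open>A sublattice of class \<open>m\<close> contains \<open>p^nU\<close>, where
  \<open>n\<close> is the size of \<open>m\<close>.\<close>

lemma subs_finite: assumes U: "fg R0 V U" "smG U" shows "finite {Y \<in> subs U. cl AG V U Y = m}"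
proof (rule finite_subset[OF _ VG.fin_index_between[OF fin_index_pk[OF U(1)]]])
 show "{Y \<in> subs U. cl AG V U Y = m} \<subseteq> between AG V (pX (size m) U) U"
  using subs_ppow[OF U] by (auto simp: between_def subs_def)
qed

lemma subs_lat: "Y \<in> subs U \<Longrightarrow> full U \<Longrightarrow> smG U \<Longrightarrow> full Y"
 using latI_sub[OF _ smG_smR _ subs_ppow[OF lat_fg]] by (auto simp: subs_def)

lemma lat_subs: "\<lbrakk>fg R0 V U; smG Y; Y \<subseteq> U; full Y\<rbrakk> \<Longrightarrow> Y \<in> subs U"
 unfolding subs_def using lat_fin_index by blast

end

locale order_pair = order_in A R0 p pinv V G
 for A :: "('a, 'c) ring_scheme" and R0 p pinv and V :: "('a, 'v, 'e) module_scheme" (structure) and G +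
 fixes L0
 assumes ordL0: "ord A R0 p L0" and L0G: "L0 \<subseteq> G"
begin

sublocale LM: order_in A R0 p pinv V L0
 by (intro order_in.intro om order_in_axioms.intro ordD(4,5)[OF ordL0])

lemma smG_smL: "smG X \<Longrightarrow> LM.smG X"
 by (rule submodule_restrict[OF _ L0G])

abbreviation "clL \<equiv> cl LM.AG V"

text \<open>The coefficient at \<open>k\<close> of the restriction of the zeta function of
  \<open>U\<close> (\<open>res_zeta\<close>): restriction of scalars becomes counting
  \<open>G\<close>-sublattices by their class over \<open>L0\<close>.\<close>

definition num where "num U k = card {Y \<in> subs U. clL U Y = k}"

lemma subs_L: "Y \<in> subs U \<Longrightarrow> Y \<in> LM.subs U"
 unfolding subs_def LM.subs_def using smG_smL by auto

lemma num_finite: assumes U: "fg R0 V U" "smG U" shows "finite {Y \<in> subs U. clL U Y = k}"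
 by (rule finite_subset[OF _ LM.subs_finite[OF U(1) smG_smL[OF U(2)], of k]]) (use subs_L in auto)

lemma res_cl: assumes U: "smG U" and Y: "Y \<in> subs U"
 shows "cl AG V U Y \<in> class_monoid AG" "res_class LM.AG (cl AG V U Y) = clL U Y"
proof -
 have Y': "smG Y" "Y \<subseteq> U" "fin_index V Y U" using Y by (auto simp: subs_def)
 show "cl AG V U Y \<in> class_monoid AG" by (rule VG.cl_class_monoid[OF subs_between[OF Y] U Y'(1,2)])
 show "res_class LM.AG (cl AG V U Y) = clL U Y"
  by (rule res_class_ci[OF VG.left_module_axioms L0G LM.VG.R.ring_axioms VG.cl_ci[OF subs_between[OF Y] U Y'(1,2)] Y'(3)])
qed

lemma res_zeta: assumes U: "fg R0 V U" "smG U"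
 shows "dir_res AG LM.AG (zeta AG (V\<lparr>carrier := U\<rparr>)) k = int (num U k)"
proof -
 have e: "{Y \<in> subs U. res_class LM.AG (cl AG V U Y) = k} = {Y \<in> subs U. clL U Y = k}"
  using res_cl(2)[OF U(2)] by auto
 show ?thesis
  unfolding zeta_eq[OF U(2)] num_def e[symmetric]
  by (rule dir_res_count[OF res_cl(1)[OF U(2)]]) (use num_finite[OF U] e in auto)
qed

lemma num_empty: assumes U: "fg R0 V U" "smG U" shows "num U {#} = 1"
proof -
 have "{Y \<in> subs U. clL U Y = {#}} = {U}"
 proof (intro equalityI subsetI)
  fix Y assume "Y \<in> {Y \<in> subs U. clL U Y = {#}}"
  then have Y: "Y \<in> subs U" "clL U Y = {#}" by auto
  have "Y = U"
   by (rule LM.VG.cl_empty[OF LM.subs_between[OF subs_L[OF Y(1)]] smG_smL[OF U(2)] smG_smL _ Y(2)])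
    (use Y in \<open>auto simp: subs_def\<close>)
  then show "Y \<in> {U}" by simp
 next
  fix Y assume "Y \<in> {U}"
  moreover have "U \<in> subs U" using U fin_index_pk[OF U(1), of 0] pX_sub[OF smG_smR[OF U(2)], of 0]
   unfolding subs_def by (auto intro: VR.fin_index_mono)
  ultimately show "Y \<in> {Y \<in> subs U. clL U Y = {#}}" using LM.VG.cl_refl[OF smG_smL[OF U(2)]] by simp
 qed
 then show ?thesis by (simp add: num_def)
qed

lemma num_class_monoid: assumes U: "fg R0 V U" "smG U" and n: "num U k \<noteq> 0" shows "k \<in> class_monoid LM.AG"
proof -
 have "{Y \<in> subs U. clL U Y = k} \<noteq> {}" using n unfolding num_def by (metis card.empty)
 then obtain Y where Y: "Y \<in> LM.subs U" "clL U Y = k" using subs_L by auto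
 show ?thesis unfolding Y(2)[symmetric]
  by (rule LM.VG.cl_class_monoid[OF LM.subs_between[OF Y(1)] smG_smL[OF U(2)]])
   (use Y(1) in \<open>auto simp: LM.subs_def\<close>)
qed

lemma res_zeta_unit: assumes U: "fg R0 V U" "smG U"
 shows "dir_res AG LM.AG (zeta AG (V\<lparr>carrier := U\<rparr>)) \<in> Units (Dir LM.AG)"
 by (rule Dir_UnitI) (use num_class_monoid[OF U] num_empty[OF U] in \<open>auto simp: res_zeta[OF U] Dir_simps\<close>)

text \<open>The left side is the coefficient at \<open>m\<close> of \<open>[W/U]\<close> times the
  restricted zeta function of \<open>U\<close>. The sublattices of \<open>U\<close> are those of
  \<open>W\<close> inside \<open>U\<close>, and \<open>[W/Y] = [W/U][U/Y]\<close>.\<close>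

lemma num_shift: assumes W: "fg R0 V W" "smG W" and U: "U \<in> subs W"
 shows "(if clL W U \<subseteq># m then int (num U (m - clL W U)) else 0)
  = int (card {Y \<in> subs W. Y \<subseteq> U \<and> clL W Y = m})"
proof -
 have Us: "smG U" "U \<subseteq> W" "fin_index V U W" using U by (auto simp: subs_def)
 have mem: "Y \<in> subs U \<longleftrightarrow> Y \<in> subs W \<and> Y \<subseteq> U" for Y
 proof
  assume Y: "Y \<in> subs U"
  then have "fin_index V Y W" using VG.fin_index_trans[OF W(2) Us(1) _ _ Us(2) _ Us(3)] by (auto simp: subs_def)
  then show "Y \<in> subs W \<and> Y \<subseteq> U" using Y Us by (auto simp: subs_def)
 next
  assume Y: "Y \<in> subs W \<and> Y \<subseteq> U"
  then have "smG Y" "fin_index V Y W" by (auto simp: subs_def)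
  then have "fin_index V (U \<inter> Y) U" using VG.fin_index_Int[OF W(2) _ Us(1,2)] by auto
  moreover have "U \<inter> Y = Y" using Y by auto
  ultimately show "Y \<in> subs U" using Y by (auto simp: subs_def)
 qed
 have add: "clL W Y = clL W U + clL U Y" if Y: "Y \<in> subs W" "Y \<subseteq> U" for Y
  by (rule LM.VG.cl_add[OF LM.subs_between[OF subs_L[OF Y(1)]] smG_smL[OF W(2)] smG_smL[OF Us(1)] smG_smL Y(2) Us(2)])
   (use Y in \<open>auto simp: subs_def\<close>)
 show ?thesis
 proof (cases "clL W U \<subseteq># m")
  case True
  then obtain n where n: "m = clL W U + n" by (auto simp: mset_subset_eq_exists_conv)
  have "{Y \<in> subs U. clL U Y = n} = {Y \<in> subs W. Y \<subseteq> U \<and> clL W Y = m}"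
   using mem add n by auto
  then show ?thesis using n by (simp add: num_def)
 next
  case False
  then have "{Y \<in> subs W. Y \<subseteq> U \<and> clL W Y = m} = {}" using add by auto
  then show ?thesis using False by (simp only: card.empty if_False of_nat_0)
 qed
qed

end

lemma conv_scale: "conv (\<lambda>m. w * f m) g m = w * conv f g m"
 unfolding conv_def by (simp add: sum_distrib_left mult.assoc)

lemma conv_poly: "finite I \<Longrightarrow> conv (\<lambda>m. \<Sum>i\<in>I. w i * dir_monom (c i) m) g m
  = (\<Sum>i\<in>I. w i * (if c i \<subseteq># m then g (m - c i) else 0))"
 using conv_sum[of I "\<lambda>i m. w i * dir_monom (c i) m" g m] by (simp add: conv_scale conv_monom)

lemma ghom_mono: "ghom A G U X V Y f \<Longrightarrow> H \<subseteq> G \<Longrightarrow> X' \<subseteq> X \<Longrightarrow> ghom A H U X' V Y f"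
 unfolding ghom_def by (meson subset_iff)

section \<open>The module generated over \<open>G\<close>, and transport of lattices along
  isomorphisms\<close>

context order_module
begin

lemma lat_mid: assumes X: "full X" and Y: "smR Y" "X \<subseteq> Y" "Y \<subseteq> Z" and Z: "fg R0 V Z"
 shows "full Y"
 unfolding lat_def absb_def using Y noeth[OF Z Y(1,3)] lat_absb[OF X] by blast

end

context order_in
begin

abbreviation "GX X \<equiv> set_smult V G X"

lemma GX_sm: assumes "X \<subseteq> carrier V" shows "smG (GX X)"
proof (rule V.ss_submodule[OF G _ assms])
 show "G \<subseteq> carrier A" using Gc by auto
 fix g s x assume *: "g \<in> G" "s \<in> G" "x \<in> X"
 then have "g \<odot> (s \<odot> x) = (g \<cdot> s) \<odot> x" using assms Gc V.smult_assoc by auto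
 then show "g \<odot> (s \<odot> x) \<in> GX X" using V.ss_mem[of "g \<cdot> s" G x X] * G_closed(4) by simp
qed

lemma GX_upper: assumes "X \<subseteq> carrier V" shows "X \<subseteq> GX X"
proof
 fix x assume x: "x \<in> X"
 then show "x \<in> GX X" using V.ss_mem[OF G_closed(2) x] assms V.smult_one[of x] by auto
qed

lemma GX_least: "X \<subseteq> Y \<Longrightarrow> smG Y \<Longrightarrow> GX X \<subseteq> Y"
 by (rule V.ss_least) (use Gc VG.sm_carrier smG_smult in auto)

lemma ghom_inj_qiso:
 assumes f: "gh W Y f" "inj_on f W" and W: "smG W" "smG Y" and X: "smG X" "X \<subseteq> W"
 shows "qiso AG V W X V (f ` W) (f ` X) f"
proof (rule ghom_qiso[OF f(1) W ghom_img_sm[OF ghom_mono[OF f(1) order_refl X(2)] X(1) W(2)] image_mono[OF X(2)] ghom_img_sm[OF f(1) W] _ order_refl])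
 show "f ` W \<subseteq> Y" using ghomD(1)[OF f(1)] by auto
 have fX: "smG (f ` X)" by (rule ghom_img_sm[OF ghom_mono[OF f(1) order_refl X(2)] X(1) W(2)])
 fix t assume t: "t \<in> f ` W"
 then have "t \<in> carrier V" using ghomD(1)[OF f(1)] VG.smD[OF W(2)] by auto
 then show "\<exists>x\<in>W. mcong V (f ` X) t (f x)" using t VG.cong_refl[OF fX] by auto
next
 fix x assume "x \<in> W"
 then show "f x \<in> f ` X \<longleftrightarrow> x \<in> X" using inj_on_image_mem_iff[OF f(2) _ X(2)] by auto
qed

lemma ghom_module_iso:
 assumes f: "gh X Y f" "inj_on f X"
 shows "module_isomorphic AG (V\<lparr>carrier := X\<rparr>) (V\<lparr>carrier := f ` X\<rparr>)"
 unfolding module_isomorphic_def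
proof (rule bexI[of _ f])
 show "f \<in> iso (add_monoid (V\<lparr>carrier := X\<rparr>)) (add_monoid (V\<lparr>carrier := f ` X\<rparr>))"
  unfolding iso_def hom_def bij_betw_def using f(2) ghomD(2)[OF f(1)] by auto
qed (use ghomD(3)[OF f(1)] in auto)

lemma ghom_preimage_sm:
 assumes f: "gh W Y f" and W: "smG W" "smG Y" and Z: "smG Z"
 shows "smG {w \<in> W. f w \<in> Z}"
proof (rule VG.submoduleI)
 note g = ghomD[OF f]
 show "\<zero> \<in> {w \<in> W. f w \<in> Z}" using ghom_zero[OF f W] VG.sm_zero W Z by auto
 show "x \<oplus> y \<in> {w \<in> W. f w \<in> Z}" if "x \<in> {w \<in> W. f w \<in> Z}" "y \<in> {w \<in> W. f w \<in> Z}" for x y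
  using that g(2) VG.sm_add[OF W(1)] VG.sm_add[OF Z] by auto
 show "a \<odot> x \<in> {w \<in> W. f w \<in> Z}" if "a \<in> carrier AG" "x \<in> {w \<in> W. f w \<in> Z}" for a x
  using that g(3) smG_smult[OF W(1)] smG_smult[OF Z] by auto
qed (use VG.smD[OF W(1)] in auto)

lemma ghom_GX:
 assumes f: "gh W Y f" and W: "smG W" "smG Y" and X: "X \<subseteq> W"
 shows "f ` GX X = GX (f ` X)"
proof
 have Xc: "X \<subseteq> carrier V" "f ` X \<subseteq> carrier V" using X VG.smD[OF W(1)] VG.smD[OF W(2)] ghomD(1)[OF f] by auto
 have GW: "GX X \<subseteq> W" by (rule GX_least[OF X W(1)])
 have "GX X \<subseteq> {w \<in> W. f w \<in> GX (f ` X)}"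
  by (rule GX_least[OF _ ghom_preimage_sm[OF f W GX_sm[OF Xc(2)]]]) (use X GX_upper[OF Xc(2)] in auto)
 then show "f ` GX X \<subseteq> GX (f ` X)" by auto
 show "GX (f ` X) \<subseteq> f ` GX X"
  by (rule GX_least[OF image_mono[OF GX_upper[OF Xc(1)]] ghom_img_sm[OF ghom_mono[OF f order_refl GW] GX_sm[OF Xc(1)] W(2)]])
qed

lemma ghom_pX: assumes f: "gh W Y f" shows "f ` pX k W = pX k (f ` W)"
 using ghomD(3)[OF f pG] by (auto simp: image_image)

lemma lat_image:
 assumes f: "gh W Y f" "f ` W = Y" and W: "full W" "smG W" and Y: "full Y" "smG Y"
  and X: "full X" "smG X" "X \<subseteq> W"
 shows "full (f ` X)" "smG (f ` X)"
proof -
 show fX: "smG (f ` X)" by (rule ghom_img_sm[OF ghom_mono[OF f(1) order_refl X(3)] X(2) Y(2)])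
 obtain k where "pX k W \<subseteq> X" using lat_absorb[OF lat_fg[OF W(1)] X(1)] by blast
 then have "f ` pX k W \<subseteq> f ` X" by (rule image_mono)
 then have pk: "pX k Y \<subseteq> f ` X" using ghom_pX[OF f(1)] f(2) by simp
 show "full (f ` X)" by (rule latI_sub[OF Y(1) smG_smR[OF fX] _ pk]) (use X(3) f(2) in auto)
qed

end

context order_pair
begin

lemma cl_image:
 assumes f: "gh W Y f" "bij_betw f W Y" and W: "full W" "smG W" and Y: "full Y" "smG Y"
  and X: "full X" "LM.smG X" "X \<subseteq> W"
 shows "full (f ` X)" "LM.smG (f ` X)" "clL W X = clL Y (f ` X)"
proof -
 interpret T: two_modules LM.AG V V by (rule LM.VG.two_self)
 have fL: "ghom A L0 V W V Y f" by (rule ghom_mono[OF f(1) L0G order_refl])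
 have fW: "f ` W = Y" "inj_on f W" using f(2) by (auto simp: bij_betw_def)
 note sW = smG_smL[OF W(2)] and sY = smG_smL[OF Y(2)]
 show i: "full (f ` X)" "LM.smG (f ` X)"
  by (rule LM.lat_image[OF fL fW(1) W(1) sW Y(1) sY X])+
 have q: "qiso LM.AG V W X V Y (f ` X) f" using LM.ghom_inj_qiso[OF fL fW(2) sW sY X(2,3)] fW(1) by simp
 have "f ` X \<subseteq> Y" using X(3) fW(1) by auto
 then show "clL W X = clL Y (f ` X)"
  by (rule T.cl_qiso[OF sW X(2,3) sY i(2) _ q]) (rule LM.VG.fin_index_between[OF lat_fin_index[OF lat_fg[OF W(1)] X(1)]])
qed

lemma cl_addL: "\<lbrakk>full X; LM.smG X; full Y; LM.smG Y; full Z; LM.smG Z; Z \<subseteq> Y; Y \<subseteq> X\<rbrakk> \<Longrightarrow>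
  clL X Z = clL X Y + clL Y Z"
 by (rule LM.VG.cl_add[OF LM.VG.fin_index_between[OF lat_fin_index[OF lat_fg]]])

end

locale zeta_setting = hereditary_module A R0 p pinv G V + order_pair A R0 p pinv V G L0
 for A :: "('a, 'c) ring_scheme" and R0 p pinv G and V :: "('a, 'v, 'e) module_scheme" (structure) and L0
begin

text \<open>Modulo \<open>N = V\<close> any two lattices agree, so \<open>lattice_iso\<close> makes
  all full \<open>G\<close>-lattices in \<open>V\<close> isomorphic.\<close>

lemma num_le:
 assumes W: "full W" "smG W" and Y: "full Y" "smG Y"
 shows "num W k \<le> num Y k"
proof -
 have e: "Z <+> carrier V = carrier V" if "smG Z" for Z
  using VG.sum_least[OF VG.sm_UNIV VG.sm_carrier[OF that] order_refl] VG.sum_upper2[OF that VG.sm_UNIV] by auto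
 obtain f where f: "gh W Y f" "bij_betw f W Y"
  using lattice_iso[OF W Y VG.sm_UNIV] e W(2) Y(2) by auto
 have fW: "f ` W = Y" "inj_on f W" using f(2) by (auto simp: bij_betw_def)
 show ?thesis unfolding num_def
 proof (rule card_inj_on_le[OF _ _ num_finite[OF lat_fg[OF Y(1)] Y(2)]])
  show "inj_on ((`) f) {Z \<in> subs W. clL W Z = k}"
   by (rule inj_on_subset[OF inj_on_image_Pow[OF fW(2)]]) (auto simp: subs_def)
  show "(`) f ` {Z \<in> subs W. clL W Z = k} \<subseteq> {Z \<in> subs Y. clL Y Z = k}"
  proof (clarify)
   fix Z assume Z: "Z \<in> subs W"
   have lZ: "full Z" by (rule subs_lat[OF Z W])
   have sZ: "smG Z" "Z \<subseteq> W" using Z by (auto simp: subs_def)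
   have "f ` Z \<in> subs Y"
    by (rule lat_subs[OF lat_fg[OF Y(1)] lat_image(2)[OF f(1) fW(1) W Y lZ sZ] _ lat_image(1)[OF f(1) fW(1) W Y lZ sZ]])
     (use sZ(2) fW(1) in auto)
   then show "f ` Z \<in> subs Y \<and> clL Y (f ` Z) = clL W Z"
    using cl_image(3)[OF f W Y lZ smG_smL[OF sZ(1)] sZ(2)] by simp
  qed
 qed
qed

lemma num_eq: "\<lbrakk>full W; smG W; full Y; smG Y\<rbrakk> \<Longrightarrow> num W k = num Y k"
 by (intro antisym num_le)

end

section \<open>The quotient of the zeta functions\<close>

locale zeta_lattice = zeta_setting A R0 p pinv G V L0
 for A :: "('a, 'c) ring_scheme" and R0 p pinv G and V :: "('a, 'v, 'e) module_scheme" (structure) and L0 +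
 fixes L
 assumes latL: "full L" and smL: "LM.smG L"
begin

definition "L' = set_smult V G L"
definition "I = two_sided_conductor A G L0"
definition "IL' = set_smult V I L'"

lemma Gsub: "G \<subseteq> carrier A" using Gc by auto

lemma Lc: "L \<subseteq> carrier V" by (rule LM.VG.sm_carrier[OF smL])

lemma conductor_exists: "\<exists>k::nat. \<forall>g\<in>G. pp k \<cdot> g \<in> L0"
proof -
 have "latA L0" by (rule ordD(2)[OF ordL0])
 then obtain k where "AA.pX k G \<subseteq> L0" using AA.lat_absorb[OF fG] by blast
 then show ?thesis by auto
qed

text \<open>An exponent with \<open>p^ck G \<subseteq> L0\<close>. It puts \<open>p^ck\<close> into
  the conductor \<open>I\<close>, so that \<open>IL'\<close> is a full lattice.\<close>

definition "ck = (SOME k::nat. \<forall>g\<in>G. pp k \<cdot> g \<in> L0)"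

lemma ck: "g \<in> G \<Longrightarrow> pp ck \<cdot> g \<in> L0"
 using someI_ex[OF conductor_exists] unfolding ck_def by blast

lemma I_L0: "I \<subseteq> L0"
proof
 fix a assume "a \<in> I"
 then have a: "a \<in> carrier A" "\<one>\<^bsub>A\<^esub> \<cdot> a \<cdot> \<one>\<^bsub>A\<^esub> \<in> L0" using G_closed(2) unfolding I_def two_sided_conductor_def by blast+
 then show "a \<in> L0" by simp
qed

lemma Ic: "a \<in> I \<Longrightarrow> a \<in> carrier A" using I_L0 LM.Gc by auto

lemma I_mult: "\<lbrakk>a \<in> I; g \<in> G\<rbrakk> \<Longrightarrow> a \<cdot> g \<in> I" "\<lbrakk>a \<in> I; g \<in> G\<rbrakk> \<Longrightarrow> g \<cdot> a \<in> I"
proof -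
 assume a: "a \<in> I" and g: "g \<in> G"
 note c = Ic[OF a] Gc[OF g]
 have h: "x \<cdot> a \<cdot> y \<in> L0" if "x \<in> G" "y \<in> G" for x y
  using a that unfolding I_def two_sided_conductor_def by blast
 show "a \<cdot> g \<in> I" unfolding I_def two_sided_conductor_def
  using h[OF _ G_closed(4)[OF g]] c Gc by (auto simp: m_assoc)
 show "g \<cdot> a \<in> I" unfolding I_def two_sided_conductor_def
  using h[OF G_closed(4)[OF _ g]] c Gc by (auto simp: m_assoc)
qed

lemma I_add: assumes "a \<in> I" "b \<in> I" shows "a \<oplus>\<^bsub>A\<^esub> b \<in> I"
proof -
 note c = Ic[OF assms(1)] Ic[OF assms(2)]
 have "x \<cdot> (a \<oplus>\<^bsub>A\<^esub> b) \<cdot> y \<in> L0" if xy: "x \<in> G" "y \<in> G" for x y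
 proof -
  have "x \<cdot> a \<cdot> y \<in> L0" "x \<cdot> b \<cdot> y \<in> L0" using assms xy unfolding I_def two_sided_conductor_def by blast+
  then have "x \<cdot> a \<cdot> y \<oplus>\<^bsub>A\<^esub> x \<cdot> b \<cdot> y \<in> L0" by (rule LM.G_closed(3))
  then show ?thesis using c xy Gc by (simp add: r_distr l_distr)
 qed
 then show ?thesis using c unfolding I_def two_sided_conductor_def by simp
qed

lemma I_sm: "submodule I W.AG RA"
proof (rule W.VG.submoduleI)
 show "I \<subseteq> carrier RA" using Ic by auto
 show "\<zero>\<^bsub>RA\<^esub> \<in> I" unfolding I_def two_sided_conductor_def using Gc LM.G_closed(1) by simp
qed (use I_add I_mult in auto)

lemma p_I: "pp ck \<in> I"
proof -
 have "x \<cdot> pp ck \<cdot> y \<in> L0" if xy: "x \<in> G" "y \<in> G" for x y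
  using ck[OF G_closed(4)[OF xy]] p_central[OF Gc[OF xy(1)], of ck] Gc xy by (simp add: m_assoc[symmetric])
 then show ?thesis unfolding I_def two_sided_conductor_def by simp
qed

lemma L'_sm: "smG L'" unfolding L'_def by (rule GX_sm[OF Lc])
lemma L_L': "L \<subseteq> L'" unfolding L'_def by (rule GX_upper[OF Lc])

lemma pGX: assumes X: "LM.smG X" shows "pX ck (GX X) \<subseteq> X"
proof -
 have Xc: "X \<subseteq> carrier V" by (rule LM.VG.sm_carrier[OF X])
 have m: "pp ck \<odot> (s \<odot> x) \<in> X" if "s \<in> G" "x \<in> X" for s x
  using LM.smG_smult[OF X ck[OF that(1)] that(2)] V.smult_assoc[of "pp ck" s x] that Gc Xc by auto
 have "pp ck \<odot> x \<in> X" if "x \<in> GX X" for x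
  by (rule V.ss_map[OF that Gsub Xc LM.VG.sm_subgroup[OF X] V.M.abelian_group_axioms, where f = "\<lambda>x. pp ck \<odot> x"])
   (use m in \<open>simp_all add: V.smult_closed V.smult_r_distr\<close>)
 then show ?thesis by auto
qed

text \<open>\<open>p^ck L' \<subseteq> L\<close> bounds \<open>L'\<close> from above, which makes it
  finitely generated.\<close>

lemma L'_lat: "full L'"
proof -
 have "fg R0 V (pX ck L')" unfolding L'_def
  by (rule noeth[OF lat_fg[OF latL] smR_pX[OF smG_smR[OF GX_sm[OF Lc]]] pGX[OF smL]])
 then have "fg R0 V L'" by (rule fg_pinvX) (rule VG.sm_carrier[OF L'_sm])
 then show ?thesis by (rule lat_mid[OF latL smG_smR[OF L'_sm] L_L' order_refl])
qed

lemma IL'_smult: "\<lbrakk>a \<in> I; x \<in> L'\<rbrakk> \<Longrightarrow> a \<odot> x \<in> IL'" unfolding IL'_def by (rule V.ss_mem)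

lemma IL'_sm: "smG IL'"
 unfolding IL'_def
proof (rule V.ss_submodule[OF G])
 fix g s x assume *: "g \<in> G" "s \<in> I" "x \<in> L'"
 have "g \<odot> (s \<odot> x) = (g \<cdot> s) \<odot> x" using * Gc Ic VG.smD[OF L'_sm] V.smult_assoc by auto
 then show "g \<odot> (s \<odot> x) \<in> set_smult V I L'" using V.ss_mem[OF I_mult(2)[OF *(2,1)] *(3)] by simp
qed (use Ic VG.smD[OF L'_sm] in auto)

text \<open>\<open>IL' = IGL\<close>, and \<open>IG \<subseteq> I \<subseteq> L0\<close>. This
  inclusion is the reason for the choice of \<open>I\<close>: a map that is the identity modulo
  \<open>IL'\<close> respects membership in \<open>L\<close>.\<close>

lemma IL'_L: "IL' \<subseteq> L"
proof -
 have m: "a \<odot> (s \<odot> x) \<in> L" if a: "a \<in> I" and x: "s \<in> G" "x \<in> L" for a s x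
 proof -
  have as: "a \<cdot> s \<in> L0" using I_mult(1)[OF a x(1)] I_L0 by auto
  have "x \<in> carrier V" "s \<in> carrier A" using x Lc Gc by auto
  then show ?thesis using LM.smG_smult[OF smL as x(2)] V.smult_assoc[of a s x] Ic[OF a] by simp
 qed
 have "a \<odot> x \<in> L" if a: "a \<in> I" and x: "x \<in> L'" for a x
  by (rule V.ss_map[OF x[unfolded L'_def] Gsub Lc LM.VG.sm_subgroup[OF smL] V.M.abelian_group_axioms, where f = "\<lambda>x. a \<odot> x"])
   (use m[OF a] Ic[OF a] in \<open>simp_all add: V.smult_closed V.smult_r_distr\<close>)
 then show ?thesis unfolding IL'_def by (intro V.ss_least[OF _ _ smL]) (use Ic VG.smD[OF L'_sm] in auto)
qed

lemma IL'_L': "IL' \<subseteq> L'" using IL'_L L_L' by auto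

lemma p_IL': "pX ck L' \<subseteq> IL'" using IL'_smult[OF p_I] by auto

lemma IL'_lat: "full IL'"
 by (rule latI_sub[OF L'_lat smG_smR[OF IL'_sm] IL'_L' p_IL'])

definition over where "over = {W. smG W \<and> IL' \<subseteq> W \<and> W \<subseteq> L'}"

lemma over_lat: "W \<in> over \<Longrightarrow> full W" "W \<in> over \<Longrightarrow> smG W"
 unfolding over_def using lat_mid[OF IL'_lat smG_smR _ _ lat_fg[OF L'_lat]] by auto

text \<open>Inside the proof, lattices in \<open>over\<close> stand for submodules of
  \<open>L' / IL'\<close>; \<open>bar\<close> translates them to the poset on which
  \<open>\<mu>\<close> lives.\<close>

definition bar where "bar Z = (+>) IL' ` Z"

definition "mu = moebius (bar ` over)"

lemma fin_over: "finite over"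
 using VG.fin_index_between[OF lat_fin_index[OF lat_fg[OF L'_lat] IL'_lat]] by (simp add: between_def over_def)

lemma bar_sub: "U \<in> over \<Longrightarrow> W \<in> over \<Longrightarrow> bar U \<subseteq> bar W \<longleftrightarrow> U \<subseteq> W"
 unfolding bar_def by (rule VG.bar_subset_iff[OF IL'_sm]) (auto simp: over_def)

lemma bar_inj: "inj_on bar over"
 by (rule inj_onI) (use bar_sub in \<open>metis order_refl antisym\<close>)

lemma mu_sum:
 assumes U: "U \<in> over" and W: "W \<in> over" and UW: "U \<subseteq> W"
 shows "(\<Sum>Z\<in>{Z \<in> over. U \<subseteq> Z \<and> Z \<subseteq> W}. mu (bar Z) (bar W)) = (if U = W then 1 else 0)"
proof -
 let ?S = "{Z \<in> over. U \<subseteq> Z \<and> Z \<subseteq> W}"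
 have e: "{z \<in> bar ` over. bar U \<le> z \<and> z \<le> bar W} = bar ` ?S"
  using bar_sub U W by auto
 have "(\<Sum>Z\<in>?S. mu (bar Z) (bar W)) = (\<Sum>z\<in>bar ` ?S. mu z (bar W))"
  by (rule sum.reindex_cong[OF _ HOL.refl HOL.refl, symmetric]) (use bar_inj in \<open>auto intro: inj_on_subset\<close>)
 also have "\<dots> = (if bar U = bar W then 1 else 0)"
  unfolding mu_def e[symmetric]
  by (rule moebius_sum_lower) (use U W UW bar_sub[OF U W] fin_over in \<open>auto simp: e\<close>)
 also have "bar U = bar W \<longleftrightarrow> U = W" using inj_on_eq_iff[OF bar_inj U W] .
 finally show ?thesis .
qed

text \<open>Moebius inversion: of the sublattices of \<open>W\<close>, only those that generate \<open>W\<close> modulo \<open>IL'\<close>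
 survive.\<close>

lemma mu_count:
 assumes W: "W \<in> over"
 shows "(\<Sum>U\<in>{U \<in> over. U \<subseteq> W}. mu (bar U) (bar W) * int (card {Y \<in> subs W. Y \<subseteq> U \<and> clL W Y = n}))
  = int (card {Y \<in> subs W. Y <+> IL' = W \<and> clL W Y = n})"
proof -
 let ?T = "{Y \<in> subs W. clL W Y = n}" and ?O = "{U \<in> over. U \<subseteq> W}"
 have Ws: "smG W" "IL' \<subseteq> W" "W \<subseteq> L'" using W by (auto simp: over_def)
 have fT: "finite ?T" by (rule num_finite[OF lat_fg[OF over_lat(1)[OF W]] Ws(1)])
 have fO: "finite ?O" using fin_over by simp
 have "int (card {Y \<in> subs W. Y \<subseteq> U \<and> clL W Y = n}) = (\<Sum>Y\<in>?T. if Y \<subseteq> U then 1 else 0)" for U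
 proof -
  have "{Y \<in> subs W. Y \<subseteq> U \<and> clL W Y = n} = {Y \<in> ?T. Y \<subseteq> U}" by auto
  then show ?thesis using fT by (simp add: sum.If_cases Int_def)
 qed
 then have "(\<Sum>U\<in>?O. mu (bar U) (bar W) * int (card {Y \<in> subs W. Y \<subseteq> U \<and> clL W Y = n}))
   = (\<Sum>U\<in>?O. \<Sum>Y\<in>?T. if Y \<subseteq> U then mu (bar U) (bar W) else 0)"
  by (auto simp: sum_distrib_left intro!: sum.cong)
 also have "\<dots> = (\<Sum>Y\<in>?T. \<Sum>U\<in>?O. if Y \<subseteq> U then mu (bar U) (bar W) else 0)" by (rule sum.swap)
 also have "\<dots> = (\<Sum>Y\<in>?T. if Y <+> IL' = W then 1 else 0)"
 proof (rule sum.cong[OF HOL.refl])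
  fix Y assume "Y \<in> ?T"
  then have Y: "smG Y" "Y \<subseteq> W" by (auto simp: subs_def)
  \<comment> \<open>A member of \<open>over\<close> contains \<open>Y\<close> if and only if it
    contains \<open>Y + IL'\<close>, so the inner sum is a dual Moebius sum over an
    interval.\<close>
  let ?U = "Y <+> IL'"
  have YW: "?U \<subseteq> W" by (rule VG.sum_least[OF Ws(1) Y(2) Ws(2)])
  have up: "Y \<subseteq> ?U" "IL' \<subseteq> ?U" using VG.sum_upper1[OF Y(1) IL'_sm] VG.sum_upper2[OF Y(1) IL'_sm] by auto
  have U: "?U \<in> over" using VG.sm_sum[OF Y(1) IL'_sm] up(2) YW Ws(3) by (auto simp: over_def)
  have "?U \<subseteq> Z \<longleftrightarrow> Y \<subseteq> Z" if "Z \<in> over" for Z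
   using that up VG.sum_least[of Z Y IL'] by (auto simp: over_def)
  then have "{Z \<in> over. ?U \<subseteq> Z \<and> Z \<subseteq> W} = {Z \<in> ?O. Y \<subseteq> Z}" by auto
  then show "(\<Sum>U\<in>?O. if Y \<subseteq> U then mu (bar U) (bar W) else 0) = (if ?U = W then 1 else 0)"
   using mu_sum[OF U W YW] fO by (simp add: sum.If_cases Int_def)
 qed
 also have "\<dots> = int (card {Y \<in> ?T. Y <+> IL' = W})" using fT by (simp add: sum.If_cases Int_def)
 also have "{Y \<in> ?T. Y <+> IL' = W} = {Y \<in> subs W. Y <+> IL' = W \<and> clL W Y = n}" by auto
 finally show ?thesis .
qed

text \<open>An isomorphism \<open>\<theta>\<close> of \<open>W\<close> onto \<open>Y\<close> that is the identity modulo \<open>IL'\<close>; it carries the sublattices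
 \<open>X\<close> of \<open>L\<close> with \<open>\<Lambda>'X = W\<close> to those with \<open>\<Lambda>'X = Y\<close>.\<close>

definition th where
 "th W Y = (SOME \<theta>. gh W Y \<theta> \<and> bij_betw \<theta> W Y \<and> (\<forall>w\<in>W. mcong V IL' (\<theta> w) w))"

lemma th:
 assumes W: "W \<in> over" and Y: "full Y" "smG Y" "Y <+> IL' = W"
 shows "gh W Y (th W Y)" "bij_betw (th W Y) W Y" "\<And>w. w \<in> W \<Longrightarrow> mcong V IL' (th W Y w) w"
proof -
 have Ws: "smG W" "IL' \<subseteq> W" using W by (auto simp: over_def)
 have "W <+> IL' = Y <+> IL'"
  unfolding Y(3) using VG.sum_least[OF Ws(1) order_refl Ws(2)] VG.sum_upper1[OF Ws(1) IL'_sm] by auto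
 from someI_ex[OF lattice_iso[OF over_lat(1)[OF W] Ws(1) Y(1,2) IL'_sm this]]
 show "gh W Y (th W Y)" "bij_betw (th W Y) W Y" "\<And>w. w \<in> W \<Longrightarrow> mcong V IL' (th W Y w) w"
  unfolding th_def by auto
qed

text \<open>\<open>W\<close> and \<open>L\<close> need not be comparable, so everything is measured
  from \<open>L'\<close>. With \<open>\<theta>\<close> for \<open>th W Y\<close>:
  \<open>[L'/L][L/\<theta>X] = [L'/Y][Y/\<theta>X] = [L'/W][W/Y][W/X] = [L'/L][L/X][W/Y]\<close>,
  because \<open>\<theta>\<close> induces \<open>[Y/\<theta>X] = [W/X]\<close>. The factor
  \<open>[L'/L]\<close> cancels.\<close>

lemma cl_shift:
 assumes W: "W \<in> over" and Y: "full Y" "smG Y" "Y <+> IL' = W"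
  and X: "full X" "LM.smG X" "X \<subseteq> W" "X \<subseteq> L"
  and XL: "th W Y ` X \<subseteq> L"
 shows "clL L (th W Y ` X) = clL L X + clL W Y"
proof -
 note t = th[OF W Y]
 note im = cl_image[OF t(1,2) over_lat[OF W] Y(1,2) X(1,2,3)]
 have tY: "th W Y ` X \<subseteq> Y" using X(3) t(2) by (auto simp: bij_betw_def)
 have Ws: "W \<subseteq> L'" using W by (auto simp: over_def)
 have YW: "Y \<subseteq> W" using VG.sum_upper1[OF Y(2) IL'_sm] Y(3) by simp
 note l = L'_lat smG_smL[OF L'_sm] latL smL over_lat(1)[OF W] smG_smL[OF over_lat(2)[OF W]] Y(1) smG_smL[OF Y(2)]
 have "clL L' L + clL L (th W Y ` X) = clL L' (th W Y ` X)"
  by (rule cl_addL[symmetric, OF l(1-4) im(1,2) XL L_L'])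
 also have "\<dots> = clL L' Y + clL Y (th W Y ` X)"
  by (rule cl_addL[OF l(1,2,7,8) im(1,2) tY subset_trans[OF YW Ws]])
 also have "clL L' Y = clL L' W + clL W Y" by (rule cl_addL[OF l(1,2,5-8) YW Ws])
 also have "clL Y (th W Y ` X) = clL W X" by (rule im(3)[symmetric])
 also have "clL L' W + clL W Y + clL W X = clL L' X + clL W Y"
  using cl_addL[OF l(1,2,5,6) X(1,2,3) Ws] by (simp add: add_ac)
 also have "clL L' X = clL L' L + clL L X" by (rule cl_addL[OF l(1-4) X(1,2,4) L_L'])
 finally show ?thesis by (simp add: add_ac)
qed

lemma th_L:
 assumes W: "W \<in> over" and Y: "full Y" "smG Y" "Y <+> IL' = W" and w: "w \<in> W"
 shows "th W Y w \<in> L \<longleftrightarrow> w \<in> L"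
 by (rule LM.VG.cong_mem[OF smL]) (rule LM.VG.cong_mono[OF th(3)[OF W Y w] IL'_L])

end

lemma poly_Dir:
 assumes "finite I" "\<And>i. i \<in> I \<Longrightarrow> c i \<in> class_monoid \<Gamma>"
 shows "(\<lambda>m. \<Sum>i\<in>I. w i * dir_monom (c i) m) \<in> Dir_poly \<Gamma>"
proof -
 have *: "m \<in> c ` I" if nz: "(\<Sum>i\<in>I. w i * dir_monom (c i) m) \<noteq> 0" for m
 proof -
  obtain i where "i \<in> I" "w i * dir_monom (c i) m \<noteq> 0" by (rule sum.not_neutral_contains_not_neutral[OF nz])
  then show ?thesis by (auto simp: dir_monom_def split: if_splits)
 qed
 have "finite {m. (\<Sum>i\<in>I. w i * dir_monom (c i) m) \<noteq> 0}"
  by (rule finite_subset[of _ "c ` I"]) (use * assms(1) in auto)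
 then show ?thesis using * assms(2) by (auto simp: Dir_poly_def Dir_simps)
qed

section \<open>The bijection between pairs and the sublattices counted by the partial zeta
  function\<close>

context zeta_lattice
begin

definition XX where
 "XX N = {X. LM.smG X \<and> X \<subseteq> L \<and> module_isomorphic LM.AG (V\<lparr>carrier := X\<rparr>) N \<and> IL' \<subseteq> GX X}"

lemma XX_facts:
 assumes X: "X \<in> XX N"
 shows "LM.smG X" "X \<subseteq> L" "GX X \<in> over" "X \<subseteq> GX X" "full X" "X \<in> LM.subs L"
  "pX (ck + ck) L' \<subseteq> X"
proof -
 show X1: "LM.smG X" and X2: "X \<subseteq> L" using X by (auto simp: XX_def)
 have Xc: "X \<subseteq> carrier V" using X2 Lc by auto
 show XG: "X \<subseteq> GX X" by (rule GX_upper[OF Xc])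
 have "GX X \<subseteq> L'" unfolding L'_def by (rule V.ss_mono[OF order_refl X2 Gsub Lc])
 then show "GX X \<in> over" using GX_sm[OF Xc] X by (auto simp: over_def XX_def)
 \<comment> \<open>One factor \<open>p^ck\<close> leads from \<open>L'\<close> into
   \<open>IL'\<close> and thus into \<open>GX X\<close>, the other from there into \<open>X\<close>;
   hence the exponent \<open>ck + ck\<close>.\<close>
 have "pX ck L' \<subseteq> GX X" using p_IL' X by (auto simp: XX_def)
 then have "pX ck (pX ck L') \<subseteq> pX ck (GX X)" by (rule image_mono)
 then show pk: "pX (ck + ck) L' \<subseteq> X" unfolding pX_add[OF VG.sm_carrier[OF L'_sm]] using pGX[OF X1] by (rule subset_trans)
 show l: "full X" by (rule latI_sub[OF L'_lat LM.smG_smR[OF X1] _ pk]) (use X2 L_L' in auto)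
 show "X \<in> LM.subs L" by (rule LM.lat_subs[OF lat_fg[OF latL] X1 X2 l])
qed

lemma XX_finite: "finite (XX N)"
proof (rule finite_subset[OF _ LM.VG.fin_index_between[OF fin_index_pk[OF lat_fg[OF L'_lat], of "ck + ck"]]])
 show "XX N \<subseteq> between LM.AG V (pX (ck + ck) L') L'"
 proof
  fix X assume "X \<in> XX N"
  from XX_facts[OF this] show "X \<in> between LM.AG V (pX (ck + ck) L') L'" using L_L' by (auto simp: between_def)
 qed
qed

lemma th_module_iso:
 assumes W: "W \<in> over" and Y: "full Y" "smG Y" "Y <+> IL' = W" and X: "LM.smG X" "X \<subseteq> W"
 shows "module_isomorphic LM.AG (V\<lparr>carrier := X\<rparr>) N \<longleftrightarrow> module_isomorphic LM.AG (V\<lparr>carrier := th W Y ` X\<rparr>) N"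
proof -
 note t = th[OF W Y]
 have fL: "ghom A L0 V X V Y (th W Y)" by (rule ghom_mono[OF t(1) L0G X(2)])
 have "inj_on (th W Y) X" using t(2) X(2) by (auto simp: bij_betw_def intro: inj_on_subset)
 then have i: "module_isomorphic LM.AG (V\<lparr>carrier := X\<rparr>) (V\<lparr>carrier := th W Y ` X\<rparr>)" by (rule LM.ghom_module_iso[OF fL])
 have lm: "left_module LM.AG (V\<lparr>carrier := X\<rparr>)" "left_module LM.AG (V\<lparr>carrier := th W Y ` X\<rparr>)"
  using LM.VG.left_module_sub[OF X(1)] LM.VG.left_module_sub[OF LM.ghom_img_sm[OF fL X(1) smG_smL[OF Y(2)]]] by auto
 show ?thesis
  using module_isomorphic_trans[OF lm(1) i] module_isomorphic_trans[OF lm(2) module_isomorphic_sym[OF lm i]] by blast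
qed

definition pairs where
 "pairs N m = (SIGMA X:XX N. {Y \<in> subs (GX X). Y <+> IL' = GX X \<and> clL L X + clL (GX X) Y = m})"

text \<open>The inverse recovers \<open>Y\<close> as \<open>GX Z\<close>, then \<open>W\<close> as
  \<open>Y + IL'\<close>, and \<open>X\<close> as the preimage of \<open>Z\<close> under the chosen
  isomorphism. This works because the choice in \<open>th\<close> depends only on \<open>W\<close>
  and \<open>Y\<close>, and both can be read off from \<open>Z\<close>.\<close>

lemma pairs_card:
 "card (pairs N m) = card {Z \<in> LM.subs L. module_isomorphic LM.AG (V\<lparr>carrier := Z\<rparr>) N \<and> clL L Z = m}"
  (is "_ = card ?Z")
proof -
 let ?f = "\<lambda>(X, Y). th (GX X) Y ` X"
 let ?W = "\<lambda>Z. GX Z <+> IL'"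
 let ?g = "\<lambda>Z. ({w \<in> ?W Z. th (?W Z) (GX Z) w \<in> Z}, GX Z)"
 have fwd: "?f (X, Y) \<in> ?Z \<and> ?g (?f (X, Y)) = (X, Y)" if "(X, Y) \<in> pairs N m" for X Y
 proof -
  have X: "X \<in> XX N" and Y: "Y \<in> subs (GX X)" "Y <+> IL' = GX X"
   and m: "clL L X + clL (GX X) Y = m" using that by (auto simp: pairs_def)
  note x = XX_facts[OF X]
  note W = over_lat[OF x(3)]
  have lY: "full Y" "smG Y" "Y \<subseteq> GX X" using subs_lat[OF Y(1) W] Y(1) by (auto simp: subs_def)
  note t = th[OF x(3) lY(1,2) Y(2)]
  let ?Z1 = "th (GX X) Y ` X"
  have ZL: "?Z1 \<subseteq> L" using th_L[OF x(3) lY(1,2) Y(2)] x(2,4) by auto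
  note im = cl_image[OF t(1,2) W lY(1,2) x(5,1,4)]
  have Z1: "?Z1 \<in> LM.subs L" by (rule LM.lat_subs[OF lat_fg[OF latL] im(2) ZL im(1)])
  have Z2: "module_isomorphic LM.AG (V\<lparr>carrier := ?Z1\<rparr>) N"
   using X unfolding th_module_iso[OF x(3) lY(1,2) Y(2) x(1,4), symmetric] by (simp add: XX_def)
  have Z3: "clL L ?Z1 = m" unfolding m[symmetric] by (rule cl_shift[OF x(3) lY(1,2) Y(2) x(5,1,4,2) ZL])
  have "GX ?Z1 = th (GX X) Y ` GX X" by (rule ghom_GX[OF t(1) W(2) lY(2) x(4), symmetric])
  also have "\<dots> = Y" using t(2) by (simp add: bij_betw_def)
  finally have GZ: "GX ?Z1 = Y" .
  have "{w \<in> GX X. th (GX X) Y w \<in> ?Z1} = X"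
   using inj_on_image_mem_iff[OF _ _ x(4), of "th (GX X) Y"] t(2) x(4) by (auto simp: bij_betw_def)
  then have gZ: "?g ?Z1 = (X, Y)" unfolding GZ Y(2) by simp
  have fX: "?f (X, Y) = ?Z1" by simp
  show ?thesis unfolding fX gZ using Z1 Z2 Z3 by simp
 qed
 have bwd: "?g Z \<in> pairs N m \<and> ?f (?g Z) = Z" if "Z \<in> ?Z" for Z
 proof -
  have Z: "Z \<in> LM.subs L" "module_isomorphic LM.AG (V\<lparr>carrier := Z\<rparr>) N" "clL L Z = m" using that by auto
  have Zs: "LM.smG Z" "Z \<subseteq> L" using Z(1) by (auto simp: LM.subs_def)
  have lZ: "full Z" by (rule LM.subs_lat[OF Z(1) latL smL])
  have Zc: "Z \<subseteq> carrier V" by (rule LM.VG.sm_carrier[OF Zs(1)])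
  let ?Y = "GX Z"
  have YL: "?Y \<subseteq> L'" unfolding L'_def by (rule V.ss_mono[OF order_refl Zs(2) Gsub Lc])
  have sY: "smG ?Y" by (rule GX_sm[OF Zc])
  have lY: "full ?Y" by (rule lat_mid[OF lZ smG_smR[OF sY] GX_upper[OF Zc] YL lat_fg[OF L'_lat]])
  have W: "?W Z \<in> over"
   using VG.sm_sum[OF sY IL'_sm] VG.sum_upper2[OF sY IL'_sm] VG.sum_least[OF L'_sm YL IL'_L'] by (simp add: over_def)
  note l = lY sY HOL.refl[of "?W Z"]
  note t = th[OF W l]
  have ti: "th (?W Z) ?Y ` ?W Z = ?Y" "inj_on (th (?W Z) ?Y) (?W Z)" using t(2) by (auto simp: bij_betw_def)
  let ?X = "{w \<in> ?W Z. th (?W Z) ?Y w \<in> Z}"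
  have sX: "LM.smG ?X"
   by (rule LM.ghom_preimage_sm[OF ghom_mono[OF t(1) L0G order_refl] smG_smL[OF over_lat(2)[OF W]] smG_smL[OF sY] Zs(1)])
  have XL: "?X \<subseteq> L"
  proof
   fix x assume x: "x \<in> ?X"
   then have "th (?W Z) ?Y x \<in> L" using Zs(2) by auto
   then show "x \<in> L" using th_L[OF W l, of x] x by simp
  qed
  have XW: "?X \<subseteq> ?W Z" by auto
  have tX: "th (?W Z) ?Y ` ?X = Z"
  proof
   show "Z \<subseteq> th (?W Z) ?Y ` ?X"
   proof
    fix z assume z: "z \<in> Z"
    then have "z \<in> th (?W Z) ?Y ` ?W Z" using ti(1) GX_upper[OF Zc] by auto
    then show "z \<in> th (?W Z) ?Y ` ?X" using z by auto
   qed
  qed auto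
  have Xc: "?X \<subseteq> carrier V" by (rule LM.VG.sm_carrier[OF sX])
  \<comment> \<open>The isomorphism is linear over \<open>G\<close>, so the module generated by the
    preimage of \<open>Z\<close> is the preimage of the module generated by \<open>Z\<close>, which
    is all of \<open>W\<close>.\<close>
  have "th (?W Z) ?Y ` GX ?X = th (?W Z) ?Y ` ?W Z"
   using ghom_GX[OF t(1) over_lat(2)[OF W] sY XW] tX ti(1) by simp
  then have GX: "GX ?X = ?W Z"
   using inj_on_image_eq_iff[OF ti(2) GX_least[OF XW over_lat(2)[OF W]] order_refl] by simp
  have XX: "?X \<in> XX N"
   unfolding XX_def
  proof (intro CollectI conjI sX XL)
   show "module_isomorphic LM.AG (V\<lparr>carrier := ?X\<rparr>) N" unfolding th_module_iso[OF W l sX XW] tX by (rule Z(2))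
   show "IL' \<subseteq> GX ?X" using W unfolding GX by (simp add: over_def)
  qed
  have lX: "full ?X" by (rule XX_facts(5)[OF XX])
  have YW: "?Y \<subseteq> ?W Z" by (rule VG.sum_upper1[OF sY IL'_sm])
  have Ys: "?Y \<in> subs (?W Z)" by (rule lat_subs[OF lat_fg[OF over_lat(1)[OF W]] sY YW lY])
  have "clL L Z = clL L ?X + clL (?W Z) ?Y"
   using cl_shift[OF W l lX sX XW XL] Zs(2) unfolding tX by simp
  then have "(?X, ?Y) \<in> pairs N m" unfolding pairs_def using XX Ys Z(3) GX by auto
  moreover have "?f (?g Z) = Z" using tX GX by simp
  ultimately show ?thesis by simp
 qed
 have "bij_betw ?f (pairs N m) ?Z"
 proof (rule bij_betw_byWitness[where f' = ?g])
  have a: "?f a \<in> ?Z \<and> ?g (?f a) = a" if "a \<in> pairs N m" for a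
   using fwd[of "fst a" "snd a"] that by (simp only: prod.collapse)
  show "\<forall>a\<in>pairs N m. ?g (?f a) = a" by (rule ballI, rule conjunct2[OF a])
  show "?f ` pairs N m \<subseteq> ?Z" by (rule image_subsetI, rule conjunct1[OF a])
  show "\<forall>a\<in>?Z. ?f (?g a) = a" by (rule ballI, rule conjunct2[OF bwd])
  show "?g ` ?Z \<subseteq> pairs N m" by (rule image_subsetI, rule conjunct1[OF bwd])
 qed
 then show ?thesis by (rule bij_betw_same_card)
qed

text \<open>The polynomial \<open>Q\<close> of \<open>GX X / IL'\<close> (\<open>Q_poly_eq\<close>),
  with lattices in \<open>V\<close> in place of submodules of a quotient; \<open>qr\<close> is its
  restriction to \<open>L0\<close>.\<close>

definition qp where
 "qp X = (\<lambda>m. \<Sum>U\<in>{U \<in> over. U \<subseteq> GX X}. mu (bar U) (bar (GX X)) * dir_monom (cl AG V (GX X) U) m)"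

definition qr where
 "qr X = (\<lambda>m. \<Sum>U\<in>{U \<in> over. U \<subseteq> GX X}. mu (bar U) (bar (GX X)) * dir_monom (clL (GX X) U) m)"

lemma over_subs: "U \<in> over \<Longrightarrow> W \<in> over \<Longrightarrow> U \<subseteq> W \<Longrightarrow> U \<in> subs W"
 using lat_subs[OF lat_fg[OF over_lat(1)] over_lat(2) _ over_lat(1)] by blast

lemma qr_eq: assumes X: "X \<in> XX N" shows "dir_res AG LM.AG (qp X) = qr X"
proof
 fix k
 note W = XX_facts(3)[OF X]
 have c: "cl AG V (GX X) U \<in> class_monoid AG" "res_class LM.AG (cl AG V (GX X) U) = clL (GX X) U"
  if "U \<in> {U \<in> over. U \<subseteq> GX X}" for U
  using that res_cl[OF over_lat(2)[OF W] over_subs[OF _ W]] by auto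
 have "dir_res AG LM.AG (qp X) k
   = (\<Sum>U\<in>{U \<in> over. U \<subseteq> GX X}. mu (bar U) (bar (GX X)) * dir_monom (res_class LM.AG (cl AG V (GX X) U)) k)"
  unfolding qp_def by (rule dir_res_poly) (use fin_over c in auto)
 also have "\<dots> = qr X k" unfolding qr_def by (rule sum.cong[OF HOL.refl]) (simp only: c(2))
 finally show "dir_res AG LM.AG (qp X) k = qr X k" .
qed

lemma qp_poly: assumes X: "X \<in> XX N" shows "qp X \<in> Dir_poly AG" "qr X \<in> Dir_poly LM.AG"
proof -
 note W = XX_facts(3)[OF X]
 show "qp X \<in> Dir_poly AG" unfolding qp_def
  by (rule poly_Dir) (use fin_over res_cl(1)[OF over_lat(2)[OF W] over_subs[OF _ W]] in auto)
 show "qr X \<in> Dir_poly LM.AG" unfolding qr_def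
 proof (rule poly_Dir)
  fix U assume "U \<in> {U \<in> over. U \<subseteq> GX X}"
  then have U: "U \<in> over" "U \<subseteq> GX X" by auto
  show "clL (GX X) U \<in> class_monoid LM.AG"
   by (rule LM.VG.cl_class_monoid[OF LM.subs_between[OF subs_L[OF over_subs[OF U(1) W U(2)]]] smG_smL[OF over_lat(2)[OF W]] smG_smL[OF over_lat(2)[OF U(1)]] U(2)])
 qed (use fin_over in auto)
qed

abbreviation "zz \<equiv> dir_res AG LM.AG (zeta AG (V\<lparr>carrier := L'\<rparr>))"

text \<open>All lattices \<open>U\<close> in the sum have the same restricted zeta function as
  \<open>L'\<close>. So the term of \<open>U\<close> counts the sublattices of \<open>GX X\<close>
  inside \<open>U\<close>, and \<open>mu_count\<close> leaves those that generate
  \<open>GX X\<close> modulo \<open>IL'\<close>.\<close>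

lemma qr_zeta:
 assumes X: "X \<in> XX N"
 shows "conv (qr X) zz n = int (card {Y \<in> subs (GX X). Y <+> IL' = GX X \<and> clL (GX X) Y = n})"
proof -
 note W = XX_facts(3)[OF X]
 have "(if clL (GX X) U \<subseteq># n then zz (n - clL (GX X) U) else 0)
   = int (card {Y \<in> subs (GX X). Y \<subseteq> U \<and> clL (GX X) Y = n})" if U: "U \<in> over" "U \<subseteq> GX X" for U
 proof -
  have zk: "zz k = int (num U k)" for k
   unfolding res_zeta[OF lat_fg[OF L'_lat] L'_sm] using num_eq[OF L'_lat L'_sm over_lat[OF U(1)]] by simp
  show ?thesis unfolding zk
   by (rule num_shift[OF lat_fg[OF over_lat(1)[OF W]] over_lat(2)[OF W] over_subs[OF U(1) W U(2)]])
 qed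
 then have "conv (qr X) zz n = (\<Sum>U\<in>{U \<in> over. U \<subseteq> GX X}. mu (bar U) (bar (GX X)) *
   int (card {Y \<in> subs (GX X). Y \<subseteq> U \<and> clL (GX X) Y = n}))"
  unfolding qr_def using fin_over by (subst conv_poly) (auto intro!: sum.cong)
 then show ?thesis unfolding mu_count[OF W] .
qed

text \<open>The coefficients at \<open>m\<close> on both sides are the number of elements of
  \<open>pairs N m\<close>.\<close>

theorem main_identity:
 "conv (\<lambda>m. \<Sum>X\<in>XX N. conv (dir_monom (clL L X)) (qr X) m) zz
  = partial_zeta LM.AG (V\<lparr>carrier := L\<rparr>) N"
proof
 fix m
 let ?P = "\<lambda>X. {Y \<in> subs (GX X). Y <+> IL' = GX X \<and> clL L X + clL (GX X) Y = m}"
 have fin: "finite (?P X)" if X: "X \<in> XX N" for X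
 proof -
  note W = over_lat[OF XX_facts(3)[OF X]]
  show ?thesis
   by (rule finite_subset[OF _ num_finite[OF lat_fg[OF W(1)] W(2), of "m - clL L X"]]) auto
 qed
 have t: "conv (conv (dir_monom (clL L X)) (qr X)) zz m = int (card (?P X))" if X: "X \<in> XX N" for X
 proof (cases "clL L X \<subseteq># m")
  case True
  then obtain n where n: "m = clL L X + n" by (auto simp: mset_subset_eq_exists_conv)
  then show ?thesis unfolding conv_assoc conv_monom using qr_zeta[OF X] by simp
 next
  case False
  then have "?P X = {}" by auto
  then show ?thesis unfolding conv_assoc conv_monom using False by (simp only: card.empty if_False of_nat_0)
 qed
 have "conv (\<lambda>m. \<Sum>X\<in>XX N. conv (dir_monom (clL L X)) (qr X) m) zz m = (\<Sum>X\<in>XX N. int (card (?P X)))"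
  unfolding conv_sum[OF XX_finite] by (rule sum.cong[OF HOL.refl t])
 also have "\<dots> = int (card (pairs N m))" unfolding pairs_def using card_SigmaI[OF XX_finite, of N ?P] fin by simp
 also have "\<dots> = partial_zeta LM.AG (V\<lparr>carrier := L\<rparr>) N m"
  unfolding pairs_card LM.partial_zeta_eq[OF smL] dir_sum_monom by (simp add: conj_assoc)
 finally show "conv (\<lambda>m. \<Sum>X\<in>XX N. conv (dir_monom (clL L X)) (qr X) m) zz m
  = partial_zeta LM.AG (V\<lparr>carrier := L\<rparr>) N m" .
qed

end

section \<open>The Moebius function and the polynomials \<open>Q\<close> in terms of
  lattices\<close>

context lmod
begin

text \<open>As \<open>I\<close> maps \<open>X\<close> into \<open>Y\<close>, a coset of scalars acts
  like each of its members; the two structures on \<open>X / Y\<close> have the same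
  submodules.\<close>

lemma submodule_factor_iff:
 assumes X: "sm X" and Y: "sm Y" "Y \<subseteq> X"
  and I: "I \<subseteq> carrier R" "\<zero>\<^bsub>R\<^esub> \<in> I" and IX: "\<And>i x. \<lbrakk>i \<in> I; x \<in> X\<rbrakk> \<Longrightarrow> i \<odot> x \<in> Y"
 shows "submodule U (R Quot I) (quot_module_factor (M\<lparr>carrier := X\<rparr>) Y) \<longleftrightarrow> submodule U R (Qm M X Y)"
proof -
 have c: "carrier (R Quot I) = (\<lambda>a. I +>\<^bsub>R\<^esub> a) ` carrier R"
  by (auto simp: FactRing_def A_RCOSETS_def')
 have s: "(I +>\<^bsub>R\<^esub> a) \<odot>\<^bsub>quot_module_factor (M\<lparr>carrier := X\<rparr>) Y\<^esub> C = a \<odot>\<^bsub>Qm M X Y\<^esub> C"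
  if a: "a \<in> carrier R" and C: "C \<in> carrier (Qm M X Y)" for a C
 proof -
  obtain x where x: "x \<in> X" "C = Y +> x" using C unfolding Q_carrier by auto
  have xc: "x \<in> carrier M" by (rule smD[OF X x(1)])
  have CX: "d \<in> X" if d: "d \<in> C" for d
   using cong_memD[OF X Y(2) _ x(1)] d coset_mem_iff[OF Y(1) xc] unfolding x(2) by blast
  have "Y <+> {b \<odot> c |b c. b \<in> I +>\<^bsub>R\<^esub> a \<and> c \<in> C} = Y <+> ((\<lambda>c. a \<odot> c) ` C)"
  proof (intro equalityI subsetI)
   fix z assume "z \<in> Y <+> {b \<odot> c |b c. b \<in> I +>\<^bsub>R\<^esub> a \<and> c \<in> C}"
   then obtain y b c where *: "y \<in> Y" "b \<in> I +>\<^bsub>R\<^esub> a" "c \<in> C" "z = y \<oplus> b \<odot> c" by (auto simp: sum_iff)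
   obtain i where i: "i \<in> I" "b = i \<oplus>\<^bsub>R\<^esub> a" using *(2) by (auto simp: a_r_coset_def')
   note cc = smD[OF X CX[OF *(3)]]
   have "z = (y \<oplus> i \<odot> c) \<oplus> a \<odot> c"
    using *(4) i I cc a smD[OF Y(1) *(1)] by (auto simp: smult_l_distr smult_closed M.a_assoc)
   moreover have "y \<oplus> i \<odot> c \<in> Y" by (rule sm_add[OF Y(1) *(1) IX[OF i(1) CX[OF *(3)]]])
   ultimately show "z \<in> Y <+> ((\<lambda>c. a \<odot> c) ` C)" using *(3) unfolding sum_iff by blast
  next
   fix z assume "z \<in> Y <+> ((\<lambda>c. a \<odot> c) ` C)"
   then obtain y c where *: "y \<in> Y" "c \<in> C" "z = y \<oplus> a \<odot> c" by (auto simp: sum_iff)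
   have "a = \<zero>\<^bsub>R\<^esub> \<oplus>\<^bsub>R\<^esub> a" using a by simp
   then have "a \<in> I +>\<^bsub>R\<^esub> a" using I(2) unfolding a_r_coset_def' by blast
   then show "z \<in> Y <+> {b \<odot> c |b c. b \<in> I +>\<^bsub>R\<^esub> a \<and> c \<in> C}" using * unfolding sum_iff by blast
  qed
  then show ?thesis by (simp add: quot_module_factor_def quot_module_def set_add_defs)
 qed
 have m: "subgroup U (add_monoid (quot_module_factor (M\<lparr>carrier := X\<rparr>) Y)) = subgroup U (add_monoid (Qm M X Y))"
  by (simp add: subgroup_def m_inv_def quot_module_factor_def quot_module_def)
 show ?thesis
 proof (cases "subgroup U (add_monoid (Qm M X Y))")
  case True
  then have "U \<subseteq> carrier (Qm M X Y)" by (metis subgroup.subset partial_object.select_convs(1))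
  then show ?thesis unfolding submodule_def submodule_axioms_def m using c s by (auto simp: subset_iff)
 next
  case False
  then show ?thesis unfolding submodule_def m by simp
 qed
qed

end

context zeta_lattice
begin

lemma over_between: "{U \<in> over. U \<subseteq> W} = between AG V IL' W" if W: "W \<in> over"
 using W by (auto simp: over_def between_def)

lemma bar_image: "W \<in> over \<Longrightarrow> {U. submodule U AG (Qm V W IL')} = bar ` {U \<in> over. U \<subseteq> W}"
 unfolding over_between bar_def[abs_def] by (rule VG.sub_Q[OF over_lat(2) IL'_sm]) (auto simp: over_def)

lemma mu_eq: "mu = moebius {U. submodule U (AG Quot I) (quot_module_factor (V\<lparr>carrier := L'\<rparr>) IL')}"
proof -
 have L'o: "L' \<in> over" using L'_sm IL'_L' by (simp add: over_def)
 have "{U. submodule U (AG Quot I) (quot_module_factor (V\<lparr>carrier := L'\<rparr>) IL')} = {U. submodule U AG (Qm V L' IL')}"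
  by (rule Collect_cong, rule VG.submodule_factor_iff[OF L'_sm IL'_sm IL'_L'])
   (use I_L0 L0G IL'_smult W.VG.sm_zero[OF I_sm] in auto)
 also have "\<dots> = bar ` over" unfolding bar_image[OF L'o] by (rule arg_cong[of _ _ "(`) bar"]) (auto simp: over_def)
 finally show ?thesis by (simp add: mu_def)
qed

text \<open>By the third isomorphism theorem, \<open>GX X / U\<close> has the same class as the
  quotient of \<open>GX X / IL'\<close> by the image of \<open>U\<close>.\<close>

lemma Q_poly_eq: assumes W: "GX X \<in> over" shows "Q_poly AG mu (Qm V (GX X) IL') = qp X"
proof
 fix m
 let ?Q = "Qm V (GX X) IL'" and ?S = "{U \<in> over. U \<subseteq> GX X}"
 have Ws: "smG (GX X)" "IL' \<subseteq> GX X" using W by (auto simp: over_def)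
 interpret T: two_modules AG V ?Q
  using VG.left_module_Q[OF Ws(1) IL'_sm Ws(2)] VG.left_module_axioms by (simp add: two_modules_def)
 have cQ: "carrier ?Q = bar (GX X)" unfolding VG.Q_carrier bar_def ..
 have c: "mod_class AG (quot_module ?Q (bar U)) = cl AG V (GX X) U" if U: "U \<in> ?S" for U
 proof -
  have Us: "smG U" "IL' \<subseteq> U" "U \<subseteq> GX X" and Uo: "U \<in> over" using U by (auto simp: over_def)
  have q: "qiso AG V (GX X) U ?Q (bar (GX X)) (bar U) (\<lambda>x. IL' +> x)"
   unfolding bar_def by (rule VG.Q_qiso[OF Ws(1) IL'_sm Ws(2) Us(1) Ws(1) Us(2,3) order_refl])
  have sb: "submodule (bar (GX X)) AG ?Q" "submodule (bar U) AG ?Q" "bar U \<subseteq> bar (GX X)"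
   unfolding bar_def using VG.sub_Q_sm[OF Ws(1) IL'_sm Ws(2) Ws(1) order_refl] VG.sub_Q_sm[OF Ws(1) IL'_sm Ws(2) Us(1,3)]
    image_mono[OF Us(3), of "(+>) IL'"] by simp_all
  have "cl AG V (GX X) U = cl AG ?Q (bar (GX X)) (bar U)"
   by (rule T.cl_qiso[OF Ws(1) Us(1,3) sb q subs_between[OF over_subs[OF Uo W Us(3)]]])
  also have "\<dots> = mod_class AG (quot_module ?Q (bar U))" unfolding cl_def cQ[symmetric] by simp
  finally show ?thesis by simp
 qed
 have inj: "inj_on bar ?S" by (rule inj_on_subset[OF bar_inj]) auto
 have "Q_poly AG mu ?Q m = (\<Sum>U\<in>bar ` ?S. mu U (bar (GX X)) * dir_monom (mod_class AG (quot_module ?Q U)) m)"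
  unfolding Q_poly_def bar_image[OF W] cQ ..
 also have "\<dots> = qp X m" unfolding qp_def sum.reindex[OF inj] comp_def
  by (rule sum.cong[OF HOL.refl]) (simp only: c)
 finally show "Q_poly AG mu ?Q m = qp X m" .
qed

theorem zeta_quotient:
 assumes Quo: "Quo = partial_zeta LM.AG (V\<lparr>carrier := L\<rparr>) N \<otimes>\<^bsub>Dir LM.AG\<^esub> inv\<^bsub>Dir LM.AG\<^esub> zz"
 shows "zz \<in> Units (Dir LM.AG)" and "finite (XX N)"
  and "Quo = (\<Oplus>\<^bsub>Dir LM.AG\<^esub>X\<in>XX N. dir_monom (clL L X) \<otimes>\<^bsub>Dir LM.AG\<^esub> dir_res AG LM.AG (Q_poly AG mu (Qm V (GX X) IL')))"
  and "\<And>X. X \<in> XX N \<Longrightarrow> Q_poly AG mu (Qm V (GX X) IL') \<in> Dir_poly AG"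
  and "\<And>X. X \<in> XX N \<Longrightarrow> dir_res AG LM.AG (Q_poly AG mu (Qm V (GX X) IL')) \<in> Dir_poly LM.AG"
  and "Quo \<in> Dir_poly LM.AG"
proof -
 interpret D: comm_monoid "Dir LM.AG" by (rule Dir_comm_monoid)
 show u: "zz \<in> Units (Dir LM.AG)" by (rule res_zeta_unit[OF lat_fg[OF L'_lat] L'_sm])
 show "finite (XX N)" by (rule XX_finite)
 have Q: "Q_poly AG mu (Qm V (GX X) IL') = qp X" if "X \<in> XX N" for X by (rule Q_poly_eq[OF XX_facts(3)[OF that]])
 show "Q_poly AG mu (Qm V (GX X) IL') \<in> Dir_poly AG" if X: "X \<in> XX N" for X using qp_poly(1)[OF X] Q[OF X] by simp
 show "dir_res AG LM.AG (Q_poly AG mu (Qm V (GX X) IL')) \<in> Dir_poly LM.AG" if X: "X \<in> XX N" for X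
  using qp_poly(2)[OF X] Q[OF X] qr_eq[OF X] by simp
 define t where "t X = conv (dir_monom (clL L X)) (qr X)" for X
 have tc: "t X \<in> Dir_poly LM.AG" if X: "X \<in> XX N" for X
 proof -
  have X': "X \<in> LM.subs L" by (rule XX_facts(6)[OF X])
  have cm: "clL L X \<in> class_monoid LM.AG"
   by (rule LM.VG.cl_class_monoid[OF LM.subs_between[OF X'] smL]) (use X' in \<open>auto simp: LM.subs_def\<close>)
  have q: "qr X \<in> carrier (Dir LM.AG)" "finite {m. qr X m \<noteq> 0}" using qp_poly(2)[OF X] by (auto simp: Dir_poly_def)
  have "dir_monom (clL L X) \<in> carrier (Dir LM.AG)" using cm by (auto simp: Dir_simps dir_monom_def)
  then have 1: "t X \<in> carrier (Dir LM.AG)" unfolding t_def using q(1) by (rule conv_closed)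
  have "{m. t X m \<noteq> 0} \<subseteq> (\<lambda>n. clL L X + n) ` {m. qr X m \<noteq> 0}"
   unfolding t_def conv_monom by (auto simp: mset_subset_eq_exists_conv split: if_splits)
  then have "finite {m. t X m \<noteq> 0}" by (rule finite_subset) (use q(2) in simp)
  then show ?thesis using 1 by (simp add: Dir_poly_def)
 qed
 let ?S = "\<lambda>m. \<Sum>X\<in>XX N. t X m"
 have Sfin: "(\<Oplus>\<^bsub>Dir LM.AG\<^esub>X\<in>XX N. t X) = ?S"
  by (rule Dir_finsum[OF XX_finite]) (use tc in \<open>auto simp: Dir_poly_def\<close>)
 have Sp: "?S \<in> Dir_poly LM.AG"
 proof -
  have *: "\<exists>X\<in>XX N. t X m \<noteq> 0" if "?S m \<noteq> 0" for m using that by (meson sum.not_neutral_contains_not_neutral)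
  have "finite {m. ?S m \<noteq> 0}"
   by (rule finite_subset[of _ "\<Union>X\<in>XX N. {m. t X m \<noteq> 0}"]) (use * tc XX_finite in \<open>auto simp: Dir_poly_def\<close>)
  moreover have "m \<in> class_monoid LM.AG" if "?S m \<noteq> 0" for m
   using *[OF that] tc by (auto simp: Dir_poly_def Dir_simps)
  ultimately show ?thesis by (auto simp: Dir_poly_def Dir_simps)
 qed
 then have Sc: "?S \<in> carrier (Dir LM.AG)" by (simp add: Dir_poly_def)
 have "partial_zeta LM.AG (V\<lparr>carrier := L\<rparr>) N = ?S \<otimes>\<^bsub>Dir LM.AG\<^esub> zz"
  unfolding main_identity[symmetric] t_def Dir_simps ..
 then have QS: "Quo = ?S" unfolding Quo using D.m_assoc[OF Sc] u Sc D.Units_closed D.Units_inv_closed D.Units_r_inv by simp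
 show "Quo \<in> Dir_poly LM.AG" unfolding QS by (rule Sp)
 have "dir_monom (clL L X) \<otimes>\<^bsub>Dir LM.AG\<^esub> dir_res AG LM.AG (Q_poly AG mu (Qm V (GX X) IL')) = t X"
  if X: "X \<in> XX N" for X unfolding t_def Q[OF X] qr_eq[OF X] Dir_simps ..
 moreover have "t X \<in> carrier (Dir LM.AG)" if "X \<in> XX N" for X using tc[OF that] by (simp add: Dir_poly_def)
 ultimately show "Quo = (\<Oplus>\<^bsub>Dir LM.AG\<^esub>X\<in>XX N. dir_monom (clL L X) \<otimes>\<^bsub>Dir LM.AG\<^esub> dir_res AG LM.AG (Q_poly AG mu (Qm V (GX X) IL')))"
  unfolding QS Sfin[symmetric]
  by (intro abelian_monoid.finsum_cong'[OF Dir_abelian_monoid HOL.refl, symmetric]) auto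
qed

end

section \<open>Independence of the maximal order\<close>

context order_module
begin

lemma smR_vimage: assumes Z: "smR Z" shows "smR {w \<in> carrier V. pp k \<odot> w \<in> Z}"
proof (rule VR.submoduleI)
 show "\<zero> \<in> {w \<in> carrier V. pp k \<odot> w \<in> Z}" using VR.sm_zero[OF Z] V.smult_zero_r by simp
 show "x \<oplus> y \<in> {w \<in> carrier V. pp k \<odot> w \<in> Z}"
  if "x \<in> {w \<in> carrier V. pp k \<odot> w \<in> Z}" "y \<in> {w \<in> carrier V. pp k \<odot> w \<in> Z}" for x y
  using that VR.sm_add[OF Z] by (simp add: V.smult_r_distr)
 fix a x assume "a \<in> carrier (A\<lparr>carrier := R0\<rparr>)" and x: "x \<in> {w \<in> carrier V. pp k \<odot> w \<in> Z}"
 then have a: "a \<in> R0" by simp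
 have "pp k \<odot> (a \<odot> x) = a \<odot> (pp k \<odot> x)" using pw_comm[OF R0c[OF a]] x by simp
 then show "a \<odot> x \<in> {w \<in> carrier V. pp k \<odot> w \<in> Z}"
  using smR_smult[OF Z a] x V.smult_closed[OF R0c[OF a]] by simp
qed auto

end

locale two_orders = order_module A R0 p pinv V +
 Z1: zeta_setting A R0 p pinv G V L0 + Z2: zeta_setting A R0 p pinv H V L0
 for A :: "('a, 'c) ring_scheme" and R0 p pinv and V :: "('a, 'v, 'e) module_scheme" (structure) and G H L0
begin

text \<open>The bimodule \<open>B = GH\<close> is invertible, so \<open>Y \<mapsto> BY\<close> takes \<open>H\<close>-lattices injectively to \<open>G\<close>-lattices.\<close>

definition "B = prd G H"
abbreviation "BX Y \<equiv> set_smult V B Y"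

lemma Gs: "G \<subseteq> carrier A" "H \<subseteq> carrier A" using Z1.Gc Z2.Gc by auto

lemma B_carrier: "B \<subseteq> carrier A" unfolding B_def by (rule Z1.prd_carrier[OF Gs])

lemma Bc: "b \<in> B \<Longrightarrow> b \<in> carrier A" using B_carrier by auto

lemma B_mem: "g \<in> G \<Longrightarrow> h \<in> H \<Longrightarrow> g \<cdot> h \<in> B"
 unfolding B_def using AA.V.ss_mem[of g G h H] by simp

lemma B_one: "\<one>\<^bsub>A\<^esub> \<in> B" using B_mem[OF Z1.G_closed(2) Z2.G_closed(2)] by simp

lemma B_left: "submodule B Z1.AG RA" unfolding B_def by (rule Z1.prd_left[OF Z1.GG Gs(2)])

lemma B_right: "b \<in> B \<Longrightarrow> h \<in> H \<Longrightarrow> b \<cdot> h \<in> B"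
 unfolding B_def by (rule prd_right_closed[OF Gs]) (use Gs Z2.G_closed(4) in auto)

text \<open>A power of \<open>p\<close> carries \<open>G\<close> into
  \<open>L0 \<subseteq> H\<close>, hence \<open>B\<close> into \<open>H\<close>; and
  \<open>B\<close> contains the full lattice \<open>H\<close>.\<close>

lemma B_lat: "latA B"
proof -
 obtain k where k: "AA.pX k G \<subseteq> L0"
  using AA.lat_absorb[OF Z1.fG ordD(2)[OF Z1.ordL0]] by blast
 have sH: "AA.smR H" by (rule AA.lat_sm[OF ordD(2)[OF Z2.ordG]])
 have sB: "AA.smR B" by (rule Z1.W.smG_smR[OF B_left])
 have "prd G H \<subseteq> {w \<in> carrier RA. pp k \<odot>\<^bsub>RA\<^esub> w \<in> H}"
 proof (rule AA.V.ss_least[OF _ _ AA.smR_vimage[OF sH]])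
  fix g h assume gh: "g \<in> G" "h \<in> H"
  have "pp k \<cdot> g \<in> H" using k gh(1) Z2.L0G by auto
  then have "pp k \<cdot> g \<cdot> h \<in> H" using gh(2) by (rule Z2.G_closed(4))
  then show "g \<odot>\<^bsub>RA\<^esub> h \<in> {w \<in> carrier RA. pp k \<odot>\<^bsub>RA\<^esub> w \<in> H}" using gh Z1.Gc Z2.Gc by (simp add: m_assoc)
 qed (use Gs in auto)
 then have b: "\<And>b. b \<in> B \<Longrightarrow> pp k \<cdot> b \<in> H" unfolding B_def by auto
 have f: "fg R0 RA B" by (rule bounded_fg[OF sB b Z2.fG])
 have HB: "H \<subseteq> B" using B_mem[OF Z1.G_closed(2)] Gs by force
 show ?thesis by (rule AA.lat_mid[OF ordD(2)[OF Z2.ordG] sB HB order_refl f])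
qed

text \<open>An exponent with \<open>p^bk B \<subseteq> H\<close>: multiples of elements of
  \<open>B\<close> by \<open>p^bk\<close> act on every \<open>H\<close>-lattice.\<close>

definition "bk = (SOME k::nat. AA.pX k B \<subseteq> H)"

lemma bk: "b \<in> B \<Longrightarrow> pp bk \<cdot> b \<in> H"
proof -
 have "\<exists>k::nat. AA.pX k B \<subseteq> H" by (rule AA.lat_absorb[OF AA.lat_fg[OF B_lat] ordD(2)[OF Z2.ordG]])
 from someI_ex[OF this] show "b \<in> B \<Longrightarrow> pp bk \<cdot> b \<in> H" unfolding bk_def by auto
qed

lemma BX_sm: assumes Y: "Y \<subseteq> carrier V" shows "Z1.smG (BX Y)"
proof (rule V.ss_submodule[OF Z1.G B_carrier Y])
 fix g s x assume *: "g \<in> G" "s \<in> B" "x \<in> Y"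
 have "g \<odot> (s \<odot> x) = (g \<cdot> s) \<odot> x" using * Y by (intro V.smult_assoc[symmetric] Z1.Gc Bc) auto
 moreover have "g \<cdot> s \<in> B" using Z1.W.smG_smult[OF B_left *(1,2)] by simp
 ultimately show "g \<odot> (s \<odot> x) \<in> BX Y" using V.ss_mem[of "g \<cdot> s" B x Y] *(3) by simp
qed

lemma BX_upper: assumes Y: "Y \<subseteq> carrier V" shows "Y \<subseteq> BX Y"
proof
 fix x assume x: "x \<in> Y"
 then show "x \<in> BX Y" using V.ss_mem[OF B_one x] Y V.smult_one[of x] by auto
qed

lemma BX_mono: "Y \<subseteq> Z \<Longrightarrow> Z \<subseteq> carrier V \<Longrightarrow> BX Y \<subseteq> BX Z"
 by (rule V.ss_mono[OF order_refl _ B_carrier])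

lemma pBX: assumes Y: "Z2.smG Y" shows "pX bk (BX Y) \<subseteq> Y"
proof -
 have Yc: "Y \<subseteq> carrier V" by (rule Z2.VG.sm_carrier[OF Y])
 have "BX Y \<subseteq> {w \<in> carrier V. pp bk \<odot> w \<in> Y}"
 proof (rule V.ss_least[OF B_carrier Yc smR_vimage[OF Z2.smG_smR[OF Y]]])
  fix s x assume *: "s \<in> B" "x \<in> Y"
  have "pp bk \<odot> (s \<odot> x) = (pp bk \<cdot> s) \<odot> x" using * Yc by (intro V.smult_assoc[symmetric] pc Bc) auto
  then have "pp bk \<odot> (s \<odot> x) \<in> Y" using Z2.smG_smult[OF Y bk[OF *(1)] *(2)] by simp
  then show "s \<odot> x \<in> {w \<in> carrier V. pp bk \<odot> w \<in> Y}"
   using V.smult_closed[OF Bc[OF *(1)]] *(2) Yc by auto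
 qed
 then show ?thesis by auto
qed

lemma BX_lat: assumes Y: "full Y" "Z2.smG Y" shows "full (BX Y)"
proof -
 have Yc: "Y \<subseteq> carrier V" by (rule Z2.VG.sm_carrier[OF Y(2)])
 have s: "smR (BX Y)" by (rule Z1.smG_smR[OF BX_sm[OF Yc]])
 have "fg R0 V (pX bk (BX Y))" by (rule noeth[OF lat_fg[OF Y(1)] smR_pX[OF s] pBX[OF Y(2)]])
 then have "fg R0 V (BX Y)" by (rule fg_pinvX) (rule VR.sm_carrier[OF s])
 then show ?thesis by (rule lat_mid[OF Y(1) s BX_upper[OF Yc] order_refl])
qed

text \<open>\<open>B\<close> is a lattice stable under the maximal order \<open>H\<close> from the
  right, so \<open>qinv A B\<close> is a left inverse of it and recovers \<open>Y\<close> from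
  \<open>BX Y\<close>.\<close>

lemma BX_inj: assumes Y: "Z2.smG Y" "Z2.smG Z" and e: "BX Y = BX Z" shows "Y \<subseteq> Z"
proof
 fix y assume y: "y \<in> Y"
 have c: "Y \<subseteq> carrier V" "Z \<subseteq> carrier V" using Z2.VG.sm_carrier Y by auto
 have Bi: "qinv A B \<subseteq> carrier A" by (auto simp: qinv_def)
 have one: "\<one>\<^bsub>A\<^esub> \<in> prd (qinv A B) B" and i: "\<And>x a. \<lbrakk>x \<in> B; a \<in> qinv A B\<rbrakk> \<Longrightarrow> a \<cdot> x \<in> H"
  using Z2.inverse_right[OF B_lat B_right] by blast+
 have "y \<in> set_smult V (prd (qinv A B) B) Y" using V.ss_mem[OF one y] y c V.smult_one[of y] by auto
 also have "\<dots> = set_smult V (prd (qinv A B) B) Z"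
  unfolding V.ss_assoc[OF Bi B_carrier c(1)] V.ss_assoc[OF Bi B_carrier c(2)] e ..
 also have "\<dots> \<subseteq> set_smult V H Z"
 proof (rule V.ss_mono[OF _ order_refl Gs(2) c(2)])
  show "prd (qinv A B) B \<subseteq> H"
   by (rule AA.V.ss_least[OF Bi _ Z2.GG]) (use B_carrier i in auto)
 qed
 also have "\<dots> \<subseteq> Z" by (rule Z2.GX_least[OF order_refl Y(2)])
 finally show "y \<in> Z" .
qed

text \<open>\<open>f\<close> is linear over \<open>H\<close> and defined on \<open>U\<close> only,
  whereas \<open>BX U\<close> may be larger. But \<open>p^bk b \<in> H\<close> for \<open>b\<close>
  in \<open>B\<close>, so \<open>f\<close> is compatible with these elements.\<close>

lemma image_pBX:
 assumes U: "full U" "Z2.smG U" and Y: "full Y" "Z2.smG Y"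
  and f: "ghom A H V U V Y f" "bij_betw f U Y"
 shows "f ` pX bk (BX U) = pX bk (BX Y)"
proof -
 have c: "U \<subseteq> carrier V" "Y \<subseteq> carrier V" using Z2.VG.sm_carrier U(2) Y(2) by auto
 have fU: "f ` U = Y" using f(2) by (simp add: bij_betw_def)
 have oR: "order_in A R0 p pinv V R0" by (intro order_in.intro om order_in_axioms.intro R0 order_refl)
 have RH: "R0 \<subseteq> H" by (rule Z2.R0G)
 have fR: "ghom A R0 V U V Y f" by (rule ghom_mono[OF f(1) RH order_refl])
 have sR: "smR U" "smR Y" using Z2.smG_smR U(2) Y(2) by auto
 have sB: "smR (BX U)" "smR (BX Y)" using Z1.smG_smR BX_sm c by auto
 have pU: "smR (pX bk (BX U))" by (rule smR_pX[OF sB(1)])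
 have pY: "smR (pX bk (BX Y))" by (rule smR_pX[OF sB(2)])
 have key: "f (pp bk \<odot> (b \<odot> u)) = pp bk \<odot> (b \<odot> f u)"
  and mem: "pp bk \<odot> (b \<odot> u) \<in> U" if b: "b \<in> B" and u: "u \<in> U" for b u
 proof -
  have e: "pp bk \<odot> (b \<odot> w) = (pp bk \<cdot> b) \<odot> w" if "w \<in> carrier V" for w
   by (rule V.smult_assoc[symmetric, OF pc(3) Bc[OF b] that])
  have fu: "f u \<in> carrier V" using fU u c by auto
  show "pp bk \<odot> (b \<odot> u) \<in> U" using Z2.smG_smult[OF U(2) bk[OF b] u] e u c by auto
  show "f (pp bk \<odot> (b \<odot> u)) = pp bk \<odot> (b \<odot> f u)"
   using ghomD(3)[OF f(1) bk[OF b] u] e[of u] e[OF fu] u c by auto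
 qed
 show ?thesis
 proof
  have P: "smR {w \<in> U. f w \<in> pX bk (BX Y)}" by (rule order_in.ghom_preimage_sm[OF oR fR sR pY])
  have "BX U \<subseteq> {w \<in> carrier V. pp bk \<odot> w \<in> {w \<in> U. f w \<in> pX bk (BX Y)}}"
  proof (rule V.ss_least[OF B_carrier c(1) smR_vimage[OF P]])
   fix s x assume *: "s \<in> B" "x \<in> U"
   have "s \<odot> f x \<in> BX Y" by (rule V.ss_mem[OF *(1)]) (use *(2) fU in auto)
   then have "f (pp bk \<odot> (s \<odot> x)) \<in> pX bk (BX Y)" unfolding key[OF *] by (rule imageI)
   moreover have "s \<odot> x \<in> carrier V" using * c by (intro V.smult_closed Bc) auto
   ultimately show "s \<odot> x \<in> {w \<in> carrier V. pp bk \<odot> w \<in> {w \<in> U. f w \<in> pX bk (BX Y)}}"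
    using mem[OF *] by simp
  qed
  then show "f ` pX bk (BX U) \<subseteq> pX bk (BX Y)" by blast
 next
  have P: "smR (f ` pX bk (BX U))"
   by (rule order_in.ghom_img_sm[OF oR ghom_mono[OF fR order_refl pBX[OF U(2)]] pU sR(2)])
  have "BX Y \<subseteq> {w \<in> carrier V. pp bk \<odot> w \<in> f ` pX bk (BX U)}"
  proof (rule V.ss_least[OF B_carrier c(2) smR_vimage[OF P]])
   fix s y assume *: "s \<in> B" "y \<in> Y"
   obtain x where x: "x \<in> U" "y = f x" using *(2) fU by auto
   have "pp bk \<odot> (s \<odot> x) \<in> pX bk (BX U)" by (rule imageI, rule V.ss_mem[OF *(1) x(1)])
   then have "f (pp bk \<odot> (s \<odot> x)) \<in> f ` pX bk (BX U)" by (rule imageI)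
   moreover have "s \<odot> y \<in> carrier V" using * c x by (intro V.smult_closed Bc) auto
   ultimately show "s \<odot> y \<in> {w \<in> carrier V. pp bk \<odot> w \<in> f ` pX bk (BX U)}"
    unfolding x(2) key[OF *(1) x(1)] by simp
  qed
  then show "pX bk (BX Y) \<subseteq> f ` pX bk (BX U)" by blast
 qed
qed

text \<open>\<open>[U/p^bk U] = [U/p^bk BU][BU/U]\<close>, the last factor being moved by
  \<open>p^bk\<close>. An isomorphism from \<open>U\<close> to \<open>Y\<close> over
  \<open>H\<close> preserves the first two classes, hence the third.\<close>

lemma cl_BX_index:
 assumes U: "full U" "Z2.smG U" and Y: "full Y" "Z2.smG Y"
 shows "Z1.clL (BX U) U = Z1.clL (BX Y) Y"
proof -
 interpret T: two_modules Z1.LM.AG V V by (rule Z1.LM.VG.two_self)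
 have e: "Z <+> carrier V = carrier V" if "Z2.smG Z" for Z
  using Z2.VG.sum_least[OF Z2.VG.sm_UNIV Z2.VG.sm_carrier[OF that] order_refl] Z2.VG.sum_upper2[OF that Z2.VG.sm_UNIV] by auto
 obtain f where f: "ghom A H V U V Y f" "bij_betw f U Y"
  using Z2.lattice_iso[OF U Y Z2.VG.sm_UNIV] e U(2) Y(2) by auto
 have f1: "Z1.clL Z (pX bk Z) = Z1.clL Z (pX bk (BX Z)) + Z1.clL (BX Z) Z"
  and f2: "full (pX bk Z)" "Z1.LM.smG (pX bk Z)" "pX bk Z \<subseteq> Z"
  and f3: "full (pX bk (BX Z))" "Z1.LM.smG (pX bk (BX Z))" "pX bk (BX Z) \<subseteq> Z"
  if Z: "full Z" "Z2.smG Z" for Z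
 proof -
  have Zc: "Z \<subseteq> carrier V" by (rule Z2.VG.sm_carrier[OF Z(2)])
  note lB = BX_lat[OF Z] and sB = Z1.smG_smL[OF BX_sm[OF Zc]] and sZ = Z2.smG_smL[OF Z(2)]
  have plat: "full (pX bk X)" if X: "full X" for X
   by (rule latI_sub[OF X smR_pX[OF lat_sm[OF X]] pX_sub[OF lat_sm[OF X]] order_refl])
  show l: "full (pX bk Z)" by (rule plat[OF Z(1)])
  show s: "Z1.LM.smG (pX bk Z)" by (rule Z1.LM.smG_pX[OF sZ])
  show "pX bk Z \<subseteq> Z" by (rule pX_sub[OF lat_sm[OF Z(1)]])
  show lB': "full (pX bk (BX Z))" by (rule plat[OF lB])
  show sB': "Z1.LM.smG (pX bk (BX Z))" by (rule Z1.LM.smG_pX[OF sB])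
  show sub: "pX bk (BX Z) \<subseteq> Z" by (rule pBX[OF Z(2)])
  have "pX bk Z \<subseteq> pX bk (BX Z)" by (rule image_mono[OF BX_upper[OF Zc]])
  then have "Z1.clL Z (pX bk Z) = Z1.clL Z (pX bk (BX Z)) + Z1.clL (pX bk (BX Z)) (pX bk Z)"
   by (rule Z1.cl_addL[OF Z(1) sZ lB' sB' l s _ sub])
  also have "Z1.clL (pX bk (BX Z)) (pX bk Z) = Z1.clL (BX Z) Z"
   by (rule T.cl_qiso[symmetric, OF sB sZ BX_upper[OF Zc] sB' s image_mono[OF BX_upper[OF Zc]] Z1.LM.pX_qiso[OF sB sZ BX_upper[OF Zc]]])
    (rule Z1.LM.VG.fin_index_between[OF lat_fin_index[OF lat_fg[OF lB] Z(1)]])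
  finally show "Z1.clL Z (pX bk Z) = Z1.clL Z (pX bk (BX Z)) + Z1.clL (BX Z) Z" .
 qed
 have fU: "f ` U = Y" using f(2) by (simp add: bij_betw_def)
 have "Z1.clL U (pX bk U) = Z1.clL Y (pX bk Y)"
  using Z2.cl_image(3)[OF f U Y f2[OF U]] Z2.ghom_pX[OF f(1)] fU by simp
 moreover have "Z1.clL U (pX bk (BX U)) = Z1.clL Y (pX bk (BX Y))"
  using Z2.cl_image(3)[OF f U Y f3[OF U]] image_pBX[OF U Y f] by simp
 ultimately show ?thesis using f1[OF U] f1[OF Y] by simp
qed

text \<open>From \<open>[BU/U][U/Y] = [BU/BY][BY/Y]\<close> and \<open>cl_BX_index\<close> follows
  \<open>[BU/BY] = [U/Y]\<close>: the translation by \<open>B\<close> preserves classes over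
  \<open>L0\<close>.\<close>

lemma num_BX:
 assumes U: "full U" "Z2.smG U" shows "Z2.num U k \<le> Z1.num (BX U) k"
 unfolding Z1.num_def Z2.num_def
proof (rule card_inj_on_le)
 have Uc: "U \<subseteq> carrier V" by (rule Z2.VG.sm_carrier[OF U(2)])
 note lB = BX_lat[OF U] and sB = BX_sm[OF Uc]
 show "finite {Y \<in> Z1.subs (BX U). Z1.clL (BX U) Y = k}" by (rule Z1.num_finite[OF lat_fg[OF lB] sB])
 show "inj_on BX {Y \<in> Z2.subs U. Z1.clL U Y = k}"
  by (rule inj_onI, rule equalityI; rule BX_inj) (auto simp: Z2.subs_def)
 show "BX ` {Y \<in> Z2.subs U. Z1.clL U Y = k} \<subseteq> {Y \<in> Z1.subs (BX U). Z1.clL (BX U) Y = k}"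
 proof (clarify)
  fix Y assume Y: "Y \<in> Z2.subs U"
  have lY: "full Y" by (rule Z2.subs_lat[OF Y U])
  have sY: "Z2.smG Y" "Y \<subseteq> U" using Y by (auto simp: Z2.subs_def)
  have Yc: "Y \<subseteq> carrier V" by (rule Z2.VG.sm_carrier[OF sY(1)])
  note lBY = BX_lat[OF lY sY(1)] and sBY = BX_sm[OF Yc]
  have le: "BX Y \<subseteq> BX U" by (rule BX_mono[OF sY(2) Uc])
  note sL = Z1.smG_smL[OF sB] Z1.smG_smL[OF sBY] Z2.smG_smL[OF U(2)] Z2.smG_smL[OF sY(1)]
  have "Z1.clL (BX U) U + Z1.clL U Y = Z1.clL (BX U) (BX Y) + Z1.clL (BX Y) Y"
   using Z1.cl_addL[OF lB sL(1) U(1) sL(3) lY sL(4) sY(2) BX_upper[OF Uc]]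
    Z1.cl_addL[OF lB sL(1) lBY sL(2) lY sL(4) BX_upper[OF Yc] le] by simp
  then have "Z1.clL (BX U) (BX Y) = Z1.clL U Y" using cl_BX_index[OF U lY sY(1)] by simp
  then show "BX Y \<in> Z1.subs (BX U) \<and> Z1.clL (BX U) (BX Y) = Z1.clL U Y"
   using Z1.lat_subs[OF lat_fg[OF lB] sBY le lBY] by simp
 qed
qed

lemma num_orders_le:
 assumes "full U" "Z2.smG U" "full W" "Z1.smG W"
 shows "Z2.num U k \<le> Z1.num W k"
 using num_BX[OF assms(1,2)] Z1.num_eq[OF BX_lat[OF assms(1,2)] BX_sm[OF Z2.VG.sm_carrier[OF assms(2)]] assms(3,4)] by simp

end

section \<open>Semisimple algebras over local fields\<close>

text \<open>Zorn's lemma gives \<open>C\<close> maximal with \<open>B \<inter> C = 0\<close>. A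
  simple submodule not inside \<open>B + C\<close> meets it in 0 and could be added to
  \<open>C\<close>; so \<open>B + C\<close> contains all simple submodules and thus
  everything.\<close>

lemma semisimple_complement:
 assumes ss: "semisimple_module R M" and B: "submodule B R M"
 shows "\<exists>C. submodule C R M \<and> B \<inter> C = {\<zero>\<^bsub>M\<^esub>} \<and> B <+>\<^bsub>M\<^esub> C = carrier M"
proof -
 interpret left_module R M using ss by (simp add: semisimple_module_def)
 let ?F = "{C. submodule C R M \<and> B \<inter> C = {\<zero>\<^bsub>M\<^esub>}}"
 have "\<exists>C\<in>?F. \<forall>X\<in>?F. C \<subseteq> X \<longrightarrow> X = C"
 proof (rule subset_Zorn_nonempty)
  have "{\<zero>\<^bsub>M\<^esub>} \<in> ?F" using sm_0 sm_zero[OF B] by auto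
  then show "?F \<noteq> {}" by blast
  fix \<C> assume C: "\<C> \<noteq> {}" "subset.chain ?F \<C>"
  then have CF: "\<And>X. X \<in> \<C> \<Longrightarrow> submodule X R M \<and> B \<inter> X = {\<zero>\<^bsub>M\<^esub>}"
   and ch: "\<And>X Y. X \<in> \<C> \<Longrightarrow> Y \<in> \<C> \<Longrightarrow> X \<subseteq> Y \<or> Y \<subseteq> X"
   by (auto simp: subset_chain_def)
  have "submodule (\<Union>\<C>) R M"
  proof (rule submoduleI)
   show "\<Union>\<C> \<subseteq> carrier M" using CF sm_carrier by blast
   show "\<zero>\<^bsub>M\<^esub> \<in> \<Union>\<C>" using C(1) CF sm_zero by blast
   fix x y assume "x \<in> \<Union>\<C>" "y \<in> \<Union>\<C>"
   then obtain X Y where XY: "X \<in> \<C>" "x \<in> X" "Y \<in> \<C>" "y \<in> Y" by auto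
   then have "\<exists>Z\<in>\<C>. x \<in> Z \<and> y \<in> Z" using ch[OF XY(1,3)] by blast
   then show "x \<oplus>\<^bsub>M\<^esub> y \<in> \<Union>\<C>" using CF sm_add by blast
  next
   fix a x assume "a \<in> carrier R" "x \<in> \<Union>\<C>"
   then show "a \<odot>\<^bsub>M\<^esub> x \<in> \<Union>\<C>" using CF sm_smult by blast
  qed
  moreover have "B \<inter> \<Union>\<C> = {\<zero>\<^bsub>M\<^esub>}" using CF C(1) by blast
  ultimately show "\<Union>\<C> \<in> ?F" by simp
 qed
 then obtain C where C: "submodule C R M" "B \<inter> C = {\<zero>\<^bsub>M\<^esub>}"
  and max: "\<And>X. submodule X R M \<Longrightarrow> B \<inter> X = {\<zero>\<^bsub>M\<^esub>} \<Longrightarrow> C \<subseteq> X \<Longrightarrow> X = C" by auto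
 have S: "submodule (B <+>\<^bsub>M\<^esub> C) R M" by (rule sm_sum[OF B C(1)])
 have up: "B \<subseteq> B <+>\<^bsub>M\<^esub> C" "C \<subseteq> B <+>\<^bsub>M\<^esub> C" using sum_upper1[OF B C(1)] sum_upper2[OF B C(1)] by auto
 have simp: "X \<subseteq> B <+>\<^bsub>M\<^esub> C" if X: "submodule X R M" "simple_module R (M\<lparr>carrier := X\<rparr>)" for X
 proof -
  have "submodule (X \<inter> (B <+>\<^bsub>M\<^esub> C)) R (M\<lparr>carrier := X\<rparr>)"
   unfolding submodule_sub_iff[OF X(1)] using sm_Int[OF X(1) S] by auto
  then have "X \<inter> (B <+>\<^bsub>M\<^esub> C) = {\<zero>\<^bsub>M\<^esub>} \<or> X \<inter> (B <+>\<^bsub>M\<^esub> C) = X" using X(2) by (auto simp: simple_module_def)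
  moreover have "X \<subseteq> C" if e: "X \<inter> (B <+>\<^bsub>M\<^esub> C) = {\<zero>\<^bsub>M\<^esub>}"
  proof -
   have CX: "C \<subseteq> C <+>\<^bsub>M\<^esub> X" "X \<subseteq> C <+>\<^bsub>M\<^esub> X" using sum_upper1[OF C(1) X(1)] sum_upper2[OF C(1) X(1)] by auto
   have "B \<inter> (C <+>\<^bsub>M\<^esub> X) \<subseteq> {\<zero>\<^bsub>M\<^esub>}"
   proof
    fix b assume b: "b \<in> B \<inter> (C <+>\<^bsub>M\<^esub> X)"
    then obtain c x where cx: "c \<in> C" "x \<in> X" "b = c \<oplus>\<^bsub>M\<^esub> x" by (auto simp: sum_iff)
    have cc: "c \<in> carrier M" "x \<in> carrier M" using smD[OF C(1) cx(1)] smD[OF X(1) cx(2)] by auto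
    have "x = b \<ominus>\<^bsub>M\<^esub> c" unfolding cx(3) using M.add_diff_cancel'[OF cc] by simp
    then have "x \<in> B <+>\<^bsub>M\<^esub> C" using sm_minus[OF S] b cx(1) up by auto
    then have "x = \<zero>\<^bsub>M\<^esub>" using e cx(2) by auto
    then have "b \<in> B \<inter> C" using b cx cc by simp
    then show "b \<in> {\<zero>\<^bsub>M\<^esub>}" using C(2) by simp
   qed
   then have "B \<inter> (C <+>\<^bsub>M\<^esub> X) = {\<zero>\<^bsub>M\<^esub>}" using sm_zero[OF B] sm_zero[OF sm_sum[OF C(1) X(1)]] by auto
   from max[OF sm_sum[OF C(1) X(1)] this CX(1)] show ?thesis using CX(2) by simp
  qed
  ultimately show ?thesis using up(2) by auto
 qed
 have "generate (add_monoid M) (\<Union>{X. submodule X R M \<and> simple_module R (M\<lparr>carrier := X\<rparr>)}) \<subseteq> B <+>\<^bsub>M\<^esub> C"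
  by (rule group.generate_subgroup_incl[OF M.a_group _ sm_subgroup[OF S]]) (use simp in blast)
 then have "carrier M \<subseteq> B <+>\<^bsub>M\<^esub> C" using ss by (simp add: semisimple_module_def)
 then have "B <+>\<^bsub>M\<^esub> C = carrier M" using sm_carrier[OF S] by auto
 then show ?thesis using C by blast
qed

text \<open>\<open>A\<close> and \<open>regular_module A\<close> are records of different types with
  the same addition; this moves generated subgroups between them.\<close>

lemma generate_cong:
 fixes X :: "'x set"
 assumes "carrier G = carrier H" "monoid.mult G = monoid.mult H" "one G = one H"
 shows "generate G X = generate H X"
proof -
 have "x \<in> generate H' X" if "x \<in> generate G' X" "carrier G' = carrier H'" "monoid.mult G' = monoid.mult H'" "one G' = one H'"
  for x and G' :: "('x, 'y) monoid_scheme" and H' :: "('x, 'z) monoid_scheme"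
  using that
 proof (induction rule: generate.induct)
  case (inv h)
  then show ?case using generate.inv[of h X H'] by (simp add: m_inv_def)
 qed (auto intro: generate.intros)
 from this[of _ G H] this[of _ H G] assms show ?thesis by auto
qed

section \<open>The valuation ring of a local field\<close>

context local_field
begin

definition "VO = carrier (val_ring K v)"

lemma VO_iff: "x \<in> VO \<longleftrightarrow> x \<in> carrier K \<and> (x = \<zero> \<or> 0 \<le> v x)"
 by (simp add: VO_def val_ring_def)

abbreviation "Kx \<equiv> carrier K - {\<zero>}"

lemma v_one: "v \<one> = 0" using val_mult[of \<one> \<one>] by simp

lemma mult_Kx: "x \<in> Kx \<Longrightarrow> y \<in> Kx \<Longrightarrow> x \<otimes> y \<in> Kx" using integral by auto

lemma inv_Kx: assumes x: "x \<in> Kx" shows "inv x \<in> Kx" "x \<otimes> inv x = \<one>" "v (inv x) = - v x"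
proof -
 have u: "x \<in> Units K" using x field_Units by auto
 show 1: "x \<otimes> inv x = \<one>" using u by simp
 have c: "inv x \<in> carrier K" using u by simp
 show 2: "inv x \<in> Kx" using c 1 x by (metis DiffD1 DiffI r_null singletonD zero_not_one)
 show "v (inv x) = - v x" using val_mult[OF x 2] 1 v_one by simp
qed

lemma v_neg: assumes x: "x \<in> Kx" shows "v (\<ominus> x) = v x"
proof -
 have m: "\<ominus> \<one> \<in> Kx" using local.minus_equality l_neg one_closed a_inv_closed by (metis DiffI minus_minus minus_zero singletonD zero_not_one)
 have "v (\<ominus> \<one>) + v (\<ominus> \<one>) = 0" using val_mult[OF m m] v_one by (simp add: l_minus r_minus)
 then have "v (\<ominus> \<one>) = 0" by simp
 moreover have "\<ominus> x = \<ominus> \<one> \<otimes> x" using x by (simp add: l_minus)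
 ultimately show ?thesis using val_mult[OF m x] by simp
qed

lemma VO_closed: "\<zero> \<in> VO" "\<one> \<in> VO" "\<lbrakk>x \<in> VO; y \<in> VO\<rbrakk> \<Longrightarrow> x \<oplus> y \<in> VO" "\<lbrakk>x \<in> VO; y \<in> VO\<rbrakk> \<Longrightarrow> x \<otimes> y \<in> VO" "x \<in> VO \<Longrightarrow> \<ominus> x \<in> VO"
proof -
 show "\<zero> \<in> VO" "\<one> \<in> VO" using v_one by (auto simp: VO_iff)
 show "x \<oplus> y \<in> VO" if "x \<in> VO" "y \<in> VO"
 proof (cases "x = \<zero> \<or> y = \<zero> \<or> x \<oplus> y = \<zero>")
  case False
  then show ?thesis using that val_add[of x y] by (auto simp: VO_iff)
 qed (use that in \<open>auto simp: VO_iff\<close>)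
 show "x \<otimes> y \<in> VO" if "x \<in> VO" "y \<in> VO"
  using that val_mult[of x y] by (cases "x = \<zero> \<or> y = \<zero>") (auto simp: VO_iff)
 show "\<ominus> x \<in> VO" if "x \<in> VO" using that v_neg[of x] by (cases "x = \<zero>") (auto simp: VO_iff)
qed

lemma VO_carrier: "x \<in> VO \<Longrightarrow> x \<in> carrier K" by (simp add: VO_iff)

definition "\<pi> = (SOME x. x \<in> Kx \<and> v x = 1)"

lemma pi: "\<pi> \<in> Kx" "v \<pi> = 1"
proof -
 have "\<exists>x. x \<in> Kx \<and> v x = 1" using val_surj by (metis UNIV_I imageE)
 from someI_ex[OF this] show "\<pi> \<in> Kx" "v \<pi> = 1" unfolding \<pi>_def by auto
qed

lemma pi_O: "\<pi> \<in> VO" using pi by (simp add: VO_iff)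

lemma pi_pow: "\<pi> [^] (n::nat) \<in> Kx \<and> v (\<pi> [^] n) = int n"
proof (induction n)
 case 0
 then show ?case using v_one by simp
next
 case (Suc n)
 then show ?case using val_mult[of "\<pi> [^] n" \<pi>] mult_Kx[of "\<pi> [^] n" \<pi>] pi by simp
qed

lemma pi_dvd: assumes x: "x \<in> carrier K" "x = \<zero> \<or> 0 < v x" shows "\<exists>t\<in>VO. x = \<pi> \<otimes> t"
proof (cases "x = \<zero>")
 case True
 then show ?thesis using pi VO_closed(1) by (intro bexI[of _ \<zero>]) auto
next
 case False
 then have xx: "x \<in> Kx" "0 < v x" using x by auto
 note i = inv_Kx[OF pi(1)]
 have "x = \<pi> \<otimes> (inv \<pi> \<otimes> x)" using i xx(1) pi(1) by (simp add: m_assoc[symmetric])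
 moreover have "inv \<pi> \<otimes> x \<in> VO" using mult_Kx[OF i(1) xx(1)] val_mult[OF i(1) xx(1)] i(3) pi(2) xx(2) by (simp add: VO_iff)
 ultimately show ?thesis by blast
qed

lemma VO_dvr: assumes x: "x \<in> VO" "x \<noteq> \<zero>" shows "\<exists>k::nat. \<exists>u\<in>VO. \<exists>w\<in>VO. u \<otimes> w = \<one> \<and> x = \<pi> [^] k \<otimes> u"
proof -
 have xx: "x \<in> Kx" "0 \<le> v x" using x by (auto simp: VO_iff)
 let ?k = "nat (v x)"
 have p: "\<pi> [^] ?k \<in> Kx" "v (\<pi> [^] ?k) = v x" using pi_pow[of ?k] xx by auto
 note i = inv_Kx[OF p(1)]
 define u where "u = inv (\<pi> [^] ?k) \<otimes> x"
 have u: "u \<in> Kx" "v u = 0" unfolding u_def using mult_Kx[OF i(1) xx(1)] val_mult[OF i(1) xx(1)] i(3) p(2) by auto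
 have "x = \<pi> [^] ?k \<otimes> u" unfolding u_def using i p(1) xx(1) by (simp add: m_assoc[symmetric])
 moreover have "u \<in> VO" "inv u \<in> VO" "u \<otimes> inv u = \<one>" using u inv_Kx[OF u(1)] by (auto simp: VO_iff)
 ultimately show ?thesis by blast
qed

text \<open>\<open>1 - \<pi>x\<close> has valuation 0, since otherwise 1 would be the sum of two
  elements of positive valuation.\<close>

lemma VO_local: assumes x: "x \<in> VO" shows "\<exists>u\<in>VO. u \<otimes> (\<one> \<ominus> \<pi> \<otimes> x) = \<one>"
proof -
 let ?y = "\<pi> \<otimes> x" and ?d = "\<one> \<ominus> \<pi> \<otimes> x"
 have xc: "x \<in> carrier K" by (rule VO_carrier[OF x])
 have pc: "\<pi> \<in> carrier K" using pi by simp
 have y: "?y \<in> carrier K" "?y = \<zero> \<or> 0 < v ?y"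
  using xc pc pi(2) x val_mult[OF pi(1), of x] by (cases "x = \<zero>"; auto simp: VO_iff)+
 have dO: "?d \<in> VO" using VO_closed(3)[OF VO_closed(2) VO_closed(5)[OF VO_closed(4)[OF pi_O x]]] by (simp add: minus_eq)
 have dc: "?d \<in> carrier K" by (rule VO_carrier[OF dO])
 have e: "\<one> = ?d \<oplus> ?y" using y(1) by (simp add: minus_eq a_assoc l_neg)
 have d: "?d \<noteq> \<zero> \<and> v ?d = 0"
 proof (cases "?y = \<zero>")
  case True
  then have "?d = \<one>" by (simp add: minus_eq)
  then show ?thesis using v_one by simp
 next
  case False
  have 0: "?d \<noteq> \<zero>"
  proof
   assume "?d = \<zero>"
   then have "\<one> = ?y" using e y(1) by simp
   then show False using y(2) False v_one by simp
  qed
  have "\<not> 0 < v ?d"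
  proof
   assume "0 < v ?d"
   moreover have "min (v ?d) (v ?y) \<le> v (?d \<oplus> ?y)" by (rule val_add) (use 0 False dc y(1) e in auto)
   ultimately show False using e v_one y(2) False by simp
  qed
  then show ?thesis using dO 0 by (auto simp: VO_iff)
 qed
 have dK: "?d \<in> Kx" using d dc by auto
 note i = inv_Kx[OF dK]
 have "inv ?d \<in> VO" using i(1,3) d by (auto simp: VO_iff)
 moreover have "inv ?d \<otimes> ?d = \<one>" using i(1,2) dc by (simp add: m_comm)
 ultimately show ?thesis by blast
qed

text \<open>One element is chosen from each residue class. It differs from \<open>x\<close> by an
  element of the maximal ideal, which is a multiple of \<open>\<pi>\<close>.\<close>

lemma VO_resfin: "\<exists>S. finite S \<and> S \<subseteq> VO \<and> (\<forall>x\<in>VO. \<exists>s\<in>S. \<exists>t\<in>VO. x = s \<oplus> \<pi> \<otimes> t)"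
proof -
 let ?m = "val_max_ideal K v"
 have c: "carrier (residue_field K v) = (\<lambda>x. {h \<oplus> x | h. h \<in> ?m}) ` VO"
  unfolding residue_field_def FactRing_def A_RCOSETS_def' a_r_coset_def' VO_def by (auto simp: val_ring_def)
 have m: "?m \<subseteq> VO" "\<zero> \<in> ?m" by (auto simp: val_max_ideal_def VO_iff)
 define S where "S = (\<lambda>C. SOME s. s \<in> C) ` carrier (residue_field K v)"
 have rep: "\<exists>h\<in>?m. (SOME s. s \<in> {h \<oplus> x | h. h \<in> ?m}) = h \<oplus> x" for x
 proof -
  have "\<exists>s. s \<in> {h \<oplus> x | h. h \<in> ?m}" using m(2) by blast
  from someI_ex[OF this] show ?thesis by blast
 qed
 have "finite S" unfolding S_def using residue_finite by simp
 moreover have "S \<subseteq> VO"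
 proof
  fix s assume "s \<in> S"
  then obtain x where x: "x \<in> VO" "s = (SOME s. s \<in> {h \<oplus> x | h. h \<in> ?m})" unfolding S_def c by auto
  then show "s \<in> VO" using rep[of x] m(1) VO_closed(3) by auto
 qed
 moreover have "\<exists>s\<in>S. \<exists>t\<in>VO. x = s \<oplus> \<pi> \<otimes> t" if x: "x \<in> VO" for x
 proof -
  obtain h where h: "h \<in> ?m" "(SOME s. s \<in> {h \<oplus> x | h. h \<in> ?m}) = h \<oplus> x" using rep by blast
  have s: "h \<oplus> x \<in> S" unfolding S_def c h(2)[symmetric] using x by blast
  obtain t where t: "t \<in> VO" "h = \<pi> \<otimes> t" using pi_dvd[of h] h(1) by (auto simp: val_max_ideal_def)
  have cs: "h \<in> carrier K" "x \<in> carrier K" "t \<in> carrier K" "\<pi> \<in> carrier K"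
   using h(1) VO_carrier[OF x] VO_carrier[OF t(1)] pi by (auto simp: val_max_ideal_def)
  have "x = (h \<oplus> x) \<oplus> \<pi> \<otimes> (\<ominus> t)" using cs t(2)
   by (metis a_comm a_inv_closed add.m_closed add.r_cancel_one' a_assoc minus_equality r_minus r_neg m_closed l_zero)
  then show ?thesis using s VO_closed(5)[OF t(1)] by blast
 qed
 ultimately show ?thesis by blast
qed

end

section \<open>Orders and lattices over the valuation ring in terms of its image \<open>R0\<close>
  in \<open>A\<close>\<close>

lemma set_smult_sub:
 assumes M: "abelian_group M" and X: "subgroup X (add_monoid M)" and sub: "\<And>s t. s \<in> S \<Longrightarrow> t \<in> T \<Longrightarrow> s \<odot>\<^bsub>M\<^esub> t \<in> X"
 shows "set_smult (M\<lparr>carrier := X\<rparr>) S T = set_smult M S T"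
proof -
 interpret abelian_group M by fact
 have "generate (add_monoid M\<lparr>carrier := X\<rparr>) {s \<odot>\<^bsub>M\<^esub> x | s x. s \<in> S \<and> x \<in> T} = generate (add_monoid M) {s \<odot>\<^bsub>M\<^esub> x | s x. s \<in> S \<and> x \<in> T}"
  by (rule group.generate_consistent[OF a_group _ X]) (use sub in auto)
 then show ?thesis by (simp add: set_smult_def)
qed

locale local_order_algebra = F: local_field K v + D: fin_dim_algebra K A
 for K :: "('k, 'c) ring_scheme" and v and A :: "('k, 'a, 'd) module_scheme" (structure) +
 assumes ss: "semisimple_ring A"
begin

abbreviation emb where "emb c \<equiv> c \<odot>\<^bsub>A\<^esub> \<one>"

lemma emb_c: "c \<in> carrier K \<Longrightarrow> emb c \<in> carrier A" by simp

lemma emb_smult: "c \<in> carrier K \<Longrightarrow> x \<in> carrier A \<Longrightarrow> c \<odot>\<^bsub>A\<^esub> x = emb c \<otimes> x"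
 using D.smult_mult_left[of c \<one> x] by simp

lemma emb_comm: "c \<in> carrier K \<Longrightarrow> x \<in> carrier A \<Longrightarrow> x \<otimes> emb c = emb c \<otimes> x"
 using D.smult_mult_right[of c x \<one>] emb_smult[of c x] by simp

lemma emb_mult: "c \<in> carrier K \<Longrightarrow> d \<in> carrier K \<Longrightarrow> emb (c \<otimes>\<^bsub>K\<^esub> d) = emb c \<otimes> emb d"
 using D.smult_assoc1[of c d \<one>] emb_smult[of c "emb d"] by simp

lemma emb_add: "c \<in> carrier K \<Longrightarrow> d \<in> carrier K \<Longrightarrow> emb (c \<oplus>\<^bsub>K\<^esub> d) = emb c \<oplus> emb d"
 using D.smult_l_distr[of c d \<one>] by simp

lemma emb_neg: "c \<in> carrier K \<Longrightarrow> emb (\<ominus>\<^bsub>K\<^esub> c) = \<ominus> emb c"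
 using D.smult_l_minus[of c \<one>] by simp

lemma emb_simps [simp]: "emb \<one>\<^bsub>K\<^esub> = \<one>" "emb \<zero>\<^bsub>K\<^esub> = \<zero>"
 using D.smult_one[of \<one>] D.smult_l_null[of \<one>] by simp_all

lemma emb_pow: "c \<in> carrier K \<Longrightarrow> emb (c [^]\<^bsub>K\<^esub> (n::nat)) = emb c [^] n"
 by (induction n) (simp_all add: emb_mult)

definition "R0 = emb ` F.VO"
definition "p = emb F.\<pi>"
definition "pinv = emb (inv\<^bsub>K\<^esub> F.\<pi>)"

lemma pi_c: "F.\<pi> \<in> carrier K" "inv\<^bsub>K\<^esub> F.\<pi> \<in> carrier K" using F.pi(1) F.inv_Kx(1)[OF F.pi(1)] by auto

lemma setting: "order_setting A R0 p pinv"
proof (intro order_setting.intro order_setting_axioms.intro)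
 note c = F.VO_carrier
 show "ring A" by (rule D.A.ring_axioms)
 show "subring R0 A"
 proof (rule D.A.subringI)
  show "R0 \<subseteq> carrier A" unfolding R0_def using c emb_c by auto
  show "\<one> \<in> R0" unfolding R0_def using F.VO_closed(2) emb_simps(1) by (metis imageI)
  show "\<ominus> x \<in> R0" if x: "x \<in> R0" for x
   using x unfolding R0_def using emb_neg[symmetric] c F.VO_closed(5) by auto
  show "x \<otimes> y \<in> R0" if x: "x \<in> R0" "y \<in> R0" for x y
   using x unfolding R0_def using emb_mult[symmetric] c F.VO_closed(4) by auto
  show "x \<oplus> y \<in> R0" if x: "x \<in> R0" "y \<in> R0" for x y
   using x unfolding R0_def using emb_add[symmetric] c F.VO_closed(3) by auto
 qed
 show "r \<otimes> a = a \<otimes> r" if r: "r \<in> R0" "a \<in> carrier A" for r a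
  using r emb_comm c unfolding R0_def by auto
 show "p \<in> R0" unfolding p_def R0_def using F.pi_O by (rule imageI)
 show "pinv \<in> carrier A" unfolding pinv_def by (rule emb_c[OF pi_c(2)])
 show "p \<otimes> pinv = \<one>"
  unfolding p_def pinv_def emb_mult[OF pi_c, symmetric] F.inv_Kx(2)[OF F.pi(1)] by simp
 show "\<exists>k::nat. \<exists>u\<in>R0. \<exists>w\<in>R0. u \<otimes> w = \<one> \<and> r = p [^] k \<otimes> u" if r: "r \<in> R0" "r \<noteq> \<zero>" for r
 proof -
  obtain x where x: "x \<in> F.VO" "r = emb x" using r(1) unfolding R0_def by auto
  then have "x \<noteq> \<zero>\<^bsub>K\<^esub>" using r(2) by auto
  then obtain k u w where k: "u \<in> F.VO" "w \<in> F.VO" "u \<otimes>\<^bsub>K\<^esub> w = \<one>\<^bsub>K\<^esub>" "x = F.\<pi> [^]\<^bsub>K\<^esub> (k::nat) \<otimes>\<^bsub>K\<^esub> u"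
   using F.VO_dvr[OF x(1)] by blast
  have "emb u \<otimes> emb w = \<one>" using emb_mult[OF c[OF k(1)] c[OF k(2)]] k(3) by simp
  moreover have "r = p [^] k \<otimes> emb u"
   using emb_mult[of "F.\<pi> [^]\<^bsub>K\<^esub> k" u] emb_pow[OF pi_c(1), of k] F.pi_pow[of k] c[OF k(1)] k(4) x(2) by (simp add: p_def)
  ultimately show ?thesis unfolding R0_def using k(1,2) by blast
 qed
 show "\<exists>u\<in>R0. u \<otimes> (\<one> \<ominus> p \<otimes> r) = \<one>" if r: "r \<in> R0" for r
 proof -
  obtain x where x: "x \<in> F.VO" "r = emb x" using r unfolding R0_def by auto
  obtain u where u: "u \<in> F.VO" "u \<otimes>\<^bsub>K\<^esub> (\<one>\<^bsub>K\<^esub> \<ominus>\<^bsub>K\<^esub> F.\<pi> \<otimes>\<^bsub>K\<^esub> x) = \<one>\<^bsub>K\<^esub>" using F.VO_local[OF x(1)] by auto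
  have m: "F.\<pi> \<otimes>\<^bsub>K\<^esub> x \<in> carrier K" using pi_c(1) c[OF x(1)] by simp
  have "emb (\<one>\<^bsub>K\<^esub> \<ominus>\<^bsub>K\<^esub> F.\<pi> \<otimes>\<^bsub>K\<^esub> x) = \<one> \<ominus> p \<otimes> r"
   using m emb_mult[OF pi_c(1) c[OF x(1)]] emb_neg[OF m] emb_add[of "\<one>\<^bsub>K\<^esub>" "\<ominus>\<^bsub>K\<^esub> (F.\<pi> \<otimes>\<^bsub>K\<^esub> x)"] x(2)
   by (simp add: a_minus_def p_def)
  moreover have "emb u \<otimes> emb (\<one>\<^bsub>K\<^esub> \<ominus>\<^bsub>K\<^esub> F.\<pi> \<otimes>\<^bsub>K\<^esub> x) = \<one>"
   using emb_mult[OF c[OF u(1)], of "\<one>\<^bsub>K\<^esub> \<ominus>\<^bsub>K\<^esub> F.\<pi> \<otimes>\<^bsub>K\<^esub> x"] u(2) m by simp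
  ultimately show ?thesis unfolding R0_def using u(1) by auto
 qed
 show "\<exists>S. finite S \<and> S \<subseteq> R0 \<and> (\<forall>r\<in>R0. \<exists>s\<in>S. \<exists>t\<in>R0. r = s \<oplus> p \<otimes> t)"
 proof -
  obtain S where S: "finite S" "S \<subseteq> F.VO" "\<And>x. x \<in> F.VO \<Longrightarrow> \<exists>s\<in>S. \<exists>t\<in>F.VO. x = s \<oplus>\<^bsub>K\<^esub> F.\<pi> \<otimes>\<^bsub>K\<^esub> t"
   using F.VO_resfin by auto
  show ?thesis
  proof (intro exI[of _ "emb ` S"] conjI ballI)
   fix r assume "r \<in> R0"
   then obtain x where x: "x \<in> F.VO" "r = emb x" unfolding R0_def by auto
   obtain s t where st: "s \<in> S" "t \<in> F.VO" "x = s \<oplus>\<^bsub>K\<^esub> F.\<pi> \<otimes>\<^bsub>K\<^esub> t" using S(3)[OF x(1)] by blast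
   have "r = emb s \<oplus> p \<otimes> emb t"
    using st S(2) c pi_c(1) x(2) emb_add[of s "F.\<pi> \<otimes>\<^bsub>K\<^esub> t"] emb_mult[OF pi_c(1), of t] by (auto simp: p_def)
   then show "\<exists>s\<in>emb ` S. \<exists>t\<in>R0. r = s \<oplus> p \<otimes> t" unfolding R0_def using st by blast
  qed (use S in \<open>auto simp: R0_def\<close>)
 qed
qed

sublocale order_setting A R0 p pinv by (rule setting)

lemma om: "left_module A V \<Longrightarrow> order_module A R0 p pinv V"
 by (intro order_module.intro setting)

lemma absorb_scalar: assumes c: "c \<in> carrier K" shows "\<exists>k::nat. pp k \<cdot> emb c \<in> R0"
proof -
 have "\<exists>k::nat. F.\<pi> [^]\<^bsub>K\<^esub> k \<otimes>\<^bsub>K\<^esub> c \<in> F.VO"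
 proof (cases "c = \<zero>\<^bsub>K\<^esub>")
  case True
  then show ?thesis using F.pi_pow F.VO_closed(1) by auto
 next
  case False
  then have cx: "c \<in> F.Kx" using c by auto
  \<comment> \<open>The order of the pole of \<open>c\<close>, or 0 if \<open>c\<close> is
    integral.\<close>
  let ?k = "nat (- v c)"
  have "F.\<pi> [^]\<^bsub>K\<^esub> ?k \<otimes>\<^bsub>K\<^esub> c \<in> F.Kx" "v (F.\<pi> [^]\<^bsub>K\<^esub> ?k \<otimes>\<^bsub>K\<^esub> c) = int ?k + v c"
   using F.mult_Kx[OF conjunct1[OF F.pi_pow] cx] F.val_mult[OF conjunct1[OF F.pi_pow] cx] F.pi_pow by auto
  then have "F.\<pi> [^]\<^bsub>K\<^esub> ?k \<otimes>\<^bsub>K\<^esub> c \<in> F.VO" by (auto simp: F.VO_iff)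
  then show ?thesis by blast
 qed
 then obtain k where k: "F.\<pi> [^]\<^bsub>K\<^esub> (k::nat) \<otimes>\<^bsub>K\<^esub> c \<in> F.VO" by auto
 have "emb (F.\<pi> [^]\<^bsub>K\<^esub> k \<otimes>\<^bsub>K\<^esub> c) = pp k \<cdot> emb c"
  using emb_mult[of "F.\<pi> [^]\<^bsub>K\<^esub> k" c] emb_pow[OF pi_c(1), of k] F.pi_pow[of k] c by (simp add: p_def)
 then show ?thesis using imageI[OF k, of emb] unfolding R0_def by auto
qed

text \<open>A power of \<open>p\<close> makes a scalar integral, and the larger of two exponents
  serves for a sum. Conversely, the powers of the inverse of \<open>p\<close> come from
  \<open>K\<close>.\<close>

lemma absb_iff:
 assumes V: "left_module A V" and X: "submodule X (A\<lparr>carrier := R0\<rparr>) V"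
 shows "absb A p V X \<longleftrightarrow> set_smult V (emb ` carrier K) X = carrier V"
proof -
 interpret M: order_module A R0 p pinv V by (rule om[OF V])
 have Xc: "X \<subseteq> carrier V" by (rule M.VR.sm_carrier[OF X])
 have Kc: "emb ` carrier K \<subseteq> carrier A" by auto
 show ?thesis
 proof
  assume a: "absb A p V X"
  have "x \<in> set_smult V (emb ` carrier K) X" if x: "x \<in> carrier V" for x
  proof -
   obtain k where k: "pp k \<odot>\<^bsub>V\<^esub> x \<in> X" using a x by (auto simp: absb_def)
   have "pv k \<in> emb ` carrier K"
    unfolding pinv_def using emb_pow[OF pi_c(2), of k] pi_c(2) by (metis F.nat_pow_closed imageI)
   from M.V.ss_mem[OF this k] show ?thesis using M.pw_cancel(1)[OF x] by simp
  qed
  then show "set_smult V (emb ` carrier K) X = carrier V" using M.V.ss_carrier[OF Kc Xc] by auto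
 next
  assume e: "set_smult V (emb ` carrier K) X = carrier V"
  have "\<exists>k::nat. pp k \<odot>\<^bsub>V\<^esub> x \<in> X" if x: "x \<in> carrier V" for x
   using x[folded e] Kc Xc
  proof (induction rule: M.V.ss_induct)
   case zero
   then show ?case using M.VR.sm_zero[OF X] M.V.smult_zero_r by simp
  next
   case (mem s x)
   obtain c where c: "c \<in> carrier K" "s = emb c" using mem by auto
   obtain k where k: "pp k \<cdot> emb c \<in> R0" using absorb_scalar[OF c(1)] by auto
   have "pp k \<odot>\<^bsub>V\<^esub> (s \<odot>\<^bsub>V\<^esub> x) = (pp k \<cdot> emb c) \<odot>\<^bsub>V\<^esub> x"
    unfolding c(2) by (rule M.V.smult_assoc[symmetric]) (use c mem Xc in auto)
   then have "pp k \<odot>\<^bsub>V\<^esub> (s \<odot>\<^bsub>V\<^esub> x) \<in> X" using M.smR_smult[OF X k mem(2)] by simp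
   then show ?case by blast
  next
   case (neg s x)
   then obtain k where k: "pp k \<odot>\<^bsub>V\<^esub> (s \<odot>\<^bsub>V\<^esub> x) \<in> X" by auto
   have "s \<odot>\<^bsub>V\<^esub> x \<in> carrier V" by (rule M.V.smult_closed) (use neg Xc in auto)
   then have "pp k \<odot>\<^bsub>V\<^esub> (\<ominus>\<^bsub>V\<^esub> (s \<odot>\<^bsub>V\<^esub> x)) \<in> X" using M.VR.sm_neg[OF X k] by (simp add: M.V.smult_minus_r)
   then show ?case by blast
  next
   case (add x y)
   then obtain j k where jk: "pp j \<odot>\<^bsub>V\<^esub> x \<in> X" "pp k \<odot>\<^bsub>V\<^esub> y \<in> X" by auto
   have c: "x \<in> carrier V" "y \<in> carrier V" using add(1,2) e by auto
   have "pp (max j k) \<odot>\<^bsub>V\<^esub> x \<in> X" "pp (max j k) \<odot>\<^bsub>V\<^esub> y \<in> X"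
    by (rule M.pw_le[OF X c(1) jk(1)], simp, rule M.pw_le[OF X c(2) jk(2)], simp)
   then have "pp (max j k) \<odot>\<^bsub>V\<^esub> (x \<oplus>\<^bsub>V\<^esub> y) \<in> X" using M.VR.sm_add[OF X] c by (simp add: M.V.smult_r_distr)
   then show ?case by blast
  qed
  then show "absb A p V X" by (simp add: absb_def)
 qed
qed

lemma ss_emb: assumes "S \<subseteq> carrier K" "X \<subseteq> carrier A"
 shows "set_smult A S X = set_smult RA (emb ` S) X"
proof -
 have e: "{s \<odot>\<^bsub>A\<^esub> x | s x. s \<in> S \<and> x \<in> X} = {s \<odot>\<^bsub>RA\<^esub> x | s x. s \<in> emb ` S \<and> x \<in> X}"
 proof (intro equalityI subsetI)
  fix y assume "y \<in> {s \<odot>\<^bsub>A\<^esub> x | s x. s \<in> S \<and> x \<in> X}"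
  then obtain s x where y: "s \<in> S" "x \<in> X" "y = s \<odot>\<^bsub>A\<^esub> x" by auto
  then have "y = emb s \<odot>\<^bsub>RA\<^esub> x" using emb_smult[of s x] assms by auto
  then show "y \<in> {s \<odot>\<^bsub>RA\<^esub> x | s x. s \<in> emb ` S \<and> x \<in> X}" using y by blast
 next
  fix y assume "y \<in> {s \<odot>\<^bsub>RA\<^esub> x | s x. s \<in> emb ` S \<and> x \<in> X}"
  then obtain s x where y: "s \<in> S" "x \<in> X" "y = emb s \<odot>\<^bsub>RA\<^esub> x" by auto
  have "s \<odot>\<^bsub>A\<^esub> x = emb s \<cdot> x" by (rule emb_smult) (use y assms in auto)
  then have "y = s \<odot>\<^bsub>A\<^esub> x" using y by simp
  then show "y \<in> {s \<odot>\<^bsub>A\<^esub> x | s x. s \<in> S \<and> x \<in> X}" using y by blast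
 qed
 show ?thesis unfolding set_smult_def e by (rule generate_cong) simp_all
qed

lemma val_carrier: "carrier (val_ring K v) = F.VO" by (simp add: F.VO_def)

lemma is_order_iff: "is_order (val_ring K v) K A \<Gamma> \<longleftrightarrow> ord A R0 p \<Gamma>"
proof (cases "subring \<Gamma> A")
 case True
 note S = subringE[OF True]
 have sg: "subgroup \<Gamma> (add_monoid A)" by (rule subring.axioms(1)[OF True])
 have VOc: "F.VO \<subseteq> carrier K" using F.VO_carrier by auto
 have closed: "c \<odot>\<^bsub>A\<^esub> x \<in> \<Gamma>" if R: "R0 \<subseteq> \<Gamma>" and cx: "c \<in> F.VO" "x \<in> \<Gamma>" for c x
 proof -
  have "emb c \<in> \<Gamma>" using R imageI[OF cx(1), of emb] by (auto simp: R0_def)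
  then have "emb c \<cdot> x \<in> \<Gamma>" using cx(2) by (rule S(6))
  moreover have "c \<odot>\<^bsub>A\<^esub> x = emb c \<cdot> x" by (rule emb_smult) (use cx VOc S(1) in auto)
  ultimately show ?thesis by simp
 qed
 \<comment> \<open>A subring contains 1, so stability under the valuation ring amounts to containing
   its image \<open>R0\<close>.\<close>
 have 1: "submodule \<Gamma> (val_ring K v) A \<longleftrightarrow> R0 \<subseteq> \<Gamma>"
 proof
  assume "submodule \<Gamma> (val_ring K v) A"
  then have "emb c \<in> \<Gamma>" if "c \<in> F.VO" for c using submodule.smult_closed[of \<Gamma> "val_ring K v" A c \<one>] S(3) that val_carrier by simp
  then show "R0 \<subseteq> \<Gamma>" by (auto simp: R0_def)
 next
  assume R: "R0 \<subseteq> \<Gamma>"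
  show "submodule \<Gamma> (val_ring K v) A" using sg val_carrier closed[OF R] by (simp add: submodule_def submodule_axioms_def)
 qed
 show ?thesis
 proof (cases "R0 \<subseteq> \<Gamma>")
  case R: True
  have sR: "AA.smR \<Gamma>"
   by (rule AA.VR.submoduleI) (use S R in auto)
  note c = closed[OF R]
  have eq: "set_smult (A\<lparr>carrier := \<Gamma>\<rparr>) F.VO T = set_smult RA R0 T" if T: "T \<subseteq> \<Gamma>" for T
  proof -
   have "set_smult (A\<lparr>carrier := \<Gamma>\<rparr>) F.VO T = set_smult A F.VO T"
    by (rule set_smult_sub[OF D.A.is_abelian_group sg]) (use c T in auto)
   also have "\<dots> = set_smult RA R0 T" unfolding R0_def by (rule ss_emb[OF VOc]) (use T S(1) in auto)
   finally show ?thesis .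
  qed
  have sub: "T \<subseteq> \<Gamma>" if T: "set_smult RA R0 T = \<Gamma>" "T \<subseteq> carrier A" for T
  proof
   fix x assume x: "x \<in> T"
   then show "x \<in> \<Gamma>" using AA.V.ss_mem[OF R0_closed(2) x] T by auto
  qed
  have "finite T \<and> T \<subseteq> \<Gamma> \<and> set_smult (A\<lparr>carrier := \<Gamma>\<rparr>) F.VO T = \<Gamma> \<longleftrightarrow>
    finite T \<and> T \<subseteq> carrier A \<and> set_smult RA R0 T = \<Gamma>" for T
   using eq[of T] sub[of T] S(1) by blast
  then have "fin_gen (val_ring K v) (A\<lparr>carrier := \<Gamma>\<rparr>) \<longleftrightarrow> fg R0 RA \<Gamma>"
   unfolding fin_gen_def AA.fg_iff val_carrier by simp
  moreover have "set_smult A (carrier K) \<Gamma> = carrier A \<longleftrightarrow> absb A p RA \<Gamma>"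
   unfolding absb_iff[OF AA.V.left_module_axioms sR] ss_emb[OF order_refl S(1)] by simp
  ultimately show ?thesis using True 1 R sR by (simp add: is_order_def ord_def lat_def)
 qed (use 1 in \<open>auto simp: is_order_def ord_def\<close>)
qed (auto simp: is_order_def ord_def)

lemma is_maximal_order_iff: "is_maximal_order (val_ring K v) K A \<Gamma> \<longleftrightarrow> maxord A R0 p \<Gamma>"
 unfolding is_maximal_order_def maxord_def is_order_iff ..

text \<open>The products of generators of \<open>\<Lambda>\<close> over \<open>R0\<close> with
  generators of \<open>L\<close> over \<open>\<Lambda>\<close> span a finitely generated
  \<open>R0\<close>-module containing \<open>L\<close>; then \<open>noeth\<close> applies.\<close>

lemma full_lattice:
 assumes \<Lambda>: "ord A R0 p \<Lambda>" and V: "left_module A V" and L: "is_full_lattice K A \<Lambda> V L"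
 shows "lat A R0 p V L" "submodule L (A\<lparr>carrier := \<Lambda>\<rparr>) V"
proof -
 interpret M: order_in A R0 p pinv V \<Lambda>
  by (intro order_in.intro om[OF V] order_in_axioms.intro ordD(4,5)[OF \<Lambda>])
 show s: "submodule L (A\<lparr>carrier := \<Lambda>\<rparr>) V" using L by (simp add: is_full_lattice_def)
 have sR: "M.smR L" by (rule M.smG_smR[OF s])
 have Lc: "L \<subseteq> carrier V" by (rule M.VG.sm_carrier[OF s])
 have ab: "absb A p V L" unfolding absb_iff[OF V sR] using L by (simp add: is_full_lattice_def)
 obtain S where S: "finite S" "S \<subseteq> L" "set_smult (V\<lparr>carrier := L\<rparr>) \<Lambda> S = L"
  using L by (auto simp: is_full_lattice_def fin_gen_def)
 have Sc: "S \<subseteq> carrier V" using S(2) Lc by auto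
 have LS: "set_smult V \<Lambda> S = L"
  using set_smult_sub[OF M.V.M.abelian_group_axioms M.VG.sm_subgroup[OF s], of \<Lambda> S] M.smG_smult[OF s] S by auto
 obtain T where T: "finite T" "T \<subseteq> carrier A" "set_smult RA R0 T = \<Lambda>"
  using ordD(3)[OF \<Lambda>] unfolding AA.fg_iff by auto
 let ?P = "{t \<odot>\<^bsub>V\<^esub> x | t x. t \<in> T \<and> x \<in> S}"
 have Pf: "finite ?P" using finite_image_set2[of "\<lambda>t. t \<in> T" "\<lambda>x. x \<in> S"] T(1) S(1) by simp
 have Pc: "?P \<subseteq> carrier V" using T(2) Sc M.V.smult_closed by auto
 have R0c': "R0 \<subseteq> carrier A" using R0c by auto
 have sP: "M.smR (set_smult V R0 ?P)"
  by (rule M.V.ss_submodule[OF R0 R0c' Pc]) (use Pc R0c R0_closed(4) M.V.smult_assoc M.V.ss_mem in \<open>metis (no_types, lifting) subsetD\<close>)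
 have PP: "?P \<subseteq> set_smult V R0 ?P"
 proof
  fix x assume x: "x \<in> ?P"
  have "\<one> \<odot>\<^bsub>V\<^esub> x = x" by (rule M.V.smult_one[OF subsetD[OF Pc x]])
  then show "x \<in> set_smult V R0 ?P" using M.V.ss_mem[OF R0_closed(2) x] by simp
 qed
 have TP: "set_smult V T S \<subseteq> set_smult V R0 ?P"
  by (rule M.V.ss_least[OF T(2) Sc sP]) (use PP in auto)
 have TSc: "set_smult V T S \<subseteq> carrier V" by (rule M.V.ss_carrier[OF T(2) Sc])
 have "L = set_smult V R0 (set_smult V T S)"
  unfolding LS[symmetric] T(3)[symmetric] by (rule M.V.ss_assoc[OF R0c' T(2) Sc])
 also have "\<dots> \<subseteq> set_smult V R0 ?P"
  by (rule M.V.ss_least[OF R0c' TSc sP]) (use TP M.smR_smult[OF sP] in auto)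
 finally have LP: "L \<subseteq> set_smult V R0 ?P" .
 have "fg R0 V (set_smult V R0 ?P)" unfolding M.fg_iff using Pf Pc by blast
 then have "fg R0 V L" by (rule M.noeth[OF _ sR LP])
 then show "lat A R0 p V L" using sR ab by (simp add: lat_def)
qed

lemma hereditary: assumes G: "maxord A R0 p G" shows "hereditary A R0 p pinv G"
proof (intro hereditary.intro max_order.intro order_ring.intro setting order_ring_axioms.intro max_order_axioms.intro hereditary_axioms.intro)
 show "ord A R0 p G" using G by (simp add: maxord_def)
 show "H = G" if "ord A R0 p H" "G \<subseteq> H" for H using G that by (simp add: maxord_def)
 show "\<exists>C. submodule C A RA \<and> B \<inter> C = {\<zero>} \<and> B <+>\<^bsub>RA\<^esub> C = carrier A" if B: "submodule B A RA" for B
  using semisimple_complement[OF _ B] ss by (simp add: semisimple_ring_def)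
qed

lemma zeta_setting:
 assumes G: "maxord A R0 p G" and V: "left_module A V" "fin_gen A V" and L0: "ord A R0 p L0" "L0 \<subseteq> G"
 shows "zeta_setting A R0 p pinv G V L0"
proof -
 have o: "ord A R0 p G" using G by (simp add: maxord_def)
 have h: "hereditary A R0 p pinv G" by (rule hereditary[OF G])
 interpret M: left_module A V by (rule V(1))
 have oi: "order_in A R0 p pinv V G"
  by (intro order_in.intro om[OF V(1)] order_in_axioms.intro ordD(4,5)[OF o])
 obtain S where S: "finite S" "S \<subseteq> carrier V" "set_smult V (carrier A) S = carrier V" using V(2) by (auto simp: fin_gen_def)
 obtain vs where vs: "set vs = S" using finite_list[OF S(1)] by auto
 have l: "submodule (lspan (carrier A) V vs) A V" "S \<subseteq> lspan (carrier A) V vs" using M.lspan_submodule[of vs] vs S(2) by auto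
 have "set_smult V (carrier A) S \<subseteq> lspan (carrier A) V vs"
  by (rule M.ss_least[OF order_refl S(2) l(1)]) (use M.sm_smult[OF l(1)] l(2) in auto)
 then have "lspan (carrier A) V vs = carrier V" using S(3) M.sm_carrier[OF l(1)] by auto
 then have gens: "\<exists>vs. set vs \<subseteq> carrier V \<and> lspan (carrier A) V vs = carrier V" using vs S(2) by blast
 show ?thesis
  by (intro zeta_setting.intro hereditary_module.intro h max_order_module.intro hereditary.axioms(1) oi
    hereditary_module_axioms.intro gens order_pair.intro order_pair_axioms.intro L0)
qed

end

theorem theorem4p4:
 fixes K :: "('k, 'c) ring_scheme" and v :: "'k \<Rightarrow> int" and q :: nat
  and R :: "('k, 'c) ring_scheme"
  and A :: "('k, 'a) module" and V :: "('a, 'v) module"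
  and \<Lambda> \<Lambda>' I :: "'a set" and L M L' IL' :: "'v set"
  and \<mu> :: "'v set set \<Rightarrow> 'v set set \<Rightarrow> int"
  and \<Lambda>r \<Lambda>'r :: "('k, 'a) module"
  and \<X> :: "'v set set" and W :: "'v set \<Rightarrow> ('a, 'v set) module"
  and Quo :: "'a dir"
 assumes K: "local_field K v"
  and R: "R = val_ring K v"
  and q: "card (carrier (residue_field K v)) = q"
  and A: "fin_dim_algebra K A" "semisimple_ring A"
  and \<Lambda>: "is_order R K A \<Lambda>"
  and V: "left_module A V" "fin_gen A V"
  and L: "is_full_lattice K A \<Lambda> V L"
  and M: "is_full_lattice K A \<Lambda> V M"
  and \<Lambda>': "is_maximal_order R K A \<Lambda>'" "\<Lambda> \<subseteq> \<Lambda>'"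
  and \<Lambda>r: "\<Lambda>r = A\<lparr>carrier := \<Lambda>\<rparr>"
  and \<Lambda>'r: "\<Lambda>'r = A\<lparr>carrier := \<Lambda>'\<rparr>"
  and L': "L' = set_smult V \<Lambda>' L"
  and I: "I = two_sided_conductor A \<Lambda>' \<Lambda>"
  and IL': "IL' = set_smult V I L'"
  and \<mu>: "\<mu> = moebius {U. submodule U (\<Lambda>'r Quot I)
               (quot_module_factor (V\<lparr>carrier := L'\<rparr>) IL')}"
  and \<X>: "\<X> = {X. submodule X \<Lambda>r (V\<lparr>carrier := L\<rparr>) \<and>
          module_isomorphic \<Lambda>r (V\<lparr>carrier := X\<rparr>) (V\<lparr>carrier := M\<rparr>) \<and>
          IL' \<subseteq> set_smult V \<Lambda>' X}"
  and W: "\<And>X. W X = quot_module (V\<lparr>carrier := set_smult V \<Lambda>' X\<rparr>) IL'"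
  and Quo: "Quo = partial_zeta \<Lambda>r (V\<lparr>carrier := L\<rparr>) (V\<lparr>carrier := M\<rparr>)
        \<otimes>\<^bsub>Dir \<Lambda>r\<^esub> inv\<^bsub>Dir \<Lambda>r\<^esub> (dir_res \<Lambda>'r \<Lambda>r (zeta \<Lambda>'r (V\<lparr>carrier := L'\<rparr>)))"
 shows "dir_res \<Lambda>'r \<Lambda>r (zeta \<Lambda>'r (V\<lparr>carrier := L'\<rparr>)) \<in> Units (Dir \<Lambda>r) \<and>
  (\<forall>\<Lambda>''. is_maximal_order R K A \<Lambda>'' \<and> \<Lambda> \<subseteq> \<Lambda>'' \<longrightarrow>
    dir_res (A\<lparr>carrier := \<Lambda>''\<rparr>) \<Lambda>r
     (zeta (A\<lparr>carrier := \<Lambda>''\<rparr>) (V\<lparr>carrier := set_smult V \<Lambda>'' L\<rparr>))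
    = dir_res \<Lambda>'r \<Lambda>r (zeta \<Lambda>'r (V\<lparr>carrier := L'\<rparr>))) \<and>
  finite \<X> \<and>
  Quo = (\<Oplus>\<^bsub>Dir \<Lambda>r\<^esub>X\<in>\<X>. dir_monom (mod_class \<Lambda>r (quot_module (V\<lparr>carrier := L\<rparr>) X))
       \<otimes>\<^bsub>Dir \<Lambda>r\<^esub> dir_res \<Lambda>'r \<Lambda>r (Q_poly \<Lambda>'r \<mu> (W X))) \<and>
  (\<forall>X\<in>\<X>. Q_poly \<Lambda>'r \<mu> (W X) \<in> Dir_poly \<Lambda>'r \<and>
    dir_res \<Lambda>'r \<Lambda>r (Q_poly \<Lambda>'r \<mu> (W X)) \<in> Dir_poly \<Lambda>r) \<and>
  Quo \<in> Dir_poly \<Lambda>r"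
proof -
 have KA: "local_order_algebra K v A"
  using K A by (simp add: local_order_algebra_def local_order_algebra_axioms_def)
 interpret P: local_order_algebra K v A by (rule KA)
 have oL: "ord A P.R0 P.p \<Lambda>" using \<Lambda> P.is_order_iff R by simp
 have zs: "zeta_setting A P.R0 P.p P.pinv G V \<Lambda>" if G: "is_maximal_order R K A G" "\<Lambda> \<subseteq> G" for G
  using P.zeta_setting[OF _ V oL G(2)] G(1) P.is_maximal_order_iff R by simp
 note fL = P.full_lattice[OF oL V(1) L]
 have zl: "zeta_lattice A P.R0 P.p P.pinv G V \<Lambda> L" if G: "is_maximal_order R K A G" "\<Lambda> \<subseteq> G" for G
  by (intro zeta_lattice.intro zeta_lattice_axioms.intro zs[OF G] fL)
 interpret Z: zeta_lattice A P.R0 P.p P.pinv \<Lambda>' V \<Lambda> L by (rule zl[OF \<Lambda>'])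
 have eL': "L' = Z.L'" unfolding L' Z.L'_def ..
 have eI: "I = Z.I" unfolding I Z.I_def ..
 have eIL': "IL' = Z.IL'" unfolding IL' Z.IL'_def eI eL' ..
 have emu: "\<mu> = Z.mu" unfolding \<mu> Z.mu_eq \<Lambda>'r eI eL' eIL' ..
 have eXX: "\<X> = Z.XX (V\<lparr>carrier := M\<rparr>)"
  unfolding \<X> Z.XX_def \<Lambda>r eIL' Z.LM.VG.submodule_sub_iff[OF fL(2)] by auto
 have zz: "dir_res \<Lambda>'r \<Lambda>r (zeta \<Lambda>'r (V\<lparr>carrier := L'\<rparr>)) = Z.zz" unfolding \<Lambda>'r \<Lambda>r eL' ..
 have eW: "W X = Qm V (Z.GX X) Z.IL'" for X unfolding W eIL' ..
 have eQ: "Quo = partial_zeta Z.LM.AG (V\<lparr>carrier := L\<rparr>) (V\<lparr>carrier := M\<rparr>) \<otimes>\<^bsub>Dir Z.LM.AG\<^esub> inv\<^bsub>Dir Z.LM.AG\<^esub> Z.zz"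
  unfolding Quo zz unfolding \<Lambda>r by (rule HOL.refl)
 note main = Z.zeta_quotient[OF eQ]
 \<comment> \<open>Both inequalities between the numbers of sublattices come from the bimodule
   argument, with the two maximal orders exchanged.\<close>
 have ind: "dir_res (A\<lparr>carrier := G\<rparr>) \<Lambda>r (zeta (A\<lparr>carrier := G\<rparr>) (V\<lparr>carrier := set_smult V G L\<rparr>)) = Z.zz"
  if G: "is_maximal_order R K A G" "\<Lambda> \<subseteq> G" for G
 proof
  fix k
  interpret Y: zeta_lattice A P.R0 P.p P.pinv G V \<Lambda> L by (rule zl[OF G])
  interpret YZ: two_orders A P.R0 P.p P.pinv V G \<Lambda>' \<Lambda>
   by (intro two_orders.intro P.om V(1) zs[OF G] zs[OF \<Lambda>'])
  interpret ZY: two_orders A P.R0 P.p P.pinv V \<Lambda>' G \<Lambda>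
   by (intro two_orders.intro P.om V(1) zs[OF G] zs[OF \<Lambda>'])
  have "Y.num Y.L' k = Z.num Z.L' k"
   by (rule antisym) (rule ZY.num_orders_le[OF Y.L'_lat Y.L'_sm Z.L'_lat Z.L'_sm], rule YZ.num_orders_le[OF Z.L'_lat Z.L'_sm Y.L'_lat Y.L'_sm])
  then show "dir_res (A\<lparr>carrier := G\<rparr>) \<Lambda>r (zeta (A\<lparr>carrier := G\<rparr>) (V\<lparr>carrier := set_smult V G L\<rparr>)) k = Z.zz k"
   unfolding \<Lambda>r Y.L'_def[symmetric] Y.res_zeta[OF Z.lat_fg[OF Y.L'_lat] Y.L'_sm] Z.res_zeta[OF Z.lat_fg[OF Z.L'_lat] Z.L'_sm] by simp
 qed
 show ?thesis
  unfolding zz eXX eW emu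
  using main ind unfolding cl_def \<Lambda>r \<Lambda>'r by auto
qed

end
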